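(* For $\gamma=1.97$, there is a reduction from $\gamma$-CVP to $\mathrm{DGS}^{2^{n/2}}_{1/2}$. The reduction makes $O(n^2)$ calls to the DGS oracle on an $(n+1)$-dimensional lattice and runs in time $2^{n/2}\cdot\mathrm{poly}(n)$.
   Context: $\gamma$-CVP: given a basis of a lattice $\mathcal{L}\subset\mathbb{R}^n$ and $\vec{t}\in\mathbb{R}^n$, output $\vec{y}\in\mathcal{L}$ with $\|\vec{y}-\vec{t}\|\le\gamma\cdot\min_{\vec{z}\in\mathcal{L}}\|\vec{z}-\vec{t}\|$. For $s>0$, $\rho_s(\vec{x})=\exp(-\pi\|\vec{x}\|^2/s^2)$ and $D_{\mathcal{L},s}$ assigns probability $\rho_s(\vec{x})/\sum_{\vec{y}\in\mathcal{L}}\rho_s(\vec{y})$ to $\vec{x}\in\mathcal{L}$. $\mathrm{DGS}^m_\epsilon$: given a basis of a lattice and any $s>0$, output $m$ vectors whose joint distribution is $\epsilon$-close in statistical distance to $m$ independent samples from $D_{\mathcal{L},s}$.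
   Formalization: Basis, target and parameter s are rational, as machine input must be finite, and poly(n) is a polynomial in the bit length of the input: for n = 1, basis (1), t = 2^k no bound in n alone can hold. The reduction succeeds with probability at least 2/3. *)

theory Defs
  imports
    "HOL-Probability.Probability"
    "HOL-Library.Landau_Symbols"
    "HOL-Library.Log_Nat"
    "Jordan_Normal_Form.Matrix"
    "Jordan_Normal_Form.DL_Rank"
begin

no_notation Inner_Product.real_inner_class.inner (infix "\<bullet>" 70)
no_notation Infinite_Sum.abs_summable_on (infixr "abs'_summable'_on" 46)

section \<open>Lattices, CVP and discrete Gaussians\<close>

text \<open>
  Vectors are those of \<open>Jordan_Normal_Form\<close>, so that the dimension is an ordinary number and one
  program can be run in all dimensions. A lattice in \<open>R^n\<close> need not have full rank.
\<close>

definition is_basis :: "nat \<Rightarrow> real vec list \<Rightarrow> bool" where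
  "is_basis n B \<longleftrightarrow> set B \<subseteq> carrier_vec n \<and> distinct B \<and>
     module.lin_indpt class_ring (module_vec TYPE(real) n) (set B)"

definition lattice_of :: "nat \<Rightarrow> real vec list \<Rightarrow> real vec set" where
  "lattice_of n B =
     {mat_of_cols n B *\<^sub>v map_vec of_int c | c :: int vec. c \<in> carrier_vec (length B)}"

definition vnorm :: "real vec \<Rightarrow> real" where
  "vnorm v = sqrt (v \<bullet> v)"

definition cvp_solution :: "real \<Rightarrow> real vec set \<Rightarrow> real vec \<Rightarrow> real vec \<Rightarrow> bool" where
  "cvp_solution \<gamma> L t y \<longleftrightarrow> y \<in> L \<and> vnorm (y - t) \<le> \<gamma> * (INF z\<in>L. vnorm (z - t))"

definition gauss_mass :: "real \<Rightarrow> real vec \<Rightarrow> real" where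
  "gauss_mass s x = exp (- pi * (vnorm x)\<^sup>2 / s\<^sup>2)"

definition discrete_gaussian :: "real vec set \<Rightarrow> real \<Rightarrow> real vec pmf" where
  "discrete_gaussian L s =
     embed_pmf (\<lambda>x. if x \<in> L then gauss_mass s x / (\<Sum>\<^sub>\<infinity>y\<in>L. gauss_mass s y) else 0)"

text \<open>
  The weights on a lattice are summable, so \<open>embed_pmf\<close> is applied to a genuine mass function
  (\<open>pmf_discrete_gaussian\<close>).
\<close>

lemma basis_mult_zero:
  assumes "is_basis n B" "c \<in> carrier_vec (length B)" "mat_of_cols n B *\<^sub>v c = 0\<^sub>v n"
  shows "c = 0\<^sub>v (length B)"
proof (rule ccontr)
  assume "c \<noteq> 0\<^sub>v (length B)"
  moreover have "cols (mat_of_cols n B) = B"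
    using assms(1) by (intro cols_mat_of_cols) (auto simp: is_basis_def)
  ultimately show False
    using vec_space.lin_depI[of "mat_of_cols n B" n "length B" c] assms
    by (auto simp: is_basis_def)
qed

lemma cauchy_schwarz_vec:
  fixes v w :: "real vec"
  assumes "v \<in> carrier_vec n" "w \<in> carrier_vec n"
  shows "(v \<bullet> w)\<^sup>2 \<le> (v \<bullet> v) * (w \<bullet> w)"
  using Cauchy_Schwarz_ineq_sum[of "\<lambda>i. v $ i" "\<lambda>i. w $ i" "{0..<n}"] assms
  by (auto simp: scalar_prod_def power2_eq_square)

lemma scalar_self: "(v::real vec) \<bullet> v = (\<Sum>i<dim_vec v. (v $ i)\<^sup>2)"
  by (simp add: scalar_prod_def power2_eq_square atLeast0LessThan)

lemma basis_lower_bound: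
  assumes "is_basis n B"
  shows "\<exists>K>0. \<forall>c\<in>carrier_vec (length B).
    c \<bullet> c \<le> K * ((mat_of_cols n B *\<^sub>v c) \<bullet> (mat_of_cols n B *\<^sub>v c))"
proof -
  let ?d = "length B"
  define A where "A = mat_of_cols n B"
  have A: "A \<in> carrier_mat n ?d" by (simp add: A_def)
  define G where "G = transpose_mat A * A"
  have G: "G \<in> carrier_mat ?d ?d" using A by (simp add: G_def)
  have "det G \<noteq> 0"
  proof
    assume "det G = 0"
    then obtain v where v: "v \<in> carrier_vec ?d" "v \<noteq> 0\<^sub>v ?d" "G *\<^sub>v v = 0\<^sub>v ?d"
      using det_0_iff_vec_prod_zero[OF G] by auto
    have "(A *\<^sub>v v) \<bullet> (A *\<^sub>v v) = v \<bullet> (G *\<^sub>v v)"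
    proof -
      have "G *\<^sub>v v = transpose_mat A *\<^sub>v (A *\<^sub>v v)"
        unfolding G_def using A v(1) by (intro assoc_mult_mat_vec) auto
      moreover have "(transpose_mat (transpose_mat A) *\<^sub>v v) \<bullet> (A *\<^sub>v v)
          = v \<bullet> (transpose_mat A *\<^sub>v (A *\<^sub>v v))"
        using A v(1) by (intro transpose_vec_mult_scalar[of _ ?d n]) auto
      ultimately show ?thesis using A by simp
    qed
    then have "(\<Sum>i<n. ((A *\<^sub>v v) $ i)\<^sup>2) = 0"
      using v A by (simp add: scalar_self del: index_mult_mat_vec)
    then have "\<forall>i<n. (A *\<^sub>v v) $ i = 0"
      by (subst (asm) sum_nonneg_eq_0_iff) auto
    then have "A *\<^sub>v v = 0\<^sub>v n" using A by (intro eq_vecI) auto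
    then show False using basis_mult_zero[OF assms v(1)] v(2) by (simp add: A_def)
  qed
  then obtain W where W: "W \<in> carrier_mat ?d ?d" "W * G = 1\<^sub>m ?d"
    using det_non_zero_imp_unit[OF G, of "()"] by (auto simp: Units_def ring_mat_def)
  define R where "R = W * transpose_mat A"
  have R: "R \<in> carrier_mat ?d n" using W A by (simp add: R_def)
  have Rc: "R *\<^sub>v (A *\<^sub>v c) = c" if c: "c \<in> carrier_vec ?d" for c
  proof -
    have "R * A = 1\<^sub>m ?d"
      unfolding R_def using W(1) A W(2)[unfolded G_def]
      by (subst assoc_mult_mat[of _ ?d ?d _ n _ ?d]) auto
    then have "(R * A) *\<^sub>v c = c" using c by simp
    then show ?thesis using R A c by (simp add: assoc_mult_mat_vec[OF R A c])
  qed
  define K where "K = 1 + (\<Sum>i<?d. row R i \<bullet> row R i)"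
  have nn: "0 \<le> (v::real vec) \<bullet> v" for v by (simp add: scalar_self sum_nonneg)
  have K: "K > 0" unfolding K_def by (smt (verit) nn sum_nonneg)
  have "c \<bullet> c \<le> K * ((A *\<^sub>v c) \<bullet> (A *\<^sub>v c))" if c: "c \<in> carrier_vec ?d" for c
  proof -
    let ?w = "A *\<^sub>v c"
    have w: "?w \<in> carrier_vec n" using A c by auto
    have "c \<bullet> c = (\<Sum>i<?d. (c $ i)\<^sup>2)" using c by (simp add: scalar_self)
    also have "\<dots> \<le> (\<Sum>i<?d. (row R i \<bullet> row R i) * (?w \<bullet> ?w))"
    proof (rule sum_mono)
      fix i assume i: "i \<in> {..<?d}"
      have "c $ i = (R *\<^sub>v ?w) $ i" using Rc[OF c] by simp
      also have "\<dots> = row R i \<bullet> ?w" using R i by (intro index_mult_mat_vec) auto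
      finally show "(c $ i)\<^sup>2 \<le> (row R i \<bullet> row R i) * (?w \<bullet> ?w)"
        using cauchy_schwarz_vec[of "row R i" n ?w] R w by auto
    qed
    also have "\<dots> = (\<Sum>i<?d. row R i \<bullet> row R i) * (?w \<bullet> ?w)"
      by (simp add: sum_distrib_right)
    also have "\<dots> \<le> K * (?w \<bullet> ?w)"
      unfolding K_def using nn[of ?w] by (simp add: algebra_simps)
    finally show ?thesis .
  qed
  then show ?thesis using K unfolding A_def by blast
qed

lemma summable_gauss_int:
  assumes "k > 0"
  shows "(\<lambda>z::int. exp (- k * (real_of_int z)\<^sup>2)) abs_summable_on (UNIV::int set)"
proof -
  have n: "(\<lambda>j::nat. exp (- k * (real j)\<^sup>2)) abs_summable_on UNIV"
  proof (rule abs_summable_on_comparison_test')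
    show "(\<lambda>j::nat. exp (-k) ^ j) abs_summable_on UNIV"
      using assms by (simp add: abs_summable_on_nat_iff' summable_geometric)
    fix j :: nat
    have "real j \<le> (real j)\<^sup>2" by (cases j) (auto simp: power2_eq_square)
    then show "norm (exp (- k * (real j)\<^sup>2)) \<le> exp (-k) ^ j"
      using assms by (simp add: exp_of_nat_mult[symmetric])
  qed
  have e: "UNIV = range int \<union> range (\<lambda>j. - int j)"
    by (auto simp: image_iff) (metis int_cases2)
  have "(\<lambda>z::int. exp (- k * (real_of_int z)\<^sup>2)) abs_summable_on range int"
    using n by (subst abs_summable_on_reindex_iff[symmetric]) auto
  moreover have "(\<lambda>z::int. exp (- k * (real_of_int z)\<^sup>2)) abs_summable_on range (\<lambda>j. - int j)"
    using n by (subst abs_summable_on_reindex_iff[symmetric]) (auto simp: inj_on_def)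
  ultimately show ?thesis unfolding e by (rule abs_summable_on_union)
qed

lemma gauss_mass_summable:
  assumes B: "is_basis n B" and s: "s > 0"
  shows "gauss_mass s abs_summable_on lattice_of n B"
proof -
  let ?d = "length B"
  define A where "A = mat_of_cols n B"
  have A: "A \<in> carrier_mat n ?d" by (simp add: A_def)
  obtain K where K: "K > 0" "\<And>c. c \<in> carrier_vec ?d \<Longrightarrow> c \<bullet> c \<le> K * ((A *\<^sub>v c) \<bullet> (A *\<^sub>v c))"
    using basis_lower_bound[OF B] unfolding A_def by blast
  define k where "k = pi / (s\<^sup>2 * K)"
  have k: "k > 0" using K(1) s by (simp add: k_def)
  define P where "P = PiE {..<?d} (\<lambda>_. UNIV :: int set)"
  define h where "h g = A *\<^sub>v (vec ?d (\<lambda>i. real_of_int (g i)))" for g :: "nat \<Rightarrow> int"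
  have L: "lattice_of n B = h ` P"
  proof safe
    fix x assume "x \<in> lattice_of n B"
    then obtain c :: "int vec" where c: "c \<in> carrier_vec ?d" "x = A *\<^sub>v map_vec of_int c"
      by (auto simp: lattice_of_def A_def)
    let ?g = "restrict (\<lambda>i. c $ i) {..<?d}"
    have "map_vec of_int c = vec ?d (\<lambda>i. real_of_int (?g i))" using c by (intro eq_vecI) auto
    then have "x = h ?g" using c by (simp add: h_def)
    then show "x \<in> h ` P" by (auto simp: P_def)
  next
    fix g
    have "vec ?d (\<lambda>i. real_of_int (g i)) = map_vec of_int (vec ?d g)" by (intro eq_vecI) auto
    then show "h g \<in> lattice_of n B"
      unfolding h_def lattice_of_def A_def by (auto intro!: exI[of _ "vec ?d g"])
  qed
  have inj: "inj_on h P"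
  proof (rule inj_onI)
    fix f g assume fg: "f \<in> P" "g \<in> P" "h f = h g"
    let ?c = "vec ?d (\<lambda>i. real_of_int (f i))" and ?e = "vec ?d (\<lambda>i. real_of_int (g i))"
    have "A *\<^sub>v (?c - ?e) = A *\<^sub>v ?c - A *\<^sub>v ?e" using A by (intro mult_minus_distrib_mat_vec) auto
    also have "\<dots> = 0\<^sub>v n" using fg(3) A by (auto simp: h_def)
    finally have "?c - ?e = 0\<^sub>v ?d" using basis_mult_zero[OF B, of "?c - ?e"] by (simp add: A_def)
    then have "(?c - ?e) $ i = 0" if "i < ?d" for i using that by simp
    then have "f i = g i" if "i < ?d" for i using that by fastforce
    then show "f = g" using fg by (intro PiE_ext[of f "{..<?d}" "\<lambda>_. UNIV" g]) (auto simp: P_def)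
  qed
  have "(\<lambda>g. gauss_mass s (h g)) abs_summable_on P"
  proof (rule abs_summable_on_comparison_test')
    show "(\<lambda>g. \<Prod>i<?d. exp (- k * (real_of_int (g i))\<^sup>2)) abs_summable_on P"
      unfolding P_def by (intro abs_summable_on_prod_PiE summable_gauss_int k) auto
    fix g assume "g \<in> P"
    let ?c = "vec ?d (\<lambda>i. real_of_int (g i))"
    have "?c \<bullet> ?c = (\<Sum>i<?d. (real_of_int (g i))\<^sup>2)" by (simp add: scalar_self)
    then have "k * (\<Sum>i<?d. (real_of_int (g i))\<^sup>2) \<le> k * (K * (h g \<bullet> h g))"
      using K(2)[of ?c] k by (intro mult_left_mono) (auto simp: h_def)
    also have "\<dots> = pi * (vnorm (h g))\<^sup>2 / s\<^sup>2"
      using K(1) by (simp add: k_def vnorm_def scalar_self sum_nonneg)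
    finally have "exp (- pi * (vnorm (h g))\<^sup>2 / s\<^sup>2) \<le> exp (- (k * (\<Sum>i<?d. (real_of_int (g i))\<^sup>2)))" by simp
    also have "\<dots> = (\<Prod>i<?d. exp (- k * (real_of_int (g i))\<^sup>2))"
      by (simp add: exp_sum[symmetric] sum_distrib_left sum_negf)
    finally show "norm (gauss_mass s (h g)) \<le> (\<Prod>i<?d. exp (- k * (real_of_int (g i))\<^sup>2))"
      by (simp add: gauss_mass_def)
  qed
  then show ?thesis unfolding L using abs_summable_on_reindex_iff[OF inj] by blast
qed

lemma pmf_discrete_gaussian:
  assumes B: "is_basis n B" and s: "s > 0"
  defines "L \<equiv> lattice_of n B"
  shows "pmf (discrete_gaussian L s) x =
    (if x \<in> L then gauss_mass s x / (\<Sum>\<^sub>\<infinity>y\<in>L. gauss_mass s y) else 0)"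
proof -
  have S: "gauss_mass s abs_summable_on L"
    using gauss_mass_summable[OF B s] by (simp add: L_def)
  then have I: "(\<Sum>\<^sub>\<infinity>y\<in>L. gauss_mass s y) = infsetsum (gauss_mass s) L"
    by (rule infsetsum_infsum[symmetric])
  define Z where "Z = infsetsum (gauss_mass s) L"
  have "mat_of_cols n B *\<^sub>v map_vec of_int (0\<^sub>v (length B)) \<in> L"
    unfolding L_def lattice_of_def by force
  then obtain z where z: "z \<in> L" by blast
  have "infsetsum (gauss_mass s) {z} \<le> Z"
    unfolding Z_def using z S
    by (intro infsetsum_mono_neutral_left) (auto simp: gauss_mass_def)
  then have Z: "Z > 0" by (simp add: gauss_mass_def) (smt (verit) exp_gt_zero)
  have "(\<integral>\<^sup>+ x. ennreal (if x \<in> L then gauss_mass s x / Z else 0) \<partial>count_space UNIV)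
      = (\<integral>\<^sup>+ x. ennreal (gauss_mass s x / Z) \<partial>count_space L)"
    by (simp add: nn_integral_count_space_indicator[of L])
      (auto intro!: nn_integral_cong simp: indicator_def)
  also have "\<dots> = ennreal (infsetsum (\<lambda>x. gauss_mass s x / Z) L)"
    using S Z by (intro nn_integral_conv_infsetsum) (auto simp: gauss_mass_def divide_inverse)
  also have "infsetsum (\<lambda>x. gauss_mass s x / Z) L = 1"
    using S Z by (simp add: divide_inverse infsetsum_cmult_left Z_def[symmetric])
  finally show ?thesis
    unfolding discrete_gaussian_def I Z_def[symmetric]
    using Z by (subst pmf_embed_pmf) (auto simp: gauss_mass_def)
qed

definition stat_dist :: "'a pmf \<Rightarrow> 'a pmf \<Rightarrow> real" where
  "stat_dist p q = (1 / 2) * (\<Sum>\<^sub>\<infinity>x. \<bar>pmf p x - pmf q x\<bar>)"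

text \<open>
  Algorithms receive and return rational vectors. A query \<open>(n, B, s)\<close> asks for samples from the
  lattice in \<open>R^n\<close> with basis \<open>B\<close>; every query is answered afresh, independently of earlier ones.
\<close>

abbreviation real_vec :: "rat vec \<Rightarrow> real vec" where
  "real_vec \<equiv> map_vec real_of_rat"

type_synonym dgs_query = "nat \<times> rat vec list \<times> rat"

definition valid_query :: "dgs_query \<Rightarrow> bool" where
  "valid_query = (\<lambda>(n, B, s). is_basis n (map real_vec B) \<and> s > 0)"

definition dgs_oracle :: "nat \<Rightarrow> real \<Rightarrow> (dgs_query \<Rightarrow> rat vec list pmf) \<Rightarrow> bool" where
  "dgs_oracle m \<epsilon> orc \<longleftrightarrow> (\<forall>n B s. valid_query (n, B, s) \<longrightarrow>
     (\<forall>xs \<in> set_pmf (orc (n, B, s)). length xs = m \<and> set xs \<subseteq> carrier_vec n) \<and>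
     stat_dist (map_pmf (map real_vec) (orc (n, B, s)))
       (replicate_pmf m (discrete_gaussian (lattice_of n (map real_vec B)) (of_rat s))) \<le> \<epsilon>)"

text \<open>The specification of the oracle is satisfiable.\<close>

lemma lattice_of_rational:
  assumes "x \<in> lattice_of n (map real_vec B)" "set B \<subseteq> carrier_vec n"
  shows "\<exists>y\<in>carrier_vec n. x = real_vec y"
proof -
  obtain c :: "int vec" where c: "c \<in> carrier_vec (length B)"
    "x = mat_of_cols n (map real_vec B) *\<^sub>v map_vec of_int c"
    using assms(1) by (auto simp: lattice_of_def)
  define y where "y = mat_of_cols n B *\<^sub>v map_vec of_int c"
  have y: "y \<in> carrier_vec n"
    unfolding y_def using c(1)
    by (intro mult_mat_vec_carrier[of _ n "length B"] mat_of_cols_carrier(1)) auto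
  have "x $ i = real_of_rat (y $ i)" if i: "i < n" for i
  proof -
    have d: "dim_vec (B ! j) = n" if "j < length B" for j
      using nth_mem[OF that] assms(2) by auto
    have "x $ i = (\<Sum>j = 0..<length B. real_of_rat (B ! j $ i) * of_int (c $ j))"
      using c i d by (simp add: scalar_prod_def mat_of_cols_def)
    moreover have "y $ i = (\<Sum>j = 0..<length B. (B ! j $ i) * of_int (c $ j))"
      using c(1) i by (simp add: y_def scalar_prod_def mat_of_cols_def)
    ultimately show ?thesis by (simp add: of_rat_sum of_rat_mult)
  qed
  moreover have "dim_vec x = n" by (simp add: c(2) mat_of_cols_def)
  ultimately have "x = real_vec y" using y by (intro eq_vecI) auto
  with y show ?thesis by blast
qed

lemma dgs_oracle_exists:
  assumes "\<epsilon> \<ge> 0"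
  shows "\<exists>orc. dgs_oracle m \<epsilon> orc"
proof -
  define D where "D = (\<lambda>(n, B, s). replicate_pmf m
    (discrete_gaussian (lattice_of n (map real_vec B)) (real_of_rat s)))"
  define rat_of_vec where "rat_of_vec = (\<lambda>x :: real vec. SOME y. x = real_vec y)"
  define orc where "orc = (\<lambda>q. map_pmf (map rat_of_vec) (D q))"
  have inj: "y = z" if "real_vec y = real_vec z" for y z
  proof (rule eq_vecI)
    show dim: "dim_vec y = dim_vec z"
      using arg_cong[OF that, of dim_vec] by simp
    show "y $ i = z $ i" if "i < dim_vec z" for i
      using arg_cong[OF \<open>real_vec y = real_vec z\<close>, of "\<lambda>v. v $ i"] that dim by simp
  qed
  have rat: "rat_of_vec (real_vec y) = y" for y
    unfolding rat_of_vec_def by (rule some_equality) (auto dest: inj)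
  have "dgs_oracle m \<epsilon> orc"
    unfolding dgs_oracle_def
  proof (intro allI impI)
    fix n :: nat and B and s :: rat
    assume v: "valid_query (n, B, s)"
    then have B: "is_basis n (map real_vec B)" and s: "real_of_rat s > 0"
      by (auto simp: valid_query_def)
    have Bc: "set B \<subseteq> carrier_vec n" using B by (auto simp: is_basis_def)
    let ?L = "lattice_of n (map real_vec B)"
    let ?G = "discrete_gaussian ?L (real_of_rat s)"
    have G: "set_pmf ?G \<subseteq> ?L"
      using pmf_discrete_gaussian[OF B s] by (auto simp: set_pmf_eq split: if_splits)
    have supp: "set xs \<subseteq> ?L" "length xs = m" if "xs \<in> set_pmf (D (n, B, s))" for xs
      using that G by (auto simp: D_def set_replicate_pmf)
    have L: "rat_of_vec x \<in> carrier_vec n" "real_vec (rat_of_vec x) = x" if "x \<in> ?L" for x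
      using lattice_of_rational[OF that Bc] rat by auto
    have 1: "length xs = m \<and> set xs \<subseteq> carrier_vec n" if xs: "xs \<in> set_pmf (orc (n, B, s))" for xs
    proof -
      obtain ys where "ys \<in> set_pmf (D (n, B, s))" "xs = map rat_of_vec ys"
        using xs by (auto simp: orc_def)
      then show ?thesis using supp[of ys] L(1) by auto
    qed
    have "map_pmf (map real_vec) (orc (n, B, s)) = map_pmf (\<lambda>xs. xs) (D (n, B, s))"
      unfolding orc_def map_pmf_comp
    proof (rule map_pmf_cong[OF refl])
      fix xs assume "xs \<in> set_pmf (D (n, B, s))"
      then show "map real_vec (map rat_of_vec xs) = xs"
        using supp(1) L(2) by (simp add: map_idI subset_iff)
    qed
    then have "stat_dist (map_pmf (map real_vec) (orc (n, B, s))) (D (n, B, s)) = 0"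
      by (simp add: stat_dist_def)
    then have 2: "stat_dist (map_pmf (map real_vec) (orc (n, B, s))) (replicate_pmf m ?G) \<le> \<epsilon>"
      using assms by (simp add: D_def)
    show "(\<forall>xs\<in>set_pmf (orc (n, B, s)). length xs = m \<and> set xs \<subseteq> carrier_vec n) \<and>
        stat_dist (map_pmf (map real_vec) (orc (n, B, s))) (replicate_pmf m ?G) \<le> \<epsilon>"
      using 1 2 by blast
  qed
  then show ?thesis by (intro exI[of _ orc])
qed

section \<open>A randomized oracle RAM with logarithmic cost\<close>

text \<open>
  The memory consists of arrays of integers, named by natural numbers and indexed by natural
  numbers; scalar variables are the cells \<open>Cell k (Num 0)\<close>. Negative indices are read as 0.
\<close>

datatype aexp = Num int | Cell nat aexp
  | Add aexp aexp | Sub aexp aexp | Mul aexp aexp | Div aexp aexp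

datatype bexp = Less aexp aexp | Not bexp | And bexp bexp

datatype com = Skip
  | Store nat aexp aexp
  | Seq com com
  | If bexp com com
  | While bexp com
  | Coin nat aexp
  | Query

type_synonym memory = "nat \<Rightarrow> nat \<Rightarrow> int"

definition len :: "int \<Rightarrow> nat" where
  "len x = nat (bitlen \<bar>x\<bar>)"

primrec aval :: "memory \<Rightarrow> aexp \<Rightarrow> int" where
  "aval M (Num c) = c"
| "aval M (Cell k e) = M k (nat (aval M e))"
| "aval M (Add e f) = aval M e + aval M f"
| "aval M (Sub e f) = aval M e - aval M f"
| "aval M (Mul e f) = aval M e * aval M f"
| "aval M (Div e f) = aval M e div aval M f"

primrec bval :: "memory \<Rightarrow> bexp \<Rightarrow> bool" where
  "bval M (Less e f) = (aval M e < aval M f)"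
| "bval M (Not b) = (\<not> bval M b)"
| "bval M (And b c) = (bval M b \<and> bval M c)"

text \<open>
  An operation is charged the number of digits it processes. Reading a cell costs the length of its
  address; its content is charged to the operation that consumes it. A comparison is charged the
  length of the shorter operand, as two numbers of different lengths are told apart by scanning
  them in parallel until one ends. Hence a program can discard an excessively long entry of an
  oracle answer without paying for its length.
\<close>

primrec acost :: "memory \<Rightarrow> aexp \<Rightarrow> nat" where
  "acost M (Num c) = 1 + len c"
| "acost M (Cell k e) = 1 + acost M e + len (aval M e)"
| "acost M (Add e f) = 1 + acost M e + acost M f + len (aval M e) + len (aval M f)"
| "acost M (Sub e f) = 1 + acost M e + acost M f + len (aval M e) + len (aval M f)"
| "acost M (Mul e f) = 1 + acost M e + acost M f + len (aval M e) + len (aval M f)"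
| "acost M (Div e f) = 1 + acost M e + acost M f + len (aval M e) + len (aval M f)"

primrec bcost :: "memory \<Rightarrow> bexp \<Rightarrow> nat" where
  "bcost M (Less e f) = 1 + acost M e + acost M f + min (len (aval M e)) (len (aval M f))"
| "bcost M (Not b) = 1 + bcost M b"
| "bcost M (And b c) = 1 + bcost M b + bcost M c"

record config =
  mem :: memory
  cost :: nat
  queries :: "dgs_query list"

definition tick :: "nat \<Rightarrow> config \<Rightarrow> config" where
  "tick c \<sigma> = \<sigma>\<lparr>cost := cost \<sigma> + c\<rparr>"

definition store :: "nat \<Rightarrow> nat \<Rightarrow> int \<Rightarrow> config \<Rightarrow> config" where
  "store k i v \<sigma> = \<sigma>\<lparr>mem := (mem \<sigma>)(k := (mem \<sigma> k)(i := v))\<rparr>"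

definition load :: "nat \<Rightarrow> int list \<Rightarrow> config \<Rightarrow> config" where
  "load k xs \<sigma> = \<sigma>\<lparr>mem := (mem \<sigma>)(k := (\<lambda>i. if i < length xs then xs ! i else 0))\<rparr>"

abbreviation (input) input_array :: nat where "input_array \<equiv> 0"
abbreviation (input) output_array :: nat where "output_array \<equiv> 1"
abbreviation (input) query_array :: nat where "query_array \<equiv> 2"
abbreviation (input) answer_array :: nat where "answer_array \<equiv> 3"

text \<open>A rational number occupies two cells, numerator and denominator.\<close>

definition enc_vec :: "rat vec \<Rightarrow> int list" where
  "enc_vec v = concat (map (\<lambda>q. [fst (quotient_of q), snd (quotient_of q)]) (list_of_vec v))"

definition dec_rat :: "(nat \<Rightarrow> int) \<Rightarrow> nat \<Rightarrow> rat" where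
  "dec_rat a p = Rat.Fract (a p) (a (p + 1))"

definition dec_vec :: "(nat \<Rightarrow> int) \<Rightarrow> nat \<Rightarrow> nat \<Rightarrow> rat vec" where
  "dec_vec a n p = vec n (\<lambda>j. dec_rat a (p + 2 * j))"

text \<open>A query is laid out as dimension, number of basis vectors, parameter, basis vectors.\<close>

definition dec_query :: "(nat \<Rightarrow> int) \<Rightarrow> dgs_query" where
  "dec_query a = (let n = nat (a 0) in
     (n, map (\<lambda>i. dec_vec a n (4 + 2 * n * i)) [0..<nat (a 1)], dec_rat a 2))"

text \<open>
  The natural-number argument bounds the number of iterations of each loop; \<open>None\<close> signals that the
  bound was exceeded. A query costs one step: its construction and the inspection of its answer are
  charged to the program, the work of the oracle is not.
\<close>

primrec exec ::
  "(dgs_query \<Rightarrow> rat vec list pmf) \<Rightarrow> nat \<Rightarrow> com \<Rightarrow> config \<Rightarrow> config option pmf" where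
  "exec orc fuel Skip = (\<lambda>\<sigma>. return_pmf (Some (tick 1 \<sigma>)))"
| "exec orc fuel (Store k e f) = (\<lambda>\<sigma>. let M = mem \<sigma> in
     return_pmf (Some (tick (1 + acost M e + acost M f + len (aval M e) + len (aval M f))
       (store k (nat (aval M e)) (aval M f) \<sigma>))))"
| "exec orc fuel (Seq c d) = (\<lambda>\<sigma>.
     bind_pmf (exec orc fuel c \<sigma>) (case_option (return_pmf None) (exec orc fuel d)))"
| "exec orc fuel (If b c d) = (\<lambda>\<sigma>.
     (if bval (mem \<sigma>) b then exec orc fuel c else exec orc fuel d)
       (tick (1 + bcost (mem \<sigma>) b) \<sigma>))"
| "exec orc fuel (While b c) =
     ((\<lambda>loop \<sigma>. let \<sigma>' = tick (1 + bcost (mem \<sigma>) b) \<sigma> in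
        if bval (mem \<sigma>) b
        then bind_pmf (exec orc fuel c \<sigma>') (case_option (return_pmf None) loop)
        else return_pmf (Some \<sigma>')) ^^ fuel) (\<lambda>\<sigma>. return_pmf None)"
| "exec orc fuel (Coin k e) = (\<lambda>\<sigma>. let M = mem \<sigma> in
     map_pmf (\<lambda>r. Some (tick (1 + acost M e + len (aval M e))
       (store k (nat (aval M e)) (of_bool r) \<sigma>))) (bernoulli_pmf (1 / 2)))"
| "exec orc fuel Query = (\<lambda>\<sigma>. let q = dec_query (mem \<sigma> query_array) in
     map_pmf (\<lambda>xs. Some (tick 1
       (load answer_array (concat (map enc_vec xs)) (\<sigma>\<lparr>queries := queries \<sigma> @ [q]\<rparr>)))) (orc q))"

section \<open>Reductions from approximate CVP to discrete Gaussian sampling\<close>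

definition enc_cvp :: "nat \<Rightarrow> rat vec list \<Rightarrow> rat vec \<Rightarrow> int list" where
  "enc_cvp n B t = [int n, int (length B)] @ concat (map enc_vec B) @ enc_vec t"

definition enc_size :: "int list \<Rightarrow> nat" where
  "enc_size xs = (\<Sum>x\<leftarrow>xs. 1 + len x)"

definition init :: "nat \<Rightarrow> rat vec list \<Rightarrow> rat vec \<Rightarrow> config" where
  "init n B t =
     load input_array (enc_cvp n B t) \<lparr>mem = (\<lambda>_ _. 0), cost = 0, queries = []\<rparr>"

definition out_vec :: "nat \<Rightarrow> config \<Rightarrow> rat vec" where
  "out_vec n \<sigma> = dec_vec (mem \<sigma> output_array) n 0"

text \<open>
  \<open>m n\<close> is the number of samples per query on inputs of dimension \<open>n\<close>, and \<open>\<epsilon>\<close> the quality of the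
  oracle. The bounds on calls and time hold on every run, whatever the oracle answers and the coins
  show; only the correctness of the output is probabilistic, with the usual bound 2/3 (runs can be
  repeated and the closest lattice vector kept). Queries concern a lattice of dimension one more
  than the input lattice, so \<open>n + 1\<close> if the input has full rank \<open>n\<close>.
\<close>

definition cvp_to_dgs_reduction ::
  "com \<Rightarrow> real \<Rightarrow> (nat \<Rightarrow> nat) \<Rightarrow> real \<Rightarrow> (nat \<Rightarrow> nat) \<Rightarrow> (nat \<Rightarrow> nat \<Rightarrow> real) \<Rightarrow> bool" where
  "cvp_to_dgs_reduction P \<gamma> m \<epsilon> calls run_time \<longleftrightarrow>
     (\<forall>n B t orc. n > 0 \<longrightarrow> is_basis n (map real_vec B) \<longrightarrow> t \<in> carrier_vec n \<longrightarrow>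
        dgs_oracle (m n) \<epsilon> orc \<longrightarrow>
        (\<exists>fuel. let res = exec orc fuel P (init n B t) in
           None \<notin> set_pmf res \<and>
           (\<forall>\<sigma>. Some \<sigma> \<in> set_pmf res \<longrightarrow>
              length (queries \<sigma>) \<le> calls n \<and>
              (\<forall>(n', B', s) \<in> set (queries \<sigma>).
                 valid_query (n', B', s) \<and> n' = n + 1 \<and> length B' = length B + 1) \<and>
              real (cost \<sigma>) \<le> run_time n (enc_size (enc_cvp n B t))) \<and>
           measure_pmf.prob res
             {Some \<sigma> | \<sigma>. cvp_solution \<gamma> (lattice_of n (map real_vec B)) (real_vec t)
                            (real_vec (out_vec n \<sigma>))} \<ge> 2 / 3))"

end

theory Submission
  imports Defs "HOL-Real_Asymp.Real_Asymp"
begin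

text \<open>
  The embedding technique turns Gaussian samples into close vectors. For a lattice \<open>L\<close> with basis
  \<open>b\<^sub>1, \<dots>, b\<^sub>d\<close> and a target \<open>t\<close>, sample with parameter \<open>s\<close> from the lattice generated by the \<open>(b\<^sub>i, 0)\<close>
  and \<open>(t, s)\<close>. A sample with last entry \<open>- s\<close> is \<open>(y - t, - s)\<close> with \<open>y\<close> in \<open>L\<close>. Let \<open>\<delta>\<close> be the distance of
  \<open>t\<close> to \<open>L\<close>. The mass of a shift of \<open>L\<close> is at most that of \<open>L\<close>, so the closest \<open>y\<close> alone shows that these
  samples have probability at least a constant times \<open>exp (- \<pi> \<delta>\<^sup>2 / s\<^sup>2)\<close>; and since the mass of \<open>L\<close> grows
  at most like the \<open>n\<close>-th power of the parameter, the part at distance more than \<open>1.97 \<delta>\<close> is exponentially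
  smaller once \<open>\<pi> \<delta>\<^sup>2 / s\<^sup>2 \<ge> 0.345 n\<close>. As \<open>0.3465 < ln 2 / 2\<close>, for \<open>\<pi> \<delta>\<^sup>2 / s\<^sup>2\<close> between \<open>0.345 n\<close> and
  \<open>0.3465 n\<close> a batch of \<open>2\<^bsup>n/2\<^esup>\<close> samples has a good one with probability at least
  \<open>1 - 1/e\<close>, hence at least \<open>0.12\<close> for the oracle. LLL reduction and Babai's nearest plane procedure locate \<open>\<delta>\<close>
  up to a factor \<open>2\<^bsup>O(n)\<^esup>\<close>, so \<open>O(n)\<close> guesses of \<open>s\<close> in geometric progression contain nine in that window,
  and \<open>0.88\<^sup>9 \<le> 1/3\<close>. The finitely many dimensions in which the constants matter are solved by enumeration.
\<close>

section \<open>Cost of deterministic programs\<close>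

text \<open>Origin of 1.97: put \<open>x = \<gamma>\<^sup>2 * ln 2\<close>. With
  \<open>\<pi> \<delta>\<^sup>2 / s\<^sup>2\<close> at its limit \<open>n * ln 2 / 2\<close>, the
  far part loses to the closest vector as soon as \<open>x - ln x > 1 + ln 2\<close>, that is for
  \<gamma> above about 1.966. Both facts about Gaussian mass usually come from Poisson summation.
  Here the bound for shifts follows from the rotation of pairs \<open>(y, z)\<close> into
  \<open>(y + z, y - z)\<close>, and the growth bound follows from it in turn: its second-order term
  at shift 0 bounds the second moment, which is the derivative of the mass in the rate. The bounds
  on time and calls hold for every answer, and an answer within statistical distance 1/2 may contain
  anything. So nothing in it is trusted: long entries are cut off by a cheap comparison, and every
  vector is moved into the coset \<open>L - t\<close> by nearest plane, which fixes the vectors that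
  lie there already. Neither the number of rounds nor the queries depend on the answers. The last
  coordinate is a multiple of \<open>s\<close> so that its weight does not depend on
  \<open>s\<close>; it costs a constant factor only.\<close>

lemma len_le_iff: "len x \<le> k \<longleftrightarrow> \<bar>x\<bar> < 2 ^ k"
  unfolding len_def using bitlen_le_iff_power[of "\<bar>x\<bar>" k] bitlen_nonneg[of "\<bar>x\<bar>"]
  by (simp add: nat_le_iff)

lemma abs_less_len: "\<bar>x\<bar> < 2 ^ len x"
  using len_le_iff by blast

lemma len_mono: "\<bar>x\<bar> \<le> \<bar>y\<bar> \<Longrightarrow> len x \<le> len y"
  using len_le_iff abs_less_len[of y] by simp

lemma len_add: "len (x + y) \<le> len x + len y + 1"
proof -
  have "\<bar>x + y\<bar> < 2 ^ len x + 2 ^ len y" using abs_less_len[of x] abs_less_len[of y] by linarith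
  also have "\<dots> \<le> 2 ^ (len x + len y) + 2 ^ (len x + len y)"
    by (intro add_mono power_increasing) auto
  finally show ?thesis by (simp add: len_le_iff)
qed

lemma len_minus: "len (x - y) \<le> len x + len y + 1"
  using len_add[of x "- y"] by (simp add: len_def)

lemma len_mult: "len (x * y) \<le> len x + len y"
proof (cases "y = 0")
  case False
  then have "\<bar>x * y\<bar> < 2 ^ len x * 2 ^ len y"
    unfolding abs_mult using abs_less_len by (intro mult_strict_mono) auto
  then show ?thesis by (simp add: len_le_iff power_add)
qed (simp add: len_def)

text \<open>Division rounds down, so a negative quotient moves away from zero; monotonicity in the
  divisor, compared with the divisor 1, bounds it all the same. For a negative divisor both operands
  are negated, and \<open>x div 0\<close> is 0.\<close>

lemma abs_div_le: "\<bar>x div y\<bar> \<le> \<bar>x :: int\<bar>"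
proof -
  have pos: "\<bar>x div y\<bar> \<le> \<bar>x\<bar>" if y: "y > 0" for x y :: int
  proof (cases "x \<ge> 0")
    case True
    have "x div y \<ge> 0" using y True by (simp add: pos_imp_zdiv_nonneg_iff)
    moreover have "x div y \<le> x div 1" using y True by (intro zdiv_mono2) auto
    ultimately show ?thesis by simp
  next
    case False
    have "x div y < 0" using y False by (simp add: div_neg_pos_less0)
    moreover have "x div 1 \<le> x div y" using y False by (intro zdiv_mono2_neg) auto
    ultimately show ?thesis by simp
  qed
  show ?thesis using pos[of y x] pos[of "- y" "- x"] by (cases y "0 :: int" rule: linorder_cases) auto
qed

lemma len_div: "len (x div y) \<le> len x"
  by (rule len_mono) (rule abs_div_le)

section \<open>Deterministic executions and their step counts\<close>

abbreviation var :: "nat \<Rightarrow> aexp" where "var k \<equiv> Cell k (Num 0)"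

definition upd :: "memory \<Rightarrow> nat \<Rightarrow> nat \<Rightarrow> int \<Rightarrow> memory" where
  "upd M k i v = M(k := (M k)(i := v))"

lemma upd_apply [simp]: "upd M k i v k' = (if k' = k then (M k)(i := v) else M k')"
  by (simp add: upd_def)

text \<open>Big-step semantics of programs without \<open>Coin\<close> and \<open>Query\<close>. It
  counts elementary commands and tests instead of their cost; as every stored value is bounded by
  \<open>Z\<close>, each of them costs at most a fixed amount, and \<open>bs_exec\<close> makes the
  conversion once and for all.\<close>

inductive bs :: "int \<Rightarrow> com \<Rightarrow> memory \<Rightarrow> nat \<Rightarrow> memory \<Rightarrow> bool" for Z where
  Skip: "bs Z Skip M 1 M"
| Store: "\<bar>aval M f\<bar> \<le> Z \<Longrightarrow> bs Z (Store k e f) M 1 (upd M k (nat (aval M e)) (aval M f))"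
| Seq: "bs Z c M t M' \<Longrightarrow> bs Z d M' t' M'' \<Longrightarrow> bs Z (Seq c d) M (t + t') M''"
| IfT: "bval M b \<Longrightarrow> bs Z c M t M' \<Longrightarrow> bs Z (If b c d) M (t + 1) M'"
| IfF: "\<not> bval M b \<Longrightarrow> bs Z d M t M' \<Longrightarrow> bs Z (If b c d) M (t + 1) M'"
| WhileF: "\<not> bval M b \<Longrightarrow> bs Z (While b c) M 1 M"
| WhileT: "bval M b \<Longrightarrow> bs Z c M t M' \<Longrightarrow> bs Z (While b c) M' t' M'' \<Longrightarrow>
    bs Z (While b c) M (1 + t + t') M''"

text \<open>Entries of the answer array come from the oracle and may have any length. The syntactic
  conditions here and in \<open>lite\<close> and \<open>okb\<close> keep them out of arithmetic:
  they may only be copied, or compared with something of bounded length.\<close>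

primrec noans :: "aexp \<Rightarrow> bool" where
  "noans (Num c) = True"
| "noans (Cell k e) = (k \<noteq> answer_array \<and> noans e)"
| "noans (Add e f) = (noans e \<and> noans f)"
| "noans (Sub e f) = (noans e \<and> noans f)"
| "noans (Mul e f) = (noans e \<and> noans f)"
| "noans (Div e f) = (noans e \<and> noans f)"

text \<open>A read at top level costs only the length of its address, whatever the cell
  contains.\<close>

fun lite :: "aexp \<Rightarrow> bool" where
  "lite (Cell k e) = noans e"
| "lite e = noans e"

primrec okb :: "bexp \<Rightarrow> bool" where
  "okb (Less e f) = (lite e \<and> lite f \<and> (noans e \<or> noans f))"
| "okb (Not b) = okb b"
| "okb (And b c) = (okb b \<and> okb c)"

lemma noans_lite: "noans e \<Longrightarrow> lite e"
  by (cases e) auto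

primrec wfc :: "com \<Rightarrow> bool" where
  "wfc Skip = True"
| "wfc (Store k e f) = (noans e \<and> lite f)"
| "wfc (Seq c d) = (wfc c \<and> wfc d)"
| "wfc (If b c d) = (okb b \<and> wfc c \<and> wfc d)"
| "wfc (While b c) = (okb b \<and> wfc c)"
| "wfc (Coin k e) = False"
| "wfc Query = False"

primrec asz :: "aexp \<Rightarrow> nat" where
  "asz (Num c) = 1 + len c"
| "asz (Cell k e) = 1 + asz e"
| "asz (Add e f) = 1 + asz e + asz f"
| "asz (Sub e f) = 1 + asz e + asz f"
| "asz (Mul e f) = 1 + asz e + asz f"
| "asz (Div e f) = 1 + asz e + asz f"

primrec bsz :: "bexp \<Rightarrow> nat" where
  "bsz (Less e f) = 1 + asz e + asz f"
| "bsz (Not b) = 1 + bsz b"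
| "bsz (And b c) = 1 + bsz b + bsz c"

primrec csz :: "com \<Rightarrow> nat" where
  "csz Skip = 1"
| "csz (Store k e f) = 1 + asz e + asz f"
| "csz (Seq c d) = csz c + csz d"
| "csz (If b c d) = 1 + bsz b + csz c + csz d"
| "csz (While b c) = 1 + bsz b + csz c"
| "csz (Coin k e) = 1"
| "csz Query = 1"

definition bd :: "int \<Rightarrow> memory \<Rightarrow> bool" where
  "bd Z M \<longleftrightarrow> (\<forall>k i. k \<noteq> answer_array \<longrightarrow> \<bar>M k i\<bar> \<le> Z)"

lemma bd_len: "bd Z M \<Longrightarrow> k \<noteq> answer_array \<Longrightarrow> len (M k i) \<le> len Z"
  by (intro len_mono) (metis bd_def abs_ge_self order_trans)

lemma len_aval:
  assumes "bd Z M" "noans e" shows "len (aval M e) \<le> asz e * (len Z + 1)"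
  using assms(2)
proof (induction e)
  case (Cell k e)
  then show ?case using bd_len[OF assms(1), of k "nat (aval M e)"] by (simp add: algebra_simps)
next
  case (Add e f)
  then show ?case using len_add[of "aval M e" "aval M f"] by (simp add: algebra_simps)
next
  case (Sub e f)
  then show ?case using len_minus[of "aval M e" "aval M f"] by (simp add: algebra_simps)
next
  case (Mul e f)
  then show ?case using len_mult[of "aval M e" "aval M f"] by (simp add: algebra_simps)
next
  case (Div e f)
  then show ?case using len_div[of "aval M e" "aval M f"] by (simp add: algebra_simps)
qed (simp add: algebra_simps)

text \<open>Induction step for the cost bounds: lengths of values are linear in the size of an
  expression, and summing them over all subexpressions gives a quadratic bound.\<close>

lemma size_aux:
  fixes a b c d A B L :: nat
  assumes "a \<le> 2 * A\<^sup>2 * L" "b \<le> 2 * B\<^sup>2 * L" "c \<le> A * L" "d \<le> B * L" "L \<ge> 1"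
  shows "1 + a + b + c + d \<le> 2 * (1 + A + B)\<^sup>2 * L"
proof -
  have "1 + a + b + c + d \<le> L + 2 * A\<^sup>2 * L + 2 * B\<^sup>2 * L + A * L + B * L" using assms by linarith
  also have "\<dots> = (1 + 2 * A\<^sup>2 + 2 * B\<^sup>2 + A + B) * L" by (simp add: algebra_simps)
  also have "\<dots> \<le> 2 * (1 + A + B)\<^sup>2 * L"
    by (intro mult_right_mono) (auto simp: power2_eq_square algebra_simps)
  finally show ?thesis .
qed

lemma acost_le:
  assumes "bd Z M" "noans e" shows "acost M e \<le> 2 * (asz e)\<^sup>2 * (len Z + 1)"
  using assms(2)
proof (induction e)
  case (Num c)
  show ?case by (simp add: power2_eq_square algebra_simps)
next
  case (Cell k e)
  then show ?case using size_aux[of "acost M e" "asz e" "len Z + 1" 0 0 "len (aval M e)" 0] len_aval[OF assms(1), of e]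
    by simp
qed (use size_aux[of _ _ "len Z + 1"] len_aval[OF assms(1)] in auto)

lemma acost_lite:
  assumes "bd Z M" "lite e" shows "acost M e \<le> 2 * (asz e)\<^sup>2 * (len Z + 1)"
proof -
  have "noans e \<or> (\<exists>k f. e = Cell k f \<and> noans f)" using assms(2) by (cases e) auto
  then show ?thesis
  proof (elim disjE exE conjE)
    fix k f assume e: "e = Cell k f" and f: "noans f"
    show ?thesis
      using e size_aux[of "acost M f" "asz f" "len Z + 1" 0 0 "len (aval M f)" 0] len_aval[OF assms(1) f]
        acost_le[OF assms(1) f] by simp
  qed (rule acost_le[OF assms(1)])
qed

lemma asz_pos: "asz e \<ge> 1" by (cases e) auto

lemma bcost_le:
  assumes "bd Z M" "okb b" shows "1 + bcost M b \<le> 2 * (1 + bsz b)\<^sup>2 * (len Z + 1)"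
proof -
  have "bcost M b \<le> 2 * (bsz b)\<^sup>2 * (len Z + 1)" using assms(2)
  proof (induction b)
    case (Less e f)
    then have l: "lite e" "lite f" by auto
    show ?case
    \<comment> \<open>A comparison is charged the shorter operand, so the length of the operand that
      avoids the answer array suffices.\<close>
    proof (cases "noans e")
      case True
      then show ?thesis
        using size_aux[OF acost_lite[OF assms(1) l(1)] acost_lite[OF assms(1) l(2)] len_aval[OF assms(1) True], of 0]
        by (simp add: min_def)
    next
      case False
      then have "noans f" using Less by simp
      then show ?thesis
        using size_aux[OF acost_lite[OF assms(1) l(1)] acost_lite[OF assms(1) l(2)] _ len_aval[OF assms(1) \<open>noans f\<close>], of 0]
        by (simp add: min_def)
    qed
  next
    case (Not b)
    then show ?case using size_aux[of "bcost M b" "bsz b" "len Z + 1" 0 0 0 0] by simp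
  next
    case (And b c)
    then show ?case using size_aux[of "bcost M b" "bsz b" "len Z + 1" "bcost M c" "bsz c" 0 0] by simp
  qed
  then show ?thesis using size_aux[of "bcost M b" "bsz b" "len Z + 1" 0 0 0 0] by simp
qed

section \<open>From step counts to executions\<close>

definition loopF where
  "loopF orc fuel b c = (\<lambda>loop \<sigma>. let \<sigma>' = tick (1 + bcost (mem \<sigma>) b) \<sigma> in
        if bval (mem \<sigma>) b
        then bind_pmf (exec orc fuel c \<sigma>') (case_option (return_pmf None) loop)
        else return_pmf (Some \<sigma>'))"

lemma exec_While: "exec orc fuel (While b c) = (loopF orc fuel b c ^^ fuel) (\<lambda>\<sigma>. return_pmf None)"
  by (simp add: loopF_def)

lemma loopF_Suc: "(loopF orc fuel b c ^^ Suc k) x \<sigma> = (let \<sigma>' = tick (1 + bcost (mem \<sigma>) b) \<sigma> in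
        if bval (mem \<sigma>) b
        then bind_pmf (exec orc fuel c \<sigma>') (case_option (return_pmf None) ((loopF orc fuel b c ^^ k) x))
        else return_pmf (Some \<sigma>'))"
  unfolding funpow.simps o_apply by (subst (1) loopF_def) (rule refl)

lemma bs_bd: "bs Z c M t M' \<Longrightarrow> bd Z M \<Longrightarrow> bd Z M'"
  by (induction rule: bs.induct) (auto simp: bd_def)

definition runs :: "nat \<Rightarrow> (config \<Rightarrow> config option pmf) \<Rightarrow> memory \<Rightarrow> nat \<Rightarrow> memory \<Rightarrow> bool" where
  "runs u E M t M' \<longleftrightarrow> (\<forall>\<sigma>. mem \<sigma> = M \<longrightarrow> (\<exists>C \<le> t * u.
     E \<sigma> = return_pmf (Some (\<sigma>\<lparr>mem := M', cost := cost \<sigma> + C\<rparr>))))"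

lemma runs_step:
  assumes "\<And>\<sigma>. mem \<sigma> = M \<Longrightarrow> \<exists>C\<le>t1 * u. E \<sigma> = E1 (\<sigma>\<lparr>mem := M1, cost := cost \<sigma> + C\<rparr>)"
    and "runs u E1 M1 t2 M'"
  shows "runs u E M (t1 + t2) M'"
  unfolding runs_def
proof (intro allI impI)
  fix \<sigma> :: config assume "mem \<sigma> = M"
  then obtain C where C: "C \<le> t1 * u" "E \<sigma> = E1 (\<sigma>\<lparr>mem := M1, cost := cost \<sigma> + C\<rparr>)" using assms(1) by blast
  obtain C' where "C' \<le> t2 * u" "E1 (\<sigma>\<lparr>mem := M1, cost := cost \<sigma> + C\<rparr>)
    = return_pmf (Some (\<sigma>\<lparr>mem := M', cost := cost \<sigma> + C + C'\<rparr>))"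
    using assms(2)[unfolded runs_def, rule_format, of "\<sigma>\<lparr>mem := M1, cost := cost \<sigma> + C\<rparr>"] by auto
  with C show "\<exists>C\<le>(t1 + t2) * u. E \<sigma> = return_pmf (Some (\<sigma>\<lparr>mem := M', cost := cost \<sigma> + C\<rparr>))"
    by (intro exI[of _ "C + C'"]) (auto simp: algebra_simps)
qed

lemma runs_bind:
  assumes "runs u E1 M t1 M1" "runs u E2 M1 t2 M'"
  shows "runs u (\<lambda>\<sigma>. bind_pmf (E1 \<sigma>) (case_option (return_pmf None) E2)) M (t1 + t2) M'"
proof (rule runs_step[OF _ assms(2)])
  fix \<sigma> :: config assume "mem \<sigma> = M"
  then obtain C where "C \<le> t1 * u" "E1 \<sigma> = return_pmf (Some (\<sigma>\<lparr>mem := M1, cost := cost \<sigma> + C\<rparr>))"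
    using assms(1) by (auto simp: runs_def)
  then show "\<exists>C\<le>t1 * u. bind_pmf (E1 \<sigma>) (case_option (return_pmf None) E2) = E2 (\<sigma>\<lparr>mem := M1, cost := cost \<sigma> + C\<rparr>)"
    by (intro exI[of _ C]) (simp add: bind_return_pmf)
qed

definition unit_cost :: "nat \<Rightarrow> int \<Rightarrow> nat" where
  "unit_cost K Z = 2 * K\<^sup>2 * (len Z + 1)"

lemma unit_cost_mono: "x \<le> 2 * y\<^sup>2 * (len Z + 1) \<Longrightarrow> y \<le> K \<Longrightarrow> x \<le> unit_cost K Z"
  unfolding unit_cost_def by (erule order_trans) (intro mult_mono power_mono, auto)

text \<open>Every loop iteration takes a step, so the number of steps also bounds the fuel needed.\<close>

lemma bs_exec_aux:
  assumes "bs Z c M t M'" "wfc c" "bd Z M" "csz c \<le> K"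
  shows "(\<forall>fuel\<ge>t. runs (unit_cost K Z) (exec orc fuel c) M t M') \<and>
    (\<forall>b d. c = While b d \<longrightarrow> (\<forall>fuel\<ge>t. \<forall>k\<ge>t.
       runs (unit_cost K Z) ((loopF orc fuel b d ^^ k) (\<lambda>\<sigma>. return_pmf None)) M t M'))"
  using assms
proof (induction rule: bs.induct)
  case (Skip M)
  have "1 \<le> unit_cost K Z" by (rule unit_cost_mono[of _ 1]) (use Skip in auto)
  then show ?case by (auto simp: runs_def tick_def intro!: exI[of _ 1])
next
  case (Store M f k e)
  let ?C = "1 + acost M e + acost M f + len (aval M e) + len (aval M f)"
  have "len (aval M f) \<le> len Z" using Store(1) by (intro len_mono) simp
  also have "\<dots> \<le> 1 * (len Z + 1)" by simp
  also have "\<dots> \<le> asz f * (len Z + 1)" using asz_pos by (intro mult_right_mono) auto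
  finally have l: "len (aval M f) \<le> asz f * (len Z + 1)" .
  have "?C \<le> 2 * (1 + asz e + asz f)\<^sup>2 * (len Z + 1)"
    using size_aux[OF acost_lite[of Z M e] acost_lite[of Z M f] len_aval[of Z M e] l] Store noans_lite[of e] by simp
  then have "?C \<le> unit_cost K Z" using Store(4) by (intro unit_cost_mono) auto
  then show ?case
    by (auto simp: runs_def tick_def store_def upd_def fun_upd_def Let_def simp del: upd_apply intro!: exI[of _ ?C])
next
  case (Seq c M t M' d t' M'')
  have "bd Z M'" using Seq bs_bd by blast
  then have "\<forall>fuel\<ge>t. runs (unit_cost K Z) (exec orc fuel c) M t M'"
    "\<forall>fuel\<ge>t'. runs (unit_cost K Z) (exec orc fuel d) M' t' M''" using Seq by auto
  then have "runs (unit_cost K Z) (exec orc fuel (Seq c d)) M (t + t') M''" if "fuel \<ge> t + t'" for fuel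
    using that unfolding exec.simps by (intro runs_bind[of _ _ M t M']) auto
  then show ?case by auto
next
  case (IfT M b c t M' d)
  have c: "1 + bcost M b \<le> unit_cost K Z"
    by (rule unit_cost_mono[OF bcost_le]) (use IfT in auto)
  have "runs (unit_cost K Z) (exec orc fuel (If b c d)) M (1 + t) M'" if "fuel \<ge> t + 1" for fuel
  proof (rule runs_step)
    show "runs (unit_cost K Z) (exec orc fuel c) M t M'" using IfT that by auto
    show "\<exists>C\<le>1 * unit_cost K Z. exec orc fuel (If b c d) \<sigma> = exec orc fuel c (\<sigma>\<lparr>mem := M, cost := cost \<sigma> + C\<rparr>)"
      if "mem \<sigma> = M" for \<sigma>
      using that IfT(1) c by (intro exI[of _ "1 + bcost M b"]) (auto simp: tick_def)
  qed
  then show ?case by auto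
next
  case (IfF M b d t M' c)
  have c: "1 + bcost M b \<le> unit_cost K Z"
    by (rule unit_cost_mono[OF bcost_le]) (use IfF in auto)
  have "runs (unit_cost K Z) (exec orc fuel (If b c d)) M (1 + t) M'" if "fuel \<ge> t + 1" for fuel
  proof (rule runs_step)
    show "runs (unit_cost K Z) (exec orc fuel d) M t M'" using IfF that by auto
    show "\<exists>C\<le>1 * unit_cost K Z. exec orc fuel (If b c d) \<sigma> = exec orc fuel d (\<sigma>\<lparr>mem := M, cost := cost \<sigma> + C\<rparr>)"
      if "mem \<sigma> = M" for \<sigma>
      using that IfF(1) c by (intro exI[of _ "1 + bcost M b"]) (auto simp: tick_def)
  qed
  then show ?case by auto
next
  case (WhileF M b c)
  have c: "1 + bcost M b \<le> unit_cost K Z"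
    by (rule unit_cost_mono[OF bcost_le]) (use WhileF in auto)
  have *: "runs (unit_cost K Z) ((loopF orc fuel b c ^^ k) (\<lambda>\<sigma>. return_pmf None)) M 1 M" if k: "k \<ge> 1" for k fuel
  proof -
    obtain k' where k': "k = Suc k'" using k by (cases k) auto
    show ?thesis unfolding runs_def k' loopF_Suc
      using c WhileF(1) by (auto intro!: exI[of _ "1 + bcost M b"] simp: tick_def Let_def)
  qed
  then show ?case unfolding exec_While by simp
next
  case (WhileT M b c t M' t' M'')
  have c: "1 + bcost M b \<le> unit_cost K Z"
    by (rule unit_cost_mono[OF bcost_le]) (use WhileT in auto)
  have "bd Z M'" using WhileT bs_bd by blast
  then have 1: "\<forall>fuel\<ge>t. runs (unit_cost K Z) (exec orc fuel c) M t M'"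
    and 2: "\<forall>fuel\<ge>t'. \<forall>k\<ge>t'. runs (unit_cost K Z) ((loopF orc fuel b c ^^ k) (\<lambda>\<sigma>. return_pmf None)) M' t' M''"
    using WhileT by auto
  \<comment> \<open>A round uses up one of the \<open>k\<close> iterations but runs its body with
    the full \<open>fuel\<close>, which is why the induction keeps the two numbers apart.\<close>
  have *: "runs (unit_cost K Z) ((loopF orc fuel b c ^^ k) (\<lambda>\<sigma>. return_pmf None)) M (1 + (t + t')) M''"
    if k: "k \<ge> 1 + t + t'" and f: "fuel \<ge> 1 + t + t'" for k fuel
  proof -
    obtain k' where k': "k = Suc k'" using k by (cases k) auto
    show ?thesis
    proof (rule runs_step)
      show "runs (unit_cost K Z) (\<lambda>\<sigma>. bind_pmf (exec orc fuel c \<sigma>) (case_option (return_pmf None)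
         ((loopF orc fuel b c ^^ k') (\<lambda>\<sigma>. return_pmf None)))) M (t + t') M''"
        using 1 2 k k' f by (intro runs_bind[of _ _ M t M']) auto
      show "\<exists>C\<le>1 * unit_cost K Z. (loopF orc fuel b c ^^ k) (\<lambda>\<sigma>. return_pmf None) \<sigma> =
        bind_pmf (exec orc fuel c (\<sigma>\<lparr>mem := M, cost := cost \<sigma> + C\<rparr>)) (case_option (return_pmf None)
         ((loopF orc fuel b c ^^ k') (\<lambda>\<sigma>. return_pmf None)))" if "mem \<sigma> = M" for \<sigma>
        unfolding k' loopF_Suc using that c WhileT(1)
        by (intro exI[of _ "1 + bcost M b"]) (auto simp: tick_def Let_def)
    qed
  qed
  then show ?case unfolding exec_While by (simp add: add.assoc)
qed

lemma bs_exec: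
  assumes "bs Z c M t M'" "wfc c" "bd Z M" "csz c \<le> K" "fuel \<ge> t" "mem \<sigma> = M"
  shows "\<exists>C \<le> t * unit_cost K Z. exec orc fuel c \<sigma> = return_pmf (Some (\<sigma>\<lparr>mem := M', cost := cost \<sigma> + C\<rparr>))"
  using bs_exec_aux[OF assms(1-4)] assms(5,6) unfolding runs_def by blast

text \<open>A total-correctness triple with a step bound. The initial memory is a fixed
  \<open>M\<close> instead of being described by a precondition, so what is known about it stays in
  ordinary hypotheses, and continuations nest as in \<open>tri_Seq\<close>.\<close>

definition tri :: "int \<Rightarrow> com \<Rightarrow> memory \<Rightarrow> nat \<Rightarrow> (memory \<Rightarrow> bool) \<Rightarrow> bool" where
  "tri Z c M t Q \<longleftrightarrow> (\<exists>t' M'. t' \<le> t \<and> bs Z c M t' M' \<and> Q M')"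

lemma tri_mono: "tri Z c M t Q \<Longrightarrow> t \<le> t' \<Longrightarrow> (\<And>M'. Q M' \<Longrightarrow> Q' M') \<Longrightarrow> tri Z c M t' Q'"
  unfolding tri_def by (meson order_trans)

lemma tri_Skip: "Q M \<Longrightarrow> tri Z Skip M (Suc t) Q"
  unfolding tri_def using bs.Skip[of Z M] by (intro exI[of _ 1] exI[of _ M]) auto

lemma tri_Store:
  "\<bar>aval M f\<bar> \<le> Z \<Longrightarrow> Q (upd M k (nat (aval M e)) (aval M f)) \<Longrightarrow> tri Z (Store k e f) M (Suc t) Q"
  unfolding tri_def using bs.Store[of M f Z k e] by (metis One_nat_def Suc_le_mono zero_le)

lemma tri_Seq: "tri Z c M t (\<lambda>M'. tri Z d M' t' Q) \<Longrightarrow> t + t' \<le> t'' \<Longrightarrow> tri Z (Seq c d) M t'' Q"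
  unfolding tri_def using bs.Seq by (meson add_mono order_trans)

lemma tri_If:
  assumes "bval M b \<Longrightarrow> tri Z c M t Q" "\<not> bval M b \<Longrightarrow> tri Z d M t Q" "t + 1 \<le> t'"
  shows "tri Z (If b c d) M t' Q"
proof (cases "bval M b")
  case True
  then show ?thesis using assms(1,3) bs.IfT[of M b Z c] unfolding tri_def
    by (meson add_le_mono1 order_trans)
next
  case False
  then show ?thesis using assms(2,3) bs.IfF[of M b Z d] unfolding tri_def
    by (meson add_le_mono1 order_trans)
qed

lemma tri_WhileF: "\<not> bval M b \<Longrightarrow> Q M \<Longrightarrow> tri Z (While b c) M (Suc t) Q"
  unfolding tri_def using bs.WhileF[of M b Z c] by (intro exI[of _ 1] exI[of _ M]) auto

lemma tri_WhileT: "bval M b \<Longrightarrow> tri Z c M t (\<lambda>M'. tri Z (While b c) M' t' Q) \<Longrightarrow> 1 + t + t' \<le> t'' \<Longrightarrow>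
    tri Z (While b c) M t'' Q"
  unfolding tri_def using bs.WhileT[of M b Z c] by (smt (verit, best) add_mono le_trans order_refl)

lemma tri_While_count:
  assumes inv: "\<And>k M. k < N \<Longrightarrow> I k M \<Longrightarrow> bval M b \<and> tri Z c M tb (I (Suc k))"
    and fin: "\<And>M. I N M \<Longrightarrow> \<not> bval M b \<and> Q M"
    and "I k M" "k \<le> N"
  shows "tri Z (While b c) M ((N - k) * (tb + 1) + 1) Q"
  using assms(3,4)
proof (induction "N - k" arbitrary: k M)
  case 0
  then show ?case using fin by (auto intro!: tri_WhileF)
next
  case (Suc r)
  then have k: "k < N" by simp
  have i: "bval M b" "tri Z c M tb (I (Suc k))" using inv[OF k Suc(3)] by auto
  show ?case
  proof (rule tri_WhileT[OF i(1) tri_mono[OF i(2) order_refl]])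
    fix M' assume "I (Suc k) M'"
    then show "tri Z (While b c) M' ((N - Suc k) * (tb + 1) + 1) Q"
      using Suc(2) k by (intro Suc(1)) auto
  next
    have "N - k = Suc (N - Suc k)" using k by simp
    then show "1 + tb + ((N - Suc k) * (tb + 1) + 1) \<le> (N - k) * (tb + 1) + 1" by simp
  qed
qed

definition For :: "nat \<Rightarrow> aexp \<Rightarrow> com \<Rightarrow> com" where
  "For v e c = Seq (Store v (Num 0) (Num 0))
     (While (Less (var v) e) (Seq c (Store v (Num 0) (Add (var v) (Num 1)))))"

text \<open>The bound \<open>e\<close> is evaluated again in every round, hence the hypothesis that
  the invariant determines its value. The body has to return the counter unchanged because the
  increment belongs to the loop.\<close>

lemma tri_For:
  assumes init: "I 0 (upd M v 0 0)"
    and bound: "\<And>k M. k \<le> N \<Longrightarrow> I k M \<Longrightarrow> M v 0 = int k \<Longrightarrow> aval M e = int N"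
    and body: "\<And>k M. k < N \<Longrightarrow> I k M \<Longrightarrow> M v 0 = int k \<Longrightarrow>
      tri Z c M tb (\<lambda>M'. M' v 0 = int k \<and> I (Suc k) (upd M' v 0 (int (Suc k))))"
    and fin: "\<And>M. I N M \<Longrightarrow> M v 0 = int N \<Longrightarrow> Q M"
    and N: "int N \<le> Z"
    and t: "N * (tb + 2) + 2 \<le> t"
  shows "tri Z (For v e c) M t Q"
  unfolding For_def
proof (rule tri_Seq[OF tri_Store])
  show "\<bar>aval M (Num 0)\<bar> \<le> Z" using N by simp
  let ?J = "\<lambda>k M. I k M \<and> M v 0 = int k"
  have "tri Z (While (Less (var v) e) (Seq c (Store v (Num 0) (Add (var v) (Num 1)))))
    (upd M v 0 0) ((N - 0) * ((tb + 1) + 1) + 1) Q"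
  proof (rule tri_While_count[of N ?J])
    fix k M assume k: "k < N" and J: "?J k M"
    have "tri Z c M tb (\<lambda>M'. tri Z (Store v (Num 0) (Add (var v) (Num 1))) M' 1 (?J (Suc k)))"
    proof (rule tri_mono[OF body[OF k] order_refl])
      fix M' assume M': "M' v 0 = int k \<and> I (Suc k) (upd M' v 0 (int (Suc k)))"
      have "tri Z (Store v (Num 0) (Add (var v) (Num 1))) M' (Suc 0) (?J (Suc k))"
        by (rule tri_Store) (use M' k N in \<open>auto simp: add.commute\<close>)
      then show "tri Z (Store v (Num 0) (Add (var v) (Num 1))) M' 1 (?J (Suc k))" by simp
    qed (use J in auto)
    then show "bval M (Less (var v) e) \<and> tri Z (Seq c (Store v (Num 0) (Add (var v) (Num 1)))) M (tb + 1) (?J (Suc k))"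
      using bound[of k M] J k by (auto intro: tri_Seq)
  next
    fix M assume J: "?J N M"
    then show "\<not> bval M (Less (var v) e) \<and> Q M" using bound[of N M] fin by auto
  qed (use init in auto)
  then show "tri Z (While (Less (var v) e) (Seq c (Store v (Num 0) (Add (var v) (Num 1)))))
    (upd M v (nat (aval M (Num 0))) (aval M (Num 0))) (N * (tb + 2) + 1) Q" by simp
  show "Suc 0 + (N * (tb + 2) + 1) \<le> t" using t by simp
qed

section \<open>Gram-Schmidt orthogonalization and lattice reduction\<close>

text \<open>Vectors are functions of which the first \<open>n\<close> coordinates count. Working
  over any commutative ring lets the integers handled by the program and their real counterparts
  share one notation.\<close>

definition ip :: "nat \<Rightarrow> (nat \<Rightarrow> 'a::comm_ring_1) \<Rightarrow> (nat \<Rightarrow> 'a) \<Rightarrow> 'a" where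
  "ip n x y = (\<Sum>j<n. x j * y j)"

lemma ip_commute: "ip n x y = ip n y x"
  by (simp add: ip_def mult.commute)

lemma ip_add_left: "ip n (\<lambda>x. v x + u x) w = ip n v w + ip n u w"
  by (simp add: ip_def algebra_simps sum.distrib)

lemma ip_diff_left: "ip n (\<lambda>x. v x - u x) w = ip n v w - ip n u w"
  by (simp add: ip_def algebra_simps sum_subtractf)

lemma ip_scale_left: "ip n (\<lambda>x. c * v x) w = c * ip n v w"
  by (simp add: ip_def algebra_simps sum_distrib_left)

lemma ip_sum_left: "ip n (\<lambda>x. \<Sum>i\<in>I. f i x) w = (\<Sum>i\<in>I. ip n (f i) w)"
  by (simp add: ip_def sum_distrib_right) (rule sum.swap)

lemma ip_add_right: "ip n w (\<lambda>x. v x + u x) = ip n w v + ip n w u"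
  by (simp add: ip_def algebra_simps sum.distrib)

lemma ip_diff_right: "ip n w (\<lambda>x. v x - u x) = ip n w v - ip n w u"
  by (simp add: ip_def algebra_simps sum_subtractf)

lemma ip_scale_right: "ip n w (\<lambda>x. c * v x) = c * ip n w v"
  by (simp add: ip_def algebra_simps sum_distrib_left)

lemma ip_sum_right: "ip n w (\<lambda>x. \<Sum>i\<in>I. f i x) = (\<Sum>i\<in>I. ip n w (f i))"
  unfolding ip_commute[of n w] by (rule ip_sum_left)

lemma ip_zero [simp]: "ip n (\<lambda>_. 0) w = 0" "ip n w (\<lambda>_. 0) = 0"
  by (simp_all add: ip_def)

lemma ip_divide_left: "ip n (\<lambda>x. v x / c) w = ip n v w / (c :: 'a :: field)"
  by (simp add: ip_def sum_divide_distrib)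

lemma ip_divide_right: "ip n w (\<lambda>x. v x / c) = ip n w v / (c :: 'a :: field)"
  by (simp add: ip_def sum_divide_distrib)

lemmas ip_simps = ip_divide_left ip_divide_right ip_add_left ip_diff_left ip_scale_left ip_sum_left
  ip_add_right ip_diff_right ip_scale_right ip_sum_right

lemma ip_nonneg: "0 \<le> ip n v (v :: nat \<Rightarrow> real)"
  by (simp add: ip_def sum_nonneg)

lemma ip_eq_0: "ip n v (v :: nat \<Rightarrow> real) = 0 \<longleftrightarrow> (\<forall>x<n. v x = 0)"
  unfolding ip_def by (subst sum_nonneg_eq_0_iff) auto

lemma of_int_ip: "of_int (ip n u v) = ip n (\<lambda>x. of_int (u x)) (\<lambda>x. of_int (v x) :: 'a::comm_ring_1)"
  by (simp add: ip_def)

lemma ip_cong: "(\<And>x. x < n \<Longrightarrow> u x = u' x) \<Longrightarrow> (\<And>x. x < n \<Longrightarrow> v x = v' x) \<Longrightarrow> ip n u v = ip n u' v'"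
  by (simp add: ip_def)

text \<open>Projection orthogonal to the first \<open>i\<close> basis vectors, by Gram-Schmidt. As
  division by zero gives 0, a dependent vector contributes nothing, so orthogonality and the
  decomposition hold for every family.\<close>

primrec proj :: "nat \<Rightarrow> (nat \<Rightarrow> nat \<Rightarrow> real) \<Rightarrow> nat \<Rightarrow> (nat \<Rightarrow> real) \<Rightarrow> nat \<Rightarrow> real" where
  "proj n b 0 = (\<lambda>v. v)"
| "proj n b (Suc i) = (\<lambda>v x. proj n b i v x -
     ip n (proj n b i v) (proj n b i (b i)) / ip n (proj n b i (b i)) (proj n b i (b i)) * proj n b i (b i) x)"

definition gs :: "nat \<Rightarrow> (nat \<Rightarrow> nat \<Rightarrow> real) \<Rightarrow> nat \<Rightarrow> nat \<Rightarrow> real" where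
  "gs n b i = proj n b i (b i)"

definition gsn :: "nat \<Rightarrow> (nat \<Rightarrow> nat \<Rightarrow> real) \<Rightarrow> nat \<Rightarrow> real" where
  "gsn n b i = ip n (gs n b i) (gs n b i)"

definition mu :: "nat \<Rightarrow> (nat \<Rightarrow> nat \<Rightarrow> real) \<Rightarrow> (nat \<Rightarrow> real) \<Rightarrow> nat \<Rightarrow> real" where
  "mu n b v j = ip n v (gs n b j) / gsn n b j"

lemma proj_Suc: "proj n b (Suc i) v = (\<lambda>x. proj n b i v x - ip n (proj n b i v) (gs n b i) / gsn n b i * gs n b i x)"
  by (simp add: gs_def gsn_def)

declare proj.simps(2) [simp del]

lemma gsn_nonneg: "gsn n b i \<ge> 0"
  by (simp add: gsn_def ip_nonneg)

lemma gsn_0_ip: "gsn n b i = 0 \<Longrightarrow> ip n v (gs n b i) = 0"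
  unfolding gsn_def ip_eq_0 by (simp add: ip_def)

lemma proj_orth: "j < i \<Longrightarrow> ip n (proj n b i v) (gs n b j) = 0"
proof (induction i arbitrary: j v)
  case (Suc i)
  show ?case
  proof (cases "j = i")
    case True
    then show ?thesis
      by (cases "gsn n b i = 0") (auto simp: proj_Suc ip_simps gsn_0_ip, simp add: gsn_def)
  next
    case False
    then have "ip n (gs n b i) (gs n b j) = 0" using Suc unfolding gs_def[of n b i] by auto
    then show ?thesis using Suc False by (simp add: proj_Suc ip_simps)
  qed
qed simp

lemma gs_orth: "i \<noteq> j \<Longrightarrow> ip n (gs n b i) (gs n b j) = 0"
  using proj_orth[of j i n b "b i"] proj_orth[of i j n b "b j"] ip_commute[of n "gs n b i" "gs n b j"]
  by (cases "i < j") (auto simp: gs_def)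

lemma proj_ip: "i \<le> j \<Longrightarrow> ip n (proj n b i v) (gs n b j) = ip n v (gs n b j)"
  by (induction i) (auto simp: proj_Suc ip_simps gs_orth)

lemma proj_decomp: "v x = proj n b i v x + (\<Sum>j<i. mu n b v j * gs n b j x)"
  by (induction i) (auto simp: proj_Suc mu_def proj_ip)

lemma proj_pythag: "ip n v v = ip n (proj n b i v) (proj n b i v) + (\<Sum>j<i. (mu n b v j)\<^sup>2 * gsn n b j)"
proof (induction i)
  case (Suc i)
  let ?P = "proj n b i v" and ?g = "gs n b i" and ?m = "mu n b v i"
  have m: "ip n ?P ?g = ?m * gsn n b i"
    by (cases "gsn n b i = 0") (auto simp: gsn_0_ip mu_def proj_ip)
  have "proj n b (Suc i) v = (\<lambda>x. ?P x - ?m * ?g x)" by (simp add: proj_Suc mu_def proj_ip)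
  then have "ip n (proj n b (Suc i) v) (proj n b (Suc i) v) = ip n ?P ?P - 2 * ?m * ip n ?P ?g + ?m\<^sup>2 * ip n ?g ?g"
    by (simp only: ip_diff_left ip_diff_right ip_scale_left ip_scale_right ip_commute[of n ?g ?P])
      (simp add: power2_eq_square algebra_simps)
  then have "ip n ?P ?P = ip n (proj n b (Suc i) v) (proj n b (Suc i) v) + ?m\<^sup>2 * gsn n b i"
    unfolding m gsn_def[symmetric] by (simp add: power2_eq_square)
  then show ?case using Suc by simp
qed simp

lemma proj_add: "proj n b i (\<lambda>x. v x + u x) = (\<lambda>x. proj n b i v x + proj n b i u x)"
proof (induction i)
  case (Suc i)
  show ?case unfolding proj_Suc Suc ip_add_left by (simp add: algebra_simps add_divide_distrib)
qed simp

lemma proj_scale: "proj n b i (\<lambda>x. c * u x) = (\<lambda>x. c * proj n b i u x)"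
proof (induction i)
  case (Suc i)
  show ?case unfolding proj_Suc Suc ip_scale_left by (simp add: algebra_simps)
qed simp

lemma proj_zero [simp]: "proj n b i (\<lambda>x. 0) = (\<lambda>x. 0)"
  using proj_scale[of n b i 0] by simp

lemma proj_diff: "proj n b i (\<lambda>x. v x - u x) = (\<lambda>x. proj n b i v x - proj n b i u x)"
  using proj_add[of n b i v "\<lambda>x. (-1) * u x"] unfolding proj_scale by simp

lemma proj_sum: "proj n b i (\<lambda>x. \<Sum>l<(k::nat). c l * f l x) = (\<lambda>x. \<Sum>l<k. c l * proj n b i (f l) x)"
  by (induction k) (auto simp: proj_add proj_scale)

lemma proj_b_zero:
  assumes "\<And>j. j < i \<Longrightarrow> gsn n b j > 0"
  shows "j < i \<Longrightarrow> proj n b i (b j) = (\<lambda>x. 0)"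
  using assms
proof (induction i)
  case (Suc i)
  show ?case
  proof (cases "j = i")
    case True
    then show ?thesis using Suc(3)[of i] by (auto simp: proj_Suc gs_def[symmetric] gsn_def[symmetric])
  next
    case False
    then show ?thesis using Suc by (auto simp: proj_Suc)
  qed
qed simp

text \<open>Ties projections back to the basis: a vanishing Gram-Schmidt vector becomes a linear
  relation, and it is these coefficients that Cramer's rule makes integral below.\<close>

lemma proj_coeff: "\<exists>c. \<forall>x. proj n b i v x = v x - (\<Sum>l<i. c l * b l x)"
proof (induction i arbitrary: v)
  case (Suc i)
  obtain c where c: "proj n b i v x = v x - (\<Sum>l<i. c l * b l x)" for x using Suc by blast
  obtain c' where c': "proj n b i (b i) x = b i x - (\<Sum>l<i. c' l * b l x)" for x using Suc by blast
  define m where "m = ip n (proj n b i v) (gs n b i) / gsn n b i"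
  have "proj n b (Suc i) v x = (v x - (\<Sum>l<i. c l * b l x)) - m * (b i x - (\<Sum>l<i. c' l * b l x))" for x
  proof -
    have "proj n b (Suc i) v x = proj n b i v x - m * proj n b i (b i) x" by (simp add: proj_Suc m_def gs_def)
    then show ?thesis unfolding c c' .
  qed
  then have "proj n b (Suc i) v x = v x - (\<Sum>l<Suc i. (if l = i then m else c l - m * c' l) * b l x)" for x
    by (simp add: algebra_simps sum.distrib sum_subtractf sum_distrib_left)
  then show ?case by (intro exI[of _ "\<lambda>l. if l = i then m else c l - m * c' l"]) blast
qed simp

lemma proj_cong:
  assumes "\<And>j. j < i \<Longrightarrow> b j = b' j" shows "proj n b i = proj n b' i"
  using assms by (induction i) (auto simp: proj.simps(2))

lemma mu_add: "mu n b (\<lambda>x. v x + u x) j = mu n b v j + mu n b u j"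
  by (simp add: mu_def ip_simps add_divide_distrib)

lemma mu_diff: "mu n b (\<lambda>x. v x - u x) j = mu n b v j - mu n b u j"
  by (simp add: mu_def ip_simps diff_divide_distrib)

lemma mu_scale: "mu n b (\<lambda>x. c * u x) j = c * mu n b u j"
  by (simp add: mu_def ip_simps)

lemma mu_self: "gsn n b j > 0 \<Longrightarrow> mu n b (b j) j = 1"
  using proj_ip[of j j n b "b j"] by (simp add: mu_def gs_def[symmetric] gsn_def[symmetric])

lemma mu_gt: assumes "\<And>j. j \<le> i \<Longrightarrow> gsn n b j > 0" "l < i" shows "mu n b (b l) i = 0"
proof -
  have "proj n b i (b l) = (\<lambda>x. 0)" using assms by (intro proj_b_zero) auto
  then show ?thesis using proj_ip[of i i n b "b l"] by (simp add: mu_def)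
qed

lemma mu_sum: "mu n b (\<lambda>x. \<Sum>l<(k::nat). c l * f l x) j = (\<Sum>l<k. c l * mu n b (f l) j)"
  by (induction k) (auto simp: mu_add mu_scale, simp add: mu_def)

lemma gsn_eq_norm: "ip n (b i) (b i) = gsn n b i + (\<Sum>j<i. (mu n b (b i) j)\<^sup>2 * gsn n b j)"
  using proj_pythag[of n "b i" b i] by (simp add: gsn_def gs_def)

lemma gsn_pos_of_indep:
  assumes "\<And>c. (\<And>x. x < n \<Longrightarrow> (\<Sum>i<d. c i * b i x) = 0) \<Longrightarrow> (\<And>i. i < d \<Longrightarrow> c i = 0)" "i < d"
  shows "gsn n b i > 0"
proof (rule ccontr)
  assume "\<not> gsn n b i > 0"
  then have z: "\<forall>x<n. gs n b i x = 0" using gsn_nonneg[of n b i] unfolding gsn_def ip_eq_0[symmetric] by linarith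
  obtain c where c: "\<And>x. gs n b i x = b i x - (\<Sum>l<i. c l * b l x)"
    using proj_coeff[of n b i "b i"] unfolding gs_def by blast
  let ?c = "\<lambda>l. if l < i then - c l else if l = i then 1 else 0"
  have "(\<Sum>l<d. ?c l * b l x) = gs n b i x" for x
  proof -
    have "(\<Sum>l<d. ?c l * b l x) = (\<Sum>l<Suc i. ?c l * b l x)"
      using assms(2) by (intro sum.mono_neutral_right) auto
    then show ?thesis by (simp add: c sum_negf)
  qed
  then have "(\<Sum>l<d. ?c l * b l x) = 0" if "x < n" for x using z that by simp
  from assms(1)[of ?c, OF this assms(2)] have "?c i = 0" .
  then show False by simp
qed

subsection \<open>Gram determinants\<close>

definition gram :: "nat \<Rightarrow> (nat \<Rightarrow> nat \<Rightarrow> int) \<Rightarrow> nat \<Rightarrow> int" where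
  "gram n b i = det (mat i i (\<lambda>(a, c). ip n (b a) (b c)))"

definition rl :: "(nat \<Rightarrow> nat \<Rightarrow> int) \<Rightarrow> nat \<Rightarrow> nat \<Rightarrow> real" where
  "rl b = (\<lambda>i x. of_int (b i x))"

lemma rl_apply: "rl b i = (\<lambda>x. of_int (b i x))" by (simp add: rl_def)

text \<open>The Gram matrix factors as \<open>U * (E * transpose_mat U)\<close>, where
  \<open>U\<close> is unit lower triangular with the coefficients \<open>mu\<close> and
  \<open>E\<close> is the diagonal of squared Gram-Schmidt norms.\<close>

lemma gram_eq: "of_int (gram n b i) = (\<Prod>j<i. gsn n (rl b) j)"
proof -
  let ?b = "rl b"
  define U where "U = mat i i (\<lambda>(a, c). if c < a then mu n ?b (?b a) c else if c = a then 1 else 0)"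
  define E where "E = mat i i (\<lambda>(a, c). if a = c then gsn n ?b a else 0)"
  have U: "U \<in> carrier_mat i i" and E: "E \<in> carrier_mat i i" by (auto simp: U_def E_def)
  have exp: "?b a x = (\<Sum>l<i. U $$ (a, l) * gs n ?b l x)" if a: "a < i" for a x
  proof -
    have "(\<Sum>l<i. U $$ (a, l) * gs n ?b l x) = (\<Sum>l<Suc a. U $$ (a, l) * gs n ?b l x)"
      using a by (intro sum.mono_neutral_right) (auto simp: U_def)
    also have "\<dots> = (\<Sum>l<a. mu n ?b (?b a) l * gs n ?b l x) + gs n ?b a x"
      using a by (simp add: U_def)
    also have "\<dots> = ?b a x" using proj_decomp[of "?b a" x n ?b a] by (simp add: gs_def)
    finally show ?thesis by simp
  qed
  have ipU: "ip n (?b a) (?b c) = (\<Sum>l<i. U $$ (a, l) * U $$ (c, l) * gsn n ?b l)" if "a < i" "c < i" for a c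
  proof -
    have "ip n (?b a) (?b c) = (\<Sum>l<i. \<Sum>l'<i. U $$ (a, l) * (U $$ (c, l') * ip n (gs n ?b l) (gs n ?b l')))"
      unfolding exp[OF that(1), abs_def] exp[OF that(2), abs_def] ip_simps
      by (simp add: sum_distrib_left)
    also have "\<dots> = (\<Sum>l<i. \<Sum>l'<i. if l' = l then U $$ (a, l) * U $$ (c, l) * gsn n ?b l else 0)"
      by (intro sum.cong refl) (auto simp: gs_orth gsn_def)
    finally show ?thesis by simp
  qed
  have "map_mat real_of_int (mat i i (\<lambda>(a, c). ip n (b a) (b c))) = U * (E * transpose_mat U)"
  proof (rule eq_matI)
    fix a c assume "a < dim_row (U * (E * transpose_mat U))" "c < dim_col (U * (E * transpose_mat U))"
    then have ac: "a < i" "c < i" using U by auto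
    have EU: "(E * transpose_mat U) $$ (l, c) = gsn n ?b l * U $$ (c, l)" if l: "l < i" for l
    proof -
      have "(E * transpose_mat U) $$ (l, c) = (\<Sum>l'<i. (if l = l' then gsn n ?b l else 0) * U $$ (c, l'))"
        using l ac U E by (auto simp: scalar_prod_def E_def atLeast0LessThan intro!: sum.cong)
      also have "\<dots> = (\<Sum>l'<i. if l' = l then gsn n ?b l * U $$ (c, l) else 0)"
        by (intro sum.cong) auto
      finally show ?thesis using l by simp
    qed
    have "(U * (E * transpose_mat U)) $$ (a, c) = (\<Sum>l<i. U $$ (a, l) * (E * transpose_mat U) $$ (l, c))"
      using ac U E by (auto simp: scalar_prod_def atLeast0LessThan intro!: sum.cong)
    also have "\<dots> = ip n (?b a) (?b c)" unfolding ipU[OF ac] by (intro sum.cong) (auto simp: EU)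
    also have "\<dots> = map_mat real_of_int (mat i i (\<lambda>(a, c). ip n (b a) (b c))) $$ (a, c)"
      using ac by (simp add: of_int_ip rl_def)
    finally show "map_mat real_of_int (mat i i (\<lambda>(a, c). ip n (b a) (b c))) $$ (a, c) = (U * (E * transpose_mat U)) $$ (a, c)" by simp
  qed (use U in auto)
  moreover have "det U = 1"
  proof -
    have d: "diag_mat U = map (\<lambda>_. 1) [0..<i]" by (auto simp: U_def diag_mat_def)
    have "det U = prod_list (diag_mat U)" using U by (intro det_lower_triangular[of i]) (auto simp: U_def)
    also have "\<dots> = 1" unfolding d by (induction i) auto
    finally show ?thesis .
  qed
  moreover have "det E = (\<Prod>j<i. gsn n ?b j)"
  proof -
    have d: "diag_mat E = map (gsn n ?b) [0..<i]" by (auto simp: E_def diag_mat_def)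
    have "det E = prod_list (diag_mat E)" using E by (intro det_lower_triangular[of i]) (auto simp: E_def)
    also have "\<dots> = (\<Prod>j<i. gsn n ?b j)" unfolding d by (simp add: prod.list_conv_set_nth atLeast0LessThan)
    finally show ?thesis .
  qed
  ultimately have "det (map_mat real_of_int (mat i i (\<lambda>(a, c). ip n (b a) (b c)))) = (\<Prod>j<i. gsn n ?b j)"
    using U E by (simp add: det_mult[of _ i] det_transpose[of _ i])
  then show ?thesis by (simp add: gram_def)
qed

lemma gram_0 [simp]: "gram n b 0 = 1"
  by (simp add: gram_def)

lemma gram_Suc: "of_int (gram n b (Suc i)) = of_int (gram n b i) * gsn n (rl b) i"
  by (simp add: gram_eq)

lemma gram_pos: "(\<And>j. j < i \<Longrightarrow> gsn n (rl b) j > 0) \<Longrightarrow> gram n b i \<ge> 1"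
proof -
  assume "\<And>j. j < i \<Longrightarrow> gsn n (rl b) j > 0"
  then have "real_of_int (gram n b i) > 0" unfolding gram_eq by (intro prod_pos) auto
  then show ?thesis by linarith
qed

lemma gsn_pos_of_gram: "gram n b i \<noteq> 0 \<Longrightarrow> j < i \<Longrightarrow> gsn n (rl b) j > 0"
proof -
  assume "gram n b i \<noteq> 0" "j < i"
  then have "real_of_int (gram n b i) \<noteq> 0" "j < i" by auto
  then have "gsn n (rl b) j \<noteq> 0" unfolding gram_eq by auto
  then show ?thesis using gsn_nonneg[of n "rl b" j] by linarith
qed

text \<open>Cramer's rule: orthogonality makes the coefficients of the projection a solution of a
  linear system with the Gram matrix, so multiplying by its determinant clears all
  denominators.\<close>

lemma gram_proj_integral:
  assumes pos: "\<And>j. j < i \<Longrightarrow> gsn n (rl b) j > 0"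
  shows "\<exists>z. \<forall>x. of_int (gram n b i) * proj n (rl b) i (rl b k) x = of_int (z x)"
proof -
  let ?b = "rl b"
  obtain c where c: "\<And>x. proj n ?b i (?b k) x = ?b k x - (\<Sum>l<i. c l * ?b l x)"
    using proj_coeff by blast
  define G where "G = mat i i (\<lambda>(a, c). ip n (b a) (b c))"
  have G: "G \<in> carrier_mat i i" by (simp add: G_def)
  have orth: "ip n (proj n ?b i (?b k)) (?b a) = 0" if a: "a < i" for a
  proof -
    have "ip n (proj n ?b i (?b k)) (?b a) = ip n (proj n ?b i (?b k))
      (\<lambda>x. gs n ?b a x + (\<Sum>j<a. mu n ?b (?b a) j * gs n ?b j x))"
      by (intro ip_cong refl) (use proj_decomp[of "?b a" _ n ?b a] in \<open>simp add: gs_def\<close>)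
    also have "\<dots> = 0" using a by (simp add: ip_simps proj_orth)
    finally show ?thesis .
  qed
  \<comment> \<open>The normal equations: row \<open>a\<close> expresses that the projection is
    orthogonal to \<open>b a\<close>.\<close>
  have sol: "(\<Sum>l<i. real_of_int (G $$ (a, l)) * c l) = of_int (ip n (b a) (b k))" if a: "a < i" for a
  proof -
    have "0 = ip n (\<lambda>x. ?b k x - (\<Sum>l<i. c l * ?b l x)) (?b a)"
      using orth[OF a] unfolding c[abs_def] by simp
    also have "\<dots> = ip n (?b k) (?b a) - (\<Sum>l<i. c l * ip n (?b l) (?b a))" by (simp add: ip_simps)
    finally have "(\<Sum>l<i. c l * ip n (?b l) (?b a)) = ip n (?b k) (?b a)" by simp
    then show ?thesis using a unfolding G_def
      by (simp add: of_int_ip rl_def ip_commute[of n "\<lambda>x. real_of_int (b a x)"] mult.commute)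
  qed
  define A where "A = adj_mat G"
  have A: "A \<in> carrier_mat i i" "A * G = det G \<cdot>\<^sub>m 1\<^sub>m i" using adj_mat[OF G] by (auto simp: A_def)
  \<comment> \<open>The adjugate inverts the system up to the determinant without leaving the
    integers.\<close>
  have int: "of_int (gram n b i) * c l = of_int (\<Sum>a<i. A $$ (l, a) * ip n (b a) (b k))" if l: "l < i" for l
  proof -
    have "real_of_int (\<Sum>a<i. A $$ (l, a) * ip n (b a) (b k))
      = (\<Sum>a<i. of_int (A $$ (l, a)) * (\<Sum>m<i. real_of_int (G $$ (a, m)) * c m))"
      by (simp add: sol)
    also have "\<dots> = (\<Sum>m<i. of_int (\<Sum>a<i. A $$ (l, a) * G $$ (a, m)) * c m)"
      by (simp add: sum_distrib_left sum_distrib_right mult.assoc) (rule sum.swap)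
    also have "\<dots> = (\<Sum>m<i. (if m = l then of_int (gram n b i) * c l else 0))"
    proof (intro sum.cong refl)
      fix m assume m: "m \<in> {..<i}"
      have "(\<Sum>a<i. A $$ (l, a) * G $$ (a, m)) = (A * G) $$ (l, m)"
        using A(1) G l m by (auto simp: scalar_prod_def atLeast0LessThan intro!: sum.cong)
      also have "\<dots> = (if l = m then gram n b i else 0)"
        unfolding A(2) using l m by (auto simp: gram_def G_def)
      finally show "of_int (\<Sum>a<i. A $$ (l, a) * G $$ (a, m)) * c m = (if m = l then of_int (gram n b i) * c l else 0)"
        by (simp del: of_int_sum)
    qed
    finally show ?thesis using l by simp
  qed
  have "of_int (gram n b i) * proj n ?b i (?b k) x =
     of_int (gram n b i * b k x - (\<Sum>l<i. (\<Sum>a<i. A $$ (l, a) * ip n (b a) (b k)) * b l x))" for x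
  proof -
    have "of_int (gram n b i) * proj n ?b i (?b k) x =
      of_int (gram n b i) * ?b k x - (\<Sum>l<i. (of_int (gram n b i) * c l) * ?b l x)"
      unfolding c by (simp add: algebra_simps sum_distrib_left)
    also have "(\<Sum>l<i. (of_int (gram n b i) * c l) * ?b l x) =
      (\<Sum>l<i. of_int (\<Sum>a<i. A $$ (l, a) * ip n (b a) (b k)) * ?b l x)"
      by (intro sum.cong refl) (use int in auto)
    finally show ?thesis by (simp add: rl_def)
  qed
  then show ?thesis by (intro exI allI)
qed

text \<open>The scaled Gram-Schmidt vectors kept by the program. For independent vectors the value
  is already an integer by \<open>gram_proj_integral\<close>; the floor only changes the
  type.\<close>

definition wv :: "nat \<Rightarrow> (nat \<Rightarrow> nat \<Rightarrow> int) \<Rightarrow> nat \<Rightarrow> nat \<Rightarrow> nat \<Rightarrow> int" where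
  "wv n b i k x = \<lfloor>of_int (gram n b i) * proj n (rl b) i (rl b k) x\<rfloor>"

lemma of_int_wv:
  assumes "\<And>j. j < i \<Longrightarrow> gsn n (rl b) j > 0"
  shows "of_int (wv n b i k x) = of_int (gram n b i) * proj n (rl b) i (rl b k) x"
  using gram_proj_integral[OF assms, of i k] unfolding wv_def by (metis floor_of_int)

lemma wv_0 [simp]: "wv n b 0 k = b k"
  by (auto simp: wv_def rl_def)

text \<open>Fraction-free Gram-Schmidt: after multiplication by the determinants of orders
  \<open>i\<close> and \<open>Suc i\<close> the projection step involves integers only, and the
  division is exact.\<close>

lemma wv_Suc:
  assumes pos: "\<And>j. j \<le> i \<Longrightarrow> gsn n (rl b) j > 0"
  shows "wv n b (Suc i) k x = (gram n b (Suc i) * wv n b i k x - ip n (b k) (wv n b i i) * wv n b i i x) div gram n b i"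
proof -
  let ?b = "rl b" and ?D = "real_of_int (gram n b i)"
  have D: "?D > 0" using gram_pos[of i n b] pos by (simp add: less_le_trans[of 0 1])
  have w: "of_int (wv n b i k x) = ?D * proj n ?b i (?b k) x" for k x using pos by (intro of_int_wv) auto
  have gi: "?D * gs n ?b i x = of_int (wv n b i i x)" for x by (simp add: w gs_def)
  have ipw: "of_int (ip n (b k) (wv n b i i)) = ?D * ip n (?b k) (gs n ?b i)"
    unfolding of_int_ip gi[symmetric] ip_simps by (simp add: rl_apply)
  have "of_int (wv n b (Suc i) k x * gram n b i) = of_int (gram n b (Suc i)) * proj n ?b (Suc i) (?b k) x * ?D"
    using pos by (simp add: of_int_wv less_Suc_eq_le)
  also have "\<dots> = of_int (gram n b (Suc i)) * (?D * proj n ?b i (?b k) x)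
      - ip n (?b k) (gs n ?b i) / gsn n ?b i * (of_int (gram n b (Suc i)) * (?D * gs n ?b i x))"
    by (simp add: proj_Suc proj_ip algebra_simps)
  also have "\<dots> = of_int (gram n b (Suc i)) * of_int (wv n b i k x) - (?D * ip n (?b k) (gs n ?b i)) * (?D * gs n ?b i x)"
    using pos[of i] by (simp add: gram_Suc w)
  also have "\<dots> = of_int (gram n b (Suc i) * wv n b i k x - ip n (b k) (wv n b i i) * wv n b i i x)"
    by (simp add: ipw gi)
  finally have "wv n b (Suc i) k x * gram n b i = gram n b (Suc i) * wv n b i k x - ip n (b k) (wv n b i i) * wv n b i i x"
    by linarith
  moreover have "gram n b i \<noteq> 0" using D by auto
  ultimately show ?thesis by (metis nonzero_mult_div_cancel_right)
qed

text \<open>Yields the next determinant as an inner product of vectors that are already at hand, so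
  no determinant is ever expanded.\<close>

lemma gram_Suc_ip:
  assumes pos: "\<And>j. j < i \<Longrightarrow> gsn n (rl b) j > 0"
  shows "gram n b (Suc i) = ip n (b i) (wv n b i i)"
proof -
  have "real_of_int (ip n (b i) (wv n b i i)) = of_int (gram n b i) * ip n (rl b i) (gs n (rl b) i)"
    using pos by (simp add: of_int_ip of_int_wv gs_def ip_simps rl_apply)
  also have "ip n (rl b i) (gs n (rl b) i) = gsn n (rl b) i"
    using proj_ip[of i i n "rl b" "rl b i"] by (simp add: gsn_def gs_def)
  finally show ?thesis using gram_Suc[of n b i] by linarith
qed

text \<open>Projecting never lengthens a vector, so only the determinant adds to its size.\<close>

lemma wv_bound:
  assumes pos: "\<And>j. j < i \<Longrightarrow> gsn n (rl b) j > 0" and "x < n" and Y: "ip n (b k) (b k) \<le> Y\<^sup>2" "Y \<ge> 0"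
  shows "\<bar>wv n b i k x\<bar> \<le> gram n b i * Y"
proof -
  let ?p = "proj n (rl b) i (rl b k)"
  have "(?p x)\<^sup>2 \<le> ip n ?p ?p"
    unfolding ip_def power2_eq_square using assms(2) by (intro member_le_sum) auto
  also have "\<dots> \<le> ip n (rl b k) (rl b k)"
    unfolding proj_pythag[of n "rl b k" "rl b" i] by (auto intro!: sum_nonneg simp: gsn_nonneg)
  also have "\<dots> = of_int (ip n (b k) (b k))" by (simp add: of_int_ip rl_apply)
  also have "\<dots> \<le> (of_int Y)\<^sup>2" using Y by (metis of_int_le_iff of_int_power)
  finally have "\<bar>?p x\<bar> \<le> of_int Y" using Y(2) by (simp add: abs_le_square_iff[symmetric])
  moreover have "gram n b i \<ge> 1" by (rule gram_pos) (rule pos)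
  ultimately have "\<bar>of_int (gram n b i) * ?p x\<bar> \<le> of_int (gram n b i) * of_int Y"
    unfolding abs_mult by (intro mult_mono) auto
  then have "\<bar>real_of_int (wv n b i k x)\<bar> \<le> of_int (gram n b i * Y)" using of_int_wv[OF pos] by simp
  then show ?thesis by linarith
qed

subsection \<open>Size reduction and swaps\<close>

text \<open>The multiples that are added come from earlier basis vectors and vanish once these are
  projected away.\<close>

lemma proj_row_op:
  assumes pos: "\<And>j. j < k \<Longrightarrow> gsn n b j > 0"
    and b': "b' = b(k := (\<lambda>x. b k x + (\<Sum>l<k. c l * b l x)))"
  shows "proj n b' i = proj n b i" "gs n b' i = gs n b i"
proof -
  have b'i: "proj n b i (b' i) = proj n b i (b i)" for i
  proof (cases "i = k")
    case True
    have "proj n b k (b' k) = (\<lambda>x. proj n b k (b k) x + (\<Sum>l<k. c l * proj n b k (b l) x))"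
      by (simp add: b' proj_add proj_sum)
    also have "\<dots> = proj n b k (b k)" using proj_b_zero[of k n b] pos by (auto intro!: sum.neutral ext)
    finally show ?thesis using True by simp
  qed (simp add: b')
  have "proj n b' i = proj n b i" for i
  proof (induction i)
    case (Suc i)
    then show ?case by (simp add: proj.simps(2) b'i)
  qed simp
  then show "proj n b' i = proj n b i" "gs n b' i = gs n b i" by (auto simp: gs_def b'i)
qed

text \<open>For \<open>i\<close> beyond both indices the swap exchanges two rows and two columns of
  the Gram matrix and the signs cancel; for \<open>i \<le> k\<close> the matrix does not see the
  swap. So at most the determinant of order \<open>Suc k\<close> changes.\<close>

lemma gram_swap:
  assumes "Suc k < i \<or> i \<le> k" and b': "b' = b(k := b (Suc k), Suc k := b k)"
  shows "gram n b' i = gram n b i"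
proof (cases "i \<le> k")
  case True
  then have "mat i i (\<lambda>(a, c). ip n (b' a) (b' c)) = mat i i (\<lambda>(a, c). ip n (b a) (b c))"
    by (intro eq_matI) (auto simp: b')
  then show ?thesis by (simp add: gram_def)
next
  case False
  then have k: "k < i" "Suc k < i" using assms(1) by auto
  let ?G = "mat i i (\<lambda>(a, c). ip n (b a) (b c))"
  have "mat i i (\<lambda>(a, c). ip n (b' a) (b' c)) = swapcols k (Suc k) (swaprows k (Suc k) ?G)"
    using k by (intro eq_matI) (auto simp: b')
  moreover have "det (swapcols k (Suc k) (swaprows k (Suc k) ?G)) = - det (swaprows k (Suc k) ?G)"
    using k by (intro det_swapcols[of _ i]) auto
  moreover have "det (swaprows k (Suc k) ?G) = - det ?G"
    using k by (intro det_swaprows[of _ i]) auto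
  ultimately show ?thesis by (simp add: gram_def)
qed

text \<open>The test on determinants says \<open>2 * ?g (Suc k) < ?g k\<close>. With a coefficient
  of at most 1/2, the new squared norm at position \<open>k\<close> is at most
  \<open>1 / 2 + 1 / 4\<close> of the old one. The bound \<open>X\<close> survives the swap, which
  keeps all numbers small during the reduction.\<close>

lemma swap_gsn:
  assumes pos: "\<And>j. j < d \<Longrightarrow> gsn n (rl b) j > 0" and k: "Suc k < d"
    and b': "b' = b(k := b (Suc k), Suc k := b k)"
    and red: "\<bar>mu n (rl b) (rl b (Suc k)) k\<bar> \<le> 1 / 2"
    and lov: "2 * gram n b (Suc (Suc k)) * gram n b k < (gram n b (Suc k))\<^sup>2"
    and X: "\<And>j. j < d \<Longrightarrow> gsn n (rl b) j \<le> X"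
  shows "\<And>j. j < d \<Longrightarrow> 0 < gsn n (rl b') j \<and> gsn n (rl b') j \<le> X"
    and "4 * gram n b' (Suc k) \<le> 3 * gram n b (Suc k)"
proof -
  let ?g = "gsn n (rl b)" and ?g' = "gsn n (rl b')" and ?m = "mu n (rl b) (rl b (Suc k)) k"
  have p: "?g k > 0" "?g (Suc k) > 0" using pos k by auto
  have gi: "gram n b i \<ge> 1" if "i \<le> d" for i using that pos by (intro gram_pos) auto
  \<comment> \<open>Dividing out the determinants turns the integer test into a Lovasz condition on
    the norms.\<close>
  have lv: "2 * ?g (Suc k) < ?g k"
  proof -
    have "real_of_int (2 * gram n b (Suc (Suc k)) * gram n b k) < of_int ((gram n b (Suc k))\<^sup>2)"
      using lov by (simp only: of_int_less_iff)
    then have "2 * ?g (Suc k) * (?g k * (of_int (gram n b k))\<^sup>2) < ?g k * (?g k * (of_int (gram n b k))\<^sup>2)"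
      by (simp add: gram_Suc power2_eq_square algebra_simps)
    then show ?thesis using gi[of k] k p by (simp add: zero_less_power)
  qed
  have pk: "proj n (rl b') k = proj n (rl b) k" by (rule proj_cong) (auto simp: b' rl_def)
  have g'k: "?g' k = ?g (Suc k) + ?m\<^sup>2 * ?g k"
  proof -
    let ?v = "proj n (rl b) k (rl b (Suc k))"
    have "?g' k = ip n ?v ?v" unfolding gsn_def gs_def pk by (simp add: b' rl_def)
    also have "\<dots> = ?g (Suc k) + ?m\<^sup>2 * ?g k"
      using proj_pythag[of n "rl b (Suc k)" "rl b" k] gsn_eq_norm[of n "rl b" "Suc k"] by simp
    finally show ?thesis .
  qed
  have m2: "?m\<^sup>2 \<le> 1 / 4" using red power_mono[of "\<bar>?m\<bar>" "1/2" 2] by (simp add: power2_eq_square)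
  have g'le: "?g' k \<le> 3 / 4 * ?g k"
    unfolding g'k using lv mult_right_mono[OF m2, of "?g k"] p by linarith
  have g'ge: "?g' k \<ge> ?g (Suc k)" unfolding g'k using p by simp
  have same: "gram n b' i = gram n b i" if "i \<noteq> Suc k" for i
    using that by (intro gram_swap[OF _ b']) auto
  have "real_of_int (gram n b' (Suc k)) \<le> 3 / 4 * of_int (gram n b (Suc k))"
    unfolding gram_Suc[of n b'] gram_Suc[of n b k] same[of k, simplified]
    using mult_left_mono[OF g'le, of "of_int (gram n b k)"] gi[of k] k by (simp add: algebra_simps)
  then show "4 * gram n b' (Suc k) \<le> 3 * gram n b (Suc k)" by linarith
  have "gram n b' d \<noteq> 0" using gi[of d] same[of d] k by simp
  then have pos': "?g' j > 0" if "j < d" for j using gsn_pos_of_gram that by blast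
  have rat: "?g' j = ?g j" if "j \<noteq> k" "j \<noteq> Suc k" "j < d" for j
  proof -
    have "real_of_int (gram n b j) > 0" using gi[of j] that by simp
    moreover have "of_int (gram n b' (Suc j)) = of_int (gram n b' j) * ?g' j" by (rule gram_Suc)
    ultimately show ?thesis using that same[of j] same[of "Suc j"] gram_Suc[of n b j] by simp
  qed
  \<comment> \<open>The determinant of order \<open>k + 2\<close> is unchanged, hence so is the
    product of the two norms. The new first norm is at least the old second one, so the new second
    norm is at most the old first one.\<close>
  have "?g' (Suc k) * ?g' k = ?g (Suc k) * ?g k"
    using gram_Suc[of n b' "Suc k"] gram_Suc[of n b' k] gram_Suc[of n b "Suc k"] gram_Suc[of n b k]
      same[of k] same[of "Suc (Suc k)"] gi[of k] k by (simp add: mult.commute)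
  also have "\<dots> \<le> ?g k * ?g' k" using g'ge p by (simp add: mult.commute)
  finally have "?g' (Suc k) \<le> ?g k" using pos'[of k] k by simp
  then show "0 < ?g' j \<and> ?g' j \<le> X" if "j < d" for j
    using pos'[OF that] rat[of j] X[of j] X[of k] g'le p that k
    by (cases "j = k"; cases "j = Suc k") auto
qed


subsection \<open>The nearest plane procedure\<close>

definition lc :: "nat \<Rightarrow> (nat \<Rightarrow> 'a::comm_ring_1) \<Rightarrow> (nat \<Rightarrow> nat \<Rightarrow> 'a) \<Rightarrow> nat \<Rightarrow> 'a" where
  "lc d c b = (\<lambda>x. \<Sum>l<d. c l * b l x)"

lemma lc_Suc: "lc (Suc d) c b = (\<lambda>x. lc d c b x + c d * b d x)"
  by (simp add: lc_def)

lemma lc_0 [simp]: "lc 0 c b = (\<lambda>x. 0)" by (simp add: lc_def)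

lemma of_int_lc: "(\<lambda>x. real_of_int (lc d c b x)) = lc d (\<lambda>l. of_int (c l)) (rl b)"
  by (simp add: lc_def rl_def)

lemma of_int_lc_apply: "real_of_int (lc d c b x) = lc d (\<lambda>l. of_int (c l)) (rl b) x"
  by (simp add: lc_def rl_def)

lemma mu_lc_ge:
  assumes "\<And>j. j \<le> i \<Longrightarrow> gsn n b j > 0" "d \<le> i" shows "mu n b (lc d c b) i = 0"
  unfolding lc_def mu_sum using mu_gt[of i n b] assms by (intro sum.neutral) auto

lemma mu_lc_top:
  assumes "\<And>j. j \<le> k \<Longrightarrow> gsn n b j > 0" shows "mu n b (lc (Suc k) c b) k = c k"
  using mu_lc_ge[OF assms, of k] mu_self[of n b k] assms[of k] by (simp add: lc_Suc mu_add mu_scale)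

lemma proj_lc:
  assumes "\<And>j. j < i \<Longrightarrow> gsn n b j > 0" "d \<le> i" shows "proj n b i (lc d c b) = (\<lambda>x. 0)"
  unfolding lc_def proj_sum using proj_b_zero[of i n b] assms by simp

text \<open>
  The base-\<open>W\<close> digits of \<open>e\<close>, shifted by \<open>- H\<close>, are added to the rounded coefficients: \<open>W = 1\<close> and \<open>H = 0\<close>
  give Babai's procedure, \<open>W = 2 * H + 1\<close> an enumeration of all vectors near the target.
\<close>

definition np_q where
  "np_q n b W H l u e = (2 * ip n u (wv n b l l) + gram n b (Suc l)) div (2 * gram n b (Suc l)) + e mod W - H"

definition np_step :: "nat \<Rightarrow> (nat \<Rightarrow> nat \<Rightarrow> int) \<Rightarrow> int \<Rightarrow> int \<Rightarrow> nat \<Rightarrow> (nat \<Rightarrow> int) \<times> int \<Rightarrow> (nat \<Rightarrow> int) \<times> int" where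
  "np_step n b W H l s = ((\<lambda>x. fst s x - np_q n b W H l (fst s) (snd s) * b l x), snd s div W)"

primrec np :: "nat \<Rightarrow> (nat \<Rightarrow> nat \<Rightarrow> int) \<Rightarrow> int \<Rightarrow> int \<Rightarrow> nat \<Rightarrow> (nat \<Rightarrow> int) \<times> int \<Rightarrow> (nat \<Rightarrow> int) \<times> int" where
  "np n b W H 0 s = s"
| "np n b W H (Suc l) s = np n b W H l (np_step n b W H l s)"

abbreviation ri :: "(nat \<Rightarrow> int) \<Rightarrow> nat \<Rightarrow> real" where "ri u \<equiv> (\<lambda>x. of_int (u x))"

lemma np_lc: "\<exists>c. fst (np n b W H K s) = (\<lambda>x. fst s x - lc K c b x)"
proof (induction K arbitrary: s)
  case (Suc l)
  obtain c where c: "fst (np n b W H l (np_step n b W H l s)) = (\<lambda>x. fst (np_step n b W H l s) x - lc l c b x)"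
    using Suc by blast
  let ?c = "\<lambda>a. if a = l then np_q n b W H l (fst s) (snd s) else c a"
  have "lc l ?c b = lc l c b" by (simp add: lc_def)
  then show ?case using c by (intro exI[of _ ?c]) (simp add: np_step_def lc_Suc algebra_simps)
qed simp

lemma mu_int:
  assumes "\<And>j. j \<le> l \<Longrightarrow> gsn n (rl b) j > 0"
  shows "mu n (rl b) (ri u) l = of_int (ip n u (wv n b l l)) / of_int (gram n b (Suc l))"
proof -
  have "real_of_int (ip n u (wv n b l l)) = of_int (gram n b l) * ip n (ri u) (gs n (rl b) l)"
    using assms by (simp add: of_int_ip of_int_wv gs_def ip_simps)
  moreover have "gram n b l \<ge> 1" using assms by (intro gram_pos) auto
  ultimately show ?thesis by (simp add: mu_def gram_Suc)
qed

lemma round_div: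
  fixes p D :: int assumes "D > 0"
  defines "q \<equiv> (2 * p + D) div (2 * D)"
  shows "\<bar>of_int p / of_int D - real_of_int q\<bar> \<le> 1 / 2"
proof -
  have "q * (2 * D) \<le> 2 * p + D" "2 * p + D < (q + 1) * (2 * D)"
  proof -
    define m where "m = (2 * p + D) mod (2 * D)"
    have "0 \<le> m" "m < 2 * D" using assms(1) by (auto simp: m_def)
    moreover have "q * (2 * D) + m = 2 * p + D" unfolding q_def m_def by (rule div_mult_mod_eq)
    ultimately show "q * (2 * D) \<le> 2 * p + D" "2 * p + D < (q + 1) * (2 * D)"
      unfolding distrib_right by linarith+
  qed
  then have "real_of_int (q * (2 * D)) \<le> of_int (2 * p + D)" "real_of_int (2 * p + D) \<le> of_int ((q + 1) * (2 * D))"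
    by linarith+
  then have "real_of_int p / of_int D - of_int q \<ge> - (1/2)" "real_of_int p / of_int D - of_int q \<le> 1/2"
    using assms(1) by (auto simp: field_simps)
  then show ?thesis by linarith
qed

text \<open>Step \<open>l\<close> rounds away the coefficient of index \<open>l\<close>; the later
  steps subtract vectors of smaller index, whose coefficient at \<open>l\<close> is zero.\<close>

lemma np_reduced:
  assumes pos: "\<And>j. j < K \<Longrightarrow> gsn n (rl b) j > 0"
  shows "j < K \<Longrightarrow> \<bar>mu n (rl b) (ri (fst (np n b 1 0 K s))) j\<bar> \<le> 1 / 2"
  using pos
proof (induction K arbitrary: s)
  case (Suc l)
  show ?case
  proof (cases "j = l")
    case False
    then show ?thesis using Suc by simp
  next
    case True
    let ?s = "np_step n b 1 0 l s" and ?q = "np_q n b 1 0 l (fst s) (snd s)"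
    obtain c where c: "fst (np n b 1 0 l ?s) = (\<lambda>x. fst ?s x - lc l c b x)" using np_lc by blast
    have "ri (fst (np n b 1 0 l ?s)) = (\<lambda>x. (ri (fst s) x - of_int ?q * rl b l x) - lc l (\<lambda>l. of_int (c l)) (rl b) x)"
      unfolding c by (simp add: np_step_def of_int_lc_apply rl_def)
    then have "mu n (rl b) (ri (fst (np n b 1 0 l ?s))) l = mu n (rl b) (ri (fst s)) l - of_int ?q"
      using Suc(3) by (simp add: mu_diff mu_scale mu_lc_ge mu_self)
    also have "\<bar>\<dots>\<bar> \<le> 1 / 2"
    proof -
      have "gram n b (Suc l) \<ge> 1" using Suc(3) by (intro gram_pos) auto
      then show ?thesis using round_div[of "gram n b (Suc l)" "ip n (fst s) (wv n b l l)"] Suc(3)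
        by (simp add: mu_int np_q_def)
    qed
    finally show ?thesis using True by simp
  qed
qed simp

text \<open>For a lattice vector the top coefficient is an integer and rounding is exact, so it is
  peeled off completely. Hence a sample that already lies in \<open>L - t\<close> comes back
  unchanged from \<open>try_c\<close>.\<close>

lemma np_lattice:
  assumes pos: "\<And>j. j < K \<Longrightarrow> gsn n (rl b) j > 0"
  shows "fst (np n b 1 0 K (lc K c b, e)) = (\<lambda>x. 0)"
  using pos
proof (induction K arbitrary: e)
  case (Suc l)
  have g: "gram n b (Suc l) \<ge> 1" using Suc(2) by (intro gram_pos) auto
  have "mu n (rl b) (ri (lc (Suc l) c b)) l = of_int (c l)"
    unfolding of_int_lc using Suc(2) by (intro mu_lc_top) auto
  then have "real_of_int (ip n (lc (Suc l) c b) (wv n b l l)) = of_int (c l * gram n b (Suc l))"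
    using Suc(2) g by (simp add: mu_int field_simps)
  then have "ip n (lc (Suc l) c b) (wv n b l l) = c l * gram n b (Suc l)" by linarith
  then have "np_q n b 1 0 l (lc (Suc l) c b) e = (gram n b (Suc l) + c l * (2 * gram n b (Suc l))) div (2 * gram n b (Suc l))"
    by (simp add: np_q_def algebra_simps)
  also have "\<dots> = c l" using g by (subst div_mult_self1) auto
  finally have "np_step n b 1 0 l (lc (Suc l) c b, e) = (lc l c b, e)"
    by (simp add: np_step_def lc_Suc)
  then show ?case using Suc by simp
qed simp

text \<open>The true coefficient and its rounded value differ by at most
  \<open>\<bar>mu\<bar> + 1 / 2 \<le> H\<close>, with \<open>mu\<close> taken for the wanted residue
  \<open>r\<close>; so some digit corrects the rounding in every step.\<close>

lemma np_enum:
  assumes pos: "\<And>j. j < K \<Longrightarrow> gsn n (rl b) j > 0"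
    and "\<And>j. j < K \<Longrightarrow> \<bar>mu n (rl b) (ri r) j\<bar> + 1 / 2 \<le> of_int H" "H \<ge> 0"
  shows "\<exists>e. 0 \<le> e \<and> e < (2 * H + 1) ^ K \<and> fst (np n b (2 * H + 1) H K (\<lambda>x. r x + lc K c b x, e)) = r"
  using assms(1,2)
proof (induction K)
  case 0
  show ?case by (intro exI[of _ 0]) simp
next
  case (Suc l)
  let ?W = "2 * H + 1" and ?u = "\<lambda>x. r x + lc (Suc l) c b x"
  obtain e where e: "0 \<le> e" "e < ?W ^ l" "fst (np n b ?W H l (\<lambda>x. r x + lc l c b x, e)) = r"
  proof -
    have "\<exists>e. 0 \<le> e \<and> e < ?W ^ l \<and> fst (np n b ?W H l (\<lambda>x. r x + lc l c b x, e)) = r"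
      by (rule Suc(1)) (use Suc(2,3) in auto)
    then show ?thesis using that by blast
  qed
  define q where "q = (2 * ip n ?u (wv n b l l) + gram n b (Suc l)) div (2 * gram n b (Suc l))"
  have g: "gram n b (Suc l) \<ge> 1" using Suc(2) by (intro gram_pos) auto
  have "mu n (rl b) (ri ?u) l = mu n (rl b) (ri r) l + of_int (c l)"
    using mu_lc_top[of l n "rl b" "\<lambda>l. of_int (c l)"] Suc(2) by (simp add: mu_add of_int_lc_apply)
  moreover have "\<bar>mu n (rl b) (ri ?u) l - of_int q\<bar> \<le> 1 / 2"
    using round_div[of "gram n b (Suc l)" "ip n ?u (wv n b l l)"] g Suc(2) unfolding q_def by (subst mu_int) auto
  ultimately have "\<bar>real_of_int (c l - q)\<bar> \<le> of_int H" using Suc(3)[OF lessI] unfolding of_int_diff by linarith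
  then have o: "0 \<le> c l - q + H" "c l - q + H < ?W" by linarith+
  \<comment> \<open>The digit for \<open>l\<close> is \<open>c l - q + H\<close>, between 0 and
    \<open>2 * H\<close>. It is the lowest digit because the procedure consumes it first.\<close>
  define e' where "e' = e * ?W + (c l - q + H)"
  have "e' < (e + 1) * ?W" using o by (simp add: e'_def algebra_simps)
  also have "\<dots> \<le> ?W ^ l * ?W" using e assms(3) by (intro mult_right_mono) auto
  finally have 1: "e' < ?W ^ Suc l" by (simp add: mult.commute)
  have 2: "e' mod ?W = c l - q + H" "e' div ?W = e" using o assms(3) by (auto simp: e'_def)
  have "np_q n b ?W H l ?u e' = c l" unfolding np_q_def q_def[symmetric] 2 by simp
  then have "np_step n b ?W H l (?u, e') = (\<lambda>x. r x + lc l c b x, e)"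
    using 2 by (simp add: np_step_def lc_Suc algebra_simps)
  then have "fst (np n b ?W H (Suc l) (?u, e')) = r" using e(3) by simp
  moreover have "0 \<le> e'" using e(1) o assms(3) by (simp add: e'_def)
  ultimately show ?case using 1 by blast
qed

lemma np_snd: "W = 1 \<Longrightarrow> snd (np n b W H K s) = snd s"
  by (induction K arbitrary: s) (auto simp: np_step_def)

lemma abs_round_le:
  fixes p D :: int assumes "D \<ge> 1" shows "\<bar>(2 * p + D) div (2 * D)\<bar> \<le> \<bar>p\<bar> + 1"
proof -
  have "\<bar>of_int p / of_int D - real_of_int ((2 * p + D) div (2 * D))\<bar> \<le> 1 / 2" using round_div[of D p] assms by simp
  moreover have "\<bar>of_int p / real_of_int D\<bar> \<le> of_int \<bar>p\<bar>"
  proof -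
    have "1 * \<bar>p\<bar> \<le> D * \<bar>p\<bar>" using assms by (intro mult_right_mono) auto
    then have "real_of_int \<bar>p\<bar> \<le> of_int (D * \<bar>p\<bar>)" by linarith
    then show ?thesis using assms by (simp add: field_simps)
  qed
  ultimately show ?thesis by linarith
qed

lemma ip_abs_le:
  fixes u v :: "nat \<Rightarrow> int"
  assumes "\<And>x. x < n \<Longrightarrow> \<bar>u x\<bar> \<le> A" "\<And>x. x < n \<Longrightarrow> \<bar>v x\<bar> \<le> B" "A \<ge> 0" "B \<ge> 0" "m \<le> n"
  shows "\<bar>ip m u v\<bar> \<le> int n * A * B"
proof -
  have "\<bar>ip m u v\<bar> \<le> (\<Sum>j<m. \<bar>u j * v j\<bar>)" unfolding ip_def by (rule sum_abs)
  also have "\<dots> \<le> (\<Sum>j<m. A * B)" using assms by (intro sum_mono) (auto simp: abs_mult intro!: mult_mono)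
  also have "\<dots> = int m * (A * B)" by simp
  also have "\<dots> \<le> int n * (A * B)" using assms by (intro mult_right_mono) auto
  finally show ?thesis by (simp add: mult.assoc)
qed

lemma np_q_bound:
  assumes u: "\<And>x. x < n \<Longrightarrow> \<bar>u x\<bar> \<le> A" and w: "\<And>x. x < n \<Longrightarrow> \<bar>wv n b l l x\<bar> \<le> Ww"
    and g: "gram n b (Suc l) \<ge> 1" and nn: "A \<ge> 0" "Ww \<ge> 0" "H \<ge> 0" "W \<ge> 1"
  shows "\<bar>np_q n b W H l u e\<bar> \<le> int n * A * Ww + 1 + W + H"
proof -
  have "\<bar>ip n u (wv n b l l)\<bar> \<le> int n * A * Ww" using u w nn by (intro ip_abs_le) auto
  moreover have "0 \<le> e mod W" "e mod W < W" using nn by auto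
  ultimately show ?thesis using abs_round_le[OF g, of "ip n u (wv n b l l)"] nn unfolding np_q_def by linarith
qed

text \<open>The factor does not depend on \<open>A\<close>, so a whole run multiplies the bound by a
  power of it and the entries keep polynomial length.\<close>

lemma np_step_bound:
  assumes u: "\<And>x. x < n \<Longrightarrow> \<bar>fst s x\<bar> \<le> A" and w: "\<And>x. x < n \<Longrightarrow> \<bar>wv n b l l x\<bar> \<le> Ww"
    and b: "\<And>x. x < n \<Longrightarrow> \<bar>b l x\<bar> \<le> Bb"
    and g: "gram n b (Suc l) \<ge> 1" and nn: "A \<ge> 1" "Ww \<ge> 0" "H \<ge> 0" "W \<ge> 1" "Bb \<ge> 0" and "x < n"
  shows "\<bar>fst (np_step n b W H l s) x\<bar> \<le> A * (1 + (int n * Ww + 1 + W + H) * Bb)"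
proof -
  have "\<bar>np_q n b W H l (fst s) (snd s)\<bar> \<le> int n * A * Ww + 1 + W + H"
    using np_q_bound[of n "fst s" A b l Ww H W "snd s"] u w g nn by simp
  also have "\<dots> \<le> A * (int n * Ww + 1 + W + H)"
  proof -
    have "1 * W \<le> A * W" "1 * H \<le> A * H" using nn by (intro mult_right_mono; simp)+
    moreover have "A * (int n * Ww + 1 + W + H) = int n * A * Ww + A + A * W + A * H" by (simp add: algebra_simps)
    ultimately show ?thesis using nn by linarith
  qed
  finally have "\<bar>np_q n b W H l (fst s) (snd s) * b l x\<bar> \<le> A * (int n * Ww + 1 + W + H) * Bb"
    unfolding abs_mult using b[OF \<open>x < n\<close>] nn by (intro mult_mono) auto
  moreover have "\<bar>fst s x\<bar> \<le> A" using u \<open>x < n\<close> by simp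
  ultimately show ?thesis by (simp add: np_step_def algebra_simps)
qed

subsection \<open>Quality of reduced bases\<close>

text \<open>Reduced norms lose at most a factor 2 from one index to the next, so the sum is
  dominated by a geometric series ending in the last term.\<close>

lemma gsn_sum_le:
  assumes "\<And>i. Suc i < d \<Longrightarrow> gsn n b i \<le> 2 * gsn n b (Suc i)" "k < d"
  shows "(\<Sum>i\<le>k. gsn n b i) \<le> (2 ^ Suc k - 1) * gsn n b k"
  using assms(2)
proof (induction k)
  case (Suc k)
  have "(\<Sum>i\<le>Suc k. gsn n b i) \<le> (2 ^ Suc k - 1) * gsn n b k + gsn n b (Suc k)" using Suc by simp
  also have "\<dots> \<le> (2 ^ Suc k - 1) * (2 * gsn n b (Suc k)) + gsn n b (Suc k)"
    using assms(1)[of k] Suc(2) one_le_power[of "2::real" "Suc k"] by (intro add_right_mono mult_left_mono) auto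
  finally show ?case by (simp add: algebra_simps)
qed simp

text \<open>Let \<open>k\<close> be the last index at which the other point of the coset differs.
  Beyond \<open>k\<close> both have the same projection; at \<open>k\<close> the nonzero integer
  forces the other coefficient to be at least 1/2 in absolute value, which by
  \<open>gsn_sum_le\<close> pays for all rounding errors up to \<open>k\<close>.\<close>

lemma babai:
  assumes pos: "\<And>j. j < d \<Longrightarrow> gsn n b j > 0"
    and lll: "\<And>i. Suc i < d \<Longrightarrow> gsn n b i \<le> 2 * gsn n b (Suc i)"
    and red: "\<And>j. j < d \<Longrightarrow> \<bar>mu n b v j\<bar> \<le> 1 / 2"
  shows "ip n v v \<le> 2 ^ d * ip n (\<lambda>x. v x + lc d (\<lambda>l. of_int (c l)) b x) (\<lambda>x. v x + lc d (\<lambda>l. of_int (c l)) b x)"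
proof (cases "\<exists>l<d. c l \<noteq> 0")
  case False
  then have "lc d (\<lambda>l. of_int (c l)) b = (\<lambda>x. 0)" by (auto simp: lc_def intro!: ext sum.neutral)
  then have "ip n v v = ip n (\<lambda>x. v x + lc d (\<lambda>l. of_int (c l)) b x) (\<lambda>x. v x + lc d (\<lambda>l. of_int (c l)) b x)" by simp
  moreover have "1 * ip n v v \<le> 2 ^ d * ip n v v" using ip_nonneg by (intro mult_right_mono one_le_power) auto
  ultimately show ?thesis by simp
next
  case True
  define k where "k = Max {l. l < d \<and> c l \<noteq> 0}"
  have "k \<in> {l. l < d \<and> c l \<noteq> 0}" unfolding k_def by (rule Max_in) (use True in auto)
  then have k: "k < d" "c k \<noteq> 0" by auto
  have mx: "c l = 0" if "l < d" "l > k" for l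
    using Max_ge[of "{l. l < d \<and> c l \<noteq> 0}" l] that by (force simp: k_def[symmetric])
  have e: "lc d (\<lambda>l. of_int (c l)) b = lc (Suc k) (\<lambda>l. of_int (c l)) b"
    unfolding lc_def using k mx by (intro ext sum.mono_neutral_right) auto
  let ?y = "\<lambda>x. v x + lc (Suc k) (\<lambda>l. of_int (c l)) b x"
  have pr: "proj n b (Suc k) ?y = proj n b (Suc k) v"
    using proj_lc[of "Suc k" n b "Suc k"] pos k by (simp add: proj_add)
  have muk: "mu n b ?y k = mu n b v k + of_int (c k)"
    using mu_lc_top[of k n b] pos k by (simp add: mu_add)
  have "1 \<le> \<bar>real_of_int (c k)\<bar>" using k by linarith
  then have "1 / 2 \<le> \<bar>mu n b ?y k\<bar>" unfolding muk using red[OF k(1)] by linarith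
  then have "(1 / 2)\<^sup>2 \<le> (mu n b ?y k)\<^sup>2" by (subst abs_le_square_iff[symmetric]) simp
  then have m4: "1 / 4 * gsn n b k \<le> (mu n b ?y k)\<^sup>2 * gsn n b k"
    using gsn_nonneg by (intro mult_right_mono) (auto simp: power2_eq_square)
  let ?p = "ip n (proj n b (Suc k) v) (proj n b (Suc k) v)"
  have "?p + 1 / 4 * gsn n b k \<le> ?p + (\<Sum>j<Suc k. (mu n b ?y j)\<^sup>2 * gsn n b j)"
    using m4 by (auto intro!: add_increasing sum_nonneg simp: gsn_nonneg)
  then have y: "?p + 1 / 4 * gsn n b k \<le> ip n ?y ?y"
    using proj_pythag[of n ?y b "Suc k"] unfolding pr by simp
  have "ip n v v \<le> ?p + (\<Sum>j<Suc k. 1 / 4 * gsn n b j)"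
    unfolding proj_pythag[of n v b "Suc k"]
  proof (intro add_left_mono sum_mono mult_right_mono gsn_nonneg)
    fix j assume "j \<in> {..<Suc k}"
    then have "\<bar>mu n b v j\<bar> \<le> 1 / 2" using red k by simp
    then show "(mu n b v j)\<^sup>2 \<le> 1 / 4" using power_mono[of "\<bar>mu n b v j\<bar>" "1/2" 2] by (simp add: power2_eq_square)
  qed
  also have "\<dots> \<le> ?p + 1 / 4 * ((2 ^ Suc k - 1) * gsn n b k)"
    using gsn_sum_le[OF lll k(1)] by (simp add: sum_divide_distrib[symmetric] lessThan_Suc_atMost)
  also have "\<dots> \<le> 2 ^ Suc k * (?p + 1 / 4 * gsn n b k)"
  proof -
    have "1 * ?p \<le> 2 ^ Suc k * ?p" using ip_nonneg by (intro mult_right_mono one_le_power) auto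
    then show ?thesis using gsn_nonneg[of n b k] by (simp add: algebra_simps)
  qed
  also have "\<dots> \<le> 2 ^ d * ip n ?y ?y"
    using y k ip_nonneg gsn_nonneg[of n b k] by (intro mult_mono power_increasing) (auto intro: add_nonneg_nonneg)
  finally show ?thesis unfolding e .
qed

lemma round_coeffs:
  assumes pos: "\<And>j. j < K \<Longrightarrow> gsn n b j > 0"
  shows "\<exists>c::nat \<Rightarrow> int. \<forall>i<K. \<bar>mu n b (\<lambda>x. v x - lc K (\<lambda>l. of_int (c l)) b x) i\<bar> \<le> 1 / 2"
  using pos
proof (induction K arbitrary: v)
  case (Suc l)
  define z where "z = round (mu n b v l)"
  obtain c :: "nat \<Rightarrow> int" where c: "\<forall>i<l. \<bar>mu n b (\<lambda>x. (v x - of_int z * b l x) - lc l (\<lambda>l. of_int (c l)) b x) i\<bar> \<le> 1 / 2"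
    using Suc(1)[of "\<lambda>x. v x - of_int z * b l x"] Suc(2) by auto
  let ?c = "c(l := z)"
  have e: "(\<lambda>x. v x - lc (Suc l) (\<lambda>l. of_int (?c l)) b x) = (\<lambda>x. (v x - of_int z * b l x) - lc l (\<lambda>l. of_int (c l)) b x)"
    by (simp add: lc_def algebra_simps)
  have "\<bar>mu n b (\<lambda>x. (v x - of_int z * b l x) - lc l (\<lambda>l. of_int (c l)) b x) l\<bar> \<le> 1 / 2"
    using Suc(2) of_int_round_abs_le[of "mu n b v l"] by (simp add: mu_diff mu_scale mu_lc_ge mu_self z_def abs_minus_commute)
  then show ?case using c unfolding less_Suc_eq by (intro exI[of _ ?c]) (auto simp only: e)
qed simp

text \<open>Rounding the coefficients up to index \<open>j\<close> gives another vector of the coset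
  with the same projection, which cannot be shorter. So the square of \<open>mu n b v j\<close>
  times \<open>gsn n b j\<close> is at most a quarter of the sum of the norms up to
  \<open>j\<close>. This fixes the box that an enumeration has to cover.\<close>

lemma closest_mu:
  assumes pos: "\<And>j. j < d \<Longrightarrow> gsn n b j > 0"
    and lll: "\<And>i. Suc i < d \<Longrightarrow> gsn n b i \<le> 2 * gsn n b (Suc i)"
    and close: "\<And>c::nat \<Rightarrow> int. ip n v v \<le> ip n (\<lambda>x. v x - lc d (\<lambda>l. of_int (c l)) b x) (\<lambda>x. v x - lc d (\<lambda>l. of_int (c l)) b x)"
    and j: "j < d"
  shows "\<bar>mu n b v j\<bar> \<le> 2 ^ j"
proof -
  obtain c :: "nat \<Rightarrow> int" where c: "\<And>i. i < Suc j \<Longrightarrow> \<bar>mu n b (\<lambda>x. v x - lc (Suc j) (\<lambda>l. of_int (c l)) b x) i\<bar> \<le> 1 / 2"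
    using round_coeffs[of "Suc j" n b v] pos j by auto
  let ?r = "\<lambda>x. v x - lc (Suc j) (\<lambda>l. of_int (c l)) b x"
  let ?c = "\<lambda>l. if l < Suc j then c l else 0"
  have "lc d (\<lambda>l. of_int (?c l)) b = lc (Suc j) (\<lambda>l. of_int (?c l)) b"
    unfolding lc_def using j by (intro ext sum.mono_neutral_right) auto
  also have "\<dots> = lc (Suc j) (\<lambda>l. of_int (c l)) b" by (simp add: lc_def)
  finally have le: "ip n v v \<le> ip n ?r ?r" using close[of ?c] by simp
  have pr: "proj n b (Suc j) ?r = proj n b (Suc j) v"
    using proj_lc[of "Suc j" n b "Suc j"] pos j by (simp add: proj_diff)
  have "(mu n b v j)\<^sup>2 * gsn n b j \<le> (\<Sum>i<Suc j. (mu n b v i)\<^sup>2 * gsn n b i)"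
    by (auto intro!: sum_nonneg simp: gsn_nonneg)
  also have "\<dots> \<le> (\<Sum>i<Suc j. (mu n b ?r i)\<^sup>2 * gsn n b i)"
    using le proj_pythag[of n v b "Suc j"] proj_pythag[of n ?r b "Suc j"] unfolding pr by linarith
  also have "\<dots> \<le> (\<Sum>i<Suc j. 1 / 4 * gsn n b i)"
  proof (intro sum_mono mult_right_mono gsn_nonneg)
    fix i assume "i \<in> {..<Suc j}"
    then have "\<bar>mu n b ?r i\<bar> \<le> 1 / 2" using c by simp
    then show "(mu n b ?r i)\<^sup>2 \<le> 1 / 4" using power_mono[of "\<bar>mu n b ?r i\<bar>" "1/2" 2] by (simp add: power2_eq_square)
  qed
  also have "\<dots> \<le> 1 / 4 * ((2 ^ Suc j - 1) * gsn n b j)"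
    using gsn_sum_le[OF lll j] by (simp add: sum_divide_distrib[symmetric] lessThan_Suc_atMost)
  also have "\<dots> \<le> (2 ^ j)\<^sup>2 * gsn n b j"
  proof -
    have "1 / 4 * (2 ^ Suc j - 1) \<le> (2 ^ j :: real) * 1"
      by simp (rule order_trans[of _ 0], auto)
    also have "\<dots> \<le> 2 ^ j * 2 ^ j" by (intro mult_left_mono one_le_power) auto
    finally show ?thesis using gsn_nonneg[of n b j] by (metis mult.assoc mult_right_mono power2_eq_square)
  qed
  finally have "(mu n b v j)\<^sup>2 \<le> (2 ^ j)\<^sup>2" using pos[OF j] by simp
  then show ?thesis by (simp add: abs_le_square_iff[symmetric])
qed

section \<open>Programs for lattice reduction\<close>

text \<open>
  Array \<open>aB\<close> holds the rows of the basis, followed by the target as row \<open>d\<close>. The Gram-Schmidt process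
  stays integral: \<open>aD\<close> holds the Gram determinants \<open>D\<^sub>k\<close> and \<open>aW\<close> the vectors \<open>D\<^sub>k b\<^sub>k\<^sup>*\<close>.
  \<open>aBest\<close> is the shortest vector of the lattice coset \<open>L - t\<close> found so far and \<open>vNrm\<close> its squared norm.
\<close>

abbreviation (input) aB :: nat where "aB \<equiv> 4"
abbreviation (input) aW :: nat where "aW \<equiv> 5"
abbreviation (input) aD :: nat where "aD \<equiv> 6"
abbreviation (input) aU :: nat where "aU \<equiv> 7"
abbreviation (input) aX :: nat where "aX \<equiv> 8"
abbreviation (input) aBest :: nat where "aBest \<equiv> 9"
abbreviation (input) aC :: nat where "aC \<equiv> 10"
abbreviation (input) vNrm :: nat where "vNrm \<equiv> 11"
abbreviation (input) vDen :: nat where "vDen \<equiv> 12"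
abbreviation (input) vH :: nat where "vH \<equiv> 13"
abbreviation (input) vW :: nat where "vW \<equiv> 14"
abbreviation (input) vE :: nat where "vE \<equiv> 15"
abbreviation (input) vS :: nat where "vS \<equiv> 16"
abbreviation (input) vP :: nat where "vP \<equiv> 17"
abbreviation (input) vQ :: nat where "vQ \<equiv> 18"
abbreviation (input) vI :: nat where "vI \<equiv> 19"
abbreviation (input) vJ :: nat where "vJ \<equiv> 20"
abbreviation (input) vK :: nat where "vK \<equiv> 21"
abbreviation (input) vp :: nat where "vp \<equiv> 22"
abbreviation (input) vq :: nat where "vq \<equiv> 23"
abbreviation (input) vPos :: nat where "vPos \<equiv> 24"
abbreviation (input) vG :: nat where "vG \<equiv> 25"
abbreviation (input) vM :: nat where "vM \<equiv> 26"
abbreviation (input) vN :: nat where "vN \<equiv> 27"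
abbreviation (input) vL :: nat where "vL \<equiv> 28"

abbreviation (input) nX :: aexp where "nX \<equiv> Cell 0 (Num 0)"
abbreviation (input) dX :: aexp where "dX \<equiv> Cell 0 (Num 1)"
abbreviation (input) ix :: "aexp \<Rightarrow> aexp" where "ix e \<equiv> Add (Mul e nX) (var vJ)"
abbreviation (input) ix0 :: aexp where "ix0 \<equiv> Add (Num 0) (var vJ)"
abbreviation (input) set_var :: "nat \<Rightarrow> aexp \<Rightarrow> com" where "set_var v \<equiv> Store v (Num 0)"

section \<open>Loops over coordinates and frame conditions\<close>

definition sumc :: "aexp \<Rightarrow> com" where
  "sumc f = Seq (set_var vp (Num 0)) (For vJ nX (set_var vp (Add (var vp) f)))"

definition vecc :: "nat \<Rightarrow> aexp \<Rightarrow> aexp \<Rightarrow> com" where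
  "vecc a base f = For vJ nX (Store a (Add base (var vJ)) f)"

definition same :: "nat set \<Rightarrow> memory \<Rightarrow> memory \<Rightarrow> bool" where
  "same S M M' \<longleftrightarrow> (\<forall>k. k \<notin> S \<longrightarrow> M' k = M k)"

lemma sameD: "same S M M' \<Longrightarrow> k \<notin> S \<Longrightarrow> M' k = M k"
  by (simp add: same_def)

lemma same_trans: "same S M M' \<Longrightarrow> same T M' M'' \<Longrightarrow> S \<subseteq> R \<Longrightarrow> T \<subseteq> R \<Longrightarrow> same R M M''"
  unfolding same_def by (metis subsetD)

lemma same_refl [simp]: "same S M M" by (simp add: same_def)

text \<open>Coordinates from \<open>n\<close> on are set to 0, so that equality of rows is equality
  of functions.\<close>

definition irow :: "nat \<Rightarrow> (nat \<Rightarrow> int) \<Rightarrow> nat \<Rightarrow> nat \<Rightarrow> int" where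
  "irow n A i = (\<lambda>j. if j < n then A (i * n + j) else 0)"

lemma nat_addr [simp]: "nat (int a * int b + int c) = a * b + c" "nat (int i + 1) = Suc i" "nat (1 + int i) = Suc i"
  by (simp_all add: nat_add_distrib nat_mult_distrib)

lemma irow_upd:
  assumes "\<And>i. A' i = (if k * n \<le> i \<and> i < k * n + n then val (i - k * n) else A i)"
  shows "irow n A' l = (if l = k then (\<lambda>j. if j < n then val j else 0) else irow n A l)"
proof (cases "l = k")
  case False
  have "\<not> (k * n \<le> l * n + j \<and> l * n + j < k * n + n)" if "j < n" for j
  proof
    assume *: "k * n \<le> l * n + j \<and> l * n + j < k * n + n"
    then have "k * n < (l + 1) * n" "l * n < (k + 1) * n" using that by (auto simp: algebra_simps)
    then show False using False by (metis Suc_eq_plus1 less_Suc_eq_le le_antisym mult_less_cancel2)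
  qed
  then show ?thesis using False by (auto simp: irow_def fun_eq_iff assms)
qed (auto simp: irow_def fun_eq_iff assms)

lemma irow_same: "irow n A i x = A (i * n + x)" if "x < n"
  using that by (simp add: irow_def)

text \<open>The iteration count is replaced by a common bound \<open>s\<close>, so that running
  times become polynomials in one variable.\<close>

lemma tri_For_le:
  assumes init: "I 0 (upd M v 0 0)"
    and bound: "\<And>k M. k \<le> N \<Longrightarrow> I k M \<Longrightarrow> M v 0 = int k \<Longrightarrow> aval M e = int N"
    and body: "\<And>k M. k < N \<Longrightarrow> I k M \<Longrightarrow> M v 0 = int k \<Longrightarrow>
      tri Z c M tb (\<lambda>M'. M' v 0 = int k \<and> I (Suc k) (upd M' v 0 (int (Suc k))))"
    and fin: "\<And>M. I N M \<Longrightarrow> M v 0 = int N \<Longrightarrow> Q M"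
    and N: "int N \<le> Z" "N \<le> s"
    and t: "s * (tb + 2) + 2 \<le> t"
  shows "tri Z (For v e c) M t Q"
  by (rule tri_For[OF init bound body fin N(1)])
    (use t mult_le_mono1[OF N(2), of "tb + 2"] in auto)

lemma tri_vecc:
  assumes n: "M 0 0 = int n" "a \<noteq> 0" "a \<noteq> vJ" "int n \<le> Z" "n \<le> s"
    and ev: "\<And>k M'. k < n \<Longrightarrow> same {vJ, a} M M' \<Longrightarrow> M' vJ 0 = int k \<Longrightarrow>
        (\<forall>i. \<not> (ofs \<le> i \<and> i < ofs + k) \<longrightarrow> M' a i = M a i) \<Longrightarrow> aval M' f = val k \<and> aval M' base = int ofs"
    and val: "\<And>k. k < n \<Longrightarrow> \<bar>val k\<bar> \<le> Z"
    and Q: "\<And>M'. same {vJ, a} M M' \<Longrightarrow>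
        (\<And>i. M' a i = (if ofs \<le> i \<and> i < ofs + n then val (i - ofs) else M a i)) \<Longrightarrow> Q M'"
    and t: "3 * s + 2 \<le> t"
  shows "tri Z (vecc a base f) M t Q"
  unfolding vecc_def
proof (rule tri_For_le[where N = n and tb = 1 and s = s and
      I = "\<lambda>k M'. same {vJ, a} M M' \<and> (\<forall>i. M' a i = (if ofs \<le> i \<and> i < ofs + k then val (i - ofs) else M a i))"])
  fix k M'
  assume k: "k < n" and I: "same {vJ, a} M M' \<and> (\<forall>i. M' a i = (if ofs \<le> i \<and> i < ofs + k then val (i - ofs) else M a i))"
    and j: "M' vJ 0 = int k"
  have e: "aval M' f = val k" "aval M' base = int ofs" using ev[OF k, of M'] I j by auto
  have "tri Z (Store a (Add base (var vJ)) f) M' (Suc 0) (\<lambda>M'. M' vJ 0 = int k \<and>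
     same {vJ, a} M (upd M' vJ 0 (int (Suc k))) \<and>
     (\<forall>i. (upd M' vJ 0 (int (Suc k))) a i = (if ofs \<le> i \<and> i < ofs + Suc k then val (i - ofs) else M a i)))"
    by (rule tri_Store) (use e val[OF k] I j n in \<open>auto simp: same_def nat_add_distrib\<close>)
  then show "tri Z (Store a (Add base (var vJ)) f) M' 1 (\<lambda>M'. M' vJ 0 = int k \<and>
     same {vJ, a} M (upd M' vJ 0 (int (Suc k))) \<and>
     (\<forall>i. (upd M' vJ 0 (int (Suc k))) a i = (if ofs \<le> i \<and> i < ofs + Suc k then val (i - ofs) else M a i)))" by simp
qed (use n t Q in \<open>auto simp: same_def\<close>)

lemma tri_sumc:
  assumes n: "M 0 0 = int n" "int n \<le> Z" "n \<le> s"
    and ev: "\<And>k M'. k < n \<Longrightarrow> same {vJ, vp} M M' \<Longrightarrow> M' vJ 0 = int k \<Longrightarrow> aval M' f = val k"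
    and val: "\<And>k. k \<le> n \<Longrightarrow> \<bar>\<Sum>i<k. val i\<bar> \<le> Z"
    and Q: "\<And>M'. same {vJ, vp} M M' \<Longrightarrow> M' vp 0 = (\<Sum>i<n. val i) \<Longrightarrow> Q M'"
    and t: "3 * s + 3 \<le> t"
  shows "tri Z (sumc f) M t Q"
  unfolding sumc_def
proof (rule tri_Seq[OF tri_Store])
  show "\<bar>aval M (Num 0)\<bar> \<le> Z" using n by simp
  show "tri Z (For vJ nX (set_var vp (Add (var vp) f))) (upd M vp (nat (aval M (Num 0))) (aval M (Num 0))) (3 * s + 2) Q"
  proof (rule tri_For_le[where N = n and tb = 1 and s = s and
      I = "\<lambda>k M'. same {vJ, vp} M M' \<and> M' vp 0 = (\<Sum>i<k. val i)"])
    fix k M'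
    assume k: "k < n" and I: "same {vJ, vp} M M' \<and> M' vp 0 = (\<Sum>i<k. val i)" and j: "M' vJ 0 = int k"
    have e: "aval M' f = val k" using ev[OF k, of M'] I j by auto
    have "tri Z (set_var vp (Add (var vp) f)) M' (Suc 0) (\<lambda>M'. M' vJ 0 = int k \<and>
       same {vJ, vp} M (upd M' vJ 0 (int (Suc k))) \<and> (upd M' vJ 0 (int (Suc k))) vp 0 = (\<Sum>i<Suc k. val i))"
      by (rule tri_Store) (use e val[of "Suc k"] k I j n in \<open>auto simp: same_def\<close>)
    then show "tri Z (set_var vp (Add (var vp) f)) M' 1 (\<lambda>M'. M' vJ 0 = int k \<and>
       same {vJ, vp} M (upd M' vJ 0 (int (Suc k))) \<and> (upd M' vJ 0 (int (Suc k))) vp 0 = (\<Sum>i<Suc k. val i))" by simp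
  qed (use n Q in \<open>auto simp: same_def\<close>)
  show "Suc 0 + (3 * s + 2) \<le> t" using t by simp
qed

text \<open>Computes \<open>aW\<close> and \<open>aD\<close> by the recurrences
  \<open>wv_Suc\<close> and \<open>gram_Suc_ip\<close>. The determinant of order 0, which is 1, must
  already be in place.\<close>

definition gso_c :: com where
  "gso_c = For vK dX (Seq (vecc aW (Mul (var vK) nX) (Cell aB (ix (var vK))))
    (Seq (For vI (var vK) (Seq (sumc (Mul (Cell aB (ix (var vK))) (Cell aW (ix (var vI)))))
       (vecc aW (Mul (var vK) nX) (Div (Sub (Mul (Cell aD (Add (var vI) (Num 1))) (Cell aW (ix (var vK))))
          (Mul (var vp) (Cell aW (ix (var vI))))) (Cell aD (var vI))))))
    (Seq (sumc (Mul (Cell aB (ix (var vK))) (Cell aW (ix (var vK)))))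
       (Store aD (Add (var vK) (Num 1)) (var vp)))))"

text \<open>The loop counts upwards while nearest plane goes downwards, hence the index
  \<open>K - 1 - vI\<close>. The remainder modulo \<open>W\<close> is computed from the
  quotient.\<close>

definition np_c :: "aexp \<Rightarrow> com" where
  "np_c K = For vI K (Seq (set_var vL (Sub (Sub K (Num 1)) (var vI)))
    (Seq (sumc (Mul (Cell aU (var vJ)) (Cell aW (ix (var vL)))))
    (Seq (set_var vq (Sub (Add (Div (Add (Mul (Num 2) (var vp)) (Cell aD (Add (var vL) (Num 1))))
        (Mul (Num 2) (Cell aD (Add (var vL) (Num 1)))))
        (Sub (var vE) (Mul (var vW) (Div (var vE) (var vW))))) (var vH)))
    (Seq (set_var vE (Div (var vE) (var vW)))
      (vecc aU (Num 0) (Sub (Cell aU (var vJ)) (Mul (var vq) (Cell aB (ix (var vL))))))))))"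

definition sr_c :: com where
  "sr_c = For vK dX (Seq (vecc aU (Num 0) (Cell aB (ix (var vK))))
    (Seq (np_c (var vK)) (vecc aB (Mul (var vK) nX) (Cell aU (var vJ)))))"

text \<open>The last violated position wins. The value 0 can stand for "none" because a swap always
  needs a predecessor.\<close>

definition scan_c :: com where
  "scan_c = Seq (set_var vPos (Num 0)) (For vI dX
    (If (And (Less (Num 0) (var vI)) (Less (Mul (Mul (Num 2) (Cell aD (Add (var vI) (Num 1)))) (Cell aD (Sub (var vI) (Num 1))))
        (Mul (Cell aD (var vI)) (Cell aD (var vI)))))
      (set_var vPos (var vI)) Skip))"

definition swap_c :: com where
  "swap_c = Seq (vecc aU (Num 0) (Cell aB (ix (Sub (var vPos) (Num 1)))))
    (Seq (vecc aB (Mul (Sub (var vPos) (Num 1)) nX) (Cell aB (ix (var vPos))))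
      (vecc aB (Mul (var vPos) nX) (Cell aU (var vJ))))"

text \<open>Recomputing the whole orthogonalization after each swap costs only a polynomial factor
  and avoids incremental updates of \<open>aW\<close> and \<open>aD\<close>. The initial 1 in
  \<open>vPos\<close> merely starts the loop.\<close>

definition lll_c :: com where
  "lll_c = Seq (set_var vPos (Num 1)) (While (Less (Num 0) (var vPos))
    (Seq gso_c (Seq sr_c (Seq scan_c (If (Less (Num 0) (var vPos)) swap_c Skip)))))"

definition gso_ok :: "nat \<Rightarrow> nat \<Rightarrow> memory \<Rightarrow> (nat \<Rightarrow> nat \<Rightarrow> int) \<Rightarrow> bool" where
  "gso_ok n k M b \<longleftrightarrow> (\<forall>l<k. irow n (M aW) l = wv n b l l) \<and> (\<forall>l\<le>k. M aD l = gram n b l)"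

lemma abs_le_of_ip:
  fixes v :: "nat \<Rightarrow> int"
  assumes "ip n v v \<le> Y\<^sup>2" "Y \<ge> 0" "x < n" shows "\<bar>v x\<bar> \<le> Y"
proof -
  have "(v x)\<^sup>2 \<le> ip n v v" unfolding ip_def power2_eq_square using assms(3) by (intro member_le_sum) auto
  then show ?thesis using assms by (metis abs_of_nonneg abs_le_square_iff order_trans)
qed

lemma wv_zero: "x \<ge> n \<Longrightarrow> (\<And>l. b l x = 0) \<Longrightarrow> wv n b i k x = 0"
proof -
  assume x: "x \<ge> n" "\<And>l. b l x = 0"
  obtain c where "proj n (rl b) i (rl b k) x = rl b k x - (\<Sum>l<i. c l * rl b l x)"
    using proj_coeff[of n "rl b" i "rl b k"] by blast
  then show ?thesis using x by (simp add: wv_def rl_def)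
qed

lemma gso_c:
  assumes M: "M 0 0 = int n" "M 0 1 = int d" "M aD 0 = 1" and b: "b = irow n (M aB)"
    and pos: "\<And>j. j < d \<Longrightarrow> gsn n (rl b) j > 0"
    and Y: "\<And>i. i < d \<Longrightarrow> ip n (b i) (b i) \<le> Y\<^sup>2" "Y \<ge> 1"
    and G: "\<And>i. i \<le> d \<Longrightarrow> gram n b i \<le> G"
    and Z: "int n * Y * (G * Y) \<le> Z" "int n \<le> Z" "int d \<le> Z" "G * Y \<le> Z"
    and s: "n \<le> s" "d \<le> s" "s \<ge> 1"
    and Q: "\<And>M'. same {aW, aD, vI, vJ, vK, vp} M M' \<Longrightarrow> gso_ok n d M' b \<Longrightarrow> Q M'"
  shows "tri Z gso_c M (31 * s ^ 3) Q"
proof -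
  let ?S = "{aW, aD, vI, vJ, vK, vp}"
  have gpos: "gram n b i \<ge> 1" if "i \<le> d" for i using that pos by (intro gram_pos) auto
  have G1: "G \<ge> 1" using gpos[of 0] G[of 0] by simp
  have wb: "\<bar>wv n b i k x\<bar> \<le> G * Y" if "i \<le> d" "k < d" "x < n" for i k x
  proof -
    have "\<bar>wv n b i k x\<bar> \<le> gram n b i * Y" using that Y pos by (intro wv_bound) auto
    also have "\<dots> \<le> G * Y" using G[of i] that Y by (intro mult_right_mono) auto
    finally show ?thesis .
  qed
  have bb: "\<bar>b k x\<bar> \<le> Y" if "k < d" "x < n" for k x
    using abs_le_of_ip[OF Y(1)[OF that(1)]] Y(2) that by simp
  have YG: "Y \<le> G * Y" using G1 Y(2) by (simp add: mult_le_cancel_right1)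
  have "G * 1 \<le> G * Y" using G1 Y(2) by (intro mult_left_mono) auto
  then have GZ: "G \<le> Z" using Z(4) by simp
  have bZ: "\<bar>b k x\<bar> \<le> Z" if "k < d" "x < n" for k x using bb[OF that] YG Z(4) by linarith
  have ipb: "\<bar>\<Sum>x<m. b k x * wv n b i k' x\<bar> \<le> Z" if "m \<le> n" "k < d" "i \<le> d" "k' < d" for m k i k'
  proof -
    have "\<bar>ip m (b k) (wv n b i k')\<bar> \<le> int n * Y * (G * Y)"
      using that bb wb G1 Y by (intro ip_abs_le) auto
    then show ?thesis using Z(1) by (simp add: ip_def)
  qed
  \<comment> \<open>Reading a vector back through \<open>irow\<close> loses nothing because it
    vanishes beyond \<open>n\<close>.\<close>
  have ext: "(\<lambda>j. if j < n then wv n b i k j else 0) = wv n b i k" for i k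
    using wv_zero[of n _ b i k] by (auto simp: b irow_def not_less)
  let ?I = "\<lambda>k M'. same ?S M M' \<and> gso_ok n k M' b"
  have t3: "s \<le> s ^ 3" "s ^ 2 \<le> s ^ 3" "1 \<le> s ^ 3" using s by (auto simp: self_le_power power_increasing)
  show ?thesis unfolding gso_c_def
  proof (rule tri_For_le[where N = d and s = s and I = ?I and tb = "s * (6 * s + 7) + 2 + (6 * s + 6)"])
    fix k M1
    assume k: "k < d" and I: "?I k M1" and vk: "M1 vK 0 = int k"
    have M1: "M1 0 0 = int n" "M1 0 1 = int d" "M1 aB = M aB" using I M by (auto simp: same_def)
    have Wr: "irow n (M1 aW) l = wv n b l l" if "l < k" for l using I that by (auto simp: gso_ok_def)
    have Dr: "M1 aD l = gram n b l" if "l \<le> k" for l using I that by (auto simp: gso_ok_def)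
    have bv: "M aB (k' * n + j) = b k' j" if "j < n" for k' j using that by (simp add: b irow_def)
    show "tri Z (Seq (vecc aW (Mul (var vK) nX) (Cell aB (ix (var vK))))
      (Seq (For vI (var vK) (Seq (sumc (Mul (Cell aB (ix (var vK))) (Cell aW (ix (var vI)))))
         (vecc aW (Mul (var vK) nX) (Div (Sub (Mul (Cell aD (Add (var vI) (Num 1))) (Cell aW (ix (var vK))))
            (Mul (var vp) (Cell aW (ix (var vI))))) (Cell aD (var vI))))))
      (Seq (sumc (Mul (Cell aB (ix (var vK))) (Cell aW (ix (var vK)))))
         (Store aD (Add (var vK) (Num 1)) (var vp))))) M1 (s * (6 * s + 7) + 2 + (6 * s + 6))
       (\<lambda>M'. M' vK 0 = int k \<and> ?I (Suc k) (upd M' vK 0 (int (Suc k))))"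
    proof (rule tri_Seq[OF tri_vecc[where n = n and ofs = "k * n" and val = "b k" and t = "3 * s + 2"]])
      fix M2 assume M2: "same {vJ, aW} M1 M2"
        and M2W: "\<And>i. M2 aW i = (if k * n \<le> i \<and> i < k * n + n then b k (i - k * n) else M1 aW i)"
      have r2: "irow n (M2 aW) l = (if l = k then wv n b 0 k else irow n (M1 aW) l)" for l
        using irow_upd[OF M2W] ext[of 0 k, unfolded wv_0] by auto
      let ?J = "\<lambda>i M'. same {aW, vI, vJ, vp} M2 M' \<and> (\<forall>l<k. irow n (M' aW) l = wv n b l l) \<and> irow n (M' aW) k = wv n b i k"
      show "tri Z (Seq (For vI (var vK) (Seq (sumc (Mul (Cell aB (ix (var vK))) (Cell aW (ix (var vI)))))
         (vecc aW (Mul (var vK) nX) (Div (Sub (Mul (Cell aD (Add (var vI) (Num 1))) (Cell aW (ix (var vK))))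
            (Mul (var vp) (Cell aW (ix (var vI))))) (Cell aD (var vI))))))
      (Seq (sumc (Mul (Cell aB (ix (var vK))) (Cell aW (ix (var vK)))))
         (Store aD (Add (var vK) (Num 1)) (var vp)))) M2 (s * (6 * s + 7) + 2 + (3 * s + 4))
       (\<lambda>M'. M' vK 0 = int k \<and> ?I (Suc k) (upd M' vK 0 (int (Suc k))))"
      proof (rule tri_Seq[OF tri_For_le[where N = k and s = s and tb = "6 * s + 5" and I = ?J and t = "s * (6 * s + 7) + 2"]])
        show "?J 0 (upd M2 vI 0 0)" using r2 Wr by (auto simp: same_def)
        show "aval M' (var vK) = int k" if "?J i M'" for i M' using that M2 vk by (auto simp: same_def)
      next
        fix i M3 assume i: "i < k" and J: "?J i M3" and vi: "M3 vI 0 = int i"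
        have M3: "M3 0 0 = int n" "M3 vK 0 = int k" "M3 aB = M aB" "M3 aD = M1 aD" "M3 0 (Suc 0) = int d"
          using J M1 M2 vk by (auto simp: same_def)
        have w3: "M3 aW (l * n + j) = wv n b l l j" if "l < k" "j < n" for l j
          using J that irow_same[of j n "M3 aW" l] by auto
        have w3k: "M3 aW (k * n + j) = wv n b i k j" if "j < n" for j
          using J that irow_same[of j n "M3 aW" k] by auto
        show "tri Z (Seq (sumc (Mul (Cell aB (ix (var vK))) (Cell aW (ix (var vI)))))
         (vecc aW (Mul (var vK) nX) (Div (Sub (Mul (Cell aD (Add (var vI) (Num 1))) (Cell aW (ix (var vK))))
            (Mul (var vp) (Cell aW (ix (var vI))))) (Cell aD (var vI))))) M3 (6 * s + 5)
           (\<lambda>M'. M' vI 0 = int i \<and> ?J (Suc i) (upd M' vI 0 (int (Suc i))))"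
        proof (rule tri_Seq[OF tri_sumc[where n = n and val = "\<lambda>j. b k j * wv n b i i j" and s = s and t = "3 * s + 3"]])
          fix M4 assume M4: "same {vJ, vp} M3 M4" and p4: "M4 vp 0 = (\<Sum>j<n. b k j * wv n b i i j)"
          show "tri Z (vecc aW (Mul (var vK) nX) (Div (Sub (Mul (Cell aD (Add (var vI) (Num 1))) (Cell aW (ix (var vK))))
            (Mul (var vp) (Cell aW (ix (var vI))))) (Cell aD (var vI)))) M4 (3 * s + 2)
             (\<lambda>M'. M' vI 0 = int i \<and> ?J (Suc i) (upd M' vI 0 (int (Suc i))))"
          proof (rule tri_vecc[where n = n and s = s and ofs = "k * n" and val = "wv n b (Suc i) k"])
            fix j M' assume j: "j < n" and s': "same {vJ, aW} M4 M'" and vj: "M' vJ 0 = int j"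
              and un: "\<forall>i. \<not> (k * n \<le> i \<and> i < k * n + j) \<longrightarrow> M' aW i = M4 aW i"
            have "M' aW (k * n + j) = wv n b i k j" using un w3k[OF j] M4 by (auto simp: same_def)
            moreover have "M' aW (i * n + j) = wv n b i i j"
            proof -
              \<comment> \<open>Row \<open>i\<close> ends before row \<open>k\<close> begins, so
                overwriting row \<open>k\<close> in place leaves it intact.\<close>
              have "i * n + j < k * n" using i j by (metis add.commute add_less_cancel_left less_le_trans mult_Suc mult_le_mono1 Suc_leI)
              then show ?thesis using un w3[OF i j] M4 by (auto simp: same_def)
            qed
            moreover have "M' 0 0 = int n" "M' vK 0 = int k" "M' vI 0 = int i" "M' aD = M1 aD"
              using s' M4 M3 vi by (auto simp: same_def)
            moreover have "M' vp 0 = ip n (b k) (wv n b i i)" using s' p4 by (auto simp: same_def ip_def)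
            moreover have "wv n b (Suc i) k j = (gram n b (Suc i) * wv n b i k j - ip n (b k) (wv n b i i) * wv n b i i j) div gram n b i"
              using i k pos by (intro wv_Suc) auto
            ultimately show "aval M' (Div (Sub (Mul (Cell aD (Add (var vI) (Num 1))) (Cell aW (ix (var vK))))
            (Mul (var vp) (Cell aW (ix (var vI))))) (Cell aD (var vI))) = wv n b (Suc i) k j \<and> aval M' (Mul (var vK) nX) = int (k * n)"
              using vj i Dr[of i] Dr[of "Suc i"] by simp
          next
            fix M' assume s': "same {vJ, aW} M4 M'" and W': "\<And>ii. M' aW ii = (if k * n \<le> ii \<and> ii < k * n + n then wv n b (Suc i) k (ii - k * n) else M4 aW ii)"
            have "irow n (M' aW) l = (if l = k then wv n b (Suc i) k else irow n (M4 aW) l)" for l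
              using irow_upd[OF W'] ext[of "Suc i" k] by auto
            moreover have "M4 aW = M3 aW" using M4 by (auto simp: same_def)
            ultimately show "M' vI 0 = int i \<and> ?J (Suc i) (upd M' vI 0 (int (Suc i)))"
              using s' M4 J vi by (auto simp: same_def)
          qed (use M4 M3 Z s i k wb[of "Suc i" k] G1 Y in \<open>auto simp: same_def intro: order_trans\<close>)
        next
          fix j M' assume "j < n" "same {vJ, vp} M3 M'" "M' vJ 0 = int j"
          then show "aval M' (Mul (Cell aB (ix (var vK))) (Cell aW (ix (var vI)))) = b k j * wv n b i i j"
            using M3 vi w3[OF i] bv by (simp add: same_def)
        qed (use M3 Z s i k ipb in auto)
      next
        fix M3 assume J: "?J k M3" and "M3 vI 0 = int k"
        have M3: "M3 0 0 = int n" "M3 vK 0 = int k" "M3 aB = M aB" "M3 aD = M1 aD"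
          using J M1 M2 vk by (auto simp: same_def)
        have w3k: "M3 aW (k * n + j) = wv n b k k j" if "j < n" for j
          using J that irow_same[of j n "M3 aW" k] by auto
        show "tri Z (Seq (sumc (Mul (Cell aB (ix (var vK))) (Cell aW (ix (var vK)))))
         (Store aD (Add (var vK) (Num 1)) (var vp))) M3 (3 * s + 4) (\<lambda>M'. M' vK 0 = int k \<and> ?I (Suc k) (upd M' vK 0 (int (Suc k))))"
        proof (rule tri_Seq[OF tri_sumc[where n = n and val = "\<lambda>j. b k j * wv n b k k j" and s = s and t = "3 * s + 3"]])
          fix M4 assume M4: "same {vJ, vp} M3 M4" and p4: "M4 vp 0 = (\<Sum>j<n. b k j * wv n b k k j)"
          have g: "gram n b (Suc k) = M4 vp 0" using k pos unfolding p4 by (subst gram_Suc_ip) (auto simp: ip_def)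
          have M4': "M4 aD = M1 aD" "M4 aW = M3 aW" "M4 vK 0 = int k" using M4 M3 by (auto simp: same_def)
          have gg: "\<bar>gram n b (Suc k)\<bar> \<le> Z" using gpos[of "Suc k"] G[of "Suc k"] k GZ by simp
          show "tri Z (Store aD (Add (var vK) (Num 1)) (var vp)) M4 (Suc 0) (\<lambda>M'. M' vK 0 = int k \<and> ?I (Suc k) (upd M' vK 0 (int (Suc k))))"
          proof (rule tri_Store)
            show "\<bar>aval M4 (var vp)\<bar> \<le> Z" using gg g by simp
            let ?M5 = "upd M4 aD (nat (aval M4 (Add (var vK) (Num 1)))) (aval M4 (var vp))"
            have "same ?S M ?M5" using I M2 J M4 by (auto simp: same_def)
            moreover have "gso_ok n (Suc k) ?M5 b"
              using J M4' g Dr by (auto simp: gso_ok_def less_Suc_eq le_Suc_eq)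
            ultimately show "?M5 vK 0 = int k \<and> ?I (Suc k) (upd ?M5 vK 0 (int (Suc k)))"
              using M4' by (auto simp: same_def gso_ok_def)
          qed
        next
          fix j M' assume "j < n" "same {vJ, vp} M3 M'" "M' vJ 0 = int j"
          then show "aval M' (Mul (Cell aB (ix (var vK))) (Cell aW (ix (var vK)))) = b k j * wv n b k k j"
            using M3 w3k bv by (simp add: same_def)
        qed (use M3 Z s k ipb in auto)
      qed (use k s Z in auto)
    next
      fix j M' assume "j < n" "same {vJ, aW} M1 M'" "M' vJ 0 = int j"
      then show "aval M' (Cell aB (ix (var vK))) = b k j \<and> aval M' (Mul (var vK) nX) = int (k * n)"
        using M1 vk bv by (simp add: same_def)
    qed (use M1 Z s k bZ in auto)
  next
    show "s * (s * (6 * s + 7) + 2 + (6 * s + 6) + 2) + 2 \<le> 31 * s ^ 3"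
    proof -
      have "s * (s * (6 * s + 7) + 2 + (6 * s + 6) + 2) + 2 = 6 * s ^ 3 + 13 * s ^ 2 + 10 * s + 2"
        by (simp add: power2_eq_square power3_eq_cube algebra_simps)
      then show ?thesis using t3 by linarith
    qed
  qed (use M Z s Q in \<open>auto simp: same_def gso_ok_def\<close>)
qed


text \<open>After \<open>i\<close> rounds the entries are at most \<open>A * Y ^ i\<close>, where
  \<open>Y\<close> is the growth factor of \<open>np_step_bound\<close>; \<open>BB\<close> bounds
  all of these.\<close>

lemma np_c:
  assumes M: "M 0 0 = int n" "M vW 0 = W" "M vH 0 = H" and b: "b = irow n (M aB)"
    and K: "\<And>M'. same {aU, vE, vI, vJ, vL, vp, vq} M M' \<Longrightarrow> aval M' K = int kk"
    and g: "gso_ok n kk M b" "\<And>l. l \<le> kk \<Longrightarrow> gram n b l \<ge> 1"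
    and u0: "u0 = irow n (M aU) 0" and e0: "e0 = M vE 0" "0 \<le> e0" "e0 \<le> Z"
    and A: "\<And>x. x < n \<Longrightarrow> \<bar>u0 x\<bar> \<le> A" "A \<ge> 1"
    and Ww: "\<And>l x. l < kk \<Longrightarrow> x < n \<Longrightarrow> \<bar>wv n b l l x\<bar> \<le> Ww" "Ww \<ge> 0"
    and Bb: "\<And>l x. l < kk \<Longrightarrow> x < n \<Longrightarrow> \<bar>b l x\<bar> \<le> Bb" "Bb \<ge> 0"
    and WH: "W \<ge> 1" "H \<ge> 0"
    and BB: "A * (1 + (int n * Ww + 1 + W + H) * Bb) ^ kk \<le> BB"
    and Z: "int n * BB * Ww + 1 + W + H \<le> Z" "BB \<le> Z" "int n \<le> Z" "int kk \<le> Z"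
    and s: "n \<le> s" "kk \<le> s" "s \<ge> 1"
    and Q: "\<And>M'. same {aU, vE, vI, vJ, vL, vp, vq} M M' \<Longrightarrow>
      (irow n (M' aU) 0, M' vE 0) = np n b W H kk (u0, e0) \<Longrightarrow> Q M'"
  shows "tri Z (np_c K) M (18 * s\<^sup>2) Q"
proof -
  let ?S = "{aU, vE, vI, vJ, vL, vp, vq}"
  define Y where "Y = 1 + (int n * Ww + 1 + W + H) * Bb"
  have Y1: "Y \<ge> 1" using Ww(2) WH Bb(2) by (simp add: Y_def)
  have AY: "A * Y ^ i \<le> BB" if "i \<le> kk" for i
    using that A Y1 BB unfolding Y_def[symmetric]
    by (meson order_trans mult_left_mono power_increasing zero_le_one)
  have AY1: "A * Y ^ i \<ge> 1" for i using A(2) Y1 mult_mono[of 1 A 1 "Y ^ i"] one_le_power[of Y i] by simp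
  \<comment> \<open>The invariant speaks of the work that remains: continuing with \<open>np\<close>
    from the current state must give the final result.\<close>
  let ?I = "\<lambda>i M'. same ?S M M' \<and> np n b W H (kk - i) (irow n (M' aU) 0, M' vE 0) = np n b W H kk (u0, e0) \<and>
    (\<forall>x<n. \<bar>M' aU x\<bar> \<le> A * Y ^ i) \<and> 0 \<le> M' vE 0 \<and> M' vE 0 \<le> Z"
  have t3: "s \<le> s\<^sup>2" "1 \<le> s\<^sup>2" using s by (auto simp: self_le_power)
  show ?thesis unfolding np_c_def
  proof (rule tri_For_le[where N = kk and s = s and I = ?I and tb = "6 * s + 8"])
    show "?I 0 (upd M vI 0 0)" using A e0 u0 by (auto simp: same_def irow_def)
    show "aval M' K = int kk" if "?I i M'" for i M' using that K by auto
    show "Q M'" if "?I kk M'" for M' using that Q by auto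
  next
    fix i M1 assume i: "i < kk" and I: "?I i M1" and vi: "M1 vI 0 = int i"
    define l where "l = kk - 1 - i"
    have l: "l < kk" "kk - i = Suc l" "kk - Suc i = l" using i by (auto simp: l_def)
    have li: "int kk - 1 - int i = int l" using i by (simp add: l_def)
    define u where "u = irow n (M1 aU) 0"
    define e where "e = M1 vE 0"
    have u: "M1 aU x = u x" "\<bar>u x\<bar> \<le> A * Y ^ i" if "x < n" for x using that I by (auto simp: u_def irow_def)
    have e: "0 \<le> e" "e \<le> Z" using I by (auto simp: e_def)
    have M1: "M1 0 0 = int n" "M1 vW 0 = W" "M1 vH 0 = H" "M1 aB = M aB" "M1 aW = M aW" "M1 aD = M aD"
      using I M by (auto simp: same_def)
    have w1: "M aW (l * n + j) = wv n b l l j" if "j < n" for j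
      using g(1) l that irow_same[of j n "M aW" l] by (auto simp: gso_ok_def)
    have D1: "M aD (Suc l) = gram n b (Suc l)" using g(1) l by (auto simp: gso_ok_def)
    have bv: "M aB (l * n + j) = b l j" if "j < n" for j using that by (simp add: b irow_def)
    define q where "q = np_q n b W H l u e"
    have gp: "gram n b (Suc l) \<ge> 1" using g(2) l by simp
    have "\<bar>q\<bar> \<le> int n * (A * Y ^ i) * Ww + 1 + W + H"
      unfolding q_def using u Ww l gp WH AY1[of i] by (intro np_q_bound) auto
    also have "\<dots> \<le> int n * BB * Ww + 1 + W + H"
      using AY[of i] i Ww(2) by (intro add_right_mono mult_right_mono mult_left_mono) auto
    finally have qZ: "\<bar>q\<bar> \<le> Z" using Z by simp
    have pZ: "\<bar>\<Sum>x<m. u x * wv n b l l x\<bar> \<le> Z" if "m \<le> n" for m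
    proof -
      have "\<bar>ip m u (wv n b l l)\<bar> \<le> int n * BB * Ww"
      proof (rule ip_abs_le)
        show "\<bar>u x\<bar> \<le> BB" if "x < n" for x using u(2)[OF that] AY[of i] i by linarith
      qed (use Ww l AY1[of 0] AY[of 0] that in auto)
      then show ?thesis using Z WH by (simp add: ip_def)
    qed
    have uY: "\<bar>u x - q * b l x\<bar> \<le> A * Y ^ Suc i" if "x < n" for x
    proof -
      have "\<bar>fst (np_step n b W H l (u, e)) x\<bar> \<le> A * Y ^ i * (1 + (int n * Ww + 1 + W + H) * Bb)"
        using u Ww Bb l gp WH AY1[of i] that by (intro np_step_bound) auto
      then show ?thesis by (simp add: np_step_def q_def Y_def algebra_simps)
    qed
    have step: "np_step n b W H l (u, e) = (\<lambda>x. if x < n then u x - q * b l x else 0, e div W)"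
      by (auto simp: np_step_def q_def u_def b irow_def)
    have eW: "0 \<le> e div W" "e div W \<le> Z" using e WH abs_div_le[of e W] by (auto simp: pos_imp_zdiv_nonneg_iff)
    have em: "e - W * (e div W) = e mod W" by (simp add: minus_mult_div_eq_mod)
    show "tri Z (Seq (set_var vL (Sub (Sub K (Num 1)) (var vI)))
    (Seq (sumc (Mul (Cell aU (var vJ)) (Cell aW (ix (var vL)))))
    (Seq (set_var vq (Sub (Add (Div (Add (Mul (Num 2) (var vp)) (Cell aD (Add (var vL) (Num 1))))
        (Mul (Num 2) (Cell aD (Add (var vL) (Num 1)))))
        (Sub (var vE) (Mul (var vW) (Div (var vE) (var vW))))) (var vH)))
    (Seq (set_var vE (Div (var vE) (var vW)))
      (vecc aU (Num 0) (Sub (Cell aU (var vJ)) (Mul (var vq) (Cell aB (ix (var vL)))))))))) M1 (6 * s + 8)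
       (\<lambda>M'. M' vI 0 = int i \<and> ?I (Suc i) (upd M' vI 0 (int (Suc i))))" (is "tri _ _ _ _ ?Q")
    proof (rule tri_Seq[OF tri_Store[where t = 0]])
      have K1: "aval M1 K = int kk" using K I by auto
      show "\<bar>aval M1 (Sub (Sub K (Num 1)) (var vI))\<bar> \<le> Z" using K1 vi li l Z by simp
      let ?M2 = "upd M1 vL (nat (aval M1 (Num 0))) (aval M1 (Sub (Sub K (Num 1)) (var vI)))"
      have M2: "?M2 vL 0 = int l" "same {vL} M1 ?M2" using K1 vi li by (auto simp: same_def)
      show "tri Z (Seq (sumc (Mul (Cell aU (var vJ)) (Cell aW (ix (var vL)))))
    (Seq (set_var vq (Sub (Add (Div (Add (Mul (Num 2) (var vp)) (Cell aD (Add (var vL) (Num 1))))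
        (Mul (Num 2) (Cell aD (Add (var vL) (Num 1)))))
        (Sub (var vE) (Mul (var vW) (Div (var vE) (var vW))))) (var vH)))
    (Seq (set_var vE (Div (var vE) (var vW)))
      (vecc aU (Num 0) (Sub (Cell aU (var vJ)) (Mul (var vq) (Cell aB (ix (var vL))))))))) ?M2 (6 * s + 7) ?Q"
      proof (rule tri_Seq[OF tri_sumc[where n = n and val = "\<lambda>x. u x * wv n b l l x" and s = s and t = "3 * s + 3"]])
        fix j M' assume "j < n" "same {vJ, vp} ?M2 M'" "M' vJ 0 = int j"
        then show "aval M' (Mul (Cell aU (var vJ)) (Cell aW (ix (var vL)))) = u j * wv n b l l j"
          using M2 M1 u w1 by (simp add: same_def)
      next
        fix M3 assume M3: "same {vJ, vp} ?M2 M3" and p3: "M3 vp 0 = (\<Sum>x<n. u x * wv n b l l x)"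
        show "tri Z (Seq (set_var vq (Sub (Add (Div (Add (Mul (Num 2) (var vp)) (Cell aD (Add (var vL) (Num 1))))
        (Mul (Num 2) (Cell aD (Add (var vL) (Num 1)))))
        (Sub (var vE) (Mul (var vW) (Div (var vE) (var vW))))) (var vH)))
    (Seq (set_var vE (Div (var vE) (var vW)))
      (vecc aU (Num 0) (Sub (Cell aU (var vJ)) (Mul (var vq) (Cell aB (ix (var vL)))))))) M3 (3 * s + 4) ?Q"
        proof (rule tri_Seq[OF tri_Store[where t = 0]])
          let ?e = "Sub (Add (Div (Add (Mul (Num 2) (var vp)) (Cell aD (Add (var vL) (Num 1))))
        (Mul (Num 2) (Cell aD (Add (var vL) (Num 1)))))
        (Sub (var vE) (Mul (var vW) (Div (var vE) (var vW))))) (var vH)"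
          have M3': "M3 vL 0 = int l" "M3 vE 0 = e" "M3 vW 0 = W" "M3 vH 0 = H" "M3 aD = M aD"
            using M3 M2 M1 e_def by (auto simp: same_def)
          have qe: "aval M3 ?e = q" using M3' p3 D1 by (simp add: q_def np_q_def ip_def em)
          show "\<bar>aval M3 ?e\<bar> \<le> Z" using qe qZ by simp
          let ?M4 = "upd M3 vq (nat (aval M3 (Num 0))) (aval M3 ?e)"
          have M4: "?M4 vq 0 = q" "same {vq} M3 ?M4" using qe by (auto simp: same_def)
          show "tri Z (Seq (set_var vE (Div (var vE) (var vW)))
      (vecc aU (Num 0) (Sub (Cell aU (var vJ)) (Mul (var vq) (Cell aB (ix (var vL))))))) ?M4 (3 * s + 3) ?Q"
          proof (rule tri_Seq[OF tri_Store[where t = 0]])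
            have ee: "aval ?M4 (Div (var vE) (var vW)) = e div W" using M3' by simp
            show "\<bar>aval ?M4 (Div (var vE) (var vW))\<bar> \<le> Z" using ee eW by simp
            let ?M5 = "upd ?M4 vE (nat (aval ?M4 (Num 0))) (aval ?M4 (Div (var vE) (var vW)))"
            have M5: "?M5 vE 0 = e div W" "?M5 vq 0 = q" "?M5 vL 0 = int l" "same {vE, vq, vJ, vp, vL} M1 ?M5"
              using ee M3' M4 M3 M2 by (auto simp: same_def)
            show "tri Z (vecc aU (Num 0) (Sub (Cell aU (var vJ)) (Mul (var vq) (Cell aB (ix (var vL)))))) ?M5 (3 * s + 2) ?Q"
            proof (rule tri_vecc[where n = n and s = s and ofs = 0 and val = "\<lambda>x. u x - q * b l x"])
              fix j M' assume "j < n" "same {vJ, aU} ?M5 M'" "M' vJ 0 = int j"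
                "\<forall>i. \<not> (0 \<le> i \<and> i < 0 + j) \<longrightarrow> M' aU i = ?M5 aU i"
              then show "aval M' (Sub (Cell aU (var vJ)) (Mul (var vq) (Cell aB (ix (var vL))))) = u j - q * b l j
                 \<and> aval M' (Num 0) = int 0"
                using M5 M1 u bv by (simp add: same_def)
            next
              fix M' assume M': "same {vJ, aU} ?M5 M'"
                and un: "\<And>i. M' aU i = (if 0 \<le> i \<and> i < 0 + n then u (i - 0) - q * b l (i - 0) else ?M5 aU i)"
              have "irow n (M' aU) 0 = (\<lambda>x. if x < n then u x - q * b l x else 0)"
                by (auto simp: irow_def un)
              moreover have "M' vE 0 = e div W" "M' vI 0 = int i" using M' M5 vi by (auto simp: same_def)
              moreover have "same ?S M M'" using I M5 M' by (auto simp: same_def)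
              moreover have "np n b W H (kk - Suc i) (np_step n b W H l (u, e)) = np n b W H kk (u0, e0)"
                using I unfolding l u_def[symmetric] e_def[symmetric] by simp
              moreover have "\<forall>x<n. \<bar>M' aU x\<bar> \<le> A * Y ^ Suc i" using uY by (simp add: un)
              ultimately show "?Q M'" using eW step by (auto simp: same_def)
            next
              fix x assume "x < n"
              then show "\<bar>u x - q * b l x\<bar> \<le> Z" using uY[of x] AY[of "Suc i"] i Z by linarith
            qed (use M1 M5 Z s in \<open>auto simp: same_def\<close>)
          qed (use s in auto)
        qed (use s in auto)
      qed (use M1 M2 Z s pZ in \<open>auto simp: same_def\<close>)
    qed (use s in auto)
  next
    show "s * (6 * s + 8 + 2) + 2 \<le> 18 * s\<^sup>2"
    proof -
      have "s * (6 * s + 8 + 2) + 2 = 6 * s\<^sup>2 + 10 * s + 2" by (simp add: power2_eq_square algebra_simps)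
      then show ?thesis using t3 by linarith
    qed
  qed (use Z s in auto)
qed

section \<open>Row operations and the lattice they preserve\<close>

definition lat :: "nat \<Rightarrow> (nat \<Rightarrow> nat \<Rightarrow> int) \<Rightarrow> (nat \<Rightarrow> int) set" where
  "lat d b = range (\<lambda>c. lc d c b)"

lemma lat_row_op_subset:
  assumes "k < d" "b' = b(k := (\<lambda>x. b k x + lc k c b x))" shows "lat d b' \<subseteq> lat d b"
proof
  fix y assume "y \<in> lat d b'"
  then obtain a where y: "y = lc d a b'" by (auto simp: lat_def)
  have "lc d a b' x = lc d (\<lambda>l. a l + (if l < k then a k * c l else 0)) b x" for x
  proof -
    have "lc d a b' x = (\<Sum>l<d. a l * b l x + (if l = k then a k * lc k c b x else 0))"
      unfolding lc_def assms(2) by (intro sum.cong) (auto simp: algebra_simps)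
    also have "\<dots> = (\<Sum>l<d. a l * b l x) + a k * lc k c b x" using assms(1) by (simp add: sum.distrib)
    also have "a k * lc k c b x = (\<Sum>l<k. (a k * c l) * b l x)" by (simp add: lc_def sum_distrib_left mult.assoc)
    also have "\<dots> = (\<Sum>l<d. (if l < k then a k * c l else 0) * b l x)"
      using assms(1) by (intro sum.mono_neutral_cong_left) auto
    finally show ?thesis by (simp add: lc_def sum.distrib algebra_simps)
  qed
  then have "y = lc d (\<lambda>l. a l + (if l < k then a k * c l else 0)) b" using y by auto
  then show "y \<in> lat d b" by (auto simp: lat_def)
qed

text \<open>The operation is undone by the one with negated coefficients, so one inclusion is
  enough.\<close>

lemma lat_row_op:
  assumes "k < d" "b' = b(k := (\<lambda>x. b k x + lc k c b x))" shows "lat d b' = lat d b"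
proof
  show "lat d b' \<subseteq> lat d b" by (rule lat_row_op_subset[OF assms])
  have "lc k (\<lambda>l. - c l) b' = (\<lambda>x. - lc k c b x)"
    by (auto simp: lc_def assms(2) sum_negf)
  then have "b = b'(k := (\<lambda>x. b' k x + lc k (\<lambda>l. - c l) b' x))"
    by (auto simp: assms(2) fun_eq_iff)
  then show "lat d b \<subseteq> lat d b'" by (rule lat_row_op_subset[OF assms(1)])
qed

lemma lat_swap:
  assumes k: "Suc k < d" and b': "b' = b(k := b (Suc k), Suc k := b k)" shows "lat d b' = lat d b"
proof -
  have sub: "lat d (b(k := b (Suc k), Suc k := b k)) \<subseteq> lat d b" for b
  proof
    fix y assume "y \<in> lat d (b(k := b (Suc k), Suc k := b k))"
    then obtain a where y: "y = lc d a (b(k := b (Suc k), Suc k := b k))" by (auto simp: lat_def)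
    let ?p = "Transposition.transpose k (Suc k)"
    have "lc d a (b(k := b (Suc k), Suc k := b k)) x = lc d (a \<circ> ?p) b x" for x
      unfolding lc_def using k
      by (intro sum.reindex_bij_witness[of _ ?p ?p]) (auto simp: Transposition.transpose_def)
    then have "y = lc d (a \<circ> ?p) b" using y by auto
    then show "y \<in> lat d b" by (auto simp: lat_def)
  qed
  have "b = b'(k := b' (Suc k), Suc k := b' k)" by (auto simp: b')
  then show ?thesis using sub[of b] sub[of b'] b' by auto
qed

lemma gram_cong: "(\<And>i. gsn n (rl b') i = gsn n (rl b) i) \<Longrightarrow> gram n b' i = gram n b i"
proof -
  assume "\<And>i. gsn n (rl b') i = gsn n (rl b) i"
  then have "real_of_int (gram n b' i) = of_int (gram n b i)" by (simp add: gram_eq)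
  then show ?thesis by linarith
qed

lemma gso_ok_cong:
  assumes "\<And>i. gs n (rl b') i = gs n (rl b) i" "gso_ok n k M b" "M' aW = M aW" "M' aD = M aD"
  shows "gso_ok n k M' b'"
proof -
  have "gram n b' i = gram n b i" for i using assms(1) by (intro gram_cong) (simp add: gsn_def)
  moreover from this have "wv n b' i i = wv n b i i" for i
    using assms(1)[of i] by (auto simp: wv_def gs_def)
  ultimately show ?thesis using assms by (simp add: gso_ok_def)
qed

lemma np_row:
  assumes pos: "\<And>j. j < d \<Longrightarrow> gsn n (rl b) j > 0" and k: "k < d"
    and b': "b' = b(k := fst (np n b 1 0 k (b k, e)))"
  shows "\<And>i. gs n (rl b') i = gs n (rl b) i" "lat d b' = lat d b"
    "\<And>j. j < k \<Longrightarrow> \<bar>mu n (rl b) (rl b' k) j\<bar> \<le> 1 / 2"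
proof -
  obtain c where c: "fst (np n b 1 0 k (b k, e)) = (\<lambda>x. b k x - lc k c b x)" using np_lc[of n b 1 0 k "(b k, e)"] by auto
  have e: "b' = b(k := (\<lambda>x. b k x + lc k (\<lambda>l. - c l) b x))"
    unfolding b' c by (simp add: lc_def sum_negf)
  then show "lat d b' = lat d b" by (rule lat_row_op[OF k])
  have "rl b' = (rl b)(k := (\<lambda>x. rl b k x + (\<Sum>l<k. of_int (- c l) * rl b l x)))"
    unfolding e by (auto simp: rl_def lc_def fun_eq_iff)
  from proj_row_op(2)[OF _ this] show "\<And>i. gs n (rl b') i = gs n (rl b) i" using pos k by auto
  show "\<bar>mu n (rl b) (rl b' k) j\<bar> \<le> 1 / 2" if "j < k" for j
    using np_reduced[of k n b j "(b k, e)"] pos k that by (simp add: b' rl_apply)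
qed

text \<open>After size reduction the length of a basis vector is controlled by Gram-Schmidt norms
  alone. As these stay below a fixed bound, the entries do not swell from round to round.\<close>

lemma reduced_norm:
  assumes X: "\<And>j. j \<le> k \<Longrightarrow> gsn n b j \<le> X" and red: "\<And>j. j < k \<Longrightarrow> \<bar>mu n b (b k) j\<bar> \<le> 1 / 2"
  shows "ip n (b k) (b k) \<le> real (Suc k) * X"
proof -
  have "(mu n b (b k) j)\<^sup>2 * gsn n b j \<le> X" if "j < k" for j
  proof -
    have "(mu n b (b k) j)\<^sup>2 \<le> 1" using power_mono[OF red[OF that], of 2] by (simp add: power2_eq_square)
    then have "(mu n b (b k) j)\<^sup>2 * gsn n b j \<le> 1 * gsn n b j" by (intro mult_right_mono gsn_nonneg)
    then show ?thesis using X[of j] that by simp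
  qed
  then have "(\<Sum>j<k. (mu n b (b k) j)\<^sup>2 * gsn n b j) \<le> (\<Sum>j<k. X)" by (intro sum_mono) auto
  then show ?thesis unfolding gsn_eq_norm using X[of k] by (simp add: algebra_simps)
qed

text \<open>Invariant of the reduction. The bound \<open>X\<close> is on squared Gram-Schmidt norms,
  from which size reduction recovers a bound on the vectors; row \<open>d\<close> holds the target
  and must stay put.\<close>

definition LB :: "nat \<Rightarrow> nat \<Rightarrow> (nat \<Rightarrow> nat \<Rightarrow> int) \<Rightarrow> real \<Rightarrow> (nat \<Rightarrow> nat \<Rightarrow> int) \<Rightarrow> bool" where
  "LB n d b0 X b \<longleftrightarrow> lat d b = lat d b0 \<and> (\<forall>i\<ge>d. b i = b0 i) \<and>
     (\<forall>i<d. 0 < gsn n (rl b) i \<and> gsn n (rl b) i \<le> X)"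

lemma irow_zero: "x \<ge> n \<Longrightarrow> irow n A i x = 0"
  by (simp add: irow_def)

lemma sr_c:
  assumes M: "M 0 0 = int n" "M 0 1 = int d" "M vW 0 = 1" "M vH 0 = 0" "M vE 0 = 0" and b: "b = irow n (M aB)"
    and g: "gso_ok n d M b" and LB: "LB n d b0 X b"
    and Y: "\<And>i. i < d \<Longrightarrow> ip n (b i) (b i) \<le> Y\<^sup>2" "Y \<ge> 1" "real d * X \<le> (of_int Y)\<^sup>2"
    and G: "\<And>i. i \<le> d \<Longrightarrow> gram n b i \<le> G"
    and BB: "Y * (1 + (int n * (G * Y) + 2) * Y) ^ d \<le> BB"
    and Z: "int n * BB * (G * Y) + 2 \<le> Z" "BB \<le> Z" "int n \<le> Z" "int d \<le> Z"
    and s: "n \<le> s" "d \<le> s" "s \<ge> 1"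
    and Q: "\<And>M' b'. same {aU, aB, vE, vI, vJ, vK, vL, vp, vq} M M' \<Longrightarrow> M' vE 0 = 0 \<Longrightarrow> b' = irow n (M' aB) \<Longrightarrow>
      gso_ok n d M' b' \<Longrightarrow> LB n d b0 X b' \<Longrightarrow> (\<And>k j. k < d \<Longrightarrow> j < k \<Longrightarrow> \<bar>mu n (rl b') (rl b' k) j\<bar> \<le> 1 / 2) \<Longrightarrow>
      (\<And>i. i < d \<Longrightarrow> ip n (b' i) (b' i) \<le> Y\<^sup>2) \<Longrightarrow> (\<And>i. gram n b' i = gram n b i) \<Longrightarrow> Q M'"
  shows "tri Z sr_c M (32 * s ^ 3) Q"
proof -
  let ?S = "{aU, aB, vE, vI, vJ, vK, vL, vp, vq}"
  have pos: "\<And>j. j < d \<Longrightarrow> gsn n (rl b) j > 0" and X: "\<And>j. j < d \<Longrightarrow> gsn n (rl b) j \<le> X"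
    using LB by (auto simp: LB_def)
  have gpos: "gram n b i \<ge> 1" if "i \<le> d" for i using that pos by (intro gram_pos) auto
  have G1: "G \<ge> 1" using gpos[of 0] G[of 0] by simp
  have GY: "G * Y \<ge> 1" using G1 Y(2) mult_mono[of 1 G 1 Y] by simp
  let ?F = "1 + (int n * (G * Y) + 2) * Y"
  have F1: "?F \<ge> 1" using GY Y(2) by simp
  have YF: "Y * ?F ^ i \<le> BB" if "i \<le> d" for i
    using that Y F1 BB by (meson order_trans mult_left_mono power_increasing zero_le_one)
  have YZ: "Y \<le> Z" using YF[of 0] Z by simp
  let ?b = "\<lambda>M'. irow n (M' aB)"
  \<comment> \<open>Size reduction leaves the Gram-Schmidt vectors alone, so \<open>aW\<close> and
    \<open>aD\<close> stay valid and all coefficients can be taken with respect to the initial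
    \<open>b\<close>.\<close>
  let ?I = "\<lambda>k M'. same ?S M M' \<and> M' vE 0 = 0 \<and> (\<forall>i. gs n (rl (?b M')) i = gs n (rl b) i) \<and> lat d (?b M') = lat d b \<and>
    (\<forall>i\<ge>k. ?b M' i = b i) \<and> (\<forall>i<k. \<forall>j<i. \<bar>mu n (rl b) (rl (?b M') i) j\<bar> \<le> 1 / 2) \<and>
    (\<forall>i<d. ip n (?b M' i) (?b M' i) \<le> Y\<^sup>2)"
  have t3: "s \<le> s ^ 3" "s ^ 2 \<le> s ^ 3" "1 \<le> s ^ 3" using s by (auto simp: self_le_power power_increasing)
  have gso: "gso_ok n d M' (?b M')" if "?I k M'" for k M'
    by (rule gso_ok_cong[OF _ g]) (use that in \<open>auto simp: same_def\<close>)
  have mucong: "mu n (rl (?b M')) v j = mu n (rl b) v j" if "?I k M'" for k M' v j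
    using that by (simp add: mu_def gsn_def)
  show ?thesis unfolding sr_c_def
  proof (rule tri_For_le[where N = d and s = s and I = ?I and tb = "18 * s\<^sup>2 + 6 * s + 4"])
    show "?I 0 (upd M vK 0 0)" using M Y b by (auto simp: same_def)
    show "aval M' dX = int d" if "?I k M'" for k M' using that M by (auto simp: same_def)
    show "Q M'" if I: "?I d M'" for M'
    proof (rule Q[of M' "?b M'"])
      show "gso_ok n d M' (?b M')" by (rule gso[OF I])
      show "LB n d b0 X (?b M')" using I LB by (auto simp: LB_def gsn_def)
      show "\<bar>mu n (rl (?b M')) (rl (?b M') k) j\<bar> \<le> 1 / 2" if "k < d" "j < k" for k j
        using I that mucong[OF I] by simp
      show "gram n (?b M') i = gram n b i" for i using I by (intro gram_cong) (simp add: gsn_def)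
    qed (use I in auto)
  next
    fix k M1 assume k: "k < d" and I: "?I k M1" and vk: "M1 vK 0 = int k"
    define c where "c = ?b M1"
    have cb: "\<bar>c i x\<bar> \<le> Y" if "i < d" "x < n" for i x
      using abs_le_of_ip[of n "c i" Y x] I that Y(2) by (simp add: c_def)
    have M1: "M1 0 0 = int n" "M1 0 1 = int d" "M1 vW 0 = 1" "M1 vH 0 = 0" "M1 vE 0 = 0" "M1 aW = M aW" "M1 aD = M aD"
      using I M by (auto simp: same_def)
    have cv: "M1 aB (l * n + j) = c l j" if "j < n" for l j using that by (simp add: c_def irow_def)
    have gc: "gso_ok n d M1 c" using gso[OF I] by (simp add: c_def)
    have gsc: "\<And>i. gs n (rl c) i = gs n (rl b) i" using I by (simp add: c_def)
    then have gsnc: "\<And>i. gsn n (rl c) i = gsn n (rl b) i" by (simp add: gsn_def)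
    have grc: "gram n c i = gram n b i" for i by (rule gram_cong) (rule gsnc)
    have wc: "\<bar>wv n c l l x\<bar> \<le> G * Y" if "l < d" "x < n" for l x
    proof -
      have "\<bar>wv n c l l x\<bar> \<le> gram n c l * Y" using that Y I gsnc pos by (intro wv_bound) (auto simp: c_def)
      also have "\<dots> \<le> G * Y" using G[of l] that Y by (intro mult_right_mono) (auto simp: grc)
      finally show ?thesis .
    qed
    show "tri Z (Seq (vecc aU (Num 0) (Cell aB (ix (var vK))))
      (Seq (np_c (var vK)) (vecc aB (Mul (var vK) nX) (Cell aU (var vJ))))) M1 (18 * s\<^sup>2 + 6 * s + 4)
      (\<lambda>M'. M' vK 0 = int k \<and> ?I (Suc k) (upd M' vK 0 (int (Suc k))))" (is "tri _ _ _ _ ?Q")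
    proof (rule tri_Seq[OF tri_vecc[where n = n and ofs = 0 and val = "c k" and s = s and t = "3 * s + 2"]])
      fix j M' assume "j < n" "same {vJ, aU} M1 M'" "M' vJ 0 = int j"
      then show "aval M' (Cell aB (ix (var vK))) = c k j \<and> aval M' (Num 0) = int 0"
        using M1 vk cv by (simp add: same_def)
    next
      fix M2 assume M2: "same {vJ, aU} M1 M2"
        and U2: "\<And>i. M2 aU i = (if 0 \<le> i \<and> i < 0 + n then c k (i - 0) else M1 aU i)"
      have u2: "irow n (M2 aU) 0 = c k"
        using irow_zero[of n _ "M1 aB" k] by (auto simp: irow_def fun_eq_iff U2 c_def not_less)
      have M2': "M2 0 0 = int n" "M2 vW 0 = 1" "M2 vH 0 = 0" "M2 vE 0 = 0" "M2 aB = M1 aB" "M2 aW = M1 aW" "M2 aD = M1 aD" "M2 vK 0 = int k"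
        using M1 M2 vk by (auto simp: same_def)
      show "tri Z (Seq (np_c (var vK)) (vecc aB (Mul (var vK) nX) (Cell aU (var vJ)))) M2 (18 * s\<^sup>2 + (3 * s + 2)) ?Q"
      proof (rule tri_Seq[OF np_c[where n = n and W = 1 and H = 0 and ?b = c and kk = k and ?u0.0 = "c k" and ?e0.0 = 0
            and A = Y and Ww = "G * Y" and Bb = Y and BB = BB and s = s]])
        show "aval M' (var vK) = int k" if "same {aU, vE, vI, vJ, vL, vp, vq} M2 M'" for M'
          using that M2' by (auto simp: same_def)
        show "gso_ok n k M2 c" using gc k M2' by (auto simp: gso_ok_def)
        show "gram n c l \<ge> 1" if "l \<le> k" for l using gpos[of l] k that by (simp add: grc)
        show "Y * (1 + (int n * (G * Y) + 1 + 1 + 0) * Y) ^ k \<le> BB" using YF[of k] k by (simp add: add.assoc)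
      next
        fix M3 assume M3: "same {aU, vE, vI, vJ, vL, vp, vq} M2 M3" and np3: "(irow n (M3 aU) 0, M3 vE 0) = np n c 1 0 k (c k, 0)"
        define v where "v = fst (np n c 1 0 k (c k, 0))"
        have u3: "M3 aU x = v x" if "x < n" for x
          using arg_cong[OF np3, of fst] that by (auto simp: v_def irow_def fun_eq_iff split: if_splits)
        have e3: "M3 vE 0 = 0" using arg_cong[OF np3, of snd] np_snd[of 1] by simp
        define c' where "c' = c(k := v)"
        have posc: "\<And>j. j < d \<Longrightarrow> gsn n (rl c) j > 0" using pos gsnc by simp
        note st = np_row[OF posc k c'_def[unfolded v_def]]
        \<comment> \<open>The norm bound is restored by \<open>reduced_norm\<close>, since the
          squared Gram-Schmidt norms are at most \<open>X\<close> and \<open>d * X\<close> is at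
          most the square of \<open>Y\<close>.\<close>
        have vn: "ip n v v \<le> Y\<^sup>2"
        proof -
          have gsn': "gsn n (rl c') i = gsn n (rl b) i" for i using st(1) gsnc[of i] by (simp add: gsn_def)
          have mu': "mu n (rl c') w j = mu n (rl c) w j" for w j using st(1) by (simp add: mu_def gsn_def)
          have "ip n (rl c' k) (rl c' k) \<le> real (Suc k) * X"
            by (rule reduced_norm) (use X k gsn' st(3) mu' in auto)
          also have "\<dots> \<le> real d * X" using k X[of k] pos[of k] by (intro mult_right_mono) auto
          also note Y(3)
          finally have "real_of_int (ip n v v) \<le> of_int (Y\<^sup>2)" by (simp add: of_int_ip rl_def c'_def)
          then show ?thesis by linarith
        qed
        have vb: "\<bar>v x\<bar> \<le> Z" if "x < n" for x using abs_le_of_ip[OF vn _ that] Y(2) YZ by linarith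
        show "tri Z (vecc aB (Mul (var vK) nX) (Cell aU (var vJ))) M3 (3 * s + 2) ?Q"
        proof (rule tri_vecc[where n = n and s = s and ofs = "k * n" and val = v])
          fix j M' assume "j < n" "same {vJ, aB} M3 M'" "M' vJ 0 = int j"
          then show "aval M' (Cell aU (var vJ)) = v j \<and> aval M' (Mul (var vK) nX) = int (k * n)"
            using M2' M3 u3 by (simp add: same_def)
        next
          fix M' assume M': "same {vJ, aB} M3 M'"
            and B': "\<And>i. M' aB i = (if k * n \<le> i \<and> i < k * n + n then v (i - k * n) else M3 aB i)"
          have z: "(\<lambda>j. if j < n then v j else 0) = v"
          proof
            fix j
            obtain cc where "v = (\<lambda>x. c k x - lc k cc c x)" using np_lc[of n c 1 0 k "(c k, 0)"] by (auto simp: v_def)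
            moreover have "c l j = 0" if "j \<ge> n" for l using that by (simp add: c_def irow_zero)
            ultimately show "(if j < n then v j else 0) = v j" by (auto simp: lc_def)
          qed
          have "M3 aB = M1 aB" using M3 M2' by (auto simp: same_def)
          then have "?b M' l = c' l" for l using irow_upd[OF B', of l] z by (simp add: c'_def c_def)
          then have b': "?b M' = c'" by (rule ext)
          have "\<bar>mu n (rl b) (rl c' i) j\<bar> \<le> 1 / 2" if "i < Suc k" "j < i" for i j
          proof (cases "i = k")
            case True
            then show ?thesis using st(3)[of j] that gsc by (simp add: mu_def gsn_def)
          next
            case False
            then show ?thesis using I that by (simp add: c'_def c_def rl_def)
          qed
          moreover have "same ?S M M'" using I M2 M3 M' by (auto simp: same_def)
          moreover have "M' vE 0 = 0" "M' vK 0 = int k" using M' e3 M3 M2' by (auto simp: same_def)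
          ultimately show "?Q M'" using b' st gsc I vn by (auto simp: c'_def c_def same_def)
        qed (use M3 M2' Z s k vb in \<open>auto simp: same_def\<close>)
      qed (use M2' c_def u2 cb wc k Z s Y GY in auto)
    qed (use M1 Z s k cb YZ in \<open>auto intro: order_trans\<close>)
  next
    show "s * (18 * s\<^sup>2 + 6 * s + 4 + 2) + 2 \<le> 32 * s ^ 3"
    proof -
      have "s * (18 * s\<^sup>2 + 6 * s + 4 + 2) + 2 = 18 * s ^ 3 + 6 * s\<^sup>2 + 6 * s + 2"
        by (simp add: power2_eq_square power3_eq_cube algebra_simps)
      then show ?thesis using t3 by linarith
    qed
  qed (use Z s in auto)
qed

lemma scan_c:
  assumes M: "M 0 1 = int d" and Z: "int d \<le> Z" "0 \<le> Z" and s: "d \<le> s" "s \<ge> 1"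
    and Q: "\<And>M'. same {vI, vPos} M M' \<Longrightarrow>
      (M' vPos 0 = 0 \<and> (\<forall>k. Suc k < d \<longrightarrow> \<not> 2 * M aD (Suc (Suc k)) * M aD k < (M aD (Suc k))\<^sup>2)) \<or>
      (\<exists>k. M' vPos 0 = int (Suc k) \<and> Suc k < d \<and> 2 * M aD (Suc (Suc k)) * M aD k < (M aD (Suc k))\<^sup>2) \<Longrightarrow> Q M'"
  shows "tri Z scan_c M (7 * s) Q"
  unfolding scan_c_def
proof (rule tri_Seq[OF tri_Store[where t = 0]])
  let ?P = "\<lambda>k. 2 * M aD (Suc (Suc k)) * M aD k < (M aD (Suc k))\<^sup>2"
  let ?I = "\<lambda>i M'. same {vI, vPos} M M' \<and> ((M' vPos 0 = 0 \<and> (\<forall>k. Suc k < i \<longrightarrow> \<not> ?P k)) \<or>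
     (\<exists>k. M' vPos 0 = int (Suc k) \<and> Suc k < d \<and> ?P k))"
  let ?M1 = "upd M vPos (nat (aval M (Num 0))) (aval M (Num 0))"
  show "tri Z (For vI dX (If (And (Less (Num 0) (var vI)) (Less (Mul (Mul (Num 2) (Cell aD (Add (var vI) (Num 1)))) (Cell aD (Sub (var vI) (Num 1))))
        (Mul (Cell aD (var vI)) (Cell aD (var vI)))))
      (set_var vPos (var vI)) Skip)) ?M1 (s * (2 + 2) + 2) Q"
  proof (rule tri_For_le[where N = d and s = s and I = ?I and tb = 2])
    fix i M' assume i: "i < d" and I: "?I i M'" and vi: "M' vI 0 = int i"
    have D: "M' aD = M aD" using I by (auto simp: same_def)
    show "tri Z (If (And (Less (Num 0) (var vI)) (Less (Mul (Mul (Num 2) (Cell aD (Add (var vI) (Num 1)))) (Cell aD (Sub (var vI) (Num 1))))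
        (Mul (Cell aD (var vI)) (Cell aD (var vI)))))
      (set_var vPos (var vI)) Skip) M' 2 (\<lambda>M'. M' vI 0 = int i \<and> ?I (Suc i) (upd M' vI 0 (int (Suc i))))"
    proof (rule tri_If[where t = "Suc 0"])
      assume c: "bval M' (And (Less (Num 0) (var vI)) (Less (Mul (Mul (Num 2) (Cell aD (Add (var vI) (Num 1)))) (Cell aD (Sub (var vI) (Num 1))))
        (Mul (Cell aD (var vI)) (Cell aD (var vI)))))"
      then obtain k where k: "i = Suc k" using vi by (cases i) auto
      have "nat (int (Suc k) - 1) = k" "nat (2 + int k) = Suc (Suc k)" by simp_all
      then have "?P k" using c vi k D by (simp add: power2_eq_square)
      then show "tri Z (set_var vPos (var vI)) M' (Suc 0) (\<lambda>M'. M' vI 0 = int i \<and> ?I (Suc i) (upd M' vI 0 (int (Suc i))))"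
        using I vi i k Z by (intro tri_Store) (auto simp: same_def)
    next
      assume c: "\<not> bval M' (And (Less (Num 0) (var vI)) (Less (Mul (Mul (Num 2) (Cell aD (Add (var vI) (Num 1)))) (Cell aD (Sub (var vI) (Num 1))))
        (Mul (Cell aD (var vI)) (Cell aD (var vI)))))"
      have "\<not> ?P k" if "i = Suc k" for k
      proof -
        have "nat (int (Suc k) - 1) = k" "nat (2 + int k) = Suc (Suc k)" by simp_all
        then show ?thesis using c vi that D by (simp add: power2_eq_square)
      qed
      then have "?I (Suc i) (upd M' vI 0 (int (Suc i)))" using I by (auto simp: same_def less_Suc_eq)
      then show "tri Z Skip M' (Suc 0) (\<lambda>M'. M' vI 0 = int i \<and> ?I (Suc i) (upd M' vI 0 (int (Suc i))))"
        using vi by (intro tri_Skip) auto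
    qed simp
  qed (use M Z s Q in \<open>auto simp: same_def\<close>)
qed (use Z s in auto)

lemma swap_c:
  assumes M: "M 0 0 = int n" "M vPos 0 = int (Suc k)" and b: "b = irow n (M aB)"
    and bb: "\<And>i x. i \<le> Suc k \<Longrightarrow> x < n \<Longrightarrow> \<bar>b i x\<bar> \<le> Z" and Z: "int n \<le> Z" and s: "n \<le> s"
    and Q: "\<And>M'. same {aU, aB, vJ} M M' \<Longrightarrow> irow n (M' aB) = b(k := b (Suc k), Suc k := b k) \<Longrightarrow> Q M'"
  shows "tri Z swap_c M (9 * s + 6) Q"
proof -
  have bv: "M aB (l * n + j) = b l j" if "j < n" for l j using that by (simp add: b irow_def)
  have na [simp]: "nat (int k * int n + int j) = k * n + j" "nat ((1 + int k) * int n + int j) = Suc k * n + j" for j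
    using nat_addr(1)[of k n j] nat_addr(1)[of "Suc k" n j] by (simp_all del: nat_addr)
  show ?thesis unfolding swap_c_def
  proof (rule tri_Seq[OF tri_vecc[where n = n and ofs = 0 and val = "b k" and s = s and t = "3 * s + 2"]])
    fix j M' assume "j < n" "same {vJ, aU} M M'" "M' vJ 0 = int j"
    then show "aval M' (Cell aB (ix (Sub (var vPos) (Num 1)))) = b k j \<and> aval M' (Num 0) = int 0"
      using M bv[of j k] by (simp add: same_def)
  next
    fix M1 assume M1: "same {vJ, aU} M M1" and U1: "\<And>i. M1 aU i = (if 0 \<le> i \<and> i < 0 + n then b k (i - 0) else M aU i)"
    show "tri Z (Seq (vecc aB (Mul (Sub (var vPos) (Num 1)) nX) (Cell aB (ix (var vPos))))
      (vecc aB (Mul (var vPos) nX) (Cell aU (var vJ)))) M1 (6 * s + 4) Q"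
    proof (rule tri_Seq[OF tri_vecc[where n = n and ofs = "k * n" and val = "b (Suc k)" and s = s and t = "3 * s + 2"]])
      fix j M' assume j: "j < n" "same {vJ, aB} M1 M'" "M' vJ 0 = int j"
        and un: "\<forall>i. \<not> (k * n \<le> i \<and> i < k * n + j) \<longrightarrow> M' aB i = M1 aB i"
      have "M1 aB = M aB" using M1 by (auto simp: same_def)
      then have "M' aB (Suc k * n + j) = b (Suc k) j" using un j bv[of j "Suc k"] by simp
      then show "aval M' (Cell aB (ix (var vPos))) = b (Suc k) j \<and> aval M' (Mul (Sub (var vPos) (Num 1)) nX) = int (k * n)"
        using M M1 j by (simp add: same_def)
    next
      fix M2 assume M2: "same {vJ, aB} M1 M2"
        and B2: "\<And>i. M2 aB i = (if k * n \<le> i \<and> i < k * n + n then b (Suc k) (i - k * n) else M1 aB i)"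
      show "tri Z (vecc aB (Mul (var vPos) nX) (Cell aU (var vJ))) M2 (3 * s + 2) Q"
      proof (rule tri_vecc[where n = n and ofs = "Suc k * n" and val = "b k" and s = s])
        fix j M' assume "j < n" "same {vJ, aB} M2 M'" "M' vJ 0 = int j"
        then show "aval M' (Cell aU (var vJ)) = b k j \<and> aval M' (Mul (var vPos) nX) = int (Suc k * n)"
          using M M1 M2 U1 by (simp add: same_def algebra_simps)
      next
        fix M3 assume M3: "same {vJ, aB} M2 M3"
          and B3: "\<And>i. M3 aB i = (if Suc k * n \<le> i \<and> i < Suc k * n + n then b k (i - Suc k * n) else M2 aB i)"
        have z: "(\<lambda>j. if j < n then b l j else 0) = b l" for l by (auto simp: b irow_def)
        have "M1 aB = M aB" using M1 by (auto simp: same_def)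
        then have "irow n (M3 aB) l = (b(k := b (Suc k), Suc k := b k)) l" for l
          using irow_upd[OF B3, of l] irow_upd[OF B2, of l] z by (simp add: b)
        then have "irow n (M3 aB) = b(k := b (Suc k), Suc k := b k)" by (rule ext)
        moreover have "same {aU, aB, vJ} M M3" using M1 M2 M3 by (auto simp: same_def)
        ultimately show "Q M3" using Q by blast
      qed (use M M1 M2 Z s bb in \<open>auto simp: same_def\<close>)
    qed (use M M1 Z s bb in \<open>auto simp: same_def\<close>)
  qed (use M Z s bb in \<open>auto simp: same_def\<close>)
qed

section \<open>Termination of the basis reduction\<close>

lemma gram_le:
  assumes "\<And>j. j < d \<Longrightarrow> 0 < gsn n (rl b) j \<and> gsn n (rl b) j \<le> X" "X \<ge> 1" "X ^ d \<le> of_int G" "i \<le> d"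
  shows "gram n b i \<le> G"
proof -
  have "real_of_int (gram n b i) \<le> (\<Prod>j<i. X)" unfolding gram_eq
    using assms(1,4) by (intro prod_mono) (auto simp: less_imp_le)
  also have "\<dots> \<le> X ^ d" using assms(2,4) by (simp add: power_increasing)
  finally show ?thesis using assms(3) by linarith
qed

definition lll_reduced :: "nat \<Rightarrow> nat \<Rightarrow> (nat \<Rightarrow> nat \<Rightarrow> int) \<Rightarrow> bool" where
  "lll_reduced n d b \<longleftrightarrow> (\<forall>i. Suc i < d \<longrightarrow> gsn n (rl b) i \<le> 2 * gsn n (rl b) (Suc i))"

text \<open>The LLL potential: a positive integer for independent vectors, and a swap changes only
  one of its factors.\<close>

definition pot :: "nat \<Rightarrow> nat \<Rightarrow> (nat \<Rightarrow> nat \<Rightarrow> int) \<Rightarrow> int" where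
  "pot n d b = (\<Prod>i\<le>d. gram n b i)"

text \<open>\<open>N\<close> bounds the swaps still possible: each one multiplies the potential by
  at most 3/4 while it remains a positive integer, so the inequality
  \<open>pot n d b * 3 ^ N \<le> 4 ^ N\<close> passes from \<open>N\<close> to
  \<open>N - 1\<close>.\<close>

lemma lll_c:
  assumes M: "M 0 0 = int n" "M 0 1 = int d" "M aD 0 = 1" "M vW 0 = 1" "M vH 0 = 0" "M vE 0 = 0"
    and b0: "b0 = irow n (M aB)" and LB0: "LB n d b0 X b0"
    and Y: "\<And>i. i < d \<Longrightarrow> ip n (b0 i) (b0 i) \<le> Y\<^sup>2" "Y \<ge> 1" "real d * X \<le> (of_int Y)\<^sup>2"
    and X: "X \<ge> 1" "X ^ d \<le> of_int G"
    and BB: "Y * (1 + (int n * (G * Y) + 2) * Y) ^ d \<le> BB"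
    and Z: "int n * BB * (G * Y) + 2 \<le> Z" "BB \<le> Z" "int n \<le> Z" "int d \<le> Z" "int n * Y * (G * Y) \<le> Z" "G * Y \<le> Z" "1 \<le> Z"
    and s: "n \<le> s" "d \<le> s" "s \<ge> 1"
    and pot0: "pot n d b0 * 3 ^ N \<le> 4 ^ N"
    and Q: "\<And>M' b'. same {aB, aW, aD, aU, vE, vI, vJ, vK, vL, vp, vq, vPos} M M' \<Longrightarrow> M' vE 0 = 0 \<Longrightarrow> b' = irow n (M' aB) \<Longrightarrow>
      gso_ok n d M' b' \<Longrightarrow> LB n d b0 X b' \<Longrightarrow> lll_reduced n d b' \<Longrightarrow>
      (\<And>i. i < d \<Longrightarrow> ip n (b' i) (b' i) \<le> Y\<^sup>2) \<Longrightarrow> Q M'"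
  shows "tri Z lll_c M ((N + 1) * (86 * s ^ 3 + 1) + 2) Q"
proof -
  let ?S = "{aB, aW, aD, aU, vE, vI, vJ, vK, vL, vp, vq, vPos}"
  let ?b = "\<lambda>M'. irow n (M' aB)"
  let ?body = "Seq gso_c (Seq sr_c (Seq scan_c (If (Less (Num 0) (var vPos)) swap_c Skip)))"
  define J where "J N M' \<longleftrightarrow> same ?S M M' \<and> M' vPos 0 \<ge> 1 \<and> M' vE 0 = 0 \<and> M' aD 0 = 1 \<and> LB n d b0 X (?b M') \<and>
    (\<forall>i<d. ip n (?b M' i) (?b M' i) \<le> Y\<^sup>2) \<and> pot n d (?b M') * 3 ^ N \<le> 4 ^ N" for N M'
  define Fin where "Fin M' \<longleftrightarrow> M' vPos 0 = 0 \<and> Q M'" for M'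
  have t3: "s \<le> s ^ 3" "s ^ 2 \<le> s ^ 3" "1 \<le> s ^ 3" using s by (auto simp: self_le_power power_increasing)
  have body: "tri Z ?body M1 (86 * s ^ 3) (\<lambda>M'. Fin M' \<or> (\<exists>N'. N = Suc N' \<and> J N' M'))" if J: "J N M1" for N M1
  proof -
    let ?Q = "\<lambda>M'. Fin M' \<or> (\<exists>N'. N = Suc N' \<and> J N' M')"
    define b where "b = ?b M1"
    have M1: "M1 0 0 = int n" "M1 0 1 = int d" "M1 aD 0 = 1" "M1 vW 0 = 1" "M1 vH 0 = 0" "M1 vE 0 = 0"
      using J M by (auto simp: J_def same_def)
    have LB: "LB n d b0 X b" and Yb: "\<And>i. i < d \<Longrightarrow> ip n (b i) (b i) \<le> Y\<^sup>2" using J by (auto simp: J_def b_def)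
    have pos: "\<And>j. j < d \<Longrightarrow> 0 < gsn n (rl b) j \<and> gsn n (rl b) j \<le> X" using LB by (auto simp: LB_def)
    have G: "gram n b i \<le> G" if "i \<le> d" for i using gram_le[OF pos X that] by simp
    have YZ: "Y \<le> Z"
    proof -
      have "gram n b 0 \<le> G" by (rule G) simp
      then have "1 * Y \<le> G * Y" using Y(2) by (intro mult_right_mono) auto
      then show ?thesis using Z(6) by simp
    qed
    show ?thesis
    proof (rule tri_Seq[OF gso_c[where n = n and d = d and ?b = b and Y = Y and G = G and s = s]])
      fix M2 assume M2: "same {aW, aD, vI, vJ, vK, vp} M1 M2" and g2: "gso_ok n d M2 b"
      show "tri Z (Seq sr_c (Seq scan_c (If (Less (Num 0) (var vPos)) swap_c Skip))) M2 (55 * s ^ 3) ?Q"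
      proof (rule tri_Seq[OF sr_c[where n = n and d = d and ?b = b and ?b0.0 = b0 and X = X and Y = Y and G = G and BB = BB and s = s]])
        fix M3 c assume M3: "same {aU, aB, vE, vI, vJ, vK, vL, vp, vq} M2 M3" and e3: "M3 vE 0 = 0" and c: "c = irow n (M3 aB)"
          and g3: "gso_ok n d M3 c" and LB3: "LB n d b0 X c"
          and red: "\<And>k j. k < d \<Longrightarrow> j < k \<Longrightarrow> \<bar>mu n (rl c) (rl c k) j\<bar> \<le> 1 / 2"
          and Yc: "\<And>i. i < d \<Longrightarrow> ip n (c i) (c i) \<le> Y\<^sup>2" and gr: "\<And>i. gram n c i = gram n b i"
        have posc: "\<And>j. j < d \<Longrightarrow> 0 < gsn n (rl c) j \<and> gsn n (rl c) j \<le> X" using LB3 by (auto simp: LB_def)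
        have gpos: "gram n c i \<ge> 1" if "i \<le> d" for i using that posc by (intro gram_pos) auto
        have S13: "same ?S M M3" using J M2 M3 by (auto simp: J_def same_def)
        have D3: "M3 aD i = gram n c i" if "i \<le> d" for i using g3 that by (auto simp: gso_ok_def)
        show "tri Z (Seq scan_c (If (Less (Num 0) (var vPos)) swap_c Skip)) M3 (23 * s ^ 3) ?Q"
        proof (rule tri_Seq[OF scan_c[where d = d and s = s]])
          fix M4 assume M4: "same {vI, vPos} M3 M4" and alt: "(M4 vPos 0 = 0 \<and> (\<forall>k. Suc k < d \<longrightarrow> \<not> 2 * M3 aD (Suc (Suc k)) * M3 aD k < (M3 aD (Suc k))\<^sup>2)) \<or>
      (\<exists>k. M4 vPos 0 = int (Suc k) \<and> Suc k < d \<and> 2 * M3 aD (Suc (Suc k)) * M3 aD k < (M3 aD (Suc k))\<^sup>2)"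
          have S14: "same ?S M M4" using S13 M4 by (auto simp: same_def)
          have M4': "M4 0 0 = int n" "M4 vE 0 = 0" "M4 aB = M3 aB" "M4 aD = M3 aD" "M4 aW = M3 aW"
            using S14 M M4 e3 by (auto simp: same_def)
          from alt show "tri Z (If (Less (Num 0) (var vPos)) swap_c Skip) M4 (9 * s + 7) ?Q"
          proof (elim disjE exE conjE)
            assume p0: "M4 vPos 0 = 0" and nl: "\<forall>k. Suc k < d \<longrightarrow> \<not> 2 * M3 aD (Suc (Suc k)) * M3 aD k < (M3 aD (Suc k))\<^sup>2"
            have "lll_reduced n d c" unfolding lll_reduced_def
            proof (intro allI impI)
              fix i assume i: "Suc i < d"
              then have "(gram n c (Suc i))\<^sup>2 \<le> 2 * gram n c (Suc (Suc i)) * gram n c i" using nl D3 by auto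
              then have "real_of_int ((gram n c (Suc i))\<^sup>2) \<le> of_int (2 * gram n c (Suc (Suc i)) * gram n c i)"
                by (simp only: of_int_le_iff)
              then have "gsn n (rl c) i * (gsn n (rl c) i * (of_int (gram n c i))\<^sup>2) \<le> 2 * gsn n (rl c) (Suc i) * (gsn n (rl c) i * (of_int (gram n c i))\<^sup>2)"
                by (simp add: gram_Suc power2_eq_square algebra_simps)
              moreover have "gsn n (rl c) i * (of_int (gram n c i))\<^sup>2 > 0" using posc[of i] gpos[of i] i by simp
              ultimately show "gsn n (rl c) i \<le> 2 * gsn n (rl c) (Suc i)" using mult_right_le_imp_le by blast
            qed
            then have "Q M4" using Q[OF S14 M4'(2), of c] M4' c g3 LB3 Yc by (simp add: gso_ok_def)
            then have "Fin M4" using p0 by (simp add: Fin_def)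
            then show ?thesis using p0 by (intro tri_If[where t = "Suc 0"] tri_Skip) auto
          next
            fix k assume p: "M4 vPos 0 = int (Suc k)" and k: "Suc k < d" and lov: "2 * M3 aD (Suc (Suc k)) * M3 aD k < (M3 aD (Suc k))\<^sup>2"
            define c' where "c' = c(k := c (Suc k), Suc k := c k)"
            have lov': "2 * gram n c (Suc (Suc k)) * gram n c k < (gram n c (Suc k))\<^sup>2" using lov D3 k by simp
            note sw = swap_gsn[OF conjunct1[OF posc] k c'_def red[OF k lessI] lov' conjunct2[OF posc]]
            have potc: "4 * pot n d c' \<le> 3 * pot n d c"
            proof -
              have "pot n d c' = gram n c' (Suc k) * (\<Prod>i\<in>{..d} - {Suc k}. gram n c' i)"
                unfolding pot_def using k by (intro prod.remove) auto
              also have "(\<Prod>i\<in>{..d} - {Suc k}. gram n c' i) = (\<Prod>i\<in>{..d} - {Suc k}. gram n c i)"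
                by (intro prod.cong gram_swap[OF _ c'_def]) auto
              finally have p': "pot n d c' = gram n c' (Suc k) * (\<Prod>i\<in>{..d} - {Suc k}. gram n c i)" .
              have p: "pot n d c = gram n c (Suc k) * (\<Prod>i\<in>{..d} - {Suc k}. gram n c i)"
                unfolding pot_def using k by (intro prod.remove) auto
              have "0 \<le> (\<Prod>i\<in>{..d} - {Suc k}. gram n c i)" using gpos by (intro prod_nonneg) force
              then show ?thesis unfolding p p' using mult_right_mono[OF sw(2)] by (simp add: mult.assoc)
            qed
            have "pot n d c' > 0"
            proof -
              have "gram n c' i \<ge> 1" if "i \<le> d" for i using sw(1) that by (intro gram_pos) auto
              then show ?thesis unfolding pot_def by (intro prod_pos) force
            qed
            have potb: "pot n d c = pot n d b" by (simp add: pot_def gr)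
            have potN: "pot n d c * 3 ^ N \<le> 4 ^ N" using J potb by (simp add: J_def b_def)
            \<comment> \<open>With \<open>N = 0\<close> the potential would be at most 1 before the
              swap and at most 3/4 after it, yet it is a positive integer.\<close>
            obtain N' where N': "N = Suc N'"
            proof (cases N)
              case 0
              then show ?thesis using potN potc \<open>pot n d c' > 0\<close> by simp
            qed
            have "4 * pot n d c' * 3 ^ N' \<le> 3 * pot n d c * 3 ^ N'" using potc by (intro mult_right_mono) auto
            also have "\<dots> \<le> 4 * 4 ^ N'" using potN N' by (simp add: algebra_simps)
            finally have pot': "pot n d c' * 3 ^ N' \<le> 4 ^ N'" by simp
            have "tri Z swap_c M4 (9 * s + 6) ?Q"
            proof (rule swap_c[where n = n and k = k and ?b = c])
              show "\<bar>c i x\<bar> \<le> Z" if "i \<le> Suc k" "x < n" for i x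
                using abs_le_of_ip[OF Yc[of i] _ that(2)] that k Y(2) YZ by simp
            next
              fix M5 assume M5: "same {aU, aB, vJ} M4 M5" and b5: "irow n (M5 aB) = c(k := c (Suc k), Suc k := c k)"
              have b5': "?b M5 = c'" using b5 by (simp add: c'_def)
              have "LB n d b0 X c'" using LB3 sw(1) lat_swap[OF k c'_def] k by (auto simp: LB_def c'_def)
              moreover have "\<forall>i<d. ip n (c' i) (c' i) \<le> Y\<^sup>2" using Yc k by (auto simp: c'_def)
              moreover have "M5 aD 0 = 1" "M5 vE 0 = 0" "M5 vPos 0 \<ge> 1" using M5 M4' D3[of 0] p by (auto simp: same_def)
              moreover have "same ?S M M5" using S14 M5 by (auto simp: same_def)
              ultimately have "J N' M5" using pot' by (simp add: J_def b5')
              then show "?Q M5" using N' by blast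
            qed (use M4' c p Z s in auto)
            then show ?thesis using p by (intro tri_If[where t = "9 * s + 6"]) auto
          qed
        next
          show "7 * s + (9 * s + 7) \<le> 23 * s ^ 3" using t3 by linarith
        qed (use S13 M Z s in \<open>auto simp: same_def\<close>)
      next
        show "b = irow n (M2 aB)" using M2 by (simp add: b_def same_def)
      qed (use M1 M2 g2 LB Yb Y G BB Z s in \<open>auto simp: same_def\<close>)
    qed (use M1 b_def pos Yb Y G Z s in \<open>auto\<close>)
  qed
  have loop: "tri Z (While (Less (Num 0) (var vPos)) ?body) M1 ((N + 1) * (86 * s ^ 3 + 1) + 1) Q" if "J N M1" for N M1
    using that
  proof (induction N arbitrary: M1 rule: less_induct)
    case (less N)
    show ?case
    proof (rule tri_WhileT[OF _ tri_mono[OF body[OF less(2)] order_refl]])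
      show "bval M1 (Less (Num 0) (var vPos))" using less(2) by (simp add: J_def)
      fix M' assume "Fin M' \<or> (\<exists>N'. N = Suc N' \<and> J N' M')"
      then show "tri Z (While (Less (Num 0) (var vPos)) ?body) M' (N * (86 * s ^ 3 + 1) + 1) Q"
      proof (elim disjE exE conjE)
        assume "Fin M'"
        then have "tri Z (While (Less (Num 0) (var vPos)) ?body) M' (Suc 0) Q"
          by (intro tri_WhileF) (auto simp: Fin_def)
        then show ?thesis by (rule tri_mono) auto
      next
        fix N' assume "N = Suc N'" "J N' M'"
        then show ?thesis using less(1)[of N' M'] by simp
      qed
    qed simp
  qed
  show ?thesis unfolding lll_c_def
  proof (rule tri_Seq[OF tri_Store[where t = 0] ])
    show "tri Z (While (Less (Num 0) (var vPos)) ?body) (upd M vPos (nat (aval M (Num 0))) (aval M (Num 1))) ((N + 1) * (86 * s ^ 3 + 1) + 1) Q"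
      by (rule loop) (use M b0 LB0 Y pot0 in \<open>auto simp: J_def same_def\<close>)
  qed (use Z Y in auto)
qed

section \<open>Programs for closest vectors\<close>

text \<open>Whatever \<open>aX\<close> contains, subtracting from it the nearest plane residue of
  the target plus \<open>aX\<close> gives a vector of the coset \<open>L - t\<close>. So a sample
  need not be tested for being useful: a bad one merely yields another candidate.\<close>

definition try_c :: com where
  "try_c = Seq (vecc aU (Num 0) (Add (Cell aB (ix dX)) (Cell aX (var vJ))))
    (Seq (np_c dX) (Seq (vecc aC (Num 0) (Sub (Cell aX (var vJ)) (Cell aU (var vJ))))
    (Seq (sumc (Mul (Cell aC (var vJ)) (Cell aC (var vJ))))
      (If (Less (var vp) (var vNrm))
        (Seq (vecc aBest (Num 0) (Cell aC (var vJ))) (set_var vNrm (var vp))) Skip))))"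

definition enum_c :: com where
  "enum_c = For vG (var vN) (Seq (set_var vE (var vG)) try_c)"

abbreviation (input) ans :: aexp where
  "ans \<equiv> Cell answer_array (Mul (Num 2) (Add (Mul (var vK) (Add nX (Num 1))) (var vJ)))"

text \<open>Only numerators are read, as the useful samples are integral in their first
  \<open>n\<close> coordinates. Entries beyond \<open>2 * S\<close> become 0; comparing them with a
  short number is cheap even if they are huge.\<close>

definition clamp_c :: com where
  "clamp_c = For vJ nX (If (And (Less ans (Add (Mul (Num 2) (var vS)) (Num 1)))
      (Less (Sub (Num (- 1)) (Mul (Num 2) (var vS))) ans))
    (Store aX ix0 ans) (Store aX ix0 (Num 0)))"

definition samples_c :: com where
  "samples_c = For vK (var vM) (Seq clamp_c try_c)"

text \<open>The search starts from the lattice vector 0, which is \<open>- t\<close> in the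
  coset.\<close>

definition initbest_c :: com where
  "initbest_c = Seq (vecc aBest (Num 0) (Sub (Num 0) (Cell aB (ix dX))))
    (Seq (sumc (Mul (Cell aBest (var vJ)) (Cell aBest (var vJ)))) (set_var vNrm (var vp)))"

definition clamp :: "int \<Rightarrow> int \<Rightarrow> int" where
  "clamp S v = (if \<bar>v\<bar> \<le> 2 * S then v else 0)"

lemma np_bound:
  assumes "\<And>x. x < n \<Longrightarrow> \<bar>fst s x\<bar> \<le> A" "A \<ge> 1"
    and "\<And>l x. l < K \<Longrightarrow> x < n \<Longrightarrow> \<bar>wv n b l l x\<bar> \<le> Ww" "Ww \<ge> 0"
    and "\<And>l x. l < K \<Longrightarrow> x < n \<Longrightarrow> \<bar>b l x\<bar> \<le> Bb" "Bb \<ge> 0"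
    and "\<And>l. l \<le> K \<Longrightarrow> gram n b l \<ge> 1" and WH: "H \<ge> 0" "W \<ge> 1" and x: "x < n"
  shows "\<bar>fst (np n b W H K s) x\<bar> \<le> A * (1 + (int n * Ww + 1 + W + H) * Bb) ^ K"
  using assms(1-7)
proof (induction K arbitrary: s A)
  case 0
  then show ?case using x by simp
next
  case (Suc l)
  let ?F = "1 + (int n * Ww + 1 + W + H) * Bb"
  have F: "1 \<le> ?F" using Suc WH by simp
  have "\<bar>fst (np n b W H l (np_step n b W H l s)) x\<bar> \<le> (A * ?F) * ?F ^ l"
  proof (rule Suc.IH)
    show "\<bar>fst (np_step n b W H l s) x\<bar> \<le> A * ?F" if "x < n" for x
      using Suc WH that by (intro np_step_bound) auto
    show "1 \<le> A * ?F" using F Suc(3) mult_mono[of 1 A 1 ?F] by simp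
  qed (use Suc in auto)
  then show ?case by (simp add: mult.assoc)
qed

text \<open>A basis with the target in row \<open>d\<close>, and bounds for everything computed from
  it: \<open>Ww\<close> for the scaled Gram-Schmidt vectors, \<open>Bb\<close> for the basis,
  \<open>Tb\<close> for the target, \<open>Xb\<close> for clamped samples, \<open>F\<close> for the
  growth in one nearest plane step, \<open>BB\<close> for residues and \<open>Cb\<close> for
  candidates.\<close>

locale reduced =
  fixes n d s :: nat and b :: "nat \<Rightarrow> nat \<Rightarrow> int" and Ww Bb Tb Xb Wm Hm F BB Cb Z :: int
  assumes zero: "\<And>l x. x \<ge> n \<Longrightarrow> b l x = 0"
    and pos: "\<And>j. j < d \<Longrightarrow> gsn n (rl b) j > 0"
    and Ww: "\<And>l x. l < d \<Longrightarrow> x < n \<Longrightarrow> \<bar>wv n b l l x\<bar> \<le> Ww" "Ww \<ge> 0"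
    and Bb: "\<And>l x. l < d \<Longrightarrow> x < n \<Longrightarrow> \<bar>b l x\<bar> \<le> Bb" "Bb \<ge> 0"
    and Tb: "\<And>x. x < n \<Longrightarrow> \<bar>b d x\<bar> \<le> Tb" "Tb \<ge> 0"
    and Xb: "Xb \<ge> 0" and WmHm: "Wm \<ge> 1" "Hm \<ge> 0"
    and F: "F = 1 + (int n * Ww + 1 + Wm + Hm) * Bb"
    and BB: "(Tb + Xb + 1) * F ^ d \<le> BB" and Cb: "Xb + BB \<le> Cb"
    and Z: "int n * BB * Ww + 1 + Wm + Hm \<le> Z" "int n * Cb * Cb \<le> Z" "Cb \<le> Z" "int n \<le> Z" "int d \<le> Z" "1 \<le> Z"
    and s: "n \<le> s" "d \<le> s" "s \<ge> 1"
begin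

lemma gpos: "l \<le> d \<Longrightarrow> gram n b l \<ge> 1"
  using pos by (intro gram_pos) auto

lemma F1: "F \<ge> 1" using Ww(2) Bb(2) WmHm by (simp add: F)

lemma BBge: "Tb + Xb + 1 \<le> BB"
proof -
  have "(Tb + Xb + 1) * 1 \<le> (Tb + Xb + 1) * F ^ d" using F1 Tb(2) Xb by (intro mult_left_mono) auto
  then show ?thesis using BB by simp
qed

lemma Tb_le: "Tb \<le> Cb" "Tb \<le> Z" "Xb \<le> Cb" "Xb \<le> Z" "0 \<le> Cb" "BB \<le> Z"
  using BBge Cb Z Xb Tb(2) by linarith+

definition Base :: "memory \<Rightarrow> bool" where
  "Base M \<longleftrightarrow> M 0 0 = int n \<and> M 0 1 = int d \<and> irow n (M aB) = b \<and> gso_ok n d M b"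

definition Best :: "memory \<Rightarrow> bool" where
  "Best M \<longleftrightarrow> M vNrm 0 = ip n (irow n (M aBest) 0) (irow n (M aBest) 0) \<and>
    (\<lambda>x. irow n (M aBest) 0 x + b d x) \<in> lat d b \<and> (\<forall>x<n. \<bar>M aBest x\<bar> \<le> Cb)"

definition cand :: "int \<Rightarrow> int \<Rightarrow> (nat \<Rightarrow> int) \<Rightarrow> int \<Rightarrow> nat \<Rightarrow> int" where
  "cand W H y e = (\<lambda>x. y x - fst (np n b W H d (\<lambda>x. b d x + y x, e)) x)"

lemma Base_same: "Base M \<Longrightarrow> same S M M' \<Longrightarrow> {0, aB, aW, aD} \<inter> S = {} \<Longrightarrow> Base M'"
  by (simp add: Base_def same_def gso_ok_def)

lemma Best_same: "Best M \<Longrightarrow> same S M M' \<Longrightarrow> {vNrm, aBest} \<inter> S = {} \<Longrightarrow> Best M'"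
  by (simp add: Best_def same_def)

lemma cand_lat: "(\<lambda>x. cand W H y e x + b d x) \<in> lat d b"
proof -
  obtain c where "fst (np n b W H d (\<lambda>x. b d x + y x, e)) = (\<lambda>x. b d x + y x - lc d c b x)"
    using np_lc[of n b W H d "(\<lambda>x. b d x + y x, e)"] by auto
  then have "(\<lambda>x. cand W H y e x + b d x) = lc d c b" by (simp add: cand_def)
  then show ?thesis by (simp add: lat_def)
qed

lemma base_nth: "Base M \<Longrightarrow> j < n \<Longrightarrow> M aB (l * n + j) = b l j"
  using irow_same[of j n "M aB" l] by (simp add: Base_def)

lemma try_c:
  assumes M: "Base M" "Best M" "M vW 0 = W" "M vH 0 = H" "1 \<le> W" "W \<le> Wm" "0 \<le> H" "H \<le> Hm"
    "0 \<le> M vE 0" "M vE 0 \<le> Z" "\<And>x. x < n \<Longrightarrow> \<bar>M aX x\<bar> \<le> Xb"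
    and Q: "\<And>M'. same {aU, aC, aBest, vNrm, vE, vI, vJ, vL, vp, vq} M M' \<Longrightarrow> Base M' \<Longrightarrow> Best M' \<Longrightarrow>
       M' vE 0 = snd (np n b W H d (\<lambda>x. b d x + irow n (M aX) 0 x, M vE 0)) \<Longrightarrow> M' vNrm 0 \<le> M vNrm 0 \<Longrightarrow>
       M' vNrm 0 \<le> ip n (cand W H (irow n (M aX) 0) (M vE 0)) (cand W H (irow n (M aX) 0) (M vE 0)) \<Longrightarrow> Q M'"
  shows "tri Z try_c M (42 * s\<^sup>2) Q"
proof -
  define y where "y = irow n (M aX) 0"
  define u0 where "u0 = (\<lambda>x. b d x + y x)"
  define res where "res = fst (np n b W H d (u0, M vE 0))"
  define c where "c = cand W H y (M vE 0)"
  have c: "c = (\<lambda>x. y x - res x)" by (simp add: c_def cand_def res_def u0_def)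
  have y: "\<bar>y x\<bar> \<le> Xb" for x using M(11)[of x] Xb by (simp add: y_def irow_def)
  have u0: "\<bar>u0 x\<bar> \<le> Tb + Xb + 1" if "x < n" for x using Tb(1)[OF that] y[of x] by (simp add: u0_def)
  have WF: "1 + (int n * Ww + 1 + W + H) * Bb \<le> F" unfolding F
    using M Bb(2) by (intro add_left_mono mult_right_mono) auto
  have W1: "1 \<le> 1 + (int n * Ww + 1 + W + H) * Bb" using M Ww(2) Bb(2) by simp
  have BB': "(Tb + Xb + 1) * (1 + (int n * Ww + 1 + W + H) * Bb) ^ d \<le> BB"
    using BB Tb(2) Xb WF W1 by (meson order_trans mult_left_mono power_mono add_nonneg_nonneg zero_le_one)
  have res: "\<bar>res x\<bar> \<le> BB" if "x < n" for x
  proof -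
    have "\<bar>res x\<bar> \<le> (Tb + Xb + 1) * (1 + (int n * Ww + 1 + W + H) * Bb) ^ d" unfolding res_def
      using u0 Tb(2) Xb Ww Bb M gpos that by (intro np_bound) auto
    then show ?thesis using BB' by simp
  qed
  have cC: "\<bar>c x\<bar> \<le> Cb" if "x < n" for x using res[OF that] y[of x] Cb unfolding c by linarith
  have n0: "M 0 0 = int n" "M 0 (Suc 0) = int d" using M(1) by (auto simp: Base_def)
  have psum: "\<bar>\<Sum>i<k. c i * c i\<bar> \<le> Z" if "k \<le> n" for k
  proof -
    have "\<bar>ip k c c\<bar> \<le> int n * Cb * Cb" using cC Tb_le that by (intro ip_abs_le) auto
    then show ?thesis using Z by (simp add: ip_def)
  qed
  have t2: "s \<le> s\<^sup>2" "1 \<le> s\<^sup>2" using s by (auto simp: self_le_power)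
  show ?thesis unfolding try_c_def
  proof (rule tri_Seq[OF tri_vecc[where n = n and ofs = 0 and val = u0 and s = s and t = "3 * s + 2"]])
    fix j M' assume "j < n" "same {vJ, aU} M M'" "M' vJ 0 = int j"
    then show "aval M' (Add (Cell aB (ix dX)) (Cell aX (var vJ))) = u0 j \<and> aval M' (Num 0) = int 0"
      using n0 base_nth[OF M(1), of j d] by (simp add: same_def u0_def y_def irow_def)
  next
    fix M1 assume M1: "same {vJ, aU} M M1" and U1: "\<And>i. M1 aU i = (if 0 \<le> i \<and> i < 0 + n then u0 (i - 0) else M aU i)"
    have B1: "Base M1" using Base_same[OF M(1) M1] by simp
    have n1: "M1 0 0 = int n" "M1 0 (Suc 0) = int d" "M1 vW 0 = W" "M1 vH 0 = H" "M1 vE = M vE" "gso_ok n d M1 b" "irow n (M1 aB) = b"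
      using B1 M M1 by (auto simp: Base_def same_def)
    have u1: "u0 = irow n (M1 aU) 0" using zero[of _ d] by (auto simp: irow_def U1 u0_def y_def fun_eq_iff)
    show "tri Z (Seq (np_c dX) (Seq (vecc aC (Num 0) (Sub (Cell aX (var vJ)) (Cell aU (var vJ))))
    (Seq (sumc (Mul (Cell aC (var vJ)) (Cell aC (var vJ))))
      (If (Less (var vp) (var vNrm))
        (Seq (vecc aBest (Num 0) (Cell aC (var vJ))) (set_var vNrm (var vp))) Skip)))) M1 (18 * s\<^sup>2 + (9 * s + 9)) Q"
    proof (rule tri_Seq[OF np_c[where n = n and W = W and H = H and ?b = b and kk = d and ?u0.0 = u0 and ?e0.0 = "M vE 0"
            and A = "Tb + Xb + 1" and Ww = Ww and Bb = Bb and BB = BB and s = s]])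
      fix M2 assume M2: "same {aU, vE, vI, vJ, vL, vp, vq} M1 M2" and np2: "(irow n (M2 aU) 0, M2 vE 0) = np n b W H d (u0, M vE 0)"
      have u2: "M2 aU x = res x" if "x < n" for x
        using arg_cong[OF np2, of fst] that by (auto simp: res_def irow_def fun_eq_iff split: if_splits)
      have e2: "M2 vE 0 = snd (np n b W H d (u0, M vE 0))" using arg_cong[OF np2, of snd] by simp
      show "tri Z (Seq (vecc aC (Num 0) (Sub (Cell aX (var vJ)) (Cell aU (var vJ))))
    (Seq (sumc (Mul (Cell aC (var vJ)) (Cell aC (var vJ))))
      (If (Less (var vp) (var vNrm))
        (Seq (vecc aBest (Num 0) (Cell aC (var vJ))) (set_var vNrm (var vp))) Skip))) M2 (9 * s + 9) Q"
      proof (rule tri_Seq[OF tri_vecc[where n = n and ofs = 0 and val = c and s = s and t = "3 * s + 2"]])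
        fix j M' assume "j < n" "same {vJ, aC} M2 M'" "M' vJ 0 = int j"
        then show "aval M' (Sub (Cell aX (var vJ)) (Cell aU (var vJ))) = c j \<and> aval M' (Num 0) = int 0"
          using u2 M1 M2 by (simp add: same_def c y_def irow_def)
      next
        fix M3 assume M3: "same {vJ, aC} M2 M3" and C3: "\<And>i. M3 aC i = (if 0 \<le> i \<and> i < 0 + n then c (i - 0) else M2 aC i)"
        have c3: "M3 aC x = c x" if "x < n" for x using C3 that by simp
        show "tri Z (Seq (sumc (Mul (Cell aC (var vJ)) (Cell aC (var vJ))))
      (If (Less (var vp) (var vNrm))
        (Seq (vecc aBest (Num 0) (Cell aC (var vJ))) (set_var vNrm (var vp))) Skip)) M3 (6 * s + 7) Q"
        proof (rule tri_Seq[OF tri_sumc[where n = n and val = "\<lambda>x. c x * c x" and s = s and t = "3 * s + 3"]])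
          fix M4 assume M4: "same {vJ, vp} M3 M4" and p4: "M4 vp 0 = (\<Sum>x<n. c x * c x)"
          have S4: "same {aU, aC, vE, vI, vJ, vL, vp, vq} M M4" using M1 M2 M3 M4 by (auto simp: same_def)
          have M4': "Base M4" "Best M4" "M4 vNrm = M vNrm" "M4 vE 0 = snd (np n b W H d (u0, M vE 0))" "M4 aC = M3 aC"
            using Base_same[OF M(1) S4] Best_same[OF M(2) S4] S4 M3 M4 e2 by (auto simp: same_def)
          have p: "M4 vp 0 = ip n c c" using p4 by (simp add: ip_def)
          have QQ: "Q M'" if "same {aU, aC, aBest, vNrm, vE, vI, vJ, vL, vp, vq} M M'" "Base M'" "Best M'" "M' vE 0 = M4 vE 0"
            "M' vNrm 0 \<le> M vNrm 0" "M' vNrm 0 \<le> ip n c c" for M'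
            using Q[of M'] that M4'(4) unfolding y_def[symmetric] u0_def[symmetric] c_def[symmetric] by simp
          show "tri Z (If (Less (var vp) (var vNrm))
        (Seq (vecc aBest (Num 0) (Cell aC (var vJ))) (set_var vNrm (var vp))) Skip) M4 (3 * s + 4) Q"
          proof (rule tri_If[where t = "3 * s + 3"])
            assume "bval M4 (Less (var vp) (var vNrm))"
            then have less: "ip n c c < M vNrm 0" using p M4' by simp
            show "tri Z (Seq (vecc aBest (Num 0) (Cell aC (var vJ))) (set_var vNrm (var vp))) M4 (3 * s + 3) Q"
            proof (rule tri_Seq[OF tri_vecc[where n = n and ofs = 0 and val = c and s = s and t = "3 * s + 2"]])
              fix j M' assume "j < n" "same {vJ, aBest} M4 M'" "M' vJ 0 = int j"
              then show "aval M' (Cell aC (var vJ)) = c j \<and> aval M' (Num 0) = int 0"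
                using c3 M4' by (simp add: same_def)
            next
              fix M5 assume M5: "same {vJ, aBest} M4 M5" and b5: "\<And>i. M5 aBest i = (if 0 \<le> i \<and> i < 0 + n then c (i - 0) else M4 aBest i)"
              have b5': "M5 aBest x = c x" if "x < n" for x using b5 that by simp
              have ic: "irow n (M5 aBest) 0 = c"
              proof -
                have "res x = 0" if "x \<ge> n" for x
                proof -
                  obtain cc where "res = (\<lambda>x. u0 x - lc d cc b x)" using np_lc[of n b W H d "(u0, M vE 0)"] by (auto simp: res_def)
                  then show ?thesis using zero[OF that] that by (simp add: lc_def u0_def y_def irow_def)
                qed
                then show ?thesis using b5' by (auto simp: irow_def fun_eq_iff c y_def)
              qed
              let ?M6 = "upd M5 vNrm (nat (aval M5 (Num 0))) (aval M5 (var vp))"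
              have p5: "M5 vp 0 = ip n c c" using M5 p by (auto simp: same_def)
              have S6: "same {vJ, aBest, vNrm} M4 ?M6" using M5 by (auto simp: same_def)
              have "Best ?M6" unfolding Best_def
                using ic p5 b5' cC cand_lat[of W H y "M vE 0"] by (simp add: c_def)
              moreover have "same {aU, aC, aBest, vNrm, vE, vI, vJ, vL, vp, vq} M ?M6" using S4 S6 by (auto simp: same_def)
              moreover have "Base ?M6" using Base_same[OF M4'(1) S6] by simp
              ultimately have "Q ?M6" using less p5 S6 by (intro QQ) (auto simp: same_def)
              moreover have "\<bar>ip n c c\<bar> \<le> Z" using psum[of n] by (simp add: ip_def)
              ultimately show "tri Z (set_var vNrm (var vp)) M5 (Suc 0) Q" using p5 by (intro tri_Store) auto
            qed (use n1 M4' cC Tb_le Z s in \<open>auto simp: Base_def intro: order_trans\<close>)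
          next
            assume "\<not> bval M4 (Less (var vp) (var vNrm))"
            then have "M vNrm 0 \<le> ip n c c" using p M4' by simp
            then have "Q M4" using S4 M4' by (intro QQ) (auto simp: same_def)
            then show "tri Z Skip M4 (3 * s + 3) Q" by (intro tri_mono[OF tri_Skip[where t = 0 and Z = Z]]) auto
          qed simp
        next
          fix j M' assume "j < n" "same {vJ, vp} M3 M'" "M' vJ 0 = int j"
          then show "aval M' (Mul (Cell aC (var vJ)) (Cell aC (var vJ))) = c j * c j" using c3 by (simp add: same_def)
        qed (use n0 M1 M2 M3 psum Z s in \<open>auto simp: same_def\<close>)
      qed (use n0 M1 M2 cC Tb_le Z s in \<open>auto simp: same_def intro: order_trans\<close>)
    qed (use n1 u1 gpos M u0 Ww Bb Tb Xb BB' Z Tb_le s in \<open>auto simp: same_def\<close>)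
  next
    show "3 * s + 2 + (18 * s\<^sup>2 + (9 * s + 9)) \<le> 42 * s\<^sup>2" using t2 by linarith
  next
    fix k assume "k < n" then show "\<bar>u0 k\<bar> \<le> Z" using u0[of k] BBge Tb_le by linarith
  qed (use n0 Z s in auto)
qed

lemma enum_c:
  assumes M: "Base M" "Best M" "M vW 0 = W" "M vH 0 = H" "1 \<le> W" "W \<le> Wm" "0 \<le> H" "H \<le> Hm"
    "\<And>x. M aX x = 0" "M vN 0 = int N" "int N \<le> Z" "N \<le> r"
    and Q: "\<And>M'. same {aU, aC, aBest, vNrm, vE, vI, vJ, vL, vp, vq, vG} M M' \<Longrightarrow> Base M' \<Longrightarrow> Best M' \<Longrightarrow>
       (\<And>e. e < N \<Longrightarrow> M' vNrm 0 \<le> ip n (fst (np n b W H d (b d, int e))) (fst (np n b W H d (b d, int e)))) \<Longrightarrow> Q M'"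
  shows "tri Z enum_c M (r * (42 * s\<^sup>2 + 3) + 2) Q"
  unfolding enum_c_def
proof (rule tri_For_le[where N = N and s = r and tb = "42 * s\<^sup>2 + 1" and
      I = "\<lambda>k M'. same {aU, aC, aBest, vNrm, vE, vI, vJ, vL, vp, vq, vG} M M' \<and> Base M' \<and> Best M' \<and>
       (\<forall>e<k. M' vNrm 0 \<le> ip n (fst (np n b W H d (b d, int e))) (fst (np n b W H d (b d, int e))))"])
  let ?S = "{aU, aC, aBest, vNrm, vE, vI, vJ, vL, vp, vq, vG}"
  let ?f = "\<lambda>e. ip n (fst (np n b W H d (b d, int e))) (fst (np n b W H d (b d, int e)))"
  show "same ?S M (upd M vG 0 0) \<and> Base (upd M vG 0 0) \<and> Best (upd M vG 0 0) \<and> (\<forall>e<0. (upd M vG 0 0) vNrm 0 \<le> ?f e)"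
    using Base_same[OF M(1), of "{vG}"] Best_same[OF M(2), of "{vG}"] by (simp add: same_def)
  fix k M1 assume k: "k < N" and I: "same ?S M M1 \<and> Base M1 \<and> Best M1 \<and> (\<forall>e<k. M1 vNrm 0 \<le> ?f e)" and vg: "M1 vG 0 = int k"
  have M1: "M1 vW 0 = W" "M1 vH 0 = H" "M1 aX = M aX" using I M by (auto simp: same_def)
  show "tri Z (Seq (set_var vE (var vG)) try_c) M1 (42 * s\<^sup>2 + 1) (\<lambda>M'. M' vG 0 = int k \<and>
     same ?S M (upd M' vG 0 (int (Suc k))) \<and> Base (upd M' vG 0 (int (Suc k))) \<and> Best (upd M' vG 0 (int (Suc k))) \<and>
     (\<forall>e<Suc k. (upd M' vG 0 (int (Suc k))) vNrm 0 \<le> ?f e))"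
  proof (rule tri_Seq[OF tri_Store[where t = 0]])
    let ?M2 = "upd M1 vE (nat (aval M1 (Num 0))) (aval M1 (var vG))"
    have S2: "same {vE} M1 ?M2" by (auto simp: same_def)
    have e2: "?M2 vE 0 = int k" using vg by simp
    have y2: "irow n (?M2 aX) 0 = (\<lambda>x. 0)" using M1 M by (auto simp: irow_def)
    \<comment> \<open>With \<open>aX\<close> zero the candidate is the negated residue, which has
      the same norm.\<close>
    have c2: "ip n (cand W H (\<lambda>x. 0) (int k)) (cand W H (\<lambda>x. 0) (int k)) = ?f k"
      by (simp add: cand_def ip_def)
    show "tri Z try_c ?M2 (42 * s\<^sup>2) (\<lambda>M'. M' vG 0 = int k \<and>
     same ?S M (upd M' vG 0 (int (Suc k))) \<and> Base (upd M' vG 0 (int (Suc k))) \<and> Best (upd M' vG 0 (int (Suc k))) \<and>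
     (\<forall>e<Suc k. (upd M' vG 0 (int (Suc k))) vNrm 0 \<le> ?f e))"
    proof (rule try_c[where W = W and H = H])
      fix M3 assume M3: "same {aU, aC, aBest, vNrm, vE, vI, vJ, vL, vp, vq} ?M2 M3" "Base M3" "Best M3"
        "M3 vNrm 0 \<le> ?M2 vNrm 0" and c3: "M3 vNrm 0 \<le> ip n (cand W H (irow n (?M2 aX) 0) (?M2 vE 0)) (cand W H (irow n (?M2 aX) 0) (?M2 vE 0))"
      have "M3 vNrm 0 \<le> ?f k" using c3 unfolding y2 e2 c2 .
      moreover have "M3 vNrm 0 \<le> ?f e" if "e < k" for e using I M3(4) that by force
      moreover have "M3 vG 0 = int k" using M3(1) vg by (auto simp: same_def)
      moreover have "same ?S M (upd M3 vG 0 (int (Suc k)))" using I S2 M3(1) by (auto simp: same_def)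
      moreover have "Base (upd M3 vG 0 (int (Suc k)))" "Best (upd M3 vG 0 (int (Suc k)))"
        using Base_same[OF M3(2), of "{vG}"] Best_same[OF M3(3), of "{vG}"] by (auto simp: same_def)
      ultimately show "M3 vG 0 = int k \<and>
     same ?S M (upd M3 vG 0 (int (Suc k))) \<and> Base (upd M3 vG 0 (int (Suc k))) \<and> Best (upd M3 vG 0 (int (Suc k))) \<and>
     (\<forall>e<Suc k. (upd M3 vG 0 (int (Suc k))) vNrm 0 \<le> ?f e)" by (auto simp: less_Suc_eq)
    qed (use I S2 M1 M vg k Xb Base_same[OF _ S2] Best_same[OF _ S2] in auto)
  qed (use vg k M in auto)
qed (use M Q in \<open>auto simp: same_def algebra_simps\<close>)

lemma clamp_c:
  assumes M: "M 0 0 = int n" "M vK 0 = int k" "M vS 0 = S" "0 \<le> S" "2 * S \<le> Xb"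
    and Q: "\<And>M'. same {aX, vJ} M M' \<Longrightarrow> (\<And>j. j < n \<Longrightarrow> M' aX j = clamp S (M answer_array (2 * (k * (n + 1) + j)))) \<Longrightarrow> Q M'"
  shows "tri Z clamp_c M (4 * s + 2) Q"
  unfolding clamp_c_def
proof (rule tri_For_le[where N = n and s = s and tb = 2 and
    I = "\<lambda>i M'. same {aX, vJ} M M' \<and> (\<forall>j<i. M' aX j = clamp S (M answer_array (2 * (k * (n + 1) + j))))"])
  fix i M' assume i: "i < n" and I: "same {aX, vJ} M M' \<and> (\<forall>j<i. M' aX j = clamp S (M answer_array (2 * (k * (n + 1) + j))))"
    and vj: "M' vJ 0 = int i"
  have M': "M' 0 0 = int n" "M' vK 0 = int k" "M' vS 0 = S" "M' 3 = M 3" using I M by (auto simp: same_def)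
  have na: "nat (2 * (int k * (int n + 1) + int i)) = 2 * (k * (n + 1) + i)"
  proof -
    have "2 * (int k * (int n + 1) + int i) = int (2 * (k * (n + 1) + i))" by (simp add: algebra_simps)
    then show ?thesis by (metis nat_int)
  qed
  have av: "aval M' ans = M 3 (2 * (k * (n + 1) + i))" using M' vj na by simp
  have bv: "bval M' (And (Less ans (Add (Mul (Num 2) (var vS)) (Num 1)))
      (Less (Sub (Num (- 1)) (Mul (Num 2) (var vS))) ans)) \<longleftrightarrow> \<bar>aval M' ans\<bar> \<le> 2 * S"
  proof -
    have "bval M' (And (Less ans (Add (Mul (Num 2) (var vS)) (Num 1)))
      (Less (Sub (Num (- 1)) (Mul (Num 2) (var vS))) ans)) \<longleftrightarrow> aval M' ans < 2 * S + 1 \<and> - 1 - 2 * S < aval M' ans"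
      by (simp add: M'(3))
    then show ?thesis by linarith
  qed
  let ?Q = "\<lambda>M'. M' vJ 0 = int i \<and> same {aX, vJ} M (upd M' vJ 0 (int (Suc i))) \<and>
     (\<forall>j<Suc i. (upd M' vJ 0 (int (Suc i))) aX j = clamp S (M answer_array (2 * (k * (n + 1) + j))))"
  show "tri Z (If (And (Less ans (Add (Mul (Num 2) (var vS)) (Num 1)))
      (Less (Sub (Num (- 1)) (Mul (Num 2) (var vS))) ans))
    (Store aX ix0 ans) (Store aX ix0 (Num 0))) M' 2 ?Q"
  proof (rule tri_If[where t = "Suc 0"])
    assume "bval M' (And (Less ans (Add (Mul (Num 2) (var vS)) (Num 1)))
      (Less (Sub (Num (- 1)) (Mul (Num 2) (var vS))) ans))"
    then have a: "\<bar>aval M' ans\<bar> \<le> 2 * S" using bv by blast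
    show "tri Z (Store aX ix0 ans) M' (Suc 0) ?Q"
    proof (rule tri_Store)
      show "\<bar>aval M' ans\<bar> \<le> Z" using a M(5) Tb_le by linarith
      show "?Q (upd M' aX (nat (aval M' ix0)) (aval M' ans))"
        using I vj a unfolding av by (auto simp: same_def less_Suc_eq clamp_def)
    qed
  next
    assume "\<not> bval M' (And (Less ans (Add (Mul (Num 2) (var vS)) (Num 1)))
      (Less (Sub (Num (- 1)) (Mul (Num 2) (var vS))) ans))"
    then have a: "\<not> \<bar>aval M' ans\<bar> \<le> 2 * S" using bv by blast
    show "tri Z (Store aX ix0 (Num 0)) M' (Suc 0) ?Q"
    proof (rule tri_Store)
      show "?Q (upd M' aX (nat (aval M' ix0)) (aval M' (Num 0)))"
        using I vj a unfolding av by (auto simp: same_def less_Suc_eq clamp_def)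
    qed (use Z in simp)
  qed simp
qed (use M Z s Q in \<open>auto simp: same_def\<close>)

text \<open>A sample takes \<open>2 * (n + 1)\<close> cells, of which the numerators of the first
  \<open>n\<close> coordinates enter.\<close>

definition smp :: "int \<Rightarrow> memory \<Rightarrow> nat \<Rightarrow> nat \<Rightarrow> int" where
  "smp S M i = (\<lambda>x. if x < n then clamp S (M answer_array (2 * (i * (n + 1) + x))) else 0)"

lemma samples_c:
  assumes M: "Base M" "Best M" "M vW 0 = 1" "M vH 0 = 0" "M vE 0 = 0" "M vS 0 = S" "0 \<le> S" "2 * S \<le> Xb"
    "M vM 0 = int m" "int m \<le> Z"
    and Q: "\<And>M'. same {aU, aC, aX, aBest, vNrm, vE, vI, vJ, vK, vL, vp, vq} M M' \<Longrightarrow> Base M' \<Longrightarrow> Best M' \<Longrightarrow>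
       M' vE 0 = 0 \<Longrightarrow> M' vNrm 0 \<le> M vNrm 0 \<Longrightarrow>
       (\<And>i. i < m \<Longrightarrow> M' vNrm 0 \<le> ip n (cand 1 0 (smp S M i) 0) (cand 1 0 (smp S M i) 0)) \<Longrightarrow> Q M'"
  shows "tri Z samples_c M (m * (50 * s\<^sup>2) + 2) Q"
  unfolding samples_c_def
proof (rule tri_For_le[where N = m and s = m and tb = "4 * s + 2 + 42 * s\<^sup>2" and
      I = "\<lambda>k M'. same {aU, aC, aX, aBest, vNrm, vE, vI, vJ, vK, vL, vp, vq} M M' \<and> Base M' \<and> Best M' \<and> M' vE 0 = 0 \<and>
       M' vNrm 0 \<le> M vNrm 0 \<and> (\<forall>i<k. M' vNrm 0 \<le> ip n (cand 1 0 (smp S M i) 0) (cand 1 0 (smp S M i) 0))"])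
  let ?S = "{aU, aC, aX, aBest, vNrm, vE, vI, vJ, vK, vL, vp, vq}"
  let ?f = "\<lambda>i. ip n (cand 1 0 (smp S M i) 0) (cand 1 0 (smp S M i) 0)"
  let ?I = "\<lambda>k M'. same ?S M M' \<and> Base M' \<and> Best M' \<and> M' vE 0 = 0 \<and> M' vNrm 0 \<le> M vNrm 0 \<and> (\<forall>i<k. M' vNrm 0 \<le> ?f i)"
  show "?I 0 (upd M vK 0 0)"
    using M Base_same[OF M(1), of "{vK}"] Best_same[OF M(2), of "{vK}"] by (simp add: same_def)
  show "aval M' (var vM) = int m" if "?I k M'" for k M' using that M by (simp add: same_def)
  show "Q M'" if "?I m M'" for M' using that Q by simp
  fix k M1 assume k: "k < m" and I: "?I k M1" and vk: "M1 vK 0 = int k"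
  have M1: "M1 vW 0 = 1" "M1 vH 0 = 0" "M1 vS 0 = S" "M1 3 = M 3" "M1 0 0 = int n" using I M by (auto simp: same_def Base_def)
  show "tri Z (Seq clamp_c try_c) M1 (4 * s + 2 + 42 * s\<^sup>2) (\<lambda>M'. M' vK 0 = int k \<and> ?I (Suc k) (upd M' vK 0 (int (Suc k))))"
  proof (rule tri_Seq[OF clamp_c[where k = k and S = S]])
    fix M2 assume M2: "same {aX, vJ} M1 M2" and X2: "\<And>j. j < n \<Longrightarrow> M2 aX j = clamp S (M1 answer_array (2 * (k * (n + 1) + j)))"
    have y2: "irow n (M2 aX) 0 = smp S M k" using X2 M1 by (auto simp: irow_def smp_def)
    have e2: "M2 vE 0 = 0" using M2 I by (auto simp: same_def)
    have B2: "Base M2" "Best M2" using I Base_same[OF _ M2] Best_same[OF _ M2] by auto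
    show "tri Z try_c M2 (42 * s\<^sup>2) (\<lambda>M'. M' vK 0 = int k \<and> ?I (Suc k) (upd M' vK 0 (int (Suc k))))"
    proof (rule try_c[where W = 1 and H = 0])
      show "\<bar>M2 aX x\<bar> \<le> Xb" if "x < n" for x using X2[OF that] M Xb by (auto simp: clamp_def)
      fix M3 assume M3: "same {aU, aC, aBest, vNrm, vE, vI, vJ, vL, vp, vq} M2 M3" "Base M3" "Best M3"
        "M3 vE 0 = snd (np n b 1 0 d (\<lambda>x. b d x + irow n (M2 aX) 0 x, M2 vE 0))"
        "M3 vNrm 0 \<le> M2 vNrm 0" and c3: "M3 vNrm 0 \<le> ip n (cand 1 0 (irow n (M2 aX) 0) (M2 vE 0)) (cand 1 0 (irow n (M2 aX) 0) (M2 vE 0))"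
      have "M3 vNrm 0 \<le> ?f k" using c3 unfolding y2 e2 .
      moreover have n2: "M2 vNrm = M1 vNrm" using M2 by (auto simp: same_def)
      moreover have "M3 vNrm 0 \<le> ?f i" if "i < k" for i using I M3(5) that n2 by force
      moreover have "M3 vK 0 = int k" using M3(1) M2 vk by (auto simp: same_def)
      moreover have "same ?S M (upd M3 vK 0 (int (Suc k)))" using I M2 M3(1) by (auto simp: same_def)
      moreover have "Base (upd M3 vK 0 (int (Suc k)))" "Best (upd M3 vK 0 (int (Suc k)))"
        using Base_same[OF M3(2), of "{vK}"] Best_same[OF M3(3), of "{vK}"] by (auto simp: same_def)
      moreover have "M3 vE 0 = 0" using M3(4) np_snd[of 1] e2 by simp
      ultimately show "M3 vK 0 = int k \<and> ?I (Suc k) (upd M3 vK 0 (int (Suc k)))"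
        using I M3(5) by (auto simp: less_Suc_eq)
    qed (use B2 M2 M1 e2 Z WmHm in \<open>auto simp: same_def\<close>)
  qed (use M1 vk M in auto)
next
  have "s \<le> s\<^sup>2" "1 \<le> s\<^sup>2" using s by (auto simp: self_le_power)
  then have "m * (4 * s + 2 + 42 * s\<^sup>2 + 2) \<le> m * (50 * s\<^sup>2)" by (intro mult_le_mono2) linarith
  then show "m * (4 * s + 2 + 42 * s\<^sup>2 + 2) + 2 \<le> m * (50 * s\<^sup>2) + 2" by simp
qed (use M in auto)

lemma initbest_c:
  assumes M: "Base M"
    and Q: "\<And>M'. same {aBest, vNrm, vJ, vp} M M' \<Longrightarrow> Base M' \<Longrightarrow> Best M' \<Longrightarrow> M' vNrm 0 = ip n (b d) (b d) \<Longrightarrow> Q M'"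
  shows "tri Z initbest_c M (6 * s + 6) Q"
proof -
  have n0: "M 0 0 = int n" "M 0 (Suc 0) = int d" using M(1) by (auto simp: Base_def)
  have psum: "\<bar>\<Sum>i<k. b d i * b d i\<bar> \<le> Z" if "k \<le> n" for k
  proof -
    have "\<bar>ip k (b d) (b d)\<bar> \<le> int n * Cb * Cb" using Tb Tb_le that by (intro ip_abs_le) (auto intro: order_trans)
    then show ?thesis using Z by (simp add: ip_def)
  qed
  show ?thesis unfolding initbest_c_def
  proof (rule tri_Seq[OF tri_vecc[where n = n and ofs = 0 and val = "\<lambda>x. - b d x" and s = s and t = "3 * s + 2"]])
    fix j M' assume "j < n" "same {vJ, aBest} M M'" "M' vJ 0 = int j"
    then show "aval M' (Sub (Num 0) (Cell aB (ix dX))) = - b d j \<and> aval M' (Num 0) = int 0"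
      using n0 base_nth[OF M, of j d] by (simp add: same_def)
  next
    fix M1 assume M1: "same {vJ, aBest} M M1" and b1: "\<And>i. M1 aBest i = (if 0 \<le> i \<and> i < 0 + n then - b d (i - 0) else M aBest i)"
    show "tri Z (Seq (sumc (Mul (Cell aBest (var vJ)) (Cell aBest (var vJ)))) (set_var vNrm (var vp))) M1 (3 * s + 4) Q"
    proof (rule tri_Seq[OF tri_sumc[where n = n and val = "\<lambda>x. b d x * b d x" and s = s and t = "3 * s + 3"]])
      fix j M' assume "j < n" "same {vJ, vp} M1 M'" "M' vJ 0 = int j"
      then show "aval M' (Mul (Cell aBest (var vJ)) (Cell aBest (var vJ))) = b d j * b d j" using b1 by (simp add: same_def)
    next
      fix M2 assume M2: "same {vJ, vp} M1 M2" and p2: "M2 vp 0 = (\<Sum>x<n. b d x * b d x)"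
      let ?M3 = "upd M2 vNrm (nat (aval M2 (Num 0))) (aval M2 (var vp))"
      have S3: "same {aBest, vNrm, vJ, vp} M ?M3" using M1 M2 by (auto simp: same_def)
      have "M2 aBest = M1 aBest" using M2 by (auto simp: same_def)
      then have ic: "irow n (?M3 aBest) 0 = (\<lambda>x. - b d x)" "\<forall>x<n. \<bar>?M3 aBest x\<bar> \<le> Cb"
        using b1 zero[of _ d] order_trans[OF Tb(1) Tb_le(1)] by (auto simp: irow_def fun_eq_iff)
      have "(\<lambda>x. 0) \<in> lat d b" unfolding lat_def by (intro image_eqI[of _ _ "\<lambda>_. 0"]) (auto simp: lc_def)
      then have "Best ?M3" unfolding Best_def ic using ic(2) p2 by (simp add: ip_def)
      moreover have "Base ?M3" using Base_same[OF M S3] by simp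
      ultimately have "Q ?M3" using S3 p2 by (intro Q) (auto simp: ip_def)
      then show "tri Z (set_var vNrm (var vp)) M2 (Suc 0) Q"
        using p2 psum[of n] by (intro tri_Store) auto
    qed (use n0 M1 Z s psum in \<open>auto simp: same_def\<close>)
  qed (use n0 Z s Tb Tb_le in \<open>auto intro: order_trans\<close>)
qed

end

section \<open>Input, search parameters, queries and output\<close>

abbreviation (input) cnt :: aexp where "cnt \<equiv> Mul (Add dX (Num 1)) nX"

text \<open>Scales the instance to integers by the product of all denominators. A least common
  multiple would be smaller, but the product is no longer than the input already, and each division
  is exact.\<close>

definition parse_c :: com where
  "parse_c = Seq (set_var vDen (Num 1))
    (Seq (For vI cnt (set_var vDen (Mul (var vDen) (Cell 0 (Add (Num 3) (Mul (Num 2) (var vI)))))))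
      (For vI cnt (Store aB (var vI) (Div (Mul (var vDen) (Cell 0 (Add (Num 2) (Mul (Num 2) (var vI)))))
        (Cell 0 (Add (Num 3) (Mul (Num 2) (var vI))))))))"

text \<open>Below \<open>n0\<close> nearest plane runs through a box of coefficients around Babai's
  point, with the half width \<open>2 ^ d\<close> that \<open>closest_mu\<close> permits; the number
  of runs depends on \<open>n0\<close> only. From \<open>n0\<close> on a single Babai run is
  made.\<close>

definition param_c :: "nat \<Rightarrow> com" where
  "param_c n0 = If (Less nX (Num (int n0)))
    (Seq (set_var vH (Num 1)) (Seq (For vI dX (set_var vH (Mul (Num 2) (var vH))))
      (Seq (set_var vW (Add (Mul (Num 2) (var vH)) (Num 1)))
        (Seq (set_var vN (Num 1)) (For vI dX (set_var vN (Mul (var vW) (var vN))))))))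
    (Seq (set_var vH (Num 0)) (Seq (set_var vW (Num 1)) (set_var vN (Num 1))))"

text \<open>A power of two replaces the square root of the norm: unless it is 1, it exceeds the root
  by less than a factor 2.\<close>

definition sq_c :: com where
  "sq_c = Seq (set_var vS (Num 1)) (While (Less (Mul (var vS) (var vS)) (var vNrm)) (set_var vS (Mul (Num 2) (var vS))))"

text \<open>The exponent \<open>n / 2\<close> is rounded up to an integer, so this may exceed the
  number of samples; cells beyond the answer read as 0 and do no harm.\<close>

definition pow_c :: com where
  "pow_c = Seq (set_var vM (Num 1)) (For vI (Div (Add nX (Num 1)) (Num 2)) (set_var vM (Mul (Num 2) (var vM))))"

abbreviation (input) qrow :: aexp where "qrow \<equiv> Div (var vI) (Add nX (Num 1))"
abbreviation (input) qcol :: aexp where "qcol \<equiv> Sub (var vI) (Mul (Add nX (Num 1)) qrow)"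
abbreviation (input) qcnt :: aexp where "qcnt \<equiv> Mul (Add dX (Num 1)) (Add nX (Num 1))"

definition fill_c :: com where
  "fill_c = For vI qcnt (Seq
     (If (Less qcol nX)
       (Store query_array (Add (Num 4) (Mul (Num 2) (var vI))) (Cell aB (Add (Mul qrow nX) qcol)))
       (Store query_array (Add (Num 4) (Mul (Num 2) (var vI))) (Num 0)))
     (Store query_array (Add (Num 5) (Mul (Num 2) (var vI))) (Num 1)))"

text \<open>Multiplies the parameter \<open>vP / vQ\<close> by \<open>a / (a + 1)\<close> before the
  query is written. \<open>fill_c\<close> leaves zeros in the whole last column; entries begin at
  address 4, so the last one is at \<open>2 + 2 * qcnt\<close>, where the final two stores put the
  parameter.\<close>

definition q_c :: "nat \<Rightarrow> com" where
  "q_c a = Seq (set_var vP (Mul (var vP) (Num (int a)))) (Seq (set_var vQ (Mul (var vQ) (Num (int a + 1))))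
    (Seq fill_c
    (Seq (Store query_array (Num 0) (Add nX (Num 1))) (Seq (Store query_array (Num 1) (Add dX (Num 1)))
    (Seq (Store query_array (Num 2) (var vP)) (Seq (Store query_array (Num 3) (var vQ))
    (Seq (Store query_array (Add (Num 2) (Mul (Num 2) qcnt)) (var vP))
      (Store query_array (Add (Num 3) (Mul (Num 2) qcnt)) (var vQ)))))))))"

definition out_c :: com where
  "out_c = For vJ nX (Seq (Store output_array (Mul (Num 2) (var vJ)) (Add (Cell aB (ix dX)) (Cell aBest (var vJ))))
    (Store output_array (Add (Mul (Num 2) (var vJ)) (Num 1)) (var vDen)))"

lemma tri_StoreSeq:
  assumes "\<bar>aval M f\<bar> \<le> Z" "tri Z c (upd M k (nat (aval M e)) (aval M f)) t Q"
  shows "tri Z (Seq (Store k e f) c) M (Suc t) Q"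
  by (rule tri_Seq[where t = "Suc 0" and t' = t], rule tri_Store) (use assms in auto)

lemma tri_iter:
  assumes v: "v \<noteq> vI" "M v 0 = x 0"
    and e: "\<And>M'. same {vI, v} M M' \<Longrightarrow> aval M' e = int N"
    and ev: "\<And>k M'. k < N \<Longrightarrow> same {vI, v} M M' \<Longrightarrow> M' v 0 = x k \<Longrightarrow> M' vI 0 = int k \<Longrightarrow> aval M' f = x (Suc k)"
    and x: "\<And>k. k \<le> N \<Longrightarrow> \<bar>x k\<bar> \<le> Z" and N: "int N \<le> Z" "N \<le> s"
    and Q: "\<And>M'. same {vI, v} M M' \<Longrightarrow> M' v 0 = x N \<Longrightarrow> Q M'" and t: "3 * s + 2 \<le> t"
  shows "tri Z (For vI e (set_var v f)) M t Q"
proof (rule tri_For_le[where N = N and s = s and tb = 1 and I = "\<lambda>k M'. same {vI, v} M M' \<and> M' v 0 = x k"])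
  fix k M' assume k: "k < N" and I: "same {vI, v} M M' \<and> M' v 0 = x k" and vi: "M' vI 0 = int k"
  have "aval M' f = x (Suc k)" using ev[OF k] I vi by blast
  then have "tri Z (set_var v f) M' (Suc 0) (\<lambda>M'. M' vI 0 = int k \<and> same {vI, v} M (upd M' vI 0 (int (Suc k))) \<and>
      (upd M' vI 0 (int (Suc k))) v 0 = x (Suc k))"
    using x[of "Suc k"] k I vi v by (intro tri_Store) (auto simp: same_def)
  then show "tri Z (set_var v f) M' 1 (\<lambda>M'. M' vI 0 = int k \<and> same {vI, v} M (upd M' vI 0 (int (Suc k))) \<and>
      (upd M' vI 0 (int (Suc k))) v 0 = x (Suc k))" by simp
qed (use v e N Q t in \<open>auto simp: same_def\<close>)

lemma nat2 [simp]: "nat (2 * int i) = 2 * i" "nat (2 * int i + 1) = 2 * i + 1" "nat (3 + 2 * int i) = 3 + 2 * i" "nat (2 + 2 * int i) = 2 + 2 * i"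
  "nat (4 + 2 * int i) = 4 + 2 * i" "nat (5 + 2 * int i) = 5 + 2 * i"
  by (auto simp: nat_add_distrib nat_mult_distrib)

lemma parse_c:
  assumes M: "M 0 0 = int n" "M 0 1 = int d"
    and inp: "\<And>i. i < (d + 1) * n \<Longrightarrow> M 0 (2 + 2 * i) = num i" "\<And>i. i < (d + 1) * n \<Longrightarrow> M 0 (3 + 2 * i) = den i"
    and den: "\<And>i. i < (d + 1) * n \<Longrightarrow> den i \<ge> 1"
    and Den: "Den = (\<Prod>i<(d + 1) * n. den i)"
    and Z: "Den \<le> Z" "\<And>i. i < (d + 1) * n \<Longrightarrow> \<bar>Den * num i div den i\<bar> \<le> Z" "int ((d + 1) * n) \<le> Z"
    and r: "(d + 1) * n \<le> r"
    and Q: "\<And>M'. same {vDen, aB, vI} M M' \<Longrightarrow> M' vDen 0 = Den \<Longrightarrow>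
       (\<And>i. i < (d + 1) * n \<Longrightarrow> M' aB i = Den * num i div den i) \<Longrightarrow> Q M'"
  shows "tri Z parse_c M (6 * r + 5) Q"
  unfolding parse_c_def
proof (rule tri_Seq[OF tri_Store[where t = 0]])
  have pre: "1 \<le> (\<Prod>i<k. den i) \<and> (\<Prod>i<k. den i) \<le> Den" if "k \<le> (d + 1) * n" for k
  proof
    show "1 \<le> (\<Prod>i<k. den i)" using den that by (intro prod_ge_1) auto
    have "(\<Prod>i<(d + 1) * n. den i) = (\<Prod>i<k. den i) * (\<Prod>i\<in>{k..<(d + 1) * n}. den i)"
      using that by (subst prod.union_disjoint[symmetric]) (auto simp: ivl_disj_un_two(8) lessThan_atLeast0 intro!: prod.cong)
    moreover have "1 \<le> (\<Prod>i\<in>{k..<(d + 1) * n}. den i)" using den by (intro prod_ge_1) auto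
    moreover have "(\<Prod>i<k. den i) * 1 \<le> (\<Prod>i<k. den i) * (\<Prod>i\<in>{k..<(d + 1) * n}. den i)"
      using \<open>1 \<le> (\<Prod>i<k. den i)\<close> calculation(2) by (intro mult_left_mono) auto
    ultimately show "(\<Prod>i<k. den i) \<le> Den" by (simp add: Den)
  qed
  have Z1: "1 \<le> Z" using pre[of 0] Z(1) by simp
  then show "\<bar>aval M (Num 1)\<bar> \<le> Z" by simp
  let ?M1 = "upd M vDen (nat (aval M (Num 0))) (aval M (Num 1))"
  show "tri Z (Seq (For vI cnt (set_var vDen (Mul (var vDen) (Cell 0 (Add (Num 3) (Mul (Num 2) (var vI)))))))
      (For vI cnt (Store aB (var vI) (Div (Mul (var vDen) (Cell 0 (Add (Num 2) (Mul (Num 2) (var vI)))))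
        (Cell 0 (Add (Num 3) (Mul (Num 2) (var vI)))))))) ?M1 (6 * r + 4) Q"
  proof (rule tri_Seq[OF tri_iter[where N = "(d + 1) * n" and x = "\<lambda>k. \<Prod>i<k. den i" and s = r and t = "3 * r + 2"]])
    fix k M' assume "k < (d + 1) * n" "same {vI, vDen} ?M1 M'" "M' vDen 0 = (\<Prod>i<k. den i)" "M' vI 0 = int k"
    then show "aval M' (Mul (var vDen) (Cell 0 (Add (Num 3) (Mul (Num 2) (var vI))))) = (\<Prod>i<Suc k. den i)"
      using inp(2)[of k] by (simp add: same_def)
  next
    show "\<bar>\<Prod>i<k. den i\<bar> \<le> Z" if "k \<le> (d + 1) * n" for k using pre[OF that] Z(1) by linarith
  next
    fix M2 assume M2: "same {vI, vDen} ?M1 M2" and D2: "M2 vDen 0 = (\<Prod>i<(d + 1) * n. den i)"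
    have M2': "M2 0 = M 0" "M2 vDen 0 = Den" using M2 D2 Den by (auto simp: same_def)
    show "tri Z (For vI cnt (Store aB (var vI) (Div (Mul (var vDen) (Cell 0 (Add (Num 2) (Mul (Num 2) (var vI)))))
        (Cell 0 (Add (Num 3) (Mul (Num 2) (var vI))))))) M2 (3 * r + 2) Q"
    proof (rule tri_For_le[where N = "(d + 1) * n" and s = r and tb = 1 and
        I = "\<lambda>k M'. same {vI, aB} M2 M' \<and> (\<forall>i<k. M' aB i = Den * num i div den i)"])
      fix k M' assume k: "k < (d + 1) * n" and I: "same {vI, aB} M2 M' \<and> (\<forall>i<k. M' aB i = Den * num i div den i)"
        and vi: "M' vI 0 = int k"
      have "M' 0 = M 0" "M' vDen 0 = Den" using I M2' by (auto simp: same_def)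
      then have e: "aval M' (Div (Mul (var vDen) (Cell 0 (Add (Num 2) (Mul (Num 2) (var vI)))))
        (Cell 0 (Add (Num 3) (Mul (Num 2) (var vI))))) = Den * num k div den k"
        using inp[of k] k vi by simp
      have "tri Z (Store aB (var vI) (Div (Mul (var vDen) (Cell 0 (Add (Num 2) (Mul (Num 2) (var vI)))))
        (Cell 0 (Add (Num 3) (Mul (Num 2) (var vI)))))) M' (Suc 0) (\<lambda>M'. M' vI 0 = int k \<and>
          same {vI, aB} M2 (upd M' vI 0 (int (Suc k))) \<and> (\<forall>i<Suc k. (upd M' vI 0 (int (Suc k))) aB i = Den * num i div den i))"
        using e Z(2)[OF k] I vi by (intro tri_Store) (auto simp: same_def less_Suc_eq)
      then show "tri Z (Store aB (var vI) (Div (Mul (var vDen) (Cell 0 (Add (Num 2) (Mul (Num 2) (var vI)))))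
        (Cell 0 (Add (Num 3) (Mul (Num 2) (var vI)))))) M' 1 (\<lambda>M'. M' vI 0 = int k \<and>
          same {vI, aB} M2 (upd M' vI 0 (int (Suc k))) \<and> (\<forall>i<Suc k. (upd M' vI 0 (int (Suc k))) aB i = Den * num i div den i))" by simp
    next
      fix M' assume "same {vI, aB} M2 M' \<and> (\<forall>i<(d + 1) * n. M' aB i = Den * num i div den i)"
      then show "Q M'" using M2 M2' by (intro Q) (auto simp: same_def)
    qed (use M M2' Z r in \<open>auto simp: same_def algebra_simps\<close>)
  qed (use M Z r in \<open>auto simp: same_def algebra_simps\<close>)
qed auto

lemma param_c:
  assumes M: "M 0 0 = int n" "M 0 1 = int d" and s: "d \<le> s" and Z: "int d \<le> Z" "3 \<le> Z"
    and ZN: "n < n0 \<Longrightarrow> 2 * 2 ^ d + 1 \<le> Z" "n < n0 \<Longrightarrow> (2 * 2 ^ d + 1) ^ d \<le> Z"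
    and Q: "\<And>M'. same {vH, vW, vN, vI} M M' \<Longrightarrow> M' vH 0 = (if n < n0 then 2 ^ d else 0) \<Longrightarrow>
      M' vW 0 = (if n < n0 then 2 * 2 ^ d + 1 else 1) \<Longrightarrow> M' vN 0 = (if n < n0 then (2 * 2 ^ d + 1) ^ d else 1) \<Longrightarrow> Q M'"
  shows "tri Z (param_c n0) M (6 * s + 8) Q"
  unfolding param_c_def
proof (rule tri_If[where t = "6 * s + 7"])
  assume "bval M (Less nX (Num (int n0)))"
  then have n: "n < n0" using M by simp
  have pw: "\<bar>2 ^ k :: int\<bar> \<le> Z" if "k \<le> d" for k
  proof -
    have "(2::int) ^ k \<le> 2 ^ d" using that by (intro power_increasing) auto
    also have "\<dots> \<le> 2 * 2 ^ d + 1" by simp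
    finally show ?thesis using ZN(1)[OF n] by simp
  qed
  show "tri Z (Seq (set_var vH (Num 1)) (Seq (For vI dX (set_var vH (Mul (Num 2) (var vH))))
      (Seq (set_var vW (Add (Mul (Num 2) (var vH)) (Num 1)))
        (Seq (set_var vN (Num 1)) (For vI dX (set_var vN (Mul (var vW) (var vN)))))))) M (6 * s + 7) Q"
  proof (rule tri_Seq[OF tri_Store[where t = 0]])
    let ?M1 = "upd M vH (nat (aval M (Num 0))) (aval M (Num 1))"
    show "tri Z (Seq (For vI dX (set_var vH (Mul (Num 2) (var vH))))
      (Seq (set_var vW (Add (Mul (Num 2) (var vH)) (Num 1)))
        (Seq (set_var vN (Num 1)) (For vI dX (set_var vN (Mul (var vW) (var vN))))))) ?M1 (6 * s + 6) Q"
    proof (rule tri_Seq[OF tri_iter[where N = d and x = "\<lambda>k. 2 ^ k" and s = s and t = "3 * s + 2"]])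
      fix M2 assume M2: "same {vI, vH} ?M1 M2" and H2: "M2 vH 0 = 2 ^ d"
      show "tri Z (Seq (set_var vW (Add (Mul (Num 2) (var vH)) (Num 1)))
        (Seq (set_var vN (Num 1)) (For vI dX (set_var vN (Mul (var vW) (var vN)))))) M2 (3 * s + 4) Q"
      proof (rule tri_Seq[OF tri_Store[where t = 0]])
        let ?M3 = "upd M2 vW (nat (aval M2 (Num 0))) (aval M2 (Add (Mul (Num 2) (var vH)) (Num 1)))"
        show "tri Z (Seq (set_var vN (Num 1)) (For vI dX (set_var vN (Mul (var vW) (var vN))))) ?M3 (3 * s + 3) Q"
        proof (rule tri_Seq[OF tri_Store[where t = 0]])
          let ?M4 = "upd ?M3 vN (nat (aval ?M3 (Num 0))) (aval ?M3 (Num 1))"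
          show "tri Z (For vI dX (set_var vN (Mul (var vW) (var vN)))) ?M4 (3 * s + 2) Q"
          proof (rule tri_iter[where N = d and x = "\<lambda>k. (2 * 2 ^ d + 1) ^ k" and s = s])
            show "\<bar>(2 * 2 ^ d + 1) ^ k\<bar> \<le> Z" if "k \<le> d" for k
            proof -
              have "(2 * 2 ^ d + 1 :: int) ^ k \<le> (2 * 2 ^ d + 1) ^ d" using that by (intro power_increasing) auto
              then have "(2 * 2 ^ d + 1 :: int) ^ k \<le> Z" using ZN(2)[OF n] by (rule order_trans)
              then show ?thesis by simp
            qed
          next
            fix M' assume "same {vI, vN} ?M4 M'" "M' vN 0 = (2 * 2 ^ d + 1) ^ d"
            then show "Q M'" using n M2 H2 by (intro Q) (auto simp: same_def)
          qed (use M M2 H2 Z s in \<open>auto simp: same_def\<close>)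
        qed (use Z in auto)
      qed (use H2 ZN(1)[OF n] in auto)
    qed (use M Z s pw in \<open>auto simp: same_def\<close>)
  qed (use Z in auto)
next
  assume "\<not> bval M (Less nX (Num (int n0)))"
  then have n: "\<not> n < n0" using M by simp
  have "tri Z (Seq (set_var vH (Num 0)) (Seq (set_var vW (Num 1)) (set_var vN (Num 1)))) M 3 Q"
    by (rule tri_Seq[OF tri_Store[where t = 0]], use Z in simp,
        rule tri_Seq[OF tri_Store[where t = 0]], use Z in simp,
        rule tri_Store[where t = 0], use Z in simp, rule Q) (use n in \<open>auto simp: same_def\<close>)
  then show "tri Z (Seq (set_var vH (Num 0)) (Seq (set_var vW (Num 1)) (set_var vN (Num 1)))) M (6 * s + 7) Q"
    by (rule tri_mono) auto
qed simp

lemma sq_c: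
  assumes nrm: "M vNrm 0 = nrm" "nrm \<le> 4 ^ K" and Z: "2 ^ K \<le> Z"
    and Q: "\<And>M' k. same {vS} M M' \<Longrightarrow> M' vS 0 = 2 ^ k \<Longrightarrow> k \<le> K \<Longrightarrow> nrm \<le> (2 ^ k)\<^sup>2 \<Longrightarrow>
       k = 0 \<or> (2 ^ k)\<^sup>2 < 4 * nrm \<Longrightarrow> Q M'"
  shows "tri Z sq_c M (2 * K + 2) Q"
  unfolding sq_c_def
proof (rule tri_Seq[OF tri_Store[where t = 0]])
  let ?w = "While (Less (Mul (var vS) (var vS)) (var vNrm)) (set_var vS (Mul (Num 2) (var vS)))"
  have "tri Z ?w M' (2 * (K - k) + 1) Q" if "same {vS} M M'" "M' vS 0 = 2 ^ k" "k \<le> K" "k = 0 \<or> (2 ^ k)\<^sup>2 < 4 * nrm" for M' k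
    using that
  proof (induction "K - k" arbitrary: k M' rule: less_induct)
    case less
    have n': "M' vNrm 0 = nrm" using less(2) nrm by (simp add: same_def)
    show ?case
    proof (cases "nrm \<le> (2 ^ k)\<^sup>2")
      case True
      then have "tri Z ?w M' (Suc 0) Q"
        using less n' by (intro tri_WhileF Q) (auto simp: power2_eq_square)
      then show ?thesis by (rule tri_mono) auto
    next
      case False
      \<comment> \<open>At \<open>k = K\<close> the square is \<open>4 ^ K\<close>, so the loop has
        stopped by then.\<close>
      have kK: "k < K"
      proof (rule ccontr)
        assume "\<not> k < K"
        then have "k = K" using less by simp
        then have "(2 ^ k :: int)\<^sup>2 = 4 ^ K" by (simp add: power2_eq_square power_mult_distrib[symmetric])
        then show False using False nrm by simp
      qed
      let ?M1 = "upd M' vS (nat (aval M' (Num 0))) (aval M' (Mul (Num 2) (var vS)))"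
      have s1: "?M1 vS 0 = 2 ^ Suc k" using less by simp
      show ?thesis
      proof (rule tri_WhileT[OF _ tri_Store[where t = 0]])
        show "tri Z ?w ?M1 (2 * (K - Suc k) + 1) Q"
          using less(1)[of "Suc k" ?M1] less(2-) s1 kK False by (auto simp: same_def power2_eq_square)
        have "(2::int) ^ Suc k \<le> 2 ^ K" using kK by (intro power_increasing) auto
        then show "\<bar>aval M' (Mul (Num 2) (var vS))\<bar> \<le> Z" using less Z by simp
      qed (use less False n' kK in \<open>auto simp: power2_eq_square\<close>)
    qed
  qed
  from this[of "upd M vS (nat (aval M (Num 0))) (aval M (Num 1))" 0]
  show "tri Z ?w (upd M vS (nat (aval M (Num 0))) (aval M (Num 1))) (2 * K + 1) Q"
    by (simp add: same_def)
  show "\<bar>aval M (Num 1)\<bar> \<le> Z" using order_trans[OF one_le_power[of "2::int" K] Z] by simp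
qed simp

lemma pow_c:
  assumes M: "M 0 0 = int n" and s: "n \<le> s" "s \<ge> 1" and Z: "2 ^ ((n + 1) div 2) \<le> Z" "int n \<le> Z"
    and Q: "\<And>M'. same {vI, vM} M M' \<Longrightarrow> M' vM 0 = 2 ^ ((n + 1) div 2) \<Longrightarrow> Q M'"
  shows "tri Z pow_c M (3 * s + 3) Q"
  unfolding pow_c_def
proof (rule tri_Seq[OF tri_Store[where t = 0]])
  let ?M1 = "upd M vM (nat (aval M (Num 0))) (aval M (Num 1))"
  have dv: "(int n + 1) div 2 = int ((n + 1) div 2)" by (simp add: zdiv_int add.commute)
  show "tri Z (For vI (Div (Add nX (Num 1)) (Num 2)) (set_var vM (Mul (Num 2) (var vM)))) ?M1 (3 * s + 2) Q"
  proof (rule tri_iter[where N = "(n + 1) div 2" and x = "\<lambda>k. 2 ^ k" and s = s])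
    show "\<bar>2 ^ k\<bar> \<le> Z" if "k \<le> (n + 1) div 2" for k
    proof -
      have "(2::int) ^ k \<le> 2 ^ ((n + 1) div 2)" using that by (intro power_increasing) auto
      then have "(2::int) ^ k \<le> Z" using Z(1) by (rule order_trans)
      then show ?thesis by simp
    qed
    show "int ((n + 1) div 2) \<le> Z"
    proof (cases n)
      case 0 then show ?thesis using Z by simp
    next
      case (Suc m) then have "(n + 1) div 2 \<le> n" by simp
      then show ?thesis using Z by linarith
    qed
    show "(n + 1) div 2 \<le> s" using s by simp
  qed (use M dv Q in \<open>auto simp: same_def\<close>)
  show "\<bar>aval M (Num 1)\<bar> \<le> Z" using order_trans[OF one_le_power[of "2::int" "(n + 1) div 2"] Z(1)] by simp
qed (use s in simp)

section \<open>A query in memory and the lattice it describes\<close>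

context reduced begin

definition qval :: "nat \<Rightarrow> int" where
  "qval l = (if l mod (n + 1) < n then b (l div (n + 1)) (l mod (n + 1)) else 0)"

lemma b_bound: "l \<le> d \<Longrightarrow> x < n \<Longrightarrow> \<bar>b l x\<bar> \<le> max Bb Tb"
  using Bb(1)[of l x] Tb(1)[of x] by (cases "l < d") auto

lemma fill_c:
  assumes M: "Base M" and Z': "Bb \<le> Z" "int ((d + 1) * (n + 1)) \<le> Z"
    and Q: "\<And>M'. same {query_array, vI} M M' \<Longrightarrow> (\<And>l. l < (d + 1) * (n + 1) \<Longrightarrow> M' query_array (4 + 2 * l) = qval l \<and>
        M' query_array (5 + 2 * l) = 1) \<Longrightarrow> Q M'"
  shows "tri Z fill_c M (20 * s\<^sup>2 + 2) Q"
  unfolding fill_c_def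
proof (rule tri_For_le[where N = "(d + 1) * (n + 1)" and s = "4 * s\<^sup>2" and tb = 3 and
    I = "\<lambda>k M'. same {query_array, vI} M M' \<and> (\<forall>l<k. M' query_array (4 + 2 * l) = qval l \<and> M' query_array (5 + 2 * l) = 1)"])
  let ?I = "\<lambda>k M'. same {query_array, vI} M M' \<and> (\<forall>l<k. M' query_array (4 + 2 * l) = qval l \<and> M' query_array (5 + 2 * l) = 1)"
  fix k M1 assume k: "k < (d + 1) * (n + 1)" and I: "?I k M1" and vi: "M1 vI 0 = int k"
  have M1: "M1 0 0 = int n" "M1 aB = M aB" using I M by (auto simp: same_def Base_def)
  have dv: "int k div (int n + 1) = int (k div (n + 1))" by (simp add: zdiv_int add.commute)
  have md: "int k - (int n + 1) * int (k div (n + 1)) = int (k mod (n + 1))"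
  proof -
    have "int k = int ((n + 1) * (k div (n + 1)) + k mod (n + 1))" by (metis mult_div_mod_eq)
    then show ?thesis by (simp add: algebra_simps)
  qed
  have kd: "k div (n + 1) \<le> d" using k by (metis less_Suc_eq_le Suc_eq_plus1 less_mult_imp_div_less)
  have q1: "aval M1 qcol = int (k mod (n + 1))" "aval M1 qrow = int (k div (n + 1))" using M1 vi dv md by simp_all
  have t: "tri Z (Store query_array (Add (Num 5) (Mul (Num 2) (var vI))) (Num 1)) M' (Suc 0) (\<lambda>M'. M' vI 0 = int k \<and> ?I (Suc k) (upd M' vI 0 (int (Suc k))))"
    if "M' = upd M1 query_array (4 + 2 * k) (qval k)" for M'
    using that I vi Z by (intro tri_Store) (auto simp: same_def less_Suc_eq)
  have qv: "\<bar>qval k\<bar> \<le> Z" using b_bound[OF kd, of "k mod (n + 1)"] Z Tb_le Z' by (auto simp: qval_def)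
  have "tri Z (If (Less qcol nX)
       (Store query_array (Add (Num 4) (Mul (Num 2) (var vI))) (Cell aB (Add (Mul qrow nX) qcol)))
       (Store query_array (Add (Num 4) (Mul (Num 2) (var vI))) (Num 0))) M1 2
     (\<lambda>M'. tri Z (Store query_array (Add (Num 5) (Mul (Num 2) (var vI))) (Num 1)) M' (Suc 0) (\<lambda>M'. M' vI 0 = int k \<and> ?I (Suc k) (upd M' vI 0 (int (Suc k)))))"
  proof (rule tri_If[where t = "Suc 0"])
    assume "bval M1 (Less qcol nX)"
    then have c: "k mod (n + 1) < n" using q1 M1 by simp
    have "aval M1 (Cell aB (Add (Mul qrow nX) qcol)) = qval k"
      using M1 q1 base_nth[OF M c, of "k div (n + 1)"] c by (simp add: qval_def)
    then show "tri Z (Store query_array (Add (Num 4) (Mul (Num 2) (var vI))) (Cell aB (Add (Mul qrow nX) qcol))) M1 (Suc 0)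
     (\<lambda>M'. tri Z (Store query_array (Add (Num 5) (Mul (Num 2) (var vI))) (Num 1)) M' (Suc 0) (\<lambda>M'. M' vI 0 = int k \<and> ?I (Suc k) (upd M' vI 0 (int (Suc k)))))"
      using qv vi by (intro tri_Store t) auto
  next
    assume "\<not> bval M1 (Less qcol nX)"
    then have c: "\<not> k mod (n + 1) < n" using q1 M1 by simp
    then show "tri Z (Store query_array (Add (Num 4) (Mul (Num 2) (var vI))) (Num 0)) M1 (Suc 0)
     (\<lambda>M'. tri Z (Store query_array (Add (Num 5) (Mul (Num 2) (var vI))) (Num 1)) M' (Suc 0) (\<lambda>M'. M' vI 0 = int k \<and> ?I (Suc k) (upd M' vI 0 (int (Suc k)))))"
      using qv vi by (intro tri_Store t) (auto simp: qval_def)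
  qed simp
  then show "tri Z (Seq
     (If (Less qcol nX)
       (Store query_array (Add (Num 4) (Mul (Num 2) (var vI))) (Cell aB (Add (Mul qrow nX) qcol)))
       (Store query_array (Add (Num 4) (Mul (Num 2) (var vI))) (Num 0)))
     (Store query_array (Add (Num 5) (Mul (Num 2) (var vI))) (Num 1))) M1 3 (\<lambda>M'. M' vI 0 = int k \<and> ?I (Suc k) (upd M' vI 0 (int (Suc k))))"
    by (rule tri_Seq) simp
next
  have "(d + 1) * (n + 1) \<le> (2 * s) * (2 * s)" using s by (intro mult_le_mono) auto
  then show "(d + 1) * (n + 1) \<le> 4 * s\<^sup>2" by (simp add: power2_eq_square)
next
  fix k M' assume I: "same {query_array, vI} M M' \<and> (\<forall>l<k. M' query_array (4 + 2 * l) = qval l \<and> M' query_array (5 + 2 * l) = 1)"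
  then show "aval M' qcnt = int ((d + 1) * (n + 1))" using M by (simp add: same_def Base_def algebra_simps)
qed (use M Z' Q in \<open>auto simp: same_def\<close>)

lemma q_c:
  assumes M: "Base M" "Best M" and Z': "Bb \<le> Z" "int ((d + 1) * (n + 1)) \<le> Z"
    and PQ: "P = M vP 0 * int a" "Q' = M vQ 0 * (int a + 1)" "\<bar>P\<bar> \<le> Z" "\<bar>Q'\<bar> \<le> Z"
    and Q: "\<And>M'. same {query_array, vI, vP, vQ} M M' \<Longrightarrow> Base M' \<Longrightarrow> Best M' \<Longrightarrow> M' vP 0 = P \<Longrightarrow> M' vQ 0 = Q' \<Longrightarrow>
        dec_query (M' query_array) = (n + 1, map (\<lambda>i. vec (n + 1) (\<lambda>j. if j < n then of_int (b i j) else if i = d then Rat.Fract P Q' else 0)) [0..<d + 1], Rat.Fract P Q') \<Longrightarrow> Q M'"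
  shows "tri Z (q_c a) M (30 * s\<^sup>2) Q"
proof -
  let ?N = "(d + 1) * (n + 1)"
  have t2: "1 \<le> s\<^sup>2" using s by simp
  have N1: "?N \<ge> 1" by simp
  have "tri Z (q_c a) M (Suc (Suc (20 * s\<^sup>2 + 2 + Suc (Suc (Suc (Suc (Suc (Suc 0)))))))) Q" unfolding q_c_def
  proof (rule tri_StoreSeq, goal_cases)
    case 1 show ?case using PQ by simp
  next
    case 2 show ?case
    proof (rule tri_StoreSeq, goal_cases)
      case 1 show ?case using PQ by simp
    next
      case 2
      let ?M1 = "upd M vP (nat (aval M (Num 0))) (aval M (Mul (var vP) (Num (int a))))"
      let ?M2 = "upd ?M1 vQ (nat (aval ?M1 (Num 0))) (aval ?M1 (Mul (var vQ) (Num (int a + 1))))"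
      have S2: "same {vP, vQ} M ?M2" by (simp add: same_def)
      have B2: "Base ?M2" using Base_same[OF M(1) S2] by simp
      have PQ2: "?M2 vP 0 = P" "?M2 vQ 0 = Q'" using PQ by auto
      show ?case
      proof (rule tri_Seq[OF fill_c[OF B2 Z'] order_refl], goal_cases)
        case (1 M3)
        have S3: "same {query_array, vI, vP, vQ} M M3" using S2 1(1) by (auto simp: same_def)
        have M3: "M3 0 0 = int n" "M3 0 (Suc 0) = int d" "M3 vP 0 = P" "M3 vQ 0 = Q'"
          using 1(1) PQ2 B2 by (auto simp: same_def Base_def)
        have nl: "nat (2 + 2 * ((int d + 1) * (int n + 1))) = 2 + 2 * ?N" "nat (3 + 2 * ((int d + 1) * (int n + 1))) = 3 + 2 * ?N"
        proof -
          have e: "(int d + 1) * (int n + 1) = int ?N" by (simp add: algebra_simps)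
          show "nat (2 + 2 * ((int d + 1) * (int n + 1))) = 2 + 2 * ?N" "nat (3 + 2 * ((int d + 1) * (int n + 1))) = 3 + 2 * ?N"
            unfolding e by (simp_all only: nat2)
        qed
        have dn: "int d + 1 \<le> Z" "int n + 1 \<le> Z"
        proof -
          have "d + 1 \<le> ?N" "n + 1 \<le> ?N" by simp_all
          then have "int (d + 1) \<le> int ?N" "int (n + 1) \<le> int ?N" by (simp_all only: of_nat_le_iff)
          from this[THEN order_trans, OF Z'(2)] show "int d + 1 \<le> Z" "int n + 1 \<le> Z" by simp_all
        qed
        have na [simp]: "nat (int n + 1) = n + 1" by simp
        define f where "f = (M3 query_array)(0 := int n + 1, 1 := int d + 1, 2 := P, 3 := Q', 2 + 2 * ?N := P, 3 + 2 * ?N := Q')"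
        have dq: "dec_query f = (n + 1, map (\<lambda>i. vec (n + 1) (\<lambda>j. if j < n then of_int (b i j) else if i = d then Rat.Fract P Q' else 0)) [0..<d + 1], Rat.Fract P Q')"
        proof -
          have e: "dec_rat f (4 + 2 * (n + 1) * i + 2 * j) = (if j < n then of_int (b i j) else if i = d then Rat.Fract P Q' else 0)"
            if i: "i \<le> d" and j: "j < n + 1" for i j
          proof -
            define l where "l = (n + 1) * i + j"
            have dm: "(j + i * (n + 1)) div (n + 1) = i \<and> (j + i * (n + 1)) mod (n + 1) = j" if "j < n + 1" for i j
              using that by (subst div_mult_self1, simp, subst mod_mult_self1, simp)
            have "l = j + i * (n + 1)" by (simp add: l_def)
            then have l: "l div (n + 1) = i" "l mod (n + 1) = j" using dm[OF j, of i] by simp_all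
            have lN: "l < ?N"
            proof -
              have "l < (n + 1) * (i + 1)" using j by (simp add: l_def)
              also have "\<dots> \<le> (n + 1) * (d + 1)" using i by (intro mult_le_mono) auto
              finally show ?thesis by (simp add: mult.commute)
            qed
            have a: "4 + 2 * (n + 1) * i + 2 * j = 4 + 2 * l" by (simp add: l_def algebra_simps)
            have last: "4 + 2 * l = 2 + 2 * ?N \<longleftrightarrow> i = d \<and> j = n"
            proof
              assume "4 + 2 * l = 2 + 2 * ?N"
              then have "l + 1 = ?N" by simp
              then have "l = n + d * (n + 1)" by simp
              then show "i = d \<and> j = n" using l dm[of n d] by simp
            next
              assume "i = d \<and> j = n"
              then show "4 + 2 * l = 2 + 2 * ?N" by (simp add: l_def algebra_simps)
            qed
            have m: "M3 query_array (4 + 2 * l) = qval l" "M3 query_array (5 + 2 * l) = 1" using 1(2)[OF lN] by auto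
            have f1: "f (4 + 2 * l) = (if i = d \<and> j = n then P else qval l)"
              unfolding f_def using last lN m(1) by (auto simp: fun_upd_def)
            have f2: "f (4 + 2 * l + 1) = (if i = d \<and> j = n then Q' else 1)"
            proof -
              have "4 + 2 * l + 1 = 3 + 2 * ?N \<longleftrightarrow> i = d \<and> j = n" using last by simp
              \<comment> \<open>Denominators sit at odd addresses, numerators at even ones.\<close>
              moreover have "4 + 2 * l + 1 \<noteq> 2 + 2 * ?N" by presburger
              moreover have "4 + 2 * l + 1 = 5 + 2 * l" by simp
              ultimately show ?thesis unfolding f_def using m(2) by (simp add: fun_upd_def)
            qed
            show ?thesis unfolding a dec_rat_def f1 f2 using j l
              by (auto simp: qval_def Fract_of_int_eq rat_number_collapse)
          qed
          have h: "f 0 = int (n + 1)" "f 1 = int (d + 1)" "f 2 = P" "f 3 = Q'" by (auto simp: f_def)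
          show ?thesis unfolding dec_query_def Let_def h nat_int
            using e h(3,4) by (auto simp: dec_vec_def dec_rat_def[of f 2] intro!: eq_vecI)
        qed
        show ?case
        proof (rule tri_StoreSeq, goal_cases)
          case 1 show ?case using M3 dn by simp
        next
          case 2 show ?case
          proof (rule tri_StoreSeq, goal_cases)
            case 1 show ?case using M3 dn by simp
          next
            case 2 show ?case
            proof (rule tri_StoreSeq, goal_cases)
              case 1 show ?case using M3 PQ by simp
            next
              case 2 show ?case
              proof (rule tri_StoreSeq, goal_cases)
                case 1 show ?case using M3 PQ by simp
              next
                case 2 show ?case
                proof (rule tri_StoreSeq, goal_cases)
                  case 1 show ?case using M3 PQ by simp
                next
                  case 2 show ?case
                  proof (rule tri_Store, goal_cases)
                    case 1 show ?case using M3 PQ by simp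
                  next
                    case 2
                    let ?M' = "M3(query_array := f)"
                    have S: "same {query_array, vI, vP, vQ} M ?M'" using S3 by (simp add: same_def)
                    have "Q ?M'" by (rule Q[OF S Base_same[OF M(1) S] Best_same[OF M(2) S]])
                       (use M3 dq in auto)
                    moreover have "?M' = (\<lambda>k. if k = query_array then f else M3 k)" by auto
                    ultimately show ?case using M3 nl by (simp add: upd_def f_def fun_upd_def cong: if_cong)
                  qed
                qed
              qed
            qed
          qed
        qed
      qed
    qed
  qed
  then show ?thesis by (rule tri_mono) (use t2 in auto)
qed

lemma out_c:
  assumes M: "Base M" "\<And>x. x < n \<Longrightarrow> \<bar>M aBest x\<bar> \<le> Cb" "\<bar>M vDen 0\<bar> \<le> Z" and Z': "Tb + Cb \<le> Z"
    and Q: "\<And>M'. same {output_array, vJ} M M' \<Longrightarrow> (\<And>j. j < n \<Longrightarrow> M' output_array (2 * j) = b d j + M aBest j \<and>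
       M' output_array (2 * j + 1) = M vDen 0) \<Longrightarrow> Q M'"
  shows "tri Z out_c M (4 * s + 2) Q"
  unfolding out_c_def
proof (rule tri_For_le[where N = n and s = s and tb = 2 and
   I = "\<lambda>k M'. same {output_array, vJ} M M' \<and> (\<forall>j<k. M' output_array (2 * j) = b d j + M aBest j \<and> M' output_array (2 * j + 1) = M vDen 0)"])
  let ?I = "\<lambda>k M'. same {output_array, vJ} M M' \<and> (\<forall>j<k. M' output_array (2 * j) = b d j + M aBest j \<and> M' output_array (2 * j + 1) = M vDen 0)"
  fix k M1 assume k: "k < n" and I: "?I k M1" and vj: "M1 vJ 0 = int k"
  have M1: "M1 0 0 = int n" "M1 0 (Suc 0) = int d" "M1 aB = M aB" "M1 aBest = M aBest" "M1 vDen = M vDen"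
    using I M by (auto simp: same_def Base_def)
  have e: "aval M1 (Add (Cell aB (ix dX)) (Cell aBest (var vJ))) = b d k + M aBest k"
    using M1 vj base_nth[OF M(1) k, of d] by simp
  show "tri Z (Seq (Store output_array (Mul (Num 2) (var vJ)) (Add (Cell aB (ix dX)) (Cell aBest (var vJ))))
    (Store output_array (Add (Mul (Num 2) (var vJ)) (Num 1)) (var vDen))) M1 2 (\<lambda>M'. M' vJ 0 = int k \<and> ?I (Suc k) (upd M' vJ 0 (int (Suc k))))"
  proof (rule tri_Seq[OF tri_Store[where t = 0]])
    show "\<bar>aval M1 (Add (Cell aB (ix dX)) (Cell aBest (var vJ)))\<bar> \<le> Z"
      using M(2)[OF k] Tb(1)[OF k] Z' unfolding e by linarith
    let ?M2 = "upd M1 output_array (nat (aval M1 (Mul (Num 2) (var vJ)))) (aval M1 (Add (Cell aB (ix dX)) (Cell aBest (var vJ))))"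
    have o2: "?M2 = upd M1 output_array (2 * k) (b d k + M aBest k)" using vj e by simp
    show "tri Z (Store output_array (Add (Mul (Num 2) (var vJ)) (Num 1)) (var vDen)) ?M2 (Suc 0)
      (\<lambda>M'. M' vJ 0 = int k \<and> ?I (Suc k) (upd M' vJ 0 (int (Suc k))))"
      unfolding o2 using I M1 M(3) vj by (intro tri_Store) (auto simp: same_def less_Suc_eq)
  qed simp
qed (use M Z s Q in \<open>auto simp: same_def Base_def\<close>)

end

section \<open>Gaussian sums over shifted lattices\<close>

text \<open>Squared length of the shifted lattice vector \<open>y + x\<close>. The real shift is
  kept apart so that lattice vectors stay integral.\<close>

definition nq :: "nat \<Rightarrow> (nat \<Rightarrow> int) \<Rightarrow> (nat \<Rightarrow> real) \<Rightarrow> real" where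
  "nq n y x = (\<Sum>j<n. (of_int (y j) + x j)\<^sup>2)"

definition sq :: "nat \<Rightarrow> (nat \<Rightarrow> real) \<Rightarrow> real" where
  "sq n x = (\<Sum>j<n. (x j)\<^sup>2)"

lemma nq_nonneg: "0 \<le> nq n y x" by (simp add: nq_def sum_nonneg)

text \<open>Compares a shifted Gaussian sum with the unshifted one at half the rate; summability for
  all shifts is reduced to shift 0 in this way.\<close>

lemma nq_le: "nq n y (\<lambda>_. 0) \<le> 2 * nq n y x + 2 * sq n x"
  unfolding nq_def sq_def sum_distrib_left sum.distrib[symmetric]
proof (rule sum_mono)
  fix j
  have "2 * (of_int (y j) + x j)\<^sup>2 + 2 * (x j)\<^sup>2 - (of_int (y j) + 0)\<^sup>2 = (of_int (y j) + 2 * x j)\<^sup>2"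
    by (simp add: power2_eq_square algebra_simps)
  then show "(of_int (y j) + 0)\<^sup>2 \<le> 2 * (of_int (y j) + x j)\<^sup>2 + 2 * (x j)\<^sup>2"
    using zero_le_power2[of "of_int (y j) + 2 * x j"] by linarith
qed

section \<open>Double sums\<close>

lemma summable_le:
  fixes f g :: "'a \<Rightarrow> real"
  assumes "g summable_on A" "\<And>x. x \<in> A \<Longrightarrow> 0 \<le> f x" "\<And>x. x \<in> A \<Longrightarrow> f x \<le> g x"
  shows "f summable_on A"
proof (rule nonneg_bdd_above_summable_on)
  have g: "0 \<le> g x" if "x \<in> A" for x using assms(2,3)[OF that] by linarith
  have "sum f F \<le> infsum g A" if "F \<subseteq> A" "finite F" for F
  proof -
    have "sum f F \<le> sum g F" using that assms(3) by (intro sum_mono) auto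
    also have "\<dots> \<le> infsum g A" using that g by (intro finite_sum_le_infsum assms(1)) auto
    finally show ?thesis .
  qed
  then show "bdd_above (sum f ` {F. F \<subseteq> A \<and> finite F})" by (intro bdd_aboveI2[of _ _ "infsum g A"]) auto
qed (use assms in auto)

lemma summable_Times:
  fixes f :: "'a \<Rightarrow> real" and g :: "'b \<Rightarrow> real"
  assumes "f summable_on A" "g summable_on B" "\<And>x. x \<in> A \<Longrightarrow> 0 \<le> f x" "\<And>x. x \<in> B \<Longrightarrow> 0 \<le> g x"
  shows "(\<lambda>(x, y). f x * g y) summable_on A \<times> B"
proof (rule summable_on_SigmaI)
  fix x assume "x \<in> A"
  show "((\<lambda>y. case (x, y) of (x, y) \<Rightarrow> f x * g y) has_sum f x * infsum g B) B"
    using assms(2) by (simp add: has_sum_cmult_right)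
next
  show "(\<lambda>x. f x * infsum g B) summable_on A" using assms(1) by (rule summable_on_cmult_left)
qed (use assms in auto)

lemma infsum_Times:
  fixes f :: "'a \<Rightarrow> real" and g :: "'b \<Rightarrow> real"
  assumes "(\<lambda>(x, y). f x * g y) summable_on A \<times> B"
  shows "infsum (\<lambda>(x, y). f x * g y) (A \<times> B) = infsum f A * infsum g B"
  using infsum_Sigma_banach[OF assms] by (simp add: infsum_cmult_right' infsum_cmult_left')

lemma summable_Times_abs:
  fixes f :: "'a \<Rightarrow> real" and g :: "'b \<Rightarrow> real"
  assumes "(\<lambda>x. \<bar>f x\<bar>) summable_on A" "(\<lambda>x. \<bar>g x\<bar>) summable_on B"
  shows "(\<lambda>(x, y). f x * g y) summable_on A \<times> B"
proof (rule abs_summable_summable)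
  have "(\<lambda>(x, y). \<bar>f x\<bar> * \<bar>g y\<bar>) summable_on A \<times> B" using assms by (intro summable_Times) auto
  then show "(\<lambda>x. norm (case x of (x, y) \<Rightarrow> f x * g y)) summable_on A \<times> B"
    by (rule summable_on_cong[THEN iffD1, rotated]) (auto simp: abs_mult)
qed

text \<open>Used for congruence modulo \<open>2L\<close>, this replaces Poisson summation in the proof of \<open>th_le\<close> below.\<close>

lemma equiv_psd:
  fixes h :: "'a \<Rightarrow> real"
  assumes R: "equiv A R" and h: "(\<lambda>x. \<bar>h x\<bar>) summable_on A"
  shows "0 \<le> infsum (\<lambda>(x, y). h x * h y) R"
proof -
  let ?S = "Sigma (A // R) (\<lambda>C. C \<times> C)"
  have RA: "R \<subseteq> A \<times> A" using R by (auto simp: equiv_def refl_on_def)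
  \<comment> \<open>The relation is the disjoint union of \<open>C \<times> C\<close> over its
    classes \<open>C\<close>, so the double sum becomes a sum of squares.\<close>
  have bij: "bij_betw snd ?S R"
  proof (rule bij_betwI')
    fix p q assume p: "p \<in> ?S" "q \<in> ?S"
    show "(snd p = snd q) \<longleftrightarrow> (p = q)"
    proof
      assume "snd p = snd q"
      then have "fst p \<inter> fst q \<noteq> {}" using p by auto
      then have "fst p = fst q" using p quotient_disj[OF R, of "fst p" "fst q"] by auto
      then show "p = q" using \<open>snd p = snd q\<close> by (simp add: prod_eq_iff)
    qed simp
  next
    fix p assume "p \<in> ?S"
    then show "snd p \<in> R" using quotient_eq_iff[OF R] by (auto simp: mem_Sigma_iff) (metis R in_quotient_imp_closed quotient_eqI quotient_eq_iff)
  next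
    fix r assume r: "r \<in> R"
    obtain x y where xy: "r = (x, y)" by force
    have "x \<in> A" using r xy RA by auto
    then have "(x, x) \<in> R" using R by (auto simp: equiv_def dest: refl_onD)
    then have "(R `` {x}, (x, y)) \<in> ?S"
      using r xy \<open>x \<in> A\<close> by (auto intro!: quotientI)
    then show "\<exists>p\<in>?S. r = snd p" using xy by (intro bexI[of _ "(R `` {x}, (x, y))"]) auto
  qed
  have sA: "(\<lambda>(x, y). h x * h y) summable_on A \<times> A" by (rule summable_Times_abs[OF h h])
  then have sR: "(\<lambda>(x, y). h x * h y) summable_on R" using RA by (rule summable_on_subset_banach)
  let ?f = "\<lambda>p. case snd p of (x, y) \<Rightarrow> h x * h y"
  have sS: "?f summable_on ?S"
    using sR summable_on_reindex_bij_betw[OF bij, of "\<lambda>(x, y). h x * h y"] by simp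
  have "infsum (\<lambda>(x, y). h x * h y) R = infsum ?f ?S"
    using infsum_reindex_bij_betw[OF bij, of "\<lambda>(x, y). h x * h y"] by simp
  also have "\<dots> = infsum (\<lambda>C. infsum (\<lambda>p. ?f (C, p)) (C \<times> C)) (A // R)"
    using infsum_Sigma_banach[OF sS] by simp
  also have "\<dots> = infsum (\<lambda>C. infsum h C * infsum h C) (A // R)"
  proof (rule infsum_cong)
    fix C assume "C \<in> A // R"
    then have "C \<subseteq> A" using R by (metis Union_quotient Union_upper)
    then have "(\<lambda>x. \<bar>h x\<bar>) summable_on C" using h by (rule summable_on_subset_banach[rotated])
    then show "infsum (\<lambda>p. ?f (C, p)) (C \<times> C) = infsum h C * infsum h C"
      using infsum_Times[OF summable_Times_abs] by simp
  qed
  also have "\<dots> \<ge> 0" by (intro infsum_nonneg) simp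
  finally show ?thesis .
qed

lemma infsum_sum_finite:
  fixes f :: "'i \<Rightarrow> 'a \<Rightarrow> real"
  assumes "finite I" "\<And>i. i \<in> I \<Longrightarrow> f i summable_on A"
  shows "(\<lambda>y. \<Sum>i\<in>I. f i y) summable_on A \<and> infsum (\<lambda>y. \<Sum>i\<in>I. f i y) A = (\<Sum>i\<in>I. infsum (f i) A)"
  using assms by (induction I rule: finite_induct) (auto simp: infsum_add intro: summable_on_add)

lemma exp_sq_le: "2 * exp (A + B) \<le> exp (A + A) + exp (B + B :: real)"
proof -
  have "0 \<le> (exp A - exp B)\<^sup>2" by simp
  then show ?thesis unfolding exp_add by (simp add: power2_eq_square algebra_simps)
qed

text \<open>The estimates rest on the group structure and on summable Gaussians alone, hence are
  stated without a basis.\<close>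

locale integer_lattice =
  fixes n :: nat and L :: "(nat \<Rightarrow> int) set"
  assumes zero: "(\<lambda>_. 0) \<in> L"
    and add: "\<And>y z. y \<in> L \<Longrightarrow> z \<in> L \<Longrightarrow> (\<lambda>j. y j + z j) \<in> L"
    and diff: "\<And>y z. y \<in> L \<Longrightarrow> z \<in> L \<Longrightarrow> (\<lambda>j. y j - z j) \<in> L"
    and summ0: "\<And>a. a > 0 \<Longrightarrow> (\<lambda>y. exp (- a * nq n y (\<lambda>_. 0))) summable_on L"
begin

text \<open>Gaussian mass of \<open>L + x\<close> with rate \<open>a = \<pi> / s\<^sup>2\<close>; as
  a function of the shift it is a theta function.\<close>

definition th :: "real \<Rightarrow> (nat \<Rightarrow> real) \<Rightarrow> real" where
  "th a x = infsum (\<lambda>y. exp (- a * nq n y x)) L"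

lemma summ: "a > 0 \<Longrightarrow> (\<lambda>y. exp (- a * nq n y x)) summable_on L"
proof -
  assume a: "a > 0"
  have "(\<lambda>y. exp (a * sq n x) * exp (- (a / 2) * nq n y (\<lambda>_. 0))) summable_on L"
    using a by (intro summable_on_cmult_right summ0) auto
  then show ?thesis
  proof (rule summable_le)
    fix y
    have "(a / 2) * nq n y (\<lambda>_. 0) \<le> (a / 2) * (2 * nq n y x + 2 * sq n x)"
      using a nq_le by (intro mult_left_mono) auto
    then show "exp (- a * nq n y x) \<le> exp (a * sq n x) * exp (- (a / 2) * nq n y (\<lambda>_. 0))"
      unfolding exp_add[symmetric] by (simp add: algebra_simps)
  qed simp
qed

lemma neg: "y \<in> L \<Longrightarrow> (\<lambda>j. - y j) \<in> L"
  using diff[OF zero, of y] by simp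

lemma nq_shift: "nq n (\<lambda>j. y j + c j) x = nq n y (\<lambda>j. of_int (c j) + x j)"
  by (simp add: nq_def add.assoc)

lemma th_shift:
  assumes c: "c \<in> L" shows "th a (\<lambda>j. of_int (c j) + x j) = th a x"
proof -
  have "bij_betw (\<lambda>y j. y j + c j) L L"
    by (rule bij_betwI[of _ _ _ "\<lambda>y j. y j - c j"]) (use add[OF _ c] diff[OF _ c] in auto)
  from infsum_reindex_bij_betw[OF this, of "\<lambda>y. exp (- a * nq n y x)"]
  show ?thesis by (simp add: th_def nq_shift)
qed

lemma th_neg: "th a (\<lambda>j. - x j) = th a x"
proof -
  have "bij_betw (\<lambda>y j. - y j) L L"
    by (rule bij_betwI[of _ _ _ "\<lambda>y j. - y j"]) (use neg in auto)
  from infsum_reindex_bij_betw[OF this, of "\<lambda>y. exp (- a * nq n y x)"]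
  have "th a x = infsum (\<lambda>y. exp (- a * nq n (\<lambda>j. - y j) x)) L" by (simp add: th_def)
  moreover have "nq n (\<lambda>j. - y j) x = nq n y (\<lambda>j. - x j)" for y
    unfolding nq_def by (intro sum.cong refl) (simp add: power2_eq_square algebra_simps)
  ultimately show ?thesis by (simp add: th_def)
qed

lemma th_pos: "a > 0 \<Longrightarrow> th a x > 0"
proof -
  assume a: "a > 0"
  have "sum (\<lambda>y. exp (- a * nq n y x)) {\<lambda>_. 0} \<le> th a x" unfolding th_def
    using summ[OF a] zero by (intro finite_sum_le_infsum) auto
  then show ?thesis by (simp add: less_le_trans[OF exp_gt_zero])
qed

text \<open>Makes the supremum in \<open>th_le\<close> finite. Translating by a lattice vector makes
  the shift \<open>x'\<close> almost the shortest of its coset, and then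
  \<open>nq n y (\<lambda>_. 0) \<le> 4 * nq n y x' + 2\<close>, so the resulting bound is the same
  for all \<open>x\<close>.\<close>

lemma th_bounded: assumes a: "a > 0" shows "\<exists>K. \<forall>x. th a x \<le> K"
proof (intro exI allI)
  fix x
  define I where "I = (INF y\<in>L. nq n y x)"
  have bdd: "bdd_below ((\<lambda>y. nq n y x) ` L)" using nq_nonneg by (intro bdd_belowI2) auto
  have "\<exists>c\<in>L. nq n c x < I + 1"
    using cINF_less_iff[OF _ bdd, of "I + 1"] zero unfolding I_def by force
  then obtain c where c: "c \<in> L" "nq n c x < I + 1" by blast
  define x' where "x' = (\<lambda>j. of_int (c j) + x j)"
  have sq': "sq n x' = nq n c x" by (simp add: sq_def nq_def x'_def)
  have "th a x = th a x'" using th_shift[OF c(1)] by (simp add: x'_def)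
  also have "\<dots> \<le> infsum (\<lambda>y. exp (a / 2) * exp (- (a / 4) * nq n y (\<lambda>_. 0))) L"
    unfolding th_def
  proof (rule infsum_mono)
    show "(\<lambda>y. exp (- a * nq n y x')) summable_on L" by (rule summ[OF a])
    show "(\<lambda>y. exp (a / 2) * exp (- (a / 4) * nq n y (\<lambda>_. 0))) summable_on L"
      using a by (intro summable_on_cmult_right summ0) auto
    fix y assume y: "y \<in> L"
    have "I \<le> nq n (\<lambda>j. y j + c j) x" unfolding I_def using bdd add[OF y c(1)] by (intro cINF_lower) auto
    then have "nq n c x \<le> nq n y x' + 1" using c(2) by (simp add: nq_shift x'_def)
    then have "nq n y (\<lambda>_. 0) \<le> 4 * nq n y x' + 2" using nq_le[of n y x'] sq' by linarith
    then have "(a / 4) * nq n y (\<lambda>_. 0) \<le> (a / 4) * (4 * nq n y x' + 2)" using a by (intro mult_left_mono) auto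
    then show "exp (- a * nq n y x') \<le> exp (a / 2) * exp (- (a / 4) * nq n y (\<lambda>_. 0))"
      unfolding exp_add[symmetric] by (simp add: algebra_simps)
  qed
  finally show "th a x \<le> infsum (\<lambda>y. exp (a / 2) * exp (- (a / 4) * nq n y (\<lambda>_. 0))) L" .
qed

definition par :: "((nat \<Rightarrow> int) \<times> (nat \<Rightarrow> int)) set" where
  "par = {(u, v). u \<in> L \<and> v \<in> L \<and> (\<exists>w\<in>L. \<forall>j. u j - v j = 2 * w j)}"

lemma par_equiv: "equiv L par"
proof (rule equivI)
  show "par \<subseteq> L \<times> L" by (auto simp: par_def)
  show "refl_on L par" using zero by (auto simp: refl_on_def par_def intro!: bexI[of _ "\<lambda>_. 0"])
  show "sym par"
  proof (rule symI)
    fix u v assume "(u, v) \<in> par"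
    then obtain w where w: "u \<in> L" "v \<in> L" "w \<in> L" "\<And>j. u j - v j = 2 * w j" by (auto simp: par_def)
    have "v j - u j = 2 * (- w j)" for j using w(4)[of j] by simp
    then show "(v, u) \<in> par" using w(1,2) neg[OF w(3)] by (auto simp: par_def intro!: bexI[of _ "\<lambda>j. - w j"])
  qed
  show "trans par"
  proof (rule transI)
    fix u v t assume "(u, v) \<in> par" "(v, t) \<in> par"
    then obtain w w' where w: "u \<in> L" "t \<in> L" "w \<in> L" "w' \<in> L" "\<And>j. u j - v j = 2 * w j" "\<And>j. v j - t j = 2 * w' j"
      by (auto simp: par_def)
    have "u j - t j = 2 * (w j + w' j)" for j using w(5)[of j] w(6)[of j] by simp
    then show "(u, t) \<in> par" using w(1,2) add[OF w(3,4)] by (auto simp: par_def intro!: bexI[of _ "\<lambda>j. w j + w' j"])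
  qed
qed

text \<open>Sum and difference put pairs of lattice vectors in bijection with pairs congruent modulo
  \<open>2L\<close>. With the parallelogram law this separates the variables in a product of two
  Gaussian sums.\<close>

lemma par_bij: "bij_betw (\<lambda>(y, z). (\<lambda>j. y j + z j, \<lambda>j. y j - z j)) (L \<times> L) par"
proof (rule bij_betwI')
  fix p q :: "(nat \<Rightarrow> int) \<times> (nat \<Rightarrow> int)"
  show "((case p of (y, z) \<Rightarrow> (\<lambda>j. y j + z j, \<lambda>j. y j - z j)) = (case q of (y, z) \<Rightarrow> (\<lambda>j. y j + z j, \<lambda>j. y j - z j))) = (p = q)"
  proof (cases p; cases q)
    fix y z y' z' assume pq: "p = (y, z)" "q = (y', z')"
    have "y j = y' j \<and> z j = z' j" if "y j + z j = y' j + z' j" "y j - z j = y' j - z' j" for j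
      using that by linarith
    then have yz: "y = y' \<and> z = z'" if "\<And>j. y j + z j = y' j + z' j" "\<And>j. y j - z j = y' j - z' j"
      using that by blast
    show ?thesis
    proof
      assume "(case p of (y, z) \<Rightarrow> (\<lambda>j. y j + z j, \<lambda>j. y j - z j)) = (case q of (y, z) \<Rightarrow> (\<lambda>j. y j + z j, \<lambda>j. y j - z j))"
      then have "(\<lambda>j. y j + z j) = (\<lambda>j. y' j + z' j)" "(\<lambda>j. y j - z j) = (\<lambda>j. y' j - z' j)" by (simp_all add: pq)
      from yz[OF fun_cong[OF this(1)] fun_cong[OF this(2)]] show "p = q" by (simp add: pq)
    qed simp
  qed
next
  fix p assume "p \<in> L \<times> L"
  then show "(case p of (y, z) \<Rightarrow> (\<lambda>j. y j + z j, \<lambda>j. y j - z j)) \<in> par"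
    using add diff by (auto simp: par_def)
next
  fix p assume "p \<in> par"
  then obtain u v w where p: "p = (u, v)" "u \<in> L" "v \<in> L" "w \<in> L" "\<And>j. u j - v j = 2 * w j" by (auto simp: par_def)
  have "u = (\<lambda>j. (v j + w j) + w j)" "v = (\<lambda>j. (v j + w j) - w j)" using p(5) by (auto simp: fun_eq_iff) (metis add.commute diff_add_cancel mult_2 add.assoc)
  then show "\<exists>q\<in>L \<times> L. p = (case q of (y, z) \<Rightarrow> (\<lambda>j. y j + z j, \<lambda>j. y j - z j))"
    using p add[OF p(3,4)] by (intro bexI[of _ "((\<lambda>j. v j + w j), w)"]) auto
qed

lemma nq_parallelogram:
  "nq n y x1 + nq n z x2 = (nq n (\<lambda>j. y j + z j) (\<lambda>j. x1 j + x2 j) + nq n (\<lambda>j. y j - z j) (\<lambda>j. x1 j - x2 j)) / 2"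
  unfolding nq_def sum.distrib[symmetric] sum_divide_distrib
  by (intro sum.cong refl) (simp add: power2_eq_square field_simps)

lemma th_mult:
  assumes a: "a > 0"
  shows "th a x1 * th a x2 = infsum (\<lambda>(u, v). exp (- (a / 2) * nq n u (\<lambda>j. x1 j + x2 j)) *
    exp (- (a / 2) * nq n v (\<lambda>j. x1 j - x2 j))) par"
proof -
  let ?F = "\<lambda>(u, v). exp (- (a / 2) * nq n u (\<lambda>j. x1 j + x2 j)) * exp (- (a / 2) * nq n v (\<lambda>j. x1 j - x2 j))"
  have "th a x1 * th a x2 = infsum (\<lambda>(y, z). exp (- a * nq n y x1) * exp (- a * nq n z x2)) (L \<times> L)"
    unfolding th_def using summ[OF a] by (subst infsum_Times[OF summable_Times]) auto
  also have "\<dots> = infsum (\<lambda>p. ?F ((\<lambda>(y, z). (\<lambda>j. y j + z j, \<lambda>j. y j - z j)) p)) (L \<times> L)"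
  proof (rule infsum_cong)
    fix p assume "p \<in> L \<times> L"
    obtain y z where p: "p = (y, z)" by force
    have "- a * nq n y x1 + - a * nq n z x2 = - a * (nq n y x1 + nq n z x2)" by (simp add: algebra_simps)
    also have "\<dots> = - (a / 2) * nq n (\<lambda>j. y j + z j) (\<lambda>j. x1 j + x2 j) + - (a / 2) * nq n (\<lambda>j. y j - z j) (\<lambda>j. x1 j - x2 j)"
      by (rule trans[OF arg_cong[OF nq_parallelogram]]) (simp add: field_simps)
    finally have "exp (- a * nq n y x1 + - a * nq n z x2) = exp (- (a / 2) * nq n (\<lambda>j. y j + z j) (\<lambda>j. x1 j + x2 j) +
      - (a / 2) * nq n (\<lambda>j. y j - z j) (\<lambda>j. x1 j - x2 j))" by (rule arg_cong)
    then show "(case p of (y, z) \<Rightarrow> exp (- a * nq n y x1) * exp (- a * nq n z x2)) =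
      ?F ((\<lambda>(y, z). (\<lambda>j. y j + z j, \<lambda>j. y j - z j)) p)"
      unfolding p prod.case exp_add .
  qed
  also have "\<dots> = infsum ?F par" by (rule infsum_reindex_bij_betw[OF par_bij])
  finally show ?thesis .
qed

text \<open>Let \<open>f\<close> and \<open>g\<close> be the Gaussians of half the rate at the
  shifts 0 and \<open>2 * x\<close>. The three products in the claim are the sums of
  \<open>f u * g v\<close>, \<open>f u * f v\<close> and \<open>g u * g v\<close> over
  \<open>par\<close>. By \<open>equiv_psd\<close> the sum for \<open>f - g\<close> is nonnegative,
  so twice the mixed sum is at most the other two together.\<close>

lemma th_double:
  assumes a: "a > 0"
  shows "(th a x)\<^sup>2 \<le> ((th a (\<lambda>_. 0))\<^sup>2 + th a (\<lambda>j. 2 * x j) * th a (\<lambda>_. 0)) / 2"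
proof -
  define f where "f = (\<lambda>u. exp (- (a / 2) * nq n u (\<lambda>_. 0)))"
  define g where "g = (\<lambda>u. exp (- (a / 2) * nq n u (\<lambda>j. 2 * x j)))"
  have a2: "a / 2 > 0" using a by simp
  have sf: "f summable_on L" "g summable_on L" unfolding f_def g_def by (rule summ[OF a2])+
  have nn: "f u \<ge> 0" "g u \<ge> 0" for u by (auto simp: f_def g_def)
  have sm: "(\<lambda>(u, v). F u * G v) summable_on par" if "F \<in> {f, g}" "G \<in> {f, g}" for F G
    by (rule summable_on_subset_banach[of _ "L \<times> L"]) (use that sf nn in \<open>auto simp: par_def intro!: summable_Times\<close>)
  have "(th a x)\<^sup>2 = th a x * th a (\<lambda>j. - x j)" by (simp add: th_neg power2_eq_square)
  also have "\<dots> = infsum (\<lambda>(u, v). f u * g v) par" unfolding th_mult[OF a] by (simp add: f_def g_def)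
  finally have fg: "(th a x)\<^sup>2 = infsum (\<lambda>(u, v). f u * g v) par" .
  have gf: "infsum (\<lambda>(u, v). g u * f v) par = (th a x)\<^sup>2"
    using th_mult[OF a, of x x] by (simp add: f_def g_def power2_eq_square)
  have ff: "infsum (\<lambda>(u, v). f u * f v) par = (th a (\<lambda>_. 0))\<^sup>2"
    using th_mult[OF a, of "\<lambda>_. 0" "\<lambda>_. 0"] by (simp add: f_def power2_eq_square)
  have gg: "infsum (\<lambda>(u, v). g u * g v) par = th a (\<lambda>j. 2 * x j) * th a (\<lambda>_. 0)"
    using th_mult[OF a, of "\<lambda>j. 2 * x j" "\<lambda>_. 0"] by (simp add: g_def)
  define h where "h = (\<lambda>u. f u - g u)"
  have "(\<lambda>u. f u + g u) summable_on L" using sf by (rule summable_on_add)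
  then have hL: "(\<lambda>u. \<bar>h u\<bar>) summable_on L"
    by (rule summable_le) (use nn in \<open>auto simp: h_def abs_le_iff add_increasing add_increasing2\<close>)
  have h0: "0 \<le> infsum (\<lambda>(u, v). h u * h v) par" by (rule equiv_psd[OF par_equiv hL])
  have sh: "(\<lambda>(u, v). h u * h v) summable_on par"
    by (rule summable_on_subset_banach[OF summable_Times_abs[OF hL hL]]) (auto simp: par_def)
  have "(th a (\<lambda>_. 0))\<^sup>2 + th a (\<lambda>j. 2 * x j) * th a (\<lambda>_. 0) =
    infsum (\<lambda>p. (case p of (u, v) \<Rightarrow> f u * f v) + (case p of (u, v) \<Rightarrow> g u * g v)) par"
    using sm by (subst infsum_add) (auto simp: ff gg)
  also have "\<dots> = infsum (\<lambda>p. (case p of (u, v) \<Rightarrow> h u * h v) + ((case p of (u, v) \<Rightarrow> f u * g v) + (case p of (u, v) \<Rightarrow> g u * f v))) par"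
    by (intro infsum_cong) (auto simp: h_def algebra_simps)
  also have "\<dots> = infsum (\<lambda>(u, v). h u * h v) par + ((th a x)\<^sup>2 + (th a x)\<^sup>2)"
  proof -
    have s1: "(\<lambda>(u, v). f u * g v) summable_on par" "(\<lambda>(u, v). g u * f v) summable_on par" using sm by auto
    show ?thesis
      by (subst infsum_add[OF sh summable_on_add[OF s1]], subst infsum_add[OF s1]) (simp only: fg[symmetric] gf)
  qed
  finally show ?thesis using h0 by simp
qed

text \<open>Taking suprema in \<open>th_double\<close> gives
  \<open>2 * S\<^sup>2 \<le> T\<^sup>2 + S * T\<close>, that is
  \<open>(S - T) * (2 * S + T) \<le> 0\<close>, where \<open>S\<close> is the supremum and
  \<open>T\<close> the value at 0.\<close>

lemma th_le: assumes a: "a > 0" shows "th a x \<le> th a (\<lambda>_. 0)"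
proof -
  define T where "T = th a (\<lambda>_. 0)"
  define S where "S = (SUP x. th a x)"
  obtain K where K: "\<And>x. th a x \<le> K" using th_bounded[OF a] by blast
  then have bdd: "bdd_above (range (th a))" by (intro bdd_aboveI2[of _ _ K]) auto
  have le: "th a x \<le> S" for x unfolding S_def using bdd by (intro cSUP_upper) auto
  have T: "T > 0" "T \<le> S" using th_pos[OF a] le by (auto simp: T_def)
  have "th a x \<le> sqrt ((T\<^sup>2 + S * T) / 2)" for x
  proof (rule real_le_rsqrt)
    have "(th a x)\<^sup>2 \<le> (T\<^sup>2 + th a (\<lambda>j. 2 * x j) * T) / 2" using th_double[OF a] by (simp add: T_def)
    also have "\<dots> \<le> (T\<^sup>2 + S * T) / 2" using le T by (intro divide_right_mono add_left_mono mult_right_mono) auto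
    finally show "(th a x)\<^sup>2 \<le> (T\<^sup>2 + S * T) / 2" .
  qed
  then have "S \<le> sqrt ((T\<^sup>2 + S * T) / 2)" unfolding S_def by (intro cSUP_least) auto
  then have "S\<^sup>2 \<le> (T\<^sup>2 + S * T) / 2"
  proof -
    have "0 \<le> S * T" using T by simp
    moreover assume "S \<le> sqrt ((T\<^sup>2 + S * T) / 2)"
    then have "S\<^sup>2 \<le> (sqrt ((T\<^sup>2 + S * T) / 2))\<^sup>2" using T by (intro power_mono) auto
    ultimately show ?thesis by simp
  qed
  then have "(S - T) * (2 * S + T) \<le> 0" by (simp add: power2_eq_square algebra_simps)
  then have "S \<le> T" using T by (simp add: mult_le_0_iff)
  then show ?thesis using le[of x] by (simp add: T_def)
qed


section \<open>Second moments and growth of the mass\<close>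

definition mom :: "real \<Rightarrow> nat \<Rightarrow> real" where
  "mom a i = infsum (\<lambda>y. (of_int (y i))\<^sup>2 * exp (- a * nq n y (\<lambda>_. 0))) L"

lemma summ_mom:
  assumes a: "a > 0" and i: "i < n"
  shows "(\<lambda>y. (of_int (y i))\<^sup>2 * exp (- a * nq n y (\<lambda>_. 0))) summable_on L"
proof -
  have "(\<lambda>y. (2 / a) * exp (- (a / 2) * nq n y (\<lambda>_. 0))) summable_on L"
    using a by (intro summable_on_cmult_right summ0) auto
  then show ?thesis
  proof (rule summable_le)
    fix y
    let ?q = "nq n y (\<lambda>_. 0)"
    have "(of_int (y i) + 0 :: real)\<^sup>2 \<le> ?q" unfolding nq_def using i by (intro member_le_sum) auto
    then have "(of_int (y i) :: real)\<^sup>2 \<le> (2 / a) * (a / 2 * ?q)" using a by simp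
    also have "\<dots> \<le> (2 / a) * exp (a / 2 * ?q)"
    proof (rule mult_left_mono)
      show "a / 2 * ?q \<le> exp (a / 2 * ?q)" using exp_ge_add_one_self[of "a / 2 * ?q"] by linarith
    qed (use a in simp)
    finally have "(of_int (y i) :: real)\<^sup>2 * exp (- a * ?q) \<le> (2 / a) * exp (a / 2 * ?q) * exp (- a * ?q)"
      by (intro mult_right_mono) auto
    also have "\<dots> = (2 / a) * exp (- (a / 2) * ?q)"
      unfolding mult.assoc exp_add[symmetric] by (simp add: algebra_simps)
    finally show "(of_int (y i))\<^sup>2 * exp (- a * ?q) \<le> (2 / a) * exp (- (a / 2) * ?q)" .
  qed simp
qed

lemma nq_unit:
  assumes "i < n"
  shows "nq n y (\<lambda>j. if j = i then t else 0) = nq n y (\<lambda>_. 0) + 2 * t * of_int (y i) + t\<^sup>2"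
proof -
  have "nq n y (\<lambda>j. if j = i then t else 0) =
    (\<Sum>j<n. (of_int (y j) + 0)\<^sup>2 + (if j = i then 2 * t * of_int (y i) + t\<^sup>2 else 0))"
    unfolding nq_def by (intro sum.cong) (auto simp: power2_eq_square algebra_simps)
  then show ?thesis using assms by (simp add: sum.distrib nq_def)
qed

text \<open>The quadratic lower bound for twice the hyperbolic cosine, from the monotonicity of the
  difference and of its derivative.\<close>

lemma exp_pair_ge: "2 + u\<^sup>2 \<le> exp u + exp (- u :: real)"
proof -
  have "1 + \<bar>u\<bar> + \<bar>u\<bar>\<^sup>2 / 2 \<le> exp \<bar>u\<bar>" by (rule exp_lower_Taylor_quadratic) simp
  define f where "f v = exp v + exp (- v) - 2 - v\<^sup>2" for v :: real
  have "f 0 \<le> f \<bar>u\<bar>"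
  proof (rule DERIV_nonneg_imp_nondecreasing[of 0 "\<bar>u\<bar>"])
    fix x :: real assume x: "0 \<le> x" "x \<le> \<bar>u\<bar>"
    define g where "g v = exp v - exp (- v) - 2 * v" for v :: real
    have "g 0 \<le> g x"
    proof (rule DERIV_nonneg_imp_nondecreasing[OF x(1)])
      fix z :: real
      have "(g has_real_derivative exp z + exp (- z) - 2) (at z)"
        unfolding g_def by (auto intro!: derivative_eq_intros)
      moreover have "0 \<le> exp z + exp (- z) - 2"
      proof -
        have "0 \<le> (exp (z / 2) - exp (- z / 2))\<^sup>2" by simp
        also have "\<dots> = exp z + exp (- z) - 2"
          by (simp add: power2_eq_square algebra_simps exp_add[symmetric])
        finally show ?thesis .
      qed
      ultimately show "\<exists>y. (g has_real_derivative y) (at z) \<and> 0 \<le> y" by blast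
    qed
    then have "0 \<le> exp x - exp (- x) - 2 * x" by (simp add: g_def)
    moreover have "(f has_real_derivative exp x - exp (- x) - 2 * x) (at x)"
      unfolding f_def by (auto intro!: derivative_eq_intros)
    ultimately show "\<exists>y. (f has_real_derivative y) (at x) \<and> 0 \<le> y" by blast
  qed simp
  then show ?thesis by (cases "u \<ge> 0") (auto simp: f_def)
qed

text \<open>By \<open>th_le\<close> the mass is largest at shift 0, so its second difference along
  an axis is at most 0 there; the moment is what appears in second order.\<close>

lemma mom_le:
  assumes a: "a > 0" and i: "i < n"
  shows "2 * a * mom a i \<le> th a (\<lambda>_. 0)"
proof -
  define T where "T = th a (\<lambda>_. 0)"
  have T: "T > 0" using th_pos[OF a] by (simp add: T_def)
  have key: "2 * a * e * mom a i \<le> (exp e - 1) * T" if e: "e > 0" for e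
  proof -
    \<comment> \<open>The shift is parametrized by the exponent \<open>e = a * t\<^sup>2\<close>
      that it contributes.\<close>
    define t where "t = sqrt (e / a)"
    have t2: "a * t\<^sup>2 = e" using a e by (simp add: t_def)
    let ?x = "\<lambda>t. (\<lambda>j. if j = i then t else 0) :: nat \<Rightarrow> real"
    let ?w = "\<lambda>y. exp (- a * nq n y (\<lambda>_. 0))"
    have s1: "(\<lambda>y. 2 * ?w y) summable_on L" using summ0[OF a] by (rule summable_on_cmult_right)
    have s2: "(\<lambda>y. (4 * a\<^sup>2 * t\<^sup>2) * ((of_int (y i))\<^sup>2 * ?w y)) summable_on L"
      using summ_mom[OF a i] by (rule summable_on_cmult_right)
    have "2 * T + (4 * a\<^sup>2 * t\<^sup>2) * mom a i = infsum (\<lambda>y. 2 * ?w y + (4 * a\<^sup>2 * t\<^sup>2) * ((of_int (y i))\<^sup>2 * ?w y)) L"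
      by (subst infsum_add[OF s1 s2]) (simp add: infsum_cmult_right' mom_def T_def th_def)
    also have "\<dots> \<le> infsum (\<lambda>y. exp e * (exp (- a * nq n y (?x t)) + exp (- a * nq n y (?x (- t))))) L"
    proof (rule infsum_mono)
      show "(\<lambda>y. exp e * (exp (- a * nq n y (?x t)) + exp (- a * nq n y (?x (- t))))) summable_on L"
        using summ[OF a] by (intro summable_on_cmult_right summable_on_add)
      fix y
      let ?u = "2 * a * t * of_int (y i)"
      have "exp e * (exp (- a * nq n y (?x t)) + exp (- a * nq n y (?x (- t)))) = ?w y * (exp (- ?u) + exp ?u)"
        unfolding nq_unit[OF i] distrib_left exp_add[symmetric] t2[symmetric] by (simp add: algebra_simps)
      moreover have "?w y * (2 + ?u\<^sup>2) \<le> ?w y * (exp (- ?u) + exp ?u)"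
        using exp_pair_ge[of ?u] by (intro mult_left_mono) auto
      ultimately show "2 * ?w y + (4 * a\<^sup>2 * t\<^sup>2) * ((of_int (y i))\<^sup>2 * ?w y) \<le>
          exp e * (exp (- a * nq n y (?x t)) + exp (- a * nq n y (?x (- t))))"
        by (simp add: power_mult_distrib algebra_simps)
    qed (use s1 s2 in \<open>rule summable_on_add\<close>)
    also have "\<dots> = exp e * (th a (?x t) + th a (?x (- t)))"
      using summ[OF a] by (simp add: infsum_cmult_right' infsum_add th_def)
    also have "\<dots> \<le> exp e * (T + T)" using th_le[OF a] by (intro mult_left_mono add_mono) (auto simp: T_def)
    finally have le: "2 * T + (4 * a\<^sup>2 * t\<^sup>2) * mom a i \<le> exp e * (T + T)" .
    have "4 * a\<^sup>2 * t\<^sup>2 = 4 * a * e" using t2 by (simp add: power2_eq_square algebra_simps)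
    from le[unfolded this] show ?thesis by (simp add: algebra_simps)
  qed
  \<comment> \<open>Divide \<open>key\<close> by \<open>e\<close>; afterwards \<open>e\<close> tends
    to 0.\<close>
  have "2 * a * mom a i \<le> (1 + e) * T" if e: "0 < e" "e \<le> 1" for e
  proof -
    have "exp e - 1 \<le> e * (1 + e)" using exp_bound[of e] e by (simp add: power2_eq_square algebra_simps)
    then have "(exp e - 1) * T \<le> e * (1 + e) * T" using T by (intro mult_right_mono) auto
    then have "e * (2 * a * mom a i) \<le> e * ((1 + e) * T)" using key[OF e(1)] by (simp add: algebra_simps)
    then show ?thesis using e by simp
  qed
  moreover have "2 * a * mom a i \<le> T" if *: "\<And>e. 0 < e \<Longrightarrow> e \<le> 1 \<Longrightarrow> 2 * a * mom a i \<le> (1 + e) * T"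
  proof (rule field_le_epsilon)
    fix d :: real assume d: "d > 0"
    have "2 * a * mom a i \<le> (1 + min 1 (d / T)) * T" using d T by (intro *) auto
    also have "\<dots> \<le> T + d" using T d by (simp add: algebra_simps min_def field_simps)
    finally show "2 * a * mom a i \<le> T + d" .
  qed
  ultimately show ?thesis by (simp add: T_def)
qed

lemma second_moment:
  assumes a: "a > 0"
  shows "(\<lambda>y. nq n y (\<lambda>_. 0) * exp (- a * nq n y (\<lambda>_. 0))) summable_on L"
    and "infsum (\<lambda>y. nq n y (\<lambda>_. 0) * exp (- a * nq n y (\<lambda>_. 0))) L \<le> real n / (2 * a) * th a (\<lambda>_. 0)"
proof -
  let ?w = "\<lambda>y. exp (- a * nq n y (\<lambda>_. 0))"
  have e: "(\<lambda>y. nq n y (\<lambda>_. 0) * ?w y) = (\<lambda>y. \<Sum>i<n. (of_int (y i))\<^sup>2 * ?w y)"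
    by (simp add: nq_def sum_distrib_right fun_eq_iff)
  show "(\<lambda>y. nq n y (\<lambda>_. 0) * ?w y) summable_on L"
    unfolding e using infsum_sum_finite[of "{..<n}" _ L] summ_mom[OF a] by auto
  have "infsum (\<lambda>y. nq n y (\<lambda>_. 0) * ?w y) L = (\<Sum>i<n. mom a i)"
    unfolding e mom_def using infsum_sum_finite[of "{..<n}" _ L] summ_mom[OF a] by auto
  also have "\<dots> \<le> (\<Sum>i<n. th a (\<lambda>_. 0) / (2 * a))"
    using mom_le[OF a] a by (intro sum_mono) (auto simp: field_simps)
  finally show "infsum (\<lambda>y. nq n y (\<lambda>_. 0) * ?w y) L \<le> real n / (2 * a) * th a (\<lambda>_. 0)" by simp
qed

text \<open>The tangent inequality \<open>1 + z \<le> exp z\<close> for the change of rate, summed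
  over the lattice: up to sign, the second moment is the derivative of the mass in the rate.\<close>

lemma th_step:
  assumes "0 < b" "b \<le> c"
  shows "th b (\<lambda>_. 0) * (1 - (c - b) * (real n / (2 * b))) \<le> th c (\<lambda>_. 0)"
proof -
  let ?w = "\<lambda>y. exp (- b * nq n y (\<lambda>_. 0))" and ?q = "\<lambda>y. nq n y (\<lambda>_. 0)"
  note sm = second_moment[OF assms(1)]
  have s1: "(\<lambda>y. - (c - b) * (?q y * ?w y)) summable_on L" using sm(1) by (rule summable_on_cmult_right)
  have "th b (\<lambda>_. 0) * (1 - (c - b) * (real n / (2 * b))) = th b (\<lambda>_. 0) - (c - b) * (real n / (2 * b) * th b (\<lambda>_. 0))"
    by (simp add: algebra_simps)
  also have "\<dots> \<le> th b (\<lambda>_. 0) + - (c - b) * infsum (\<lambda>y. ?q y * ?w y) L"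
  proof -
    have "(c - b) * infsum (\<lambda>y. ?q y * ?w y) L \<le> (c - b) * (real n / (2 * b) * th b (\<lambda>_. 0))"
      using assms by (intro mult_left_mono[OF sm(2)]) auto
    then show ?thesis unfolding mult_minus_left by linarith
  qed
  also have "\<dots> = infsum (\<lambda>y. ?w y + - (c - b) * (?q y * ?w y)) L"
    unfolding th_def using summ0[OF assms(1)] s1 by (subst infsum_add) (simp_all only: infsum_cmult_right')
  also have "\<dots> \<le> th c (\<lambda>_. 0)" unfolding th_def
  proof (rule infsum_mono)
    show "(\<lambda>y. ?w y + - (c - b) * (?q y * ?w y)) summable_on L" using summ0[OF assms(1)] s1 by (rule summable_on_add)
    show "(\<lambda>y. exp (- c * ?q y)) summable_on L" using assms by (intro summ0) auto
    fix y
    have "?w y * (1 + - (c - b) * ?q y) \<le> ?w y * exp (- (c - b) * ?q y)"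
      by (intro mult_left_mono exp_ge_add_one_self) simp
    also have "\<dots> = exp (- c * ?q y)" unfolding exp_add[symmetric] by (simp add: algebra_simps)
    finally show "?w y + - (c - b) * (?q y * ?w y) \<le> exp (- c * ?q y)" by (simp add: algebra_simps)
  qed
  finally show ?thesis .
qed

text \<open>The rate goes from \<open>b\<close> to \<open>a\<close> in \<open>N\<close> geometric
  steps with \<open>q ^ N = a / b\<close>. By \<open>th_step\<close> each of them keeps at least the
  fraction \<open>1 - (n / 2) * (q - 1)\<close> of the mass, and for large \<open>N\<close> the
  product tends to the exponential in the claim.\<close>

lemma growth:
  assumes "0 < b" "b \<le> a"
  shows "th b (\<lambda>_. 0) * exp (- (real n / 2) * ln (a / b)) \<le> th a (\<lambda>_. 0)"
proof -
  define l where "l = ln (a / b)"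
  have l: "l \<ge> 0" using assms by (simp add: l_def)
  define c where "c = real n / 2"
  have c: "c \<ge> 0" by (simp add: c_def)
  have it: "th b (\<lambda>_. 0) * (1 - c * (exp (l / real N) - 1)) ^ N \<le> th a (\<lambda>_. 0)"
    if N: "N > 0" "c * (exp (l / real N) - 1) \<le> 1" for N
  proof -
    define q where "q = exp (l / real N)"
    have q: "q \<ge> 1" "q ^ N = a / b" using N(1) l assms by (auto simp: q_def exp_of_nat_mult[symmetric] l_def)
    have "th b (\<lambda>_. 0) * (1 - c * (q - 1)) ^ k \<le> th (b * q ^ k) (\<lambda>_. 0)" for k
    proof (induction k)
      case (Suc k)
      have bq: "b * q ^ k > 0" using assms q by simp
      have "th b (\<lambda>_. 0) * (1 - c * (q - 1)) ^ Suc k \<le> th (b * q ^ k) (\<lambda>_. 0) * (1 - c * (q - 1))"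
        using mult_right_mono[OF Suc, of "1 - c * (q - 1)"] N(2) by (simp add: q_def algebra_simps)
      also have "\<dots> = th (b * q ^ k) (\<lambda>_. 0) * (1 - (b * q ^ Suc k - b * q ^ k) * (real n / (2 * (b * q ^ k))))"
        using bq assms q by (simp add: c_def field_simps)
      also have "\<dots> \<le> th (b * q ^ Suc k) (\<lambda>_. 0)"
        using bq q assms by (intro th_step) (auto simp: mult_le_cancel_left1)
      finally show ?case .
    qed simp
    from this[of N] show ?thesis using q assms by (simp add: q_def)
  qed
  have lim: "(\<lambda>N. (1 - c * (exp (l / real N) - 1)) ^ N) \<longlonglongrightarrow> exp (- c * l)"
    by real_asymp
  have "eventually (\<lambda>N. c * (exp (l / real N) - 1) < 1) sequentially"
  proof (rule order_tendstoD(2))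
    show "(\<lambda>N. c * (exp (l / real N) - 1)) \<longlonglongrightarrow> 0" by real_asymp
  qed simp
  then have "eventually (\<lambda>N. th b (\<lambda>_. 0) * (1 - c * (exp (l / real N) - 1)) ^ N \<le> th a (\<lambda>_. 0)) sequentially"
    using eventually_gt_at_top[of 0] by eventually_elim (intro it, auto)
  then have "th b (\<lambda>_. 0) * exp (- c * l) \<le> th a (\<lambda>_. 0)"
    by (intro tendsto_upperbound[OF tendsto_mult_left[OF lim]]) auto
  then show ?thesis by (simp add: c_def l_def)
qed

text \<open>Replace \<open>x\<close> by \<open>x' = c + x\<close> and pair the summands at
  \<open>x'\<close> and \<open>- x'\<close>. By the parallelogram law and the inequality of
  arithmetic and geometric means their average is at least \<open>exp (- a * nq n c x)\<close> times
  the unshifted summand.\<close>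

lemma th_lower:
  assumes a: "a > 0" and c: "c \<in> L"
  shows "exp (- a * nq n c x) * th a (\<lambda>_. 0) \<le> th a x"
proof -
  define x' where "x' = (\<lambda>j. of_int (c j) + x j)"
  have sq': "sq n x' = nq n c x" by (simp add: sq_def nq_def x'_def)
  have nqs: "nq n y x' + nq n y (\<lambda>j. - x' j) = 2 * nq n y (\<lambda>_. 0) + 2 * sq n x'" for y
    unfolding nq_def sq_def sum_distrib_left sum.distrib[symmetric]
    by (intro sum.cong refl) (simp add: power2_eq_square algebra_simps)
  have "2 * (exp (- a * nq n c x) * th a (\<lambda>_. 0)) = infsum (\<lambda>y. 2 * exp (- a * nq n c x) * exp (- a * nq n y (\<lambda>_. 0))) L"
    by (simp add: th_def infsum_cmult_right')
  also have "\<dots> \<le> infsum (\<lambda>y. exp (- a * nq n y x') + exp (- a * nq n y (\<lambda>j. - x' j))) L"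
  proof (rule infsum_mono)
    show "(\<lambda>y. 2 * exp (- a * nq n c x) * exp (- a * nq n y (\<lambda>_. 0))) summable_on L"
      using summ0[OF a] by (rule summable_on_cmult_right)
    show "(\<lambda>y. exp (- a * nq n y x') + exp (- a * nq n y (\<lambda>j. - x' j))) summable_on L"
      using summ[OF a] by (intro summable_on_add)
    fix y
    let ?A = "- a * nq n y x' / 2" and ?B = "- a * nq n y (\<lambda>j. - x' j) / 2"
    have AB: "?A + ?B = - a * nq n c x + - a * nq n y (\<lambda>_. 0)"
    proof -
      have "?A + ?B = - a * (nq n y x' + nq n y (\<lambda>j. - x' j)) / 2" by (simp add: field_simps)
      then show ?thesis unfolding nqs sq' by (simp add: field_simps)
    qed
    have "2 * exp (?A + ?B) \<le> exp (?A + ?A) + exp (?B + ?B)" by (rule exp_sq_le)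
    then show "2 * exp (- a * nq n c x) * exp (- a * nq n y (\<lambda>_. 0)) \<le> exp (- a * nq n y x') + exp (- a * nq n y (\<lambda>j. - x' j))"
      unfolding AB exp_add[of "- a * nq n c x"] by (simp add: mult.assoc)
  qed
  also have "\<dots> = th a x' + th a (\<lambda>j. - x' j)" using summ[OF a] by (simp add: infsum_add th_def)
  also have "\<dots> = 2 * th a x" 
  proof -
    have "th a (\<lambda>j. - x' j) = th a x'" by (rule th_neg)
    moreover have "th a x' = th a x" unfolding x'_def by (rule th_shift[OF c])
    ultimately show ?thesis by simp
  qed
  finally show ?thesis by simp
qed

text \<open>Chernoff's method: beyond squared radius \<open>r\<close> the rate \<open>a\<close> is
  traded for a smaller \<open>b\<close> at a gain of \<open>exp (- (a - b) * r)\<close>;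
  \<open>th_le\<close> and \<open>growth\<close> lead back to rate \<open>a\<close>. The choice of
  \<open>b\<close> is left open.\<close>

lemma tail:
  assumes ab: "0 < b" "b \<le> a"
  shows "infsum (\<lambda>y. exp (- a * nq n y x)) {y\<in>L. nq n y x > r} \<le>
    exp (- (a - b) * r + (real n / 2) * ln (a / b)) * th a (\<lambda>_. 0)"
proof -
  have a: "a > 0" using ab by simp
  have sub: "{y\<in>L. nq n y x > r} \<subseteq> L" by auto
  have sb: "(\<lambda>y. exp (- (a - b) * r) * exp (- b * nq n y x)) summable_on L"
    using summ[OF ab(1)] by (rule summable_on_cmult_right)
  have "infsum (\<lambda>y. exp (- a * nq n y x)) {y\<in>L. nq n y x > r} \<le> infsum (\<lambda>y. exp (- (a - b) * r) * exp (- b * nq n y x)) L"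
  proof (rule infsum_mono_neutral)
    show "(\<lambda>y. exp (- a * nq n y x)) summable_on {y\<in>L. nq n y x > r}" using summ[OF a] sub by (rule summable_on_subset_banach)
    fix y assume "y \<in> {y\<in>L. nq n y x > r} \<inter> L"
    then have "(a - b) * r \<le> (a - b) * nq n y x" using ab by (intro mult_left_mono) auto
    then show "exp (- a * nq n y x) \<le> exp (- (a - b) * r) * exp (- b * nq n y x)"
      unfolding exp_add[symmetric] by (simp add: algebra_simps)
  qed (use sb sub in auto)
  also have "\<dots> = exp (- (a - b) * r) * th b x" by (simp add: infsum_cmult_right' th_def)
  also have "\<dots> \<le> exp (- (a - b) * r) * th b (\<lambda>_. 0)" using th_le[OF ab(1)] by (intro mult_left_mono) auto
  also have "\<dots> \<le> exp (- (a - b) * r) * (exp ((real n / 2) * ln (a / b)) * th a (\<lambda>_. 0))"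
  proof (intro mult_left_mono)
    let ?u = "(real n / 2) * ln (a / b)"
    have "th b (\<lambda>_. 0) * exp (- ?u) * exp ?u \<le> th a (\<lambda>_. 0) * exp ?u"
      using growth[OF ab] by (intro mult_right_mono) auto
    then show "th b (\<lambda>_. 0) \<le> exp ?u * th a (\<lambda>_. 0)"
      unfolding mult.assoc exp_add[symmetric] by (simp add: mult.commute)
  qed simp
  finally show ?thesis by (simp add: exp_add mult.assoc)
qed

lemma good_mass:
  assumes ab: "0 < b" "b \<le> a" and c: "c \<in> L"
  shows "(exp (- a * nq n c x) - exp (- (a - b) * r + (real n / 2) * ln (a / b))) * th a (\<lambda>_. 0)
    \<le> infsum (\<lambda>y. exp (- a * nq n y x)) {y\<in>L. nq n y x \<le> r}"
proof -
  have a: "a > 0" using ab by simp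
  have u: "L = {y\<in>L. nq n y x \<le> r} \<union> {y\<in>L. nq n y x > r}" by auto
  have "th a x = infsum (\<lambda>y. exp (- a * nq n y x)) {y\<in>L. nq n y x \<le> r} + infsum (\<lambda>y. exp (- a * nq n y x)) {y\<in>L. nq n y x > r}"
    unfolding th_def 
    by (subst u, rule infsum_Un_disjoint; (rule summable_on_subset_banach[OF summ[OF a]])?) auto
  then show ?thesis using th_lower[OF a c, of x] tail[OF ab, of x r] by (simp add: algebra_simps)
qed

end

section \<open>Probability estimates\<close>

lemma pmf_infsum: "measure_pmf.prob p A = infsum (pmf p) A"
  unfolding measure_pmf_conv_infsetsum by (rule infsetsum_infsum) auto

lemma pmf_summable_on: "pmf p summable_on A"
  using abs_summable_equivalent[of "pmf p" A] by (auto intro: abs_summable_summable)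

text \<open>The two probabilities of \<open>A\<close> differ by a sum over \<open>A\<close>, and in
  the opposite sense by a sum over the complement. Adding both uses the full sum, which explains the
  factor 1/2 in \<open>stat_dist\<close>.\<close>

lemma stat_dist_prob:
  assumes "stat_dist p q \<le> \<epsilon>"
  shows "measure_pmf.prob q A - \<epsilon> \<le> measure_pmf.prob p A"
proof -
  let ?f = "\<lambda>x. \<bar>pmf p x - pmf q x\<bar>"
  have sp: "(\<lambda>x. pmf p x + pmf q x) summable_on A" for A by (intro summable_on_add pmf_summable_on)
  have sf: "?f summable_on A" for A
  proof (rule nonneg_bdd_above_summable_on)
    have "sum ?f F \<le> infsum (\<lambda>x. pmf p x + pmf q x) A" if "F \<subseteq> A" "finite F" for F
    proof -
      have "sum ?f F \<le> sum (\<lambda>x. pmf p x + pmf q x) F" by (intro sum_mono) (auto simp: abs_le_iff add_increasing add_increasing2)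
      also have "\<dots> \<le> infsum (\<lambda>x. pmf p x + pmf q x) A" using that by (intro finite_sum_le_infsum sp) auto
      finally show ?thesis .
    qed
    then show "bdd_above (sum ?f ` {F. F \<subseteq> A \<and> finite F})" by (intro bdd_aboveI2) auto
  qed auto
  have part: "infsum (pmf r) A \<le> infsum (pmf r') A + infsum ?f A" if "{r, r'} = {p, q}" for r r' A
  proof -
    have "infsum (pmf r) A \<le> infsum (\<lambda>x. pmf r' x + ?f x) A"
      by (intro infsum_mono pmf_summable_on summable_on_add sf) (use that in \<open>auto simp: doubleton_eq_iff\<close>)
    also have "\<dots> = infsum (pmf r') A + infsum ?f A" by (intro infsum_add pmf_summable_on sf)
    finally show ?thesis .
  qed
  have u: "UNIV = A \<union> - A" by auto
  have "infsum ?f UNIV = infsum ?f A + infsum ?f (- A)"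
    by (subst u, rule infsum_Un_disjoint) (auto intro: sf)
  moreover have c: "infsum (pmf r) A + infsum (pmf r) (- A) = 1" for r
    unfolding pmf_infsum[symmetric] using measure_pmf.prob_compl[of A r] by (simp add: Compl_eq_Diff_UNIV)
  moreover have 1: "infsum (pmf q) A \<le> infsum (pmf p) A + infsum ?f A" by (intro part) auto
  moreover have 2: "infsum (pmf p) (- A) \<le> infsum (pmf q) (- A) + infsum ?f (- A)" by (intro part) auto
  ultimately have "2 * (infsum (pmf q) A - infsum (pmf p) A) \<le> infsum ?f UNIV"
    using c[of p] c[of q] by argo
  then show ?thesis using assms unfolding stat_dist_def pmf_infsum by simp
qed

lemma replicate_pmf_none:
  "measure_pmf.prob (replicate_pmf m p) {xs. \<forall>x\<in>set xs. x \<notin> G} = (1 - measure_pmf.prob p G) ^ m"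
proof -
  have c: "1 - measure_pmf.prob p G = measure_pmf.prob p (- G)"
    using measure_pmf.prob_compl[of G p] by (simp add: Compl_eq_Diff_UNIV)
  have "emeasure (replicate_pmf m p) {xs. \<forall>x\<in>set xs. x \<notin> G} = emeasure p (- G) ^ m"
  proof (induction m)
    case 0
    show ?case by (simp add: indicator_def)
  next
    case (Suc m)
    have "emeasure (replicate_pmf (Suc m) p) {xs. \<forall>x\<in>set xs. x \<notin> G} =
      (\<integral>\<^sup>+x. \<integral>\<^sup>+xs. indicator {xs. \<forall>x\<in>set xs. x \<notin> G} (x # xs) \<partial>replicate_pmf m p \<partial>p)"
      by simp
    also have "\<dots> = (\<integral>\<^sup>+x. indicator (- G) x * (\<integral>\<^sup>+xs. indicator {xs. \<forall>x\<in>set xs. x \<notin> G} xs \<partial>replicate_pmf m p) \<partial>p)"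
      by (subst nn_integral_cmult[symmetric]) (auto intro!: nn_integral_cong simp: indicator_def)
    also have "\<dots> = emeasure p (- G) * emeasure p (- G) ^ m" using Suc by (simp add: nn_integral_multc)
    finally show ?case by simp
  qed
  then show ?thesis unfolding c measure_pmf.emeasure_eq_measure
    by (simp add: ennreal_power)
qed

text \<open>\<open>B\<close> collects the outcomes of the first stage after which failure is still
  possible.\<close>

lemma bind_prob_le:
  assumes "\<And>x. x \<in> set_pmf M \<Longrightarrow> measure_pmf.prob (N x) A \<le> (if x \<in> B then c else 0)"
    and "measure_pmf.prob M B \<le> \<delta>" "0 \<le> c"
  shows "measure_pmf.prob (bind_pmf M N) A \<le> \<delta> * c"
proof -
  have \<delta>: "0 \<le> \<delta>" using assms(2) measure_nonneg[of "measure_pmf M" B] by linarith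
  have "emeasure (bind_pmf M N) A = (\<integral>\<^sup>+x. emeasure (N x) A \<partial>M)" by simp
  also have "\<dots> \<le> (\<integral>\<^sup>+x. ennreal c * indicator B x \<partial>M)"
  proof (rule nn_integral_mono_AE, unfold AE_measure_pmf_iff, rule ballI)
    fix x assume "x \<in> set_pmf M"
    then show "emeasure (N x) A \<le> ennreal c * indicator B x"
      using assms(1)[of x] by (cases "x \<in> B") (auto simp: measure_pmf.emeasure_eq_measure intro: ennreal_leI antisym)
  qed
  also have "\<dots> = ennreal c * ennreal (measure_pmf.prob M B)"
    by (simp add: nn_integral_cmult measure_pmf.emeasure_eq_measure)
  also have "\<dots> \<le> ennreal c * ennreal \<delta>" using assms by (intro mult_left_mono ennreal_leI) auto
  also have "\<dots> = ennreal (\<delta> * c)" using assms \<delta> by (simp add: ennreal_mult mult.commute)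
  finally show ?thesis using assms(3) \<delta> by (simp add: measure_pmf.emeasure_eq_measure)
qed

text \<open>\<open>Good\<close> is never lost, so the loop fails only if every round does; the
  bounds hold conditionally on the state before a round, which lets them multiply although rounds
  share their state. \<open>Fin\<close> holds on every run.\<close>

lemma loop_prob:
  assumes step: "\<And>g \<sigma>. g < G \<Longrightarrow> Inv g \<sigma> \<Longrightarrow> bval (mem \<sigma>) b \<and>
      (let p = exec orc fuel c (tick (1 + bcost (mem \<sigma>) b) \<sigma>) in
        None \<notin> set_pmf p \<and> (\<forall>\<tau>. Some \<tau> \<in> set_pmf p \<longrightarrow> Inv (Suc g) \<tau> \<and> (Good \<sigma> \<longrightarrow> Good \<tau>)) \<and>
        (\<not> Good \<sigma> \<longrightarrow> measure_pmf.prob p {Some \<tau> | \<tau>. \<not> Good \<tau>} \<le> \<delta> g))"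
    and fin: "\<And>\<sigma>. Inv G \<sigma> \<Longrightarrow> \<not> bval (mem \<sigma>) b \<and> Fin (tick (1 + bcost (mem \<sigma>) b) \<sigma>) \<and>
       (Good \<sigma> \<longrightarrow> Good (tick (1 + bcost (mem \<sigma>) b) \<sigma>))"
    and \<delta>: "\<And>g. 0 \<le> \<delta> g"
    and "Inv g \<sigma>" "g \<le> G" "k > G - g"
  shows "let res = (loopF orc fuel b c ^^ k) (\<lambda>\<sigma>. return_pmf None) \<sigma> in
     None \<notin> set_pmf res \<and> (\<forall>\<tau>. Some \<tau> \<in> set_pmf res \<longrightarrow> Fin \<tau>) \<and>
     measure_pmf.prob res {Some \<tau> | \<tau>. \<not> Good \<tau>} \<le> (if Good \<sigma> then 0 else \<Prod>i\<in>{g..<G}. \<delta> i)"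
  using assms(4-6)
proof (induction "G - g" arbitrary: g \<sigma> k)
  case 0
  then have g: "g = G" by simp
  obtain k' where k: "k = Suc k'" using 0 by (cases k) auto
  have "(loopF orc fuel b c ^^ k) (\<lambda>\<sigma>. return_pmf None) \<sigma> = return_pmf (Some (tick (1 + bcost (mem \<sigma>) b) \<sigma>))"
    unfolding k loopF_Suc using fin[of \<sigma>] 0 g by (simp add: Let_def)
  then show ?case using fin[of \<sigma>] 0 g by (auto simp: Let_def)
next
  case (Suc r)
  then have g: "g < G" by simp
  obtain k' where k: "k = Suc k'" using Suc by (cases k) auto
  define p where "p = exec orc fuel c (tick (1 + bcost (mem \<sigma>) b) \<sigma>)"
  define K where "K = case_option (return_pmf None) ((loopF orc fuel b c ^^ k') (\<lambda>\<sigma>. return_pmf None))"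
  have st: "bval (mem \<sigma>) b" "None \<notin> set_pmf p" "\<And>\<tau>. Some \<tau> \<in> set_pmf p \<Longrightarrow> Inv (Suc g) \<tau>"
    "\<And>\<tau>. Some \<tau> \<in> set_pmf p \<Longrightarrow> Good \<sigma> \<Longrightarrow> Good \<tau>"
    "\<not> Good \<sigma> \<Longrightarrow> measure_pmf.prob p {Some \<tau> | \<tau>. \<not> Good \<tau>} \<le> \<delta> g"
    using step[OF g Suc(3)] by (auto simp: Let_def p_def)
  have e: "(loopF orc fuel b c ^^ k) (\<lambda>\<sigma>. return_pmf None) \<sigma> = bind_pmf p K"
    unfolding k loopF_Suc using st(1) by (simp add: Let_def p_def K_def)
  have IH: "None \<notin> set_pmf (K x)" "\<And>\<tau>'. Some \<tau>' \<in> set_pmf (K x) \<Longrightarrow> Fin \<tau>'"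
    "measure_pmf.prob (K x) {Some \<tau> | \<tau>. \<not> Good \<tau>} \<le> (if x \<in> {Some \<tau> | \<tau>. \<not> Good \<tau>} then \<Prod>i\<in>{Suc g..<G}. \<delta> i else 0)"
    if x: "x \<in> set_pmf p" for x
  proof -
    obtain \<tau> where \<tau>: "x = Some \<tau>" using x st(2) by (cases x) auto
    have "r = G - Suc g" "Suc g \<le> G" "k' > G - Suc g" using Suc k by auto
    from Suc(1)[OF this(1) st(3)[of \<tau>] this(2,3)] x
    show "None \<notin> set_pmf (K x)" "\<And>\<tau>'. Some \<tau>' \<in> set_pmf (K x) \<Longrightarrow> Fin \<tau>'"
      "measure_pmf.prob (K x) {Some \<tau> | \<tau>. \<not> Good \<tau>} \<le> (if x \<in> {Some \<tau> | \<tau>. \<not> Good \<tau>} then \<Prod>i\<in>{Suc g..<G}. \<delta> i else 0)"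
      by (auto simp: \<tau> K_def Let_def)
  qed
  have P: "0 \<le> (\<Prod>i\<in>{Suc g..<G}. \<delta> i)" using \<delta> by (intro prod_nonneg) auto
  have "measure_pmf.prob (bind_pmf p K) {Some \<tau> | \<tau>. \<not> Good \<tau>} \<le> (if Good \<sigma> then 0 else \<delta> g) * (\<Prod>i\<in>{Suc g..<G}. \<delta> i)"
  proof (rule bind_prob_le[OF IH(3)])
    show "measure_pmf.prob p {Some \<tau> | \<tau>. \<not> Good \<tau>} \<le> (if Good \<sigma> then 0 else \<delta> g)"
    proof (cases "Good \<sigma>")
      case True
      then have "set_pmf p \<inter> {Some \<tau> | \<tau>. \<not> Good \<tau>} = {}" using st(4) by auto
      then have "measure_pmf.prob p {Some \<tau> | \<tau>. \<not> Good \<tau>} = 0" by (simp only: measure_pmf_zero_iff)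
      then show ?thesis using True by simp
    qed (use st(5) in simp)
  qed (use P in auto)
  moreover have "(\<Prod>i\<in>{g..<G}. \<delta> i) = \<delta> g * (\<Prod>i\<in>{Suc g..<G}. \<delta> i)"
    using g by (subst prod.atLeast_Suc_lessThan) auto
  ultimately have "measure_pmf.prob (bind_pmf p K) {Some \<tau> | \<tau>. \<not> Good \<tau>} \<le> (if Good \<sigma> then 0 else \<Prod>i\<in>{g..<G}. \<delta> i)"
    by (auto split: if_splits)
  then show ?case unfolding e Let_def using IH by auto
qed

section \<open>Numerical constants\<close>

lemma exp_ge_sum: "0 \<le> x \<Longrightarrow> (\<Sum>k<N. x ^ k / fact k) \<le> exp (x::real)"
proof -
  assume x: "0 \<le> x"
  obtain t where "exp x = (\<Sum>m<N. (x ^ m) / fact m) + (exp t / fact N) * x ^ N" using Maclaurin_exp_le[of x N] by blast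
  then show ?thesis using x by simp
qed

text \<open>Bounding the exponential of a negative number gives a remainder of even order, which is
  nonnegative. Half of the constant is the 0.34651 in \<open>window\<close>, just above the end
  0.3465 of the window.\<close>

lemma ln2_lower: "69302 / 100000 \<le> ln (2::real)"
proof -
  obtain t where "exp (- (69302 / 100000) :: real) = (\<Sum>m<8. (- (69302 / 100000)) ^ m / fact m) + (exp t / fact 8) * (- (69302 / 100000)) ^ 8"
    using Maclaurin_exp_le[of "- (69302 / 100000)" 8] by blast
  moreover have "(exp t / fact 8) * (- (69302 / 100000)) ^ 8 \<ge> (0::real)" by simp
  moreover have "(\<Sum>m<8. (- (69302 / 100000 :: real)) ^ m / fact m) \<ge> 1 / 2"
    by (simp add: eval_nat_numeral)
  ultimately have "exp (- (69302 / 100000) :: real) \<ge> 1 / 2" by linarith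
  then have "exp (69302 / 100000 :: real) \<le> 2" by (simp add: exp_minus field_simps)
  then show ?thesis by (subst ln_ge_iff) auto
qed

lemma ln269_upper: "ln (269 / 100 :: real) \<le> 99 / 100"
proof -
  have "(269 / 100 :: real) \<le> (\<Sum>k<8. (99 / 100) ^ k / fact k)" by (simp add: eval_nat_numeral)
  also have "\<dots> \<le> exp (99 / 100)" by (rule exp_ge_sum) simp
  finally show ?thesis by (subst ln_le_cancel_iff[of _ "exp (99/100)", unfolded ln_exp]) auto
qed

text \<open>The closest vector has weight at least \<open>exp (- 0.3465 * n)\<close> and the batch
  at least \<open>exp (0.34651 * n) / 2\<close> samples, which leaves
  \<open>exp (n / 100000)\<close> to absorb the constant \<open>K\<close>. The tail is smaller by
  another factor \<open>exp (- n / 1000)\<close>. The ratio 2.69 of the rates is close to the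
  optimal \<open>1.97\<^sup>2 * ln 2\<close>.\<close>

lemma window:
  fixes K :: real assumes K: "K > 0"
  shows "\<exists>n0. \<forall>n\<ge>n0. \<forall>\<beta>. 345 / 1000 \<le> \<beta> \<longrightarrow> \<beta> \<le> 3465 / 10000 \<longrightarrow>
    1 \<le> real (nat \<lfloor>2 powr (real n / 2)\<rfloor>) * (K * (exp (- \<beta> * real n) -
      exp (- (1 - 100 / 269) * (197 / 100)\<^sup>2 * \<beta> * real n + real n / 2 * ln (269 / 100))))"
proof -
  have "eventually (\<lambda>n. 1 \<le> 1 / 2 * K * exp (real n / 100000) * (1 - exp (- (real n / 1000)))) sequentially"
    using K by real_asymp
  then obtain n0 where n0: "\<And>n. n \<ge> n0 \<Longrightarrow> 1 \<le> 1 / 2 * K * exp (real n / 100000) * (1 - exp (- (real n / 1000)))"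
    by (auto simp: eventually_sequentially)
  show ?thesis
  proof (intro exI allI impI)
    fix n \<beta> assume n: "n \<ge> n0" and \<beta>: "345 / 1000 \<le> \<beta>" "\<beta> \<le> (3465 / 10000 :: real)"
    let ?y = "2 powr (real n / 2)"
    have y1: "1 \<le> ?y" by (simp add: ge_one_powr_ge_zero)
    have "1 \<le> \<lfloor>?y\<rfloor>" using y1 by (simp add: le_floor_iff)
    then have fl: "?y / 2 \<le> real (nat \<lfloor>?y\<rfloor>)" by linarith
    have "exp (34651 / 100000 * real n) \<le> ?y"
    proof -
      have "34651 / 100000 * real n \<le> real n / 2 * ln 2"
        using mult_left_mono[OF ln2_lower, of "real n / 2"] by simp
      then show ?thesis by (simp add: powr_def)
    qed
    then have m: "exp (34651 / 100000 * real n) / 2 \<le> real (nat \<lfloor>?y\<rfloor>)" using fl by linarith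
    define E where "E = exp (- \<beta> * real n)"
    have tail: "exp (- (1 - 100 / 269) * (197 / 100)\<^sup>2 * \<beta> * real n + real n / 2 * ln (269 / 100)) \<le> E * exp (- (real n / 1000))"
    proof -
      \<comment> \<open>The coefficient of \<beta> on the left is about \<open>- 2.44\<close>, so
        the slack grows with \<beta> and the lower end 0.345 decides.\<close>
      have "- (1 - 100 / 269) * (197 / 100)\<^sup>2 * \<beta> + 1 / 2 * ln (269 / 100) \<le> - \<beta> - 1 / 1000"
        using ln269_upper \<beta>(1) by (simp add: power2_eq_square)
      from mult_right_mono[OF this, of "real n"]
      show ?thesis unfolding E_def exp_add[symmetric] by (simp add: algebra_simps)
    qed
    have "1 \<le> 1 / 2 * K * exp (real n / 100000) * (1 - exp (- (real n / 1000)))" using n0[OF n] .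
    also have "exp (real n / 100000) \<le> exp (34651 / 100000 * real n) * E"
      unfolding E_def exp_add[symmetric] using mult_right_mono[OF \<beta>(2), of "real n"] by simp
    then have "1 / 2 * K * exp (real n / 100000) * (1 - exp (- (real n / 1000))) \<le>
        1 / 2 * K * (exp (34651 / 100000 * real n) * E) * (1 - exp (- (real n / 1000)))"
      using K by (intro mult_right_mono mult_left_mono) auto
    also have "\<dots> = (exp (34651 / 100000 * real n) / 2) * (K * (E - E * exp (- (real n / 1000))))"
      by (simp add: algebra_simps)
    also have "\<dots> \<le> real (nat \<lfloor>?y\<rfloor>) * (K * (E - exp (- (1 - 100 / 269) * (197 / 100)\<^sup>2 * \<beta> * real n + real n / 2 * ln (269 / 100))))"
    proof (rule mult_mono[OF m])
      show "K * (E - E * exp (- (real n / 1000))) \<le> K * (E - exp (- (1 - 100 / 269) * (197 / 100)\<^sup>2 * \<beta> * real n + real n / 2 * ln (269 / 100)))"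
        using tail K by (intro mult_left_mono diff_left_mono) auto
      have "E * exp (- (real n / 1000)) \<le> E * 1" unfolding E_def by (intro mult_left_mono) auto
      then show "0 \<le> K * (E - E * exp (- (real n / 1000)))" using K by simp
    qed simp
    finally show "1 \<le> real (nat \<lfloor>?y\<rfloor>) * (K * (exp (- \<beta> * real n) - exp (- (1 - 100 / 269) * (197 / 100)\<^sup>2 * \<beta> * real n + real n / 2 * ln (269 / 100))))"
      by (simp add: E_def)
  qed
qed

section \<open>The lattice of a query\<close>

lemma indep_of_gsn:
  assumes "\<And>j. j < d \<Longrightarrow> gsn n b j > 0" "\<And>x. x < n \<Longrightarrow> lc d c b x = 0" "i < d"
  shows "c i = 0"
  using assms
proof (induction d)
  case (Suc k)
  have "mu n b (lc (Suc k) c b) k = mu n b (\<lambda>x. 0) k"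
    unfolding mu_def using Suc(3) by (intro arg_cong2[where f = "(/)"] ip_cong refl) auto
  moreover have "mu n b (lc (Suc k) c b) k = c k" using Suc(2) by (intro mu_lc_top) auto
  ultimately have ck: "c k = 0" by (auto simp: mu_def)
  then have "lc k c b x = 0" if "x < n" for x using Suc(3)[OF that] by (simp add: lc_Suc)
  then show ?case using Suc(1,2,4) ck by (cases "i = k") auto
qed simp

lemma mat_of_cols_mult:
  fixes B :: "real vec list"
  assumes "j < n" "c \<in> carrier_vec (length B)" "set B \<subseteq> carrier_vec n"
  shows "(mat_of_cols n B *\<^sub>v c) $ j = (\<Sum>i<length B. c $ i * B ! i $ j)"
  using assms by (auto simp: scalar_prod_def mat_of_cols_def row_def atLeast0LessThan intro!: sum.cong)

text \<open>Independence is a property of the set of vectors, so \<open>is_basis\<close> asks for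
  distinctness separately; a repeated vector would give the relation with coefficients 1 and
  -1.\<close>

lemma is_basisI:
  fixes B :: "real vec list"
  assumes B: "set B \<subseteq> carrier_vec n"
    and ind: "\<And>c i. (\<And>x. x < n \<Longrightarrow> (\<Sum>i<length B. c i * B ! i $ x) = 0) \<Longrightarrow> i < length B \<Longrightarrow> c i = 0"
  shows "is_basis n B"
proof -
  let ?A = "mat_of_cols n B"
  have cB: "cols ?A = B" using B by (intro cols_mat_of_cols)
  have dist: "distinct B"
    unfolding distinct_conv_nth
  proof (intro allI impI)
    fix i j assume ij: "i < length B" "j < length B" "i \<noteq> j"
    show "B ! i \<noteq> B ! j"
    proof
      assume e: "B ! i = B ! j"
      let ?c = "\<lambda>k. if k = i then 1 else if k = j then -1 else (0::real)"
      have "(\<Sum>k<length B. ?c k * B ! k $ x) = 0" for x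
      proof -
        have "(\<Sum>k<length B. ?c k * B ! k $ x) = (\<Sum>k\<in>{i, j}. ?c k * B ! k $ x)"
          using ij by (intro sum.mono_neutral_right) auto
        also have "\<dots> = 0" using ij e by simp
        finally show ?thesis .
      qed
      from ind[of ?c i, OF this ij(1)] show False by simp
    qed
  qed
  have "\<not> module.lin_dep class_ring (module_vec TYPE(real) n) (set B)"
  proof
    assume "module.lin_dep class_ring (module_vec TYPE(real) n) (set B)"
    then obtain v where v: "v \<in> carrier_vec (length B)" "v \<noteq> 0\<^sub>v (length B)" "?A *\<^sub>v v = 0\<^sub>v n"
      using vec_space.lin_depE[of ?A n "length B"] cB dist by auto
    have "(\<Sum>i<length B. v $ i * B ! i $ x) = 0" if "x < n" for x
      using mat_of_cols_mult[OF that v(1) B] v(3) that by simp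
    then have "v $ i = 0" if "i < length B" for i using ind[of "\<lambda>i. v $ i" i] that by auto
    then have "v = 0\<^sub>v (length B)" using v(1) by (intro eq_vecI) auto
    then show False using v(2) by simp
  qed
  then show ?thesis using B dist by (simp add: is_basis_def)
qed

lemma is_basis_indep:
  fixes B :: "real vec list"
  assumes B: "is_basis n B" and c: "\<And>x. x < n \<Longrightarrow> (\<Sum>i<length B. c i * B ! i $ x) = 0" and i: "i < length B"
  shows "c i = 0"
proof -
  have BC: "set B \<subseteq> carrier_vec n" using B by (auto simp: is_basis_def)
  let ?v = "vec (length B) c"
  have "mat_of_cols n B *\<^sub>v ?v = 0\<^sub>v n"
  proof (rule eq_vecI)
    fix x assume "x < dim_vec (0\<^sub>v n)"
    then show "(mat_of_cols n B *\<^sub>v ?v) $ x = 0\<^sub>v n $ x" using c[of x] BC by (subst mat_of_cols_mult) auto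
  qed (use BC in auto)
  then have "?v = 0\<^sub>v (length B)" by (intro basis_mult_zero[OF B]) auto
  then have "?v $ i = 0" using i by simp
  then show ?thesis using i by simp
qed

lemma is_basis_length:
  assumes B: "is_basis n B" shows "length B \<le> n"
proof -
  interpret vec_space "TYPE(real)" n .
  have "card (set B) \<le> dim" using B by (intro li_le_dim(2)) (auto simp: is_basis_def fin_dim)
  then show ?thesis using B by (simp add: is_basis_def distinct_card dim_is_n)
qed

lemma lattice_of_iff:
  fixes B :: "real vec list"
  assumes "set B \<subseteq> carrier_vec n"
  shows "x \<in> lattice_of n B \<longleftrightarrow> (\<exists>c :: nat \<Rightarrow> int. x = vec n (\<lambda>j. \<Sum>i<length B. of_int (c i) * B ! i $ j))"
proof -
  have e: "mat_of_cols n B *\<^sub>v map_vec of_int c = vec n (\<lambda>j. \<Sum>i<length B. of_int (c $ i) * B ! i $ j)"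
    if "c \<in> carrier_vec (length B)" for c :: "int vec"
  proof (rule eq_vecI)
    fix j assume "j < dim_vec (vec n (\<lambda>j. \<Sum>i<length B. of_int (c $ i) * B ! i $ j))"
    then show "(mat_of_cols n B *\<^sub>v map_vec of_int c) $ j = vec n (\<lambda>j. \<Sum>i<length B. of_int (c $ i) * B ! i $ j) $ j"
      using that assms by (subst mat_of_cols_mult) auto
  qed (use that in auto)
  show ?thesis
  proof
    assume "x \<in> lattice_of n B"
    then show "\<exists>c :: nat \<Rightarrow> int. x = vec n (\<lambda>j. \<Sum>i<length B. of_int (c i) * B ! i $ j)"
      using e by (auto simp: lattice_of_def)
  next
    assume "\<exists>c :: nat \<Rightarrow> int. x = vec n (\<lambda>j. \<Sum>i<length B. of_int (c i) * B ! i $ j)"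
    then obtain c :: "nat \<Rightarrow> int" where c: "x = vec n (\<lambda>j. \<Sum>i<length B. of_int (c i) * B ! i $ j)" by blast
    have "vec (length B) c \<in> carrier_vec (length B)" by simp
    note e = e[OF this]
    have "vec n (\<lambda>j. \<Sum>i<length B. real_of_int (vec (length B) c $ i) * B ! i $ j) = x"
      unfolding c by (intro eq_vecI) auto
    then show "x \<in> lattice_of n B" unfolding lattice_of_def using e by (auto intro!: exI[of _ "vec (length B) c"])
  qed
qed

section \<open>Integer bases as lattices of real vectors\<close>

definition bvec :: "nat \<Rightarrow> nat \<Rightarrow> (nat \<Rightarrow> nat \<Rightarrow> int) \<Rightarrow> real vec list" where
  "bvec n d b = map (\<lambda>i. vec n (\<lambda>j. of_int (b i j))) [0..<d]"

lemma bvec_basis: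
  assumes "\<And>j. j < d \<Longrightarrow> gsn n (rl b) j > 0" shows "is_basis n (bvec n d b)"
proof (rule is_basisI)
  fix c i assume c: "\<And>x. x < n \<Longrightarrow> (\<Sum>i<length (bvec n d b). c i * bvec n d b ! i $ x) = 0" and i: "i < length (bvec n d b)"
  have "lc d c (rl b) x = 0" if "x < n" for x using c[OF that] that by (simp add: lc_def rl_def bvec_def)
  then show "c i = 0" using indep_of_gsn[of d n "rl b" c i] assms i by (simp add: bvec_def)
qed (auto simp: bvec_def)

lemma bvec_lattice: "lattice_of n (bvec n d b) = (\<lambda>y. vec n (\<lambda>j. of_int (y j))) ` lat d b"
proof -
  have C: "set (bvec n d b) \<subseteq> carrier_vec n" by (auto simp: bvec_def)
  have "vec n (\<lambda>j. \<Sum>i<length (bvec n d b). of_int (c i) * bvec n d b ! i $ j) = vec n (\<lambda>j. of_int (lc d c b j))"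
    for c :: "nat \<Rightarrow> int" by (intro eq_vecI) (auto simp: bvec_def lc_def)
  then show ?thesis unfolding lat_def by (auto simp: lattice_of_iff[OF C])
qed

lemma vnorm_vec: "(vnorm (vec n f))\<^sup>2 = (\<Sum>j<n. (f j)\<^sup>2)"
  by (simp add: vnorm_def scalar_self sum_nonneg)

text \<open>With this, integer functions in the lattice are determined by the vectors of dimension
  \<open>n\<close> they stand for.\<close>

definition trunc :: "nat \<Rightarrow> (nat \<Rightarrow> nat \<Rightarrow> int) \<Rightarrow> bool" where
  "trunc n b \<longleftrightarrow> (\<forall>i. \<forall>j\<ge>n. b i j = 0)"

lemma lat_trunc: "trunc n b \<Longrightarrow> y \<in> lat d b \<Longrightarrow> n \<le> j \<Longrightarrow> y j = 0"
  by (auto simp: lat_def lc_def trunc_def)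

lemma vec_int_eqD: "vec n (\<lambda>j. real_of_int (y j)) = vec n (\<lambda>j. of_int (z j)) \<Longrightarrow> j < n \<Longrightarrow> y j = z j"
  by (metis index_vec of_int_eq_iff)

lemma lat_integer_lattice:
  assumes pos: "\<And>j. j < d \<Longrightarrow> gsn n (rl b) j > 0" and tr: "trunc n b"
  shows "integer_lattice n (lat d b)"
proof
  show "(\<lambda>_. 0) \<in> lat d b" by (auto simp: lat_def lc_def intro!: image_eqI[of _ _ "\<lambda>_. 0"])
  show "(\<lambda>j. y j + z j) \<in> lat d b" "(\<lambda>j. y j - z j) \<in> lat d b" if yz: "y \<in> lat d b" "z \<in> lat d b" for y z
  proof -
    obtain c e where ce: "y = lc d c b" "z = lc d e b" using yz by (auto simp: lat_def)
    show "(\<lambda>j. y j + z j) \<in> lat d b" unfolding lat_def ce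
      by (intro image_eqI[of _ _ "\<lambda>i. c i + e i"]) (auto simp: lc_def sum.distrib algebra_simps)
    show "(\<lambda>j. y j - z j) \<in> lat d b" unfolding lat_def ce
      by (intro image_eqI[of _ _ "\<lambda>i. c i - e i"]) (auto simp: lc_def sum_subtractf algebra_simps)
  qed
  fix a :: real assume a: "a > 0"
  \<comment> \<open>Turns the rate \<open>a\<close> into the parameter of \<open>gauss_mass\<close>,
    whose summability is known.\<close>
  define s where "s = sqrt (pi / a)"
  have s: "s > 0" "s\<^sup>2 = pi / a" using a by (auto simp: s_def)
  let ?f = "\<lambda>y. vec n (\<lambda>j. real_of_int (y j))"
  have inj: "inj_on ?f (lat d b)"
  proof (rule inj_onI)
    fix y z assume yz: "y \<in> lat d b" "z \<in> lat d b" "?f y = ?f z"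
    show "y = z"
    proof
      fix j show "y j = z j"
        using vec_int_eqD[OF yz(3), of j] lat_trunc[OF tr yz(1), of j] lat_trunc[OF tr yz(2), of j]
        by (cases "j < n") auto
    qed
  qed
  have "gauss_mass s abs_summable_on ?f ` lat d b"
    using gauss_mass_summable[OF bvec_basis[OF pos] s(1)] by (simp add: bvec_lattice)
  then have "(\<lambda>y. gauss_mass s (?f y)) abs_summable_on lat d b"
    using abs_summable_on_reindex_iff[OF inj, of "gauss_mass s"] by simp
  then have "(\<lambda>y. gauss_mass s (?f y)) summable_on lat d b"
    using abs_summable_equivalent abs_summable_summable by blast
  moreover have "gauss_mass s (?f y) = exp (- a * nq n y (\<lambda>_. 0))" for y
    using a unfolding gauss_mass_def vnorm_vec s(2) by (simp add: nq_def field_simps)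
  ultimately show "(\<lambda>y. exp (- a * nq n y (\<lambda>_. 0))) summable_on lat d b" by simp
qed

text \<open>Total weight of the extra coordinate of the embedding. It depends neither on the
  dimension nor on the parameter.\<close>

definition theta :: real where
  "theta = infsum (\<lambda>k::int. exp (- pi * (of_int k)\<^sup>2)) UNIV"

lemma theta_summable: "(\<lambda>k::int. exp (- pi * (of_int k)\<^sup>2)) summable_on UNIV"
  using summable_gauss_int[of pi] abs_summable_equivalent abs_summable_summable by fastforce

lemma theta_pos: "theta > 0"
proof -
  have "sum (\<lambda>k::int. exp (- pi * (of_int k)\<^sup>2)) {0} \<le> theta" unfolding theta_def
    by (intro finite_sum_le_infsum theta_summable) auto
  then show ?thesis by simp
qed

section \<open>The embedding lattice and its Gaussian\<close>

locale embedding =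
  fixes n d :: nat and b :: "nat \<Rightarrow> nat \<Rightarrow> int" and \<sigma> :: rat
  assumes pos: "\<And>j. j < d \<Longrightarrow> gsn n (rl b) j > 0" and tr: "trunc n b" and \<sigma>: "\<sigma> > 0"
begin

sublocale integer_lattice n "lat d b" by (rule lat_integer_lattice) (use pos tr in auto)

abbreviation s :: real where "s \<equiv> of_rat \<sigma>"

definition bq :: "rat vec list" where
  "bq = map (\<lambda>i. vec (n + 1) (\<lambda>j. if j < n then of_int (b i j) else if i = d then \<sigma> else 0)) [0..<d + 1]"

definition emb :: "int \<times> (nat \<Rightarrow> int) \<Rightarrow> real vec" where
  "emb p = vec (n + 1) (\<lambda>j. if j < n then of_int (snd p j) + of_int (fst p) * of_int (b d j) else of_int (fst p) * s)"

abbreviation tv :: "int \<Rightarrow> nat \<Rightarrow> real" where "tv k \<equiv> (\<lambda>j. of_int k * of_int (b d j))"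

lemma s_pos: "s > 0" using \<sigma> by simp

lemma bq_carrier: "set (map real_vec bq) \<subseteq> carrier_vec (n + 1)"
  by (auto simp: bq_def)

lemma bq_sum:
  assumes "j < n + 1"
  shows "(\<Sum>i<length (map real_vec bq). c i * (map real_vec bq) ! i $ j) =
    (if j < n then lc d c (rl b) j + c d * of_int (b d j) else c d * s)"
proof -
  have "(\<Sum>i<length (map real_vec bq). c i * (map real_vec bq) ! i $ j) =
      (\<Sum>i<d + 1. c i * (if j < n then of_int (b i j) else if i = d then s else 0))"
    using assms by (intro sum.cong) (auto simp: bq_def simp del: upt_Suc)
  also have "\<dots> = (if j < n then lc d c (rl b) j + c d * of_int (b d j) else c d * s)"
    by (simp add: lc_def rl_def)
  finally show ?thesis .
qed

lemma bq_basis: "is_basis (n + 1) (map real_vec bq)"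
proof (rule is_basisI[OF bq_carrier])
  fix c :: "nat \<Rightarrow> real" and i
  assume c: "\<And>x. x < n + 1 \<Longrightarrow> (\<Sum>i<length (map real_vec bq). c i * (map real_vec bq) ! i $ x) = 0" and i: "i < length (map real_vec bq)"
  have cd: "c d = 0" using trans[OF bq_sum[symmetric] c, of n] \<sigma> by simp
  have "lc d c (rl b) x = 0" if "x < n" for x using trans[OF bq_sum[symmetric] c, of x] that cd by simp
  then show "c i = 0" using indep_of_gsn[of d n "rl b" c i] pos cd i by (cases "i = d") (auto simp: bq_def)
qed

lemma bq_lattice: "lattice_of (n + 1) (map real_vec bq) = emb ` (UNIV \<times> lat d b)"
proof -
  have e: "vec (n + 1) (\<lambda>j. \<Sum>i<length (map real_vec bq). of_int (c i) * (map real_vec bq) ! i $ j) = emb (c d, lc d c b)"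
    for c :: "nat \<Rightarrow> int"
    unfolding emb_def by (intro eq_vecI) (auto simp del: length_map simp: bq_sum of_int_lc_apply)
  show ?thesis
  proof (intro equalityI subsetI)
    fix x assume "x \<in> lattice_of (n + 1) (map real_vec bq)"
    then show "x \<in> emb ` (UNIV \<times> lat d b)" unfolding lattice_of_iff[OF bq_carrier] e by (auto simp: lat_def)
  next
    fix x assume "x \<in> emb ` (UNIV \<times> lat d b)"
    then obtain k c where x: "x = emb (k, lc d c b)" by (auto simp: lat_def)
    have "lc d (c(d := k)) b = lc d c b" by (auto simp: lc_def)
    then have "x = emb ((c(d := k)) d, lc d (c(d := k)) b)" using x by simp
    then show "x \<in> lattice_of (n + 1) (map real_vec bq)" unfolding lattice_of_iff[OF bq_carrier] e by blast
  qed
qed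

lemma emb_inj: "inj_on emb (UNIV \<times> lat d b)"
proof (rule inj_onI)
  fix p q assume p: "p \<in> UNIV \<times> lat d b" "q \<in> UNIV \<times> lat d b" "emb p = emb q"
  have "emb p $ n = emb q $ n" using p(3) by simp
  then have f: "fst p = fst q" using s_pos \<sigma> by (simp add: emb_def)
  have "snd p j = snd q j" for j
  proof (cases "j < n")
    case True
    have "emb p $ j = emb q $ j" using p(3) by simp
    then show ?thesis using True f by (simp add: emb_def)
  next
    case False
    then show ?thesis using p(1,2) lat_trunc[OF tr, of _ d j] by (metis linorder_not_less mem_Times_iff)
  qed
  then show "p = q" using f by (auto simp: prod_eq_iff)
qed

text \<open>The extra coordinate is a multiple of \<open>s\<close>, so its weight is free of the
  parameter and splits off from that of the shifted lattice in layer \<open>k\<close>.\<close>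

lemma gauss_emb: "gauss_mass s (emb (k, y)) = exp (- (pi / s\<^sup>2) * nq n y (tv k)) * exp (- pi * (of_int k)\<^sup>2)"
proof -
  have "(vnorm (emb (k, y)))\<^sup>2 = nq n y (tv k) + (of_int k * s)\<^sup>2"
    unfolding emb_def vnorm_vec nq_def by simp
  then have "- pi * (vnorm (emb (k, y)))\<^sup>2 / s\<^sup>2 = - (pi / s\<^sup>2) * nq n y (tv k) + - pi * (of_int k)\<^sup>2"
    using s_pos \<sigma> by (simp add: field_simps power_mult_distrib)
  then show ?thesis unfolding gauss_mass_def exp_add[symmetric] by simp
qed

lemma gauss_summable: "(\<lambda>p. gauss_mass s (emb p)) summable_on UNIV \<times> lat d b"
proof -
  have "gauss_mass s abs_summable_on emb ` (UNIV \<times> lat d b)"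
    using gauss_mass_summable[OF bq_basis s_pos] by (simp only: bq_lattice)
  then have "(\<lambda>p. gauss_mass s (emb p)) abs_summable_on UNIV \<times> lat d b"
    using abs_summable_on_reindex_iff[OF emb_inj, of "gauss_mass s"] by simp
  then show ?thesis using abs_summable_equivalent abs_summable_summable by blast
qed

text \<open>Every layer is a shift of the lattice and hence, by \<open>th_le\<close>, at most as
  heavy as the lattice itself.\<close>

lemma gauss_total:
  defines "T \<equiv> infsum (gauss_mass s) (lattice_of (n + 1) (map real_vec bq))"
  shows "0 < T" "T \<le> theta * th (pi / s\<^sup>2) (\<lambda>_. 0)"
proof -
  let ?a = "pi / s\<^sup>2"
  have a: "?a > 0" using s_pos by simp
  have T: "T = infsum (\<lambda>p. gauss_mass s (emb p)) (UNIV \<times> lat d b)"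
    unfolding T_def bq_lattice using infsum_reindex[OF emb_inj, of "gauss_mass s"] by (simp add: o_def)
  have "sum (\<lambda>p. gauss_mass s (emb p)) {(0, \<lambda>_. 0)} \<le> T" unfolding T
    using zero by (intro finite_sum_le_infsum gauss_summable) (auto simp: gauss_mass_def)
  then show "0 < T" by (simp add: gauss_mass_def less_le_trans[OF exp_gt_zero])
  have "T = infsum (\<lambda>k. infsum (\<lambda>y. gauss_mass s (emb (k, y))) (lat d b)) UNIV"
    unfolding T using infsum_Sigma_banach[OF gauss_summable] by simp
  also have "\<dots> = infsum (\<lambda>k. th ?a (tv k) * exp (- pi * (of_int k)\<^sup>2)) UNIV"
    unfolding gauss_emb th_def by (intro infsum_cong infsum_cmult_left')
  also have "\<dots> \<le> infsum (\<lambda>k::int. th ?a (\<lambda>_. 0) * exp (- pi * (of_int k)\<^sup>2)) UNIV"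
  proof (rule infsum_mono)
    show s2: "(\<lambda>k::int. th ?a (\<lambda>_. 0) * exp (- pi * (of_int k)\<^sup>2)) summable_on UNIV"
      by (intro summable_on_cmult_right theta_summable)
    show le: "th ?a (tv k) * exp (- pi * (of_int k)\<^sup>2) \<le> th ?a (\<lambda>_. 0) * exp (- pi * (of_int k)\<^sup>2)" for k
      by (intro mult_right_mono th_le a) auto
    show "(\<lambda>k. th ?a (tv k) * exp (- pi * (of_int k)\<^sup>2)) summable_on UNIV"
      by (rule summable_le[OF s2 _ le]) (auto intro!: mult_nonneg_nonneg less_imp_le[OF th_pos] a)
  qed
  also have "\<dots> = theta * th ?a (\<lambda>_. 0)" by (subst infsum_cmult_right') (simp add: theta_def mult.commute)
  finally show "T \<le> theta * th ?a (\<lambda>_. 0)" .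
qed

definition good :: "real \<Rightarrow> real vec set" where
  "good r = (\<lambda>y. emb (-1, y)) ` {y\<in>lat d b. nq n y (tv (-1)) \<le> r}"

text \<open>The layer \<open>- 1\<close> has weight \<open>exp (- pi)\<close>. Its part near the
  target is bounded below by \<open>good_mass\<close>, the total above by
  \<open>gauss_total\<close>, and the mass of the unshifted lattice cancels.\<close>

lemma good_prob:
  assumes ab: "0 < \<beta>" "\<beta> \<le> pi / s\<^sup>2" and c: "c \<in> lat d b"
  shows "exp (- pi) / theta * (exp (- (pi / s\<^sup>2) * nq n c (tv (-1))) -
      exp (- (pi / s\<^sup>2 - \<beta>) * r + real n / 2 * ln ((pi / s\<^sup>2) / \<beta>)))
    \<le> measure_pmf.prob (discrete_gaussian (lattice_of (n + 1) (map real_vec bq)) s) (good r)"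
proof -
  let ?a = "pi / s\<^sup>2" and ?L = "lattice_of (n + 1) (map real_vec bq)"
  define T where "T = infsum (gauss_mass s) ?L"
  define E where "E = exp (- ?a * nq n c (tv (-1))) - exp (- (?a - \<beta>) * r + real n / 2 * ln (?a / \<beta>))"
  let ?Y = "{y\<in>lat d b. nq n y (tv (-1)) \<le> r}"
  have a: "?a > 0" using s_pos by simp
  have T: "0 < T" "T \<le> theta * th ?a (\<lambda>_. 0)" using gauss_total by (simp_all only: T_def)
  have sub: "good r \<subseteq> ?L" unfolding bq_lattice good_def by auto
  have inj: "inj_on (\<lambda>y. emb (-1, y)) ?Y"
    by (rule inj_onI) (use inj_onD[OF emb_inj] in auto)
  have "measure_pmf.prob (discrete_gaussian ?L s) (good r) = infsum (\<lambda>x. gauss_mass s x * (1 / T)) (good r)"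
    unfolding pmf_infsum pmf_discrete_gaussian[OF bq_basis s_pos] T_def using sub by (intro infsum_cong) auto
  also have "\<dots> = infsum (gauss_mass s) (good r) * (1 / T)" by (rule infsum_cmult_left')
  also have "infsum (gauss_mass s) (good r) = infsum (\<lambda>y. gauss_mass s (emb (-1, y))) ?Y"
    unfolding good_def using infsum_reindex[OF inj, of "gauss_mass s"] by (simp add: o_def)
  also have "\<dots> = infsum (\<lambda>y. exp (- ?a * nq n y (tv (-1)))) ?Y * exp (- pi)"
    unfolding gauss_emb by (subst infsum_cmult_left') simp
  finally have P: "measure_pmf.prob (discrete_gaussian ?L s) (good r) =
      infsum (\<lambda>y. exp (- ?a * nq n y (tv (-1)))) ?Y * exp (- pi) / T" by simp
  have M: "E * th ?a (\<lambda>_. 0) \<le> infsum (\<lambda>y. exp (- ?a * nq n y (tv (-1)))) ?Y"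
    unfolding E_def by (rule good_mass[OF ab c])
  show ?thesis
  \<comment> \<open>A nonpositive estimate says nothing; otherwise enlarging the denominator from
    \<open>T\<close> to its bound only lowers the quotient.\<close>
  proof (cases "E \<le> 0")
    case True
    have "exp (- pi) / theta * E \<le> 0" using True theta_pos by (intro mult_nonneg_nonpos) auto
    then show ?thesis unfolding E_def using measure_nonneg by (rule order_trans)
  next
    case False
    have "exp (- pi) / theta * E = E * th ?a (\<lambda>_. 0) * exp (- pi) / (theta * th ?a (\<lambda>_. 0))"
      using th_pos[OF a, of "\<lambda>_. 0"] theta_pos by simp
    also have "\<dots> \<le> E * th ?a (\<lambda>_. 0) * exp (- pi) / T"
      using False th_pos[OF a, of "\<lambda>_. 0"] T theta_pos by (intro divide_left_mono mult_nonneg_nonneg mult_pos_pos) auto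
    also have "\<dots> \<le> measure_pmf.prob (discrete_gaussian ?L s) (good r)"
      unfolding P using M T(1) by (intro divide_right_mono mult_right_mono) auto
    finally show ?thesis unfolding E_def .
  qed
qed

text \<open>All \<open>m\<close> exact samples miss with probability at most
  \<open>exp (- 1) \<le> 0.38\<close>. The statistical distance adds 1/2, and the sum is still below
  1.\<close>

lemma oracle_miss:
  assumes orc: "dgs_oracle m (1 / 2) orc"
    and p: "1 \<le> real m * measure_pmf.prob (discrete_gaussian (lattice_of (n + 1) (map real_vec bq)) s) (good r)"
  shows "measure_pmf.prob (orc (n + 1, bq, \<sigma>)) {xs. \<forall>x\<in>set xs. real_vec x \<notin> good r} \<le> 88 / 100"
proof -
  let ?D = "discrete_gaussian (lattice_of (n + 1) (map real_vec bq)) s" and ?q = "(n + 1, bq, \<sigma>)"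
  let ?N = "{xs. \<forall>x\<in>set xs. x \<notin> good r}"
  define p where "p = measure_pmf.prob ?D (good r)"
  have v: "valid_query ?q" using bq_basis \<sigma> by (simp add: valid_query_def)
  have p1: "p \<le> 1" "0 \<le> p" by (auto simp: p_def)
  have "(1 - p) ^ m \<le> exp (- p) ^ m" using p1 exp_ge_add_one_self[of "- p"] by (intro power_mono) auto
  also have "\<dots> = exp (- (real m * p))" by (simp add: exp_of_nat_mult[symmetric])
  also have "\<dots> \<le> exp (-1)" using p by (simp add: p_def)
  also have "\<dots> \<le> 38 / 100"
  proof -
    have "(100 / 38 :: real) \<le> (\<Sum>k<8. 1 ^ k / fact k)" by (simp add: eval_nat_numeral)
    also have "\<dots> \<le> exp 1" by (rule exp_ge_sum) simp
    finally show ?thesis by (simp add: exp_minus field_simps)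
  qed
  finally have r: "measure_pmf.prob (replicate_pmf m ?D) ?N \<le> 38 / 100"
    unfolding replicate_pmf_none p_def .
  have c: "measure_pmf.prob q (- ?N) = 1 - measure_pmf.prob q ?N" for q
    using measure_pmf.prob_compl[of ?N q] by (simp add: Compl_eq_Diff_UNIV)
  have "stat_dist (map_pmf (map real_vec) (orc ?q)) (replicate_pmf m ?D) \<le> 1 / 2"
    using orc v unfolding dgs_oracle_def by blast
  from stat_dist_prob[OF this, of "- ?N"]
  have "measure_pmf.prob (map_pmf (map real_vec) (orc ?q)) ?N \<le> 88 / 100"
    unfolding c using r by linarith
  moreover have "map real_vec -` ?N = {xs. \<forall>x\<in>set xs. real_vec x \<notin> good r}" by auto
  ultimately show ?thesis by (simp add: measure_map_pmf)
qed

end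

section \<open>Hitting the right parameter\<close>

lemma nth_concat_map_const:
  assumes "\<And>x. x \<in> set xs \<Longrightarrow> length (f x) = K" "i < length xs" "j < K"
  shows "concat (map f xs) ! (i * K + j) = f (xs ! i) ! j \<and> i * K + j < length (concat (map f xs))"
  using assms
proof (induction xs arbitrary: i)
  case (Cons x xs)
  show ?case
  proof (cases i)
    case 0
    then show ?thesis using Cons by (simp add: nth_append)
  next
    case (Suc i')
    then show ?thesis using Cons(1)[of i'] Cons(2-) by (simp add: nth_append)
  qed
qed simp

lemma length_enc_vec [simp]: "length (enc_vec v) = 2 * dim_vec v"
proof -
  have "length (concat (map (\<lambda>q. [fst (quotient_of q), snd (quotient_of q)]) xs)) = 2 * length xs" for xs
    by (induction xs) auto
  then show ?thesis by (simp add: enc_vec_def)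
qed

lemma enc_vec_nth:
  assumes "j < dim_vec v"
  shows "enc_vec v ! (2 * j) = fst (quotient_of (v $ j))" "enc_vec v ! (2 * j + 1) = snd (quotient_of (v $ j))"
proof -
  have "enc_vec v ! (j * 2 + e) = [fst (quotient_of (v $ j)), snd (quotient_of (v $ j))] ! e" if "e < 2" for e
    unfolding enc_vec_def
    using nth_concat_map_const[of "list_of_vec v" "\<lambda>q. [fst (quotient_of q), snd (quotient_of q)]" 2 j e] assms that
    by (simp add: list_of_vec_index)
  from this[of 0] this[of 1]
  show "enc_vec v ! (2 * j) = fst (quotient_of (v $ j))" "enc_vec v ! (2 * j + 1) = snd (quotient_of (v $ j))"
    by (simp_all add: mult.commute)
qed

lemma enc_vecs_nth:
  assumes "\<And>v. v \<in> set vs \<Longrightarrow> dim_vec v = N" "i < length vs" "j < N"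
  shows "concat (map enc_vec vs) ! (2 * (i * N + j)) = fst (quotient_of (vs ! i $ j))"
    "concat (map enc_vec vs) ! (2 * (i * N + j) + 1) = snd (quotient_of (vs ! i $ j))"
    "2 * (i * N + j) + 1 < length (concat (map enc_vec vs))"
proof -
  have d: "dim_vec (vs ! i) = N" using assms by simp
  have c: "concat (map enc_vec vs) ! (i * (2 * N) + e) = enc_vec (vs ! i) ! e \<and> i * (2 * N) + e < length (concat (map enc_vec vs))"
    if "e < 2 * N" for e using assms that by (intro nth_concat_map_const) auto
  have e: "2 * (i * N + j) = i * (2 * N) + 2 * j" by (simp add: algebra_simps)
  show "concat (map enc_vec vs) ! (2 * (i * N + j)) = fst (quotient_of (vs ! i $ j))"
    using c[of "2 * j"] enc_vec_nth(1)[of j "vs ! i"] d assms(3) unfolding e by simp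
  show "concat (map enc_vec vs) ! (2 * (i * N + j) + 1) = snd (quotient_of (vs ! i $ j))"
    using c[of "2 * j + 1"] enc_vec_nth(2)[of j "vs ! i"] d assms(3) unfolding e by simp
  show "2 * (i * N + j) + 1 < length (concat (map enc_vec vs))"
    using c[of "2 * j + 1"] assms(3) unfolding e by simp
qed

text \<open>Just before the first index past \<open>lo\<close> the value is still below
  \<open>lo\<close>, so the next \<open>k\<close> values are at most
  \<open>lo * \<rho> ^ k\<close>.\<close>

lemma nine_window:
  fixes B0 \<rho> lo hi :: real
  assumes "0 < B0" "B0 < lo" "lo \<le> B0 * \<rho> ^ G" "1 \<le> \<rho>" "lo * \<rho> ^ k \<le> hi"
  shows "\<exists>g0. g0 < G \<and> (\<forall>g. g0 \<le> g \<and> g < g0 + k \<longrightarrow> lo \<le> B0 * \<rho> ^ (g + 1) \<and> B0 * \<rho> ^ (g + 1) \<le> hi)"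
proof -
  define h where "h = (LEAST h. lo \<le> B0 * \<rho> ^ h)"
  have h: "lo \<le> B0 * \<rho> ^ h" unfolding h_def using assms(3) by (rule LeastI)
  have hG: "h \<le> G" unfolding h_def using assms(3) by (rule Least_le)
  have "h \<noteq> 0" using h assms(2) by (intro notI) simp
  then obtain g0 where g0: "h = Suc g0" by (cases h) auto
  have "\<not> lo \<le> B0 * \<rho> ^ g0" using not_less_Least[of g0 "\<lambda>h. lo \<le> B0 * \<rho> ^ h"] g0 unfolding h_def by simp
  then have lt: "B0 * \<rho> ^ g0 \<le> lo" by simp
  have "lo \<le> B0 * \<rho> ^ (g + 1) \<and> B0 * \<rho> ^ (g + 1) \<le> hi" if g: "g0 \<le> g" "g < g0 + k" for g
  proof
    have "B0 * \<rho> ^ h \<le> B0 * \<rho> ^ (g + 1)"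
      using g g0 assms(1,4) by (intro mult_left_mono power_increasing) auto
    then show "lo \<le> B0 * \<rho> ^ (g + 1)" using h by simp
    have "B0 * \<rho> ^ (g + 1) \<le> B0 * \<rho> ^ (g0 + k)"
      using g assms(1,4) by (intro mult_left_mono power_increasing) auto
    also have "\<dots> = B0 * \<rho> ^ g0 * \<rho> ^ k" by (simp add: power_add)
    also have "\<dots> \<le> lo * \<rho> ^ k" using lt assms(4) by (intro mult_right_mono) auto
    finally show "B0 * \<rho> ^ (g + 1) \<le> hi" using assms(5) by simp
  qed
  then show ?thesis using g0 hG by (intro exI[of _ g0]) auto
qed

text \<open>
  The ratio \<open>10000 / 10001\<close> of consecutive guesses is so close to 1 that nine of them hit the
  window of \<open>window\<close>; \<open>nrm\<close> is the squared distance of the Babai point and \<open>m\<close> that of the closest one.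
\<close>

lemma guesses_hit:
  fixes S m nrm :: real
  assumes n: "n \<ge> 1" and m: "1 \<le> m" "m \<le> nrm" "nrm \<le> S\<^sup>2" "nrm \<le> 2 ^ n * m" and S: "1 \<le> S" "S = 1 \<or> S\<^sup>2 < 4 * nrm"
  defines "\<beta> \<equiv> \<lambda>g. pi * m / (4 * S * (10000 / 10001) ^ (g + 1))\<^sup>2 / real n"
  shows "\<exists>g0. g0 + 9 \<le> 30000 * n \<and> (\<forall>g. g0 \<le> g \<and> g < g0 + 9 \<longrightarrow> 345 / 1000 \<le> \<beta> g \<and> \<beta> g \<le> 3465 / 10000)"
proof -
  define \<rho> :: real where "\<rho> = (10001 / 10000)\<^sup>2"
  define B0 where "B0 = pi * m / (16 * S\<^sup>2 * real n)"
  have \<beta>: "\<beta> g = B0 * \<rho> ^ (g + 1)" for g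
  proof -
    have "(4 * S * (10000 / 10001) ^ (g + 1))\<^sup>2 = 16 * S\<^sup>2 * ((10000 / 10001)\<^sup>2) ^ (g + 1)"
      unfolding power_mult_distrib power_mult[symmetric] by (simp only: mult.commute) simp
    also have "((10000 / 10001 :: real)\<^sup>2) = 1 / \<rho>" by (simp add: \<rho>_def field_simps)
    finally show ?thesis unfolding \<beta>_def B0_def by (simp add: power_divide field_simps)
  qed
  have S2: "1 \<le> S\<^sup>2" using S(1) by (simp add: one_le_power)
  have B0: "0 < B0" unfolding B0_def using m n S by simp
  \<comment> \<open>\<open>B0\<close> belongs to the parameter \<open>4 * S\<close> before the first
    guess. The factor 4 puts it below the window: \<open>S\<close> is at least the distance, so
    \<open>B0\<close> is at most \<open>pi / 16\<close>.\<close>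
  have B1: "B0 < 345 / 1000"
  proof -
    have "B0 \<le> pi * S\<^sup>2 / (16 * S\<^sup>2 * real n)" unfolding B0_def using m n S by (intro divide_right_mono mult_left_mono) auto
    also have "\<dots> = pi / (16 * real n)" using S by simp
    also have "\<dots> \<le> pi / (16 * 1)" using n by (intro divide_left_mono mult_left_mono) auto
    also have "\<dots> < 345 / 1000" using pi_less_4 by simp
    finally show ?thesis .
  qed
  have \<rho>1: "1 \<le> \<rho>" by (simp add: \<rho>_def power2_eq_square)
  \<comment> \<open>The square of \<open>S\<close> is at most \<open>4 * 2 ^ n * m\<close>, so
    \<open>B0\<close> is not below \<open>pi / (64 * 2 ^ n * n)\<close>. As
    \<open>\<rho> ^ 5000 \<ge> 2\<close>, the power \<open>30000 * n\<close> of \<rho> is at least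
    \<open>64 ^ n\<close>, which more than makes up for that. The 8 leaves room for nine guesses
    from the first hit on.\<close>
  have B2: "345 / 1000 \<le> B0 * \<rho> ^ (30000 * n - 8)"
  proof -
    have S4: "S\<^sup>2 \<le> 4 * (2 ^ n * m)"
    proof (cases "S = 1")
      case True
      have "1 * 1 \<le> 2 ^ n * m" using m by (intro mult_mono) auto
      then show ?thesis using True by simp
    qed (use S m in linarith)
    have nn: "32 * real n \<le> (32 :: real) ^ n"
    proof -
      have "1 + real (n - 1) * 31 \<le> (1 + 31 :: real) ^ (n - 1)" by (rule Bernoulli_inequality) auto
      moreover have "(32 :: real) ^ n = 32 * 32 ^ (n - 1)" using n by (simp add: power_eq_if)
      moreover have "(1 + 31 :: real) ^ (n - 1) = 32 ^ (n - 1)" by simp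
      moreover have "real (n - 1) = real n - 1" using n by simp
      moreover have "1 \<le> real n" using n by simp
      ultimately show ?thesis by linarith
    qed
    have "2 \<le> (1 + 1 / 10000 :: real) ^ 10000" using Bernoulli_inequality[of "1 / 10000 :: real" 10000] by simp
    then have "2 ^ (6 * n) \<le> ((10001 / 10000 :: real) ^ 10000) ^ (6 * n)" by (intro power_mono) auto
    also have "\<dots> = \<rho> ^ (30000 * n)" by (simp add: \<rho>_def power_mult[symmetric])
    also have "\<dots> = \<rho> ^ (30000 * n - 8) * \<rho> ^ 8" using n by (simp add: power_add[symmetric])
    also have "\<dots> \<le> \<rho> ^ (30000 * n - 8) * 2"
      using \<rho>1 by (intro mult_left_mono) (auto simp: \<rho>_def power_divide)
    finally have P: "2 ^ (6 * n) / 2 \<le> \<rho> ^ (30000 * n - 8)" by simp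
    have "(64 :: real) ^ n = 2 ^ (6 * n)" by (simp add: power_mult)
    then have P': "64 ^ n / 2 \<le> \<rho> ^ (30000 * n - 8)" using P by simp
    have "pi * m / (16 * (4 * (2 ^ n * m)) * real n) \<le> B0" unfolding B0_def
      using S4 m n S2 by (intro divide_left_mono mult_right_mono mult_left_mono mult_pos_pos) auto
    then have "pi / (64 * 2 ^ n * real n) \<le> B0" using m by simp
    then have "pi / (64 * 2 ^ n * real n) * (64 ^ n / 2) \<le> B0 * \<rho> ^ (30000 * n - 8)"
      using P' B0 n by (intro mult_mono) auto
    moreover have "pi / (64 * 2 ^ n * real n) * (64 ^ n / 2) = pi * 32 ^ n / (128 * real n)"
    proof -
      have "(64 :: real) ^ n = 2 ^ n * 32 ^ n" by (simp add: power_mult_distrib[symmetric])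
      then show ?thesis using n by simp
    qed
    moreover have "pi * (32 * real n) / (128 * real n) \<le> pi * 32 ^ n / (128 * real n)"
      using nn n by (intro divide_right_mono mult_left_mono) auto
    moreover have "pi * (32 * real n) / (128 * real n) = pi / 4" using n by simp
    ultimately show ?thesis using pi_gt3 by linarith
  qed
  \<comment> \<open>Nine steps change \<beta> by about 0.18 percent, while the window is about 0.43
    percent wide.\<close>
  have \<rho>9: "345 / 1000 * \<rho> ^ 9 \<le> 3465 / 10000" unfolding \<rho>_def power_mult[symmetric] by (simp add: power_divide)
  obtain g0 where "g0 < 30000 * n - 8" "\<forall>g. g0 \<le> g \<and> g < g0 + 9 \<longrightarrow> 345 / 1000 \<le> B0 * \<rho> ^ (g + 1) \<and> B0 * \<rho> ^ (g + 1) \<le> 3465 / 10000"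
    using nine_window[OF B0 B1 B2 \<rho>1 \<rho>9] by blast
  then show ?thesis unfolding \<beta> using n by (intro exI[of _ g0]) auto
qed

text \<open>The dimensions in which the comparison of \<open>window\<close> holds with the constant
  from \<open>good_prob\<close>. They include all from some \<open>n0\<close> on; the finitely many
  below it are enumerated.\<close>

definition good_dim :: "nat \<Rightarrow> bool" where
  "good_dim n \<longleftrightarrow> (\<forall>\<beta>. 345 / 1000 \<le> \<beta> \<longrightarrow> \<beta> \<le> 3465 / 10000 \<longrightarrow>
    1 \<le> real (nat \<lfloor>2 powr (real n / 2)\<rfloor>) * (exp (- pi) / theta * (exp (- \<beta> * real n) -
      exp (- (1 - 100 / 269) * (197 / 100)\<^sup>2 * \<beta> * real n + real n / 2 * ln (269 / 100)))))"

lemma good_dim_ex: "\<exists>n0. \<forall>n\<ge>n0. good_dim n"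
  using window[of "exp (- pi) / theta"] theta_pos unfolding good_dim_def by simp

lemma (in embedding) miss_le:
  assumes gd: "good_dim n" and orc: "dgs_oracle (nat \<lfloor>2 powr (real n / 2)\<rfloor>) (1 / 2) orc"
    and c: "c \<in> lat d b" and m: "m = nq n c (tv (-1))" and n: "n \<ge> 1"
    and \<beta>: "345 / 1000 \<le> pi * m / s\<^sup>2 / real n" "pi * m / s\<^sup>2 / real n \<le> 3465 / 10000"
  shows "measure_pmf.prob (orc (n + 1, bq, \<sigma>)) {xs. \<forall>x\<in>set xs. real_vec x \<notin> good ((197 / 100)\<^sup>2 * m)} \<le> 88 / 100"
proof (rule oracle_miss[OF orc])
  define \<beta> where "\<beta> = pi * m / s\<^sup>2 / real n"
  let ?a = "pi / s\<^sup>2" and ?r = "(197 / 100)\<^sup>2 * m"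
  have a: "?a > 0" using s_pos by simp
  have am: "?a * m = \<beta> * real n" using n by (simp add: \<beta>_def)
  let ?P = "measure_pmf.prob (discrete_gaussian (lattice_of (n + 1) (map real_vec bq)) s) (good ?r)"
  \<comment> \<open>The free rate of \<open>tail\<close> is taken as \<open>100 / 269\<close> of the
    rate of the query.\<close>
  have "exp (- pi) / theta * (exp (- ?a * m) - exp (- (?a - ?a * (100 / 269)) * ?r + real n / 2 * ln (?a / (?a * (100 / 269))))) \<le> ?P"
    unfolding m using a by (intro good_prob c) auto
  also have "- ?a * m = - \<beta> * real n" using am by simp
  also have "?a / (?a * (100 / 269)) = 269 / 100" using \<sigma> by simp
  also have "- (?a - ?a * (100 / 269)) * ?r = - (1 - 100 / 269) * (197 / 100)\<^sup>2 * (?a * m)" by (simp add: algebra_simps)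
  also have "\<dots> = - (1 - 100 / 269) * (197 / 100)\<^sup>2 * \<beta> * real n" unfolding am by simp
  finally have P: "exp (- pi) / theta * (exp (- \<beta> * real n) -
      exp (- (1 - 100 / 269) * (197 / 100)\<^sup>2 * \<beta> * real n + real n / 2 * ln (269 / 100))) \<le> ?P" .
  have "1 \<le> real (nat \<lfloor>2 powr (real n / 2)\<rfloor>) * (exp (- pi) / theta * (exp (- \<beta> * real n) -
      exp (- (1 - 100 / 269) * (197 / 100)\<^sup>2 * \<beta> * real n + real n / 2 * ln (269 / 100))))"
    using gd \<beta> unfolding good_dim_def \<beta>_def by blast
  also have "\<dots> \<le> real (nat \<lfloor>2 powr (real n / 2)\<rfloor>) * ?P" using P by (intro mult_left_mono) auto
  finally show "1 \<le> real (nat \<lfloor>2 powr (real n / 2)\<rfloor>) * ?P" .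
qed

section \<open>Samples that give close vectors\<close>

context reduced
begin

lemma red_trunc: "trunc n b" using zero by (simp add: trunc_def)

lemma cand_lattice:
  assumes "y \<in> lat d b" "\<And>x. u x = y x - b d x" shows "cand 1 0 u e = u"
proof -
  obtain c where c: "y = lc d c b" using assms(1) by (auto simp: lat_def)
  have "(\<lambda>x. b d x + u x) = lc d c b" using assms(2) c by auto
  then show ?thesis unfolding cand_def using np_lattice[OF pos, of d c e] by simp
qed

text \<open>A good sample survives unchanged: its first \<open>n\<close> entries are integers, so
  the numerators are the entries; their norm is at most \<open>2 * S\<close>, so nothing is clamped;
  and they form a vector of \<open>L - t\<close>, which \<open>try_c\<close> returns.\<close>

lemma smp_hit:
  assumes \<sigma>: "\<sigma> > 0" and xs: "length xs \<le> m" "set xs \<subseteq> carrier_vec (n + 1)"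
    and M: "M answer_array = (\<lambda>i. if i < length (concat (map enc_vec xs)) then concat (map enc_vec xs) ! i else 0)"
    and hit: "\<exists>x\<in>set xs. real_vec x \<in> embedding.good n d b \<sigma> r" and S: "r \<le> (2 * of_int S)\<^sup>2" "0 \<le> S"
  shows "\<exists>i<m. of_int (ip n (cand 1 0 (smp S M i) 0) (cand 1 0 (smp S M i) 0)) \<le> r"
proof -
  interpret E: embedding n d b \<sigma> by unfold_locales (use pos red_trunc \<sigma> in auto)
  obtain i where i: "i < length xs" "real_vec (xs ! i) \<in> E.good r" using hit by (metis in_set_conv_nth)
  obtain y where y: "y \<in> lat d b" "nq n y (E.tv (-1)) \<le> r" "real_vec (xs ! i) = E.emb (-1, y)"
    using i(2) by (auto simp: E.good_def)
  have dim: "dim_vec v = n + 1" if "v \<in> set xs" for v using that xs(2) by auto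
  let ?u = "\<lambda>x. y x - b d x"
  have ent: "M answer_array (2 * (i * (n + 1) + j)) = ?u j" if j: "j < n" for j
  proof -
    have j': "j < n + 1" using j by simp
    have "real_vec (xs ! i) $ j = E.emb (-1, y) $ j" using y(3) by simp
    then have "real_of_rat (xs ! i $ j) = real_of_int (?u j)" using j dim[of "xs ! i"] i(1) by (simp add: E.emb_def)
    then have q: "xs ! i $ j = of_int (?u j)" by (metis of_rat_of_int_eq of_rat_eq_iff)
    have "fst (quotient_of (xs ! i $ j)) = ?u j" unfolding q quotient_of_rat_of_int by simp
    then show ?thesis unfolding M using enc_vecs_nth(1,3)[OF dim i(1) j'] by simp
  qed
  have nq: "nq n y (E.tv (-1)) = of_int (ip n ?u ?u)"
    by (simp add: nq_def ip_def power2_eq_square)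
  have bound: "\<bar>?u j\<bar> \<le> 2 * S" if "j < n" for j
  proof -
    have "real_of_int (ip n ?u ?u) \<le> real_of_int ((2 * S)\<^sup>2)" using y(2) S(1) nq by simp
    then have "ip n ?u ?u \<le> (2 * S)\<^sup>2" by linarith
    then show ?thesis using abs_le_of_ip[of n ?u "2 * S" j] that S(2) by simp
  qed
  have tr: "?u j = 0" if "j \<ge> n" for j using lat_trunc[OF red_trunc y(1) that] zero[OF that] by simp
  have smp: "smp S M i = ?u"
  proof
    fix j show "smp S M i j = ?u j"
      using ent[of j] bound[of j] tr[of j] by (cases "j < n") (auto simp: smp_def clamp_def)
  qed
  have "cand 1 0 (smp S M i) 0 = ?u" unfolding smp using y(1) by (intro cand_lattice) auto
  then show ?thesis using y(2) nq i(1) xs(1) by (intro exI[of _ i]) simp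
qed

end

section \<open>The search\<close>

definition prep_c :: "nat \<Rightarrow> com" where
  "prep_c n0 = Seq parse_c (Seq (Store aD (Num 0) (Num 1)) (Seq (set_var vW (Num 1)) (Seq lll_c (Seq initbest_c
     (Seq (param_c n0) (Seq enum_c (Seq (set_var vH (Num 0)) (Seq (set_var vW (Num 1)) (Seq (set_var vE (Num 0))
     (Seq sq_c (Seq pow_c (Seq (set_var vP (Mul (Num 4) (var vS))) (Seq (set_var vQ (Num 1)) (set_var vG (Num 0)))))))))))))))"

definition inc_c :: com where
  "inc_c = Seq samples_c (set_var vG (Add (var vG) (Num 1)))"

definition guard_b :: bexp where
  "guard_b = Less (var vG) (Mul (Num 30000) nX)"

text \<open>The parameter is scaled before the query, so round \<open>g\<close>, counted from 0,
  uses the power \<open>g + 1\<close> of the ratio.\<close>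

definition body_c :: com where
  "body_c = Seq (q_c 10000) (Seq Query inc_c)"

definition reduction_c :: "nat \<Rightarrow> com" where
  "reduction_c n0 = Seq (prep_c n0) (Seq (While guard_b body_c) out_c)"

lemma okb_guard: "okb guard_b" by (simp add: guard_b_def)

lemma wfc_parts: "wfc (prep_c n0)" "wfc (q_c 10000)" "wfc inc_c" "wfc out_c"
  by (simp_all add: prep_c_def parse_c_def For_def lll_c_def gso_c_def np_c_def sr_c_def scan_c_def swap_c_def
    sumc_def vecc_def initbest_c_def param_c_def enum_c_def try_c_def sq_c_def pow_c_def q_c_def fill_c_def inc_c_def
    samples_c_def clamp_c_def out_c_def)

locale search = reduced n d s b Ww Bb Tb Xb Wm Hm F BB Cb Z
  for n d s :: nat and b Ww Bb Tb Xb Wm Hm F BB Cb Z +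
  fixes S Den :: int and K c0 fuel :: nat and orc :: "dgs_query \<Rightarrow> rat vec list pmf"
  assumes S: "0 < S" "2 * S \<le> Xb" and MZ: "2 ^ ((n + 1) div 2) \<le> Z" "Bb \<le> Z" "int ((d + 1) * (n + 1)) \<le> Z"
    "4 * S * 10001 ^ (30000 * n) \<le> Z" "30000 * int n \<le> Z"
    and K: "csz (q_c 10000) \<le> K" "csz inc_c \<le> K" "1 + bsz guard_b \<le> K"
    and fuel: "fuel \<ge> 2 ^ ((n + 1) div 2) * (50 * s\<^sup>2) + 30 * s\<^sup>2 + 6"
begin

definition sg :: "nat \<Rightarrow> rat" where
  "sg g = Rat.Fract (4 * S * 10000 ^ (g + 1)) (10001 ^ (g + 1))"

definition qry :: "nat \<Rightarrow> dgs_query" where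
  "qry g = (n + 1, embedding.bq n d b (sg g), sg g)"

text \<open>Price of one round: guard, preparation of the query, the query itself and the processing
  of all samples, rounded up.\<close>

definition c1 :: nat where
  "c1 = (2 ^ ((n + 1) div 2) * (50 * s\<^sup>2) + 30 * s\<^sup>2 + 6) * unit_cost K Z"

definition Inv :: "nat \<Rightarrow> config \<Rightarrow> bool" where
  "Inv g \<sigma> \<longleftrightarrow> (let M = mem \<sigma> in Base M \<and> Best M \<and> M vW 0 = 1 \<and> M vH 0 = 0 \<and> M vE 0 = 0 \<and> M vS 0 = S \<and>
     M vM 0 = 2 ^ ((n + 1) div 2) \<and> M vDen 0 = Den \<and> M vG 0 = int g \<and> M vP 0 = 4 * S * 10000 ^ g \<and> M vQ 0 = 10001 ^ g \<and>
     bd Z M \<and> length (queries \<sigma>) = g \<and>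
     (\<forall>(n', B', s') \<in> set (queries \<sigma>). valid_query (n', B', s') \<and> n' = n + 1 \<and> length B' = d + 1) \<and>
     cost \<sigma> \<le> c0 + g * c1)"

lemma sg_pos: "sg g > 0" unfolding sg_def using S(1) by (subst Rat.zero_less_Fract_iff) auto

lemma emb: "embedding n d b (sg g)"
  by unfold_locales (use pos red_trunc sg_pos in auto)

lemma bsz_guard_cost: "bd Z M \<Longrightarrow> 1 + bcost M guard_b \<le> unit_cost K Z"
  using unit_cost_mono[OF bcost_le[OF _ okb_guard] K(3)] by simp

lemma guard_val:
  assumes "Inv g \<sigma>" shows "bval (mem \<sigma>) guard_b \<longleftrightarrow> g < 30000 * n"
  using assms by (auto simp: Inv_def Let_def guard_b_def Base_def)

lemma pow_le: "g \<le> 30000 * n \<Longrightarrow> 4 * S * 10000 ^ g \<le> Z \<and> 10001 ^ g \<le> Z"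
proof -
  assume g: "g \<le> 30000 * n"
  have 1: "(10000 :: int) ^ g \<le> 10001 ^ g" by (intro power_mono) auto
  have 2: "(10001 :: int) ^ g \<le> 10001 ^ (30000 * n)" using g by (intro power_increasing) auto
  have "4 * S * 10000 ^ g \<le> 4 * S * 10001 ^ (30000 * n)" using order_trans[OF 1 2] S(1) by (intro mult_left_mono) auto
  moreover have "1 * 10001 ^ (30000 * n) \<le> 4 * S * 10001 ^ (30000 * n)" using S(1) by (intro mult_right_mono) auto
  ultimately show ?thesis using 2 MZ(4) by linarith
qed

text \<open>The answer is the only randomness in a round, so the round is the image of the oracle's
  distribution under a function. Invariant and monotonicity hold for every answer, the gain for
  answers that contain a good sample.\<close>

lemma iter:
  assumes I: "Inv g \<sigma>" and g: "g < 30000 * n"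
  shows "\<exists>f. exec orc fuel body_c (tick (1 + bcost (mem \<sigma>) guard_b) \<sigma>) = map_pmf (\<lambda>xs. Some (f xs)) (orc (qry g)) \<and>
    (\<forall>xs. Inv (Suc g) (f xs) \<and> mem (f xs) vNrm 0 \<le> mem \<sigma> vNrm 0 \<and>
      (\<forall>r. length xs \<le> 2 ^ ((n + 1) div 2) \<and> set xs \<subseteq> carrier_vec (n + 1) \<and>
        (\<exists>x\<in>set xs. real_vec x \<in> embedding.good n d b (sg g) r) \<and> r \<le> (2 * of_int S)\<^sup>2 \<longrightarrow> of_int (mem (f xs) vNrm 0) \<le> r))"
proof -
  interpret E: embedding n d b "sg g" by (rule emb)
  define M where "M = mem \<sigma>"
  define u where "u = unit_cost K Z"
  have u1: "1 \<le> u" unfolding u_def using bsz_guard_cost[of M] I by (simp add: Inv_def Let_def M_def)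
  have M: "Base M" "Best M" "M vW 0 = 1" "M vH 0 = 0" "M vE 0 = 0" "M vS 0 = S" "M vM 0 = 2 ^ ((n + 1) div 2)"
    "M vDen 0 = Den" "M vG 0 = int g" "M vP 0 = 4 * S * 10000 ^ g" "M vQ 0 = 10001 ^ g" "bd Z M"
    and qs: "length (queries \<sigma>) = g" "\<forall>(n', B', s') \<in> set (queries \<sigma>). valid_query (n', B', s') \<and> n' = n + 1 \<and> length B' = d + 1"
    and cst: "cost \<sigma> \<le> c0 + g * c1"
    using I by (auto simp: Inv_def Let_def M_def)
  let ?Q2 = "\<lambda>M'. same {query_array, vI, vP, vQ} M M' \<and> Base M' \<and> Best M' \<and> M' vP 0 = 4 * S * 10000 ^ (g + 1) \<and>
     M' vQ 0 = 10001 ^ (g + 1) \<and> dec_query (M' query_array) = qry g"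
  have "tri Z (q_c 10000) M (30 * s\<^sup>2) ?Q2"
    unfolding qry_def E.bq_def unfolding sg_def
  proof (rule q_c[OF M(1,2) MZ(2,3)])
    show "4 * S * 10000 ^ (g + 1) = M vP 0 * int 10000" "10001 ^ (g + 1) = M vQ 0 * (int 10000 + 1)"
      using M by simp_all
    show "\<bar>4 * S * 10000 ^ (g + 1)\<bar> \<le> Z" "\<bar>10001 ^ (g + 1)\<bar> \<le> Z"
      using pow_le[of "g + 1"] g S(1) by (auto simp: abs_mult)
  qed (intro conjI; assumption)
  then obtain t2 M2 where b2: "t2 \<le> 30 * s\<^sup>2" "bs Z (q_c 10000) M t2 M2" "?Q2 M2" by (auto simp: tri_def)
  define \<sigma>1 where "\<sigma>1 = tick (1 + bcost M guard_b) \<sigma>"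
  obtain C2 where C2: "C2 \<le> t2 * u" "exec orc fuel (q_c 10000) \<sigma>1 = return_pmf (Some (\<sigma>1\<lparr>mem := M2, cost := cost \<sigma>1 + C2\<rparr>))"
    using bs_exec[OF b2(2) wfc_parts(2) M(12) K(1), of fuel \<sigma>1 orc] b2(1) fuel by (auto simp: \<sigma>1_def tick_def M_def u_def)
  define \<sigma>2 where "\<sigma>2 = \<sigma>1\<lparr>mem := M2, cost := cost \<sigma>1 + C2\<rparr>"
  have bd2: "bd Z M2" using bs_bd[OF b2(2) M(12)] .
  define \<sigma>3 where "\<sigma>3 xs = tick 1 (load answer_array (concat (map enc_vec xs)) (\<sigma>2\<lparr>queries := queries \<sigma>2 @ [qry g]\<rparr>))" for xs
  have ex1: "exec orc fuel body_c \<sigma>1 = bind_pmf (orc (qry g)) (\<lambda>xs. exec orc fuel inc_c (\<sigma>3 xs))"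
  proof -
    have "dec_query (mem \<sigma>2 query_array) = qry g" using b2(3) by (simp add: \<sigma>2_def)
    then have "exec orc fuel Query \<sigma>2 = map_pmf (\<lambda>xs. Some (\<sigma>3 xs)) (orc (qry g))" by (simp add: \<sigma>3_def Let_def)
    then show ?thesis unfolding body_c_def exec.simps(3) C2(2) \<sigma>2_def[symmetric]
      by (simp add: bind_return_pmf bind_map_pmf)
  qed
  \<comment> \<open>For a fixed answer the rest of the round is deterministic; the function
    \<open>f\<close> is then obtained by choice over all answers.\<close>
  have "\<exists>\<tau>. exec orc fuel inc_c (\<sigma>3 xs) = return_pmf (Some \<tau>) \<and> Inv (Suc g) \<tau> \<and> mem \<tau> vNrm 0 \<le> M vNrm 0 \<and>
      (\<forall>i<2 ^ ((n + 1) div 2). mem \<tau> vNrm 0 \<le> ip n (cand 1 0 (smp S (mem (\<sigma>3 xs)) i) 0) (cand 1 0 (smp S (mem (\<sigma>3 xs)) i) 0))" for xs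
  proof -
    define M3 where "M3 = mem (\<sigma>3 xs)"
    have M3: "M3 = M2(answer_array := (\<lambda>i. if i < length (concat (map enc_vec xs)) then concat (map enc_vec xs) ! i else 0))"
      by (simp add: M3_def \<sigma>3_def tick_def load_def \<sigma>2_def)
    have sm23: "same {answer_array} M2 M3" by (auto simp: same_def M3)
    have sm: "same {query_array, vI, vP, vQ, answer_array} M M3"
      using same_trans[OF conjunct1[OF b2(3)] sm23] by simp
    have B3: "Base M3" "Best M3" using Base_same[OF _ sm23] Best_same[OF _ sm23] b2(3) by auto
    \<comment> \<open>\<open>bd\<close> exempts the answer array, so an arbitrary answer does not
      spoil the bound \<open>Z\<close>.\<close>
    have bd3: "bd Z M3" using bd2 by (auto simp: bd_def M3)
    have N3: "M3 vNrm 0 = M vNrm 0" using sameD[OF sm] by simp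
    let ?Q4 = "\<lambda>M'. same {aU, aC, aX, aBest, vNrm, vE, vI, vJ, vK, vL, vp, vq} M3 M' \<and> Base M' \<and> Best M' \<and>
       M' vE 0 = 0 \<and> M' vNrm 0 \<le> M3 vNrm 0 \<and>
       (\<forall>i<2 ^ ((n + 1) div 2). M' vNrm 0 \<le> ip n (cand 1 0 (smp S M3 i) 0) (cand 1 0 (smp S M3 i) 0))"
    let ?Q5 = "\<lambda>M''. \<exists>M'. ?Q4 M' \<and> M'' = upd M' vG 0 (int g + 1)"
    have "tri Z inc_c M3 (2 ^ ((n + 1) div 2) * (50 * s\<^sup>2) + 2 + 1) ?Q5"
      unfolding inc_c_def
    proof (rule tri_Seq[where t = "2 ^ ((n + 1) div 2) * (50 * s\<^sup>2) + 2" and t' = "Suc 0"])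
      show "tri Z samples_c M3 (2 ^ ((n + 1) div 2) * (50 * s\<^sup>2) + 2)
         (\<lambda>M'. tri Z (set_var vG (Add (var vG) (Num 1))) M' (Suc 0) ?Q5)"
      proof (rule samples_c[OF B3 _ _ _ _ _ S(2)])
        show "M3 vW 0 = 1" "M3 vH 0 = 0" "M3 vE 0 = 0" "M3 vS 0 = S" "0 \<le> S" "int (2 ^ ((n + 1) div 2)) \<le> Z"
          using M S(1) MZ(1) sameD[OF sm] by simp_all
        show "M3 vM 0 = int (2 ^ ((n + 1) div 2))" using M sameD[OF sm] by simp
        fix M' assume Q: "same {aU, aC, aX, aBest, vNrm, vE, vI, vJ, vK, vL, vp, vq} M3 M'" "Base M'" "Best M'"
          "M' vE 0 = 0" "M' vNrm 0 \<le> M3 vNrm 0"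
          "\<And>i. i < 2 ^ ((n + 1) div 2) \<Longrightarrow> M' vNrm 0 \<le> ip n (cand 1 0 (smp S M3 i) 0) (cand 1 0 (smp S M3 i) 0)"
        have "M' vG 0 = int g" using sameD[OF Q(1), of vG] sameD[OF sm, of vG] M by simp
        then have e: "aval M' (Add (var vG) (Num 1)) = int g + 1" by simp
        show "tri Z (set_var vG (Add (var vG) (Num 1))) M' (Suc 0) ?Q5"
        proof (rule tri_Store; unfold e)
          show "\<bar>int g + 1\<bar> \<le> Z" using g MZ(5) by linarith
          show "\<exists>M'a. ?Q4 M'a \<and> upd M' vG (nat (aval M' (Num 0))) (int g + 1) = upd M'a vG 0 (int g + 1)"
            using Q by (intro exI[of _ M']) simp
        qed
      qed
    qed simp
    then obtain t4 M4 M' where b4: "t4 \<le> 2 ^ ((n + 1) div 2) * (50 * s\<^sup>2) + 3" "bs Z inc_c M3 t4 M4" "?Q4 M'" "M4 = upd M' vG 0 (int g + 1)"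
    proof -
      have "2 ^ ((n + 1) div 2) * (50 * s\<^sup>2) + 2 + 1 = 2 ^ ((n + 1) div 2) * (50 * s\<^sup>2) + 3" by simp
      then show thesis using \<open>tri Z inc_c M3 _ ?Q5\<close> that unfolding tri_def by metis
    qed
    obtain C4 where C4: "C4 \<le> t4 * u" "exec orc fuel inc_c (\<sigma>3 xs) = return_pmf (Some ((\<sigma>3 xs)\<lparr>mem := M4, cost := cost (\<sigma>3 xs) + C4\<rparr>))"
      using bs_exec[OF b4(2) wfc_parts(3) bd3 K(2), of fuel "\<sigma>3 xs" orc] b4(1) fuel by (auto simp: M3_def u_def)
    define \<tau> where "\<tau> = (\<sigma>3 xs)\<lparr>mem := M4, cost := cost (\<sigma>3 xs) + C4\<rparr>"
    have smG: "same {vG} M' M4" by (simp add: b4(4) same_def)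
    have B4: "Base M4" "Best M4" using Base_same[OF _ smG] Best_same[OF _ smG] b4(3) by auto
    have sm4: "same {query_array, vI, vP, vQ, answer_array, aU, aC, aX, aBest, vNrm, vE, vJ, vK, vL, vp, vq, vG} M M4"
      using sm conjunct1[OF b4(3)] smG by (auto simp: same_def)
    have "Inv (Suc g) \<tau>"
    proof -
      have bd4: "bd Z M4" using bs_bd[OF b4(2) bd3] .
      have e: "M4 vE 0 = 0" "M4 vG 0 = int (Suc g)" using b4(3,4) by simp_all
      have pq: "M4 vP 0 = 4 * S * 10000 ^ Suc g" "M4 vQ 0 = 10001 ^ Suc g"
        using b2(3) sameD[OF sm23] sameD[OF conjunct1[OF b4(3)]] b4(4) by simp_all
      have r: "M4 vW 0 = 1" "M4 vH 0 = 0" "M4 vS 0 = S" "M4 vM 0 = 2 ^ ((n + 1) div 2)" "M4 vDen 0 = Den"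
        using sameD[OF sm4] M by simp_all
      have qq: "queries \<tau> = queries \<sigma> @ [qry g]" by (simp add: \<tau>_def \<sigma>3_def tick_def load_def \<sigma>2_def \<sigma>1_def)
      have vq: "valid_query (qry g)" using E.bq_basis sg_pos by (simp add: valid_query_def qry_def)
      have "cost \<tau> = cost \<sigma> + (1 + bcost M guard_b) + C2 + 1 + C4"
        by (simp add: \<tau>_def \<sigma>3_def tick_def load_def \<sigma>2_def \<sigma>1_def)
      also have "\<dots> \<le> cost \<sigma> + u + (30 * s\<^sup>2) * u + u + (2 ^ ((n + 1) div 2) * (50 * s\<^sup>2) + 3) * u"
      proof -
        have "C2 \<le> (30 * s\<^sup>2) * u" using C2(1) b2(1) by (meson le_trans mult_le_mono1)
        moreover have "C4 \<le> (2 ^ ((n + 1) div 2) * (50 * s\<^sup>2) + 3) * u" using C4(1) b4(1) by (meson le_trans mult_le_mono1)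
        moreover have "1 + bcost M guard_b \<le> u" using bsz_guard_cost[OF M(12)] by (simp add: u_def)
        ultimately show ?thesis using u1 by linarith
      qed
      also have "\<dots> \<le> cost \<sigma> + c1" by (simp add: c1_def u_def[symmetric] algebra_simps)
      finally have "cost \<tau> \<le> c0 + Suc g * c1" using cst by simp
      moreover have "mem \<tau> = M4" by (simp add: \<tau>_def)
      moreover have "length (E.bq) = d + 1" by (simp add: E.bq_def)
      ultimately show ?thesis
        using B4 bd4 e pq r qq qs vq unfolding Inv_def Let_def by (auto simp: qry_def)
    qed
    moreover have "mem \<tau> vNrm 0 \<le> M vNrm 0" using b4(3,4) N3 by (simp add: \<tau>_def)
    moreover have "\<forall>i<2 ^ ((n + 1) div 2). mem \<tau> vNrm 0 \<le> ip n (cand 1 0 (smp S (mem (\<sigma>3 xs)) i) 0) (cand 1 0 (smp S (mem (\<sigma>3 xs)) i) 0)"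
      using b4(3,4) by (simp add: \<tau>_def M3_def)
    ultimately show ?thesis using C4(2) unfolding \<tau>_def[symmetric] by blast
  qed
  then obtain f where f: "\<And>xs. exec orc fuel inc_c (\<sigma>3 xs) = return_pmf (Some (f xs))" "\<And>xs. Inv (Suc g) (f xs)"
    "\<And>xs. mem (f xs) vNrm 0 \<le> M vNrm 0"
    "\<And>xs i. i < 2 ^ ((n + 1) div 2) \<Longrightarrow> mem (f xs) vNrm 0 \<le> ip n (cand 1 0 (smp S (mem (\<sigma>3 xs)) i) 0) (cand 1 0 (smp S (mem (\<sigma>3 xs)) i) 0)"
    by metis
  have "exec orc fuel body_c \<sigma>1 = map_pmf (\<lambda>xs. Some (f xs)) (orc (qry g))"
    unfolding ex1 f(1) map_pmf_def ..
  moreover have "of_int (mem (f xs) vNrm 0) \<le> r"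
    if r: "length xs \<le> 2 ^ ((n + 1) div 2)" "set xs \<subseteq> carrier_vec (n + 1)" "\<exists>x\<in>set xs. real_vec x \<in> E.good r" "r \<le> (2 * of_int S)\<^sup>2"
    for xs and r :: real
  proof -
    have "mem (\<sigma>3 xs) answer_array = (\<lambda>i. if i < length (concat (map enc_vec xs)) then concat (map enc_vec xs) ! i else 0)"
      by (simp add: \<sigma>3_def tick_def load_def)
    from smp_hit[where \<sigma> = "sg g" and M = "mem (\<sigma>3 xs)", OF sg_pos r(1,2) this r(3,4)] S(1)
    obtain i where i: "i < 2 ^ ((n + 1) div 2)" "of_int (ip n (cand 1 0 (smp S (mem (\<sigma>3 xs)) i) 0) (cand 1 0 (smp S (mem (\<sigma>3 xs)) i) 0)) \<le> r" by auto
    have "real_of_int (mem (f xs) vNrm 0) \<le> of_int (ip n (cand 1 0 (smp S (mem (\<sigma>3 xs)) i) 0) (cand 1 0 (smp S (mem (\<sigma>3 xs)) i) 0))"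
      using f(4)[OF i(1)] by (simp only: of_int_le_iff)
    then show ?thesis using i(2) by linarith
  qed
  ultimately show ?thesis using f(2,3) unfolding \<sigma>1_def M_def by blast
qed

end

section \<open>Success probability of the search\<close>

context search
begin

definition Succ :: "real \<Rightarrow> config \<Rightarrow> bool" where
  "Succ R \<tau> \<longleftrightarrow> (\<exists>z\<in>lat d b. (\<forall>j<n. mem \<tau> output_array (2 * j) = z j \<and> mem \<tau> output_array (2 * j + 1) = Den) \<and>
     of_int (ip n (\<lambda>x. z x - b d x) (\<lambda>x. z x - b d x)) \<le> R)"

definition Fin :: "config \<Rightarrow> bool" where
  "Fin \<tau> \<longleftrightarrow> (\<exists>\<sigma>. Inv (30000 * n) \<sigma> \<and> \<tau> = tick (1 + bcost (mem \<sigma>) guard_b) \<sigma>)"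

lemma of_rat_sg: "real_of_rat (sg g) = 4 * of_int S * (10000 / 10001) ^ (g + 1)"
  unfolding sg_def by (subst of_rat_rat) (auto simp: power_divide)

lemma step_miss:
  assumes I: "Inv g \<sigma>" and g: "g < 30000 * n" and gd: "good_dim n" and n: "n \<ge> 1"
    and orc: "dgs_oracle (nat \<lfloor>2 powr (real n / 2)\<rfloor>) (1 / 2) orc"
    and c: "c \<in> lat d b" and m: "m = nq n c (\<lambda>j. of_int (- 1) * of_int (b d j))" "m \<le> (of_int S)\<^sup>2"
    and w: "345 / 1000 \<le> pi * m / (4 * of_int S * (10000 / 10001) ^ (g + 1))\<^sup>2 / real n"
      "pi * m / (4 * of_int S * (10000 / 10001) ^ (g + 1))\<^sup>2 / real n \<le> 3465 / 10000"
    and f: "\<And>xs r. length xs \<le> 2 ^ ((n + 1) div 2) \<Longrightarrow> set xs \<subseteq> carrier_vec (n + 1) \<Longrightarrow>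
        \<exists>x\<in>set xs. real_vec x \<in> embedding.good n d b (sg g) r \<Longrightarrow> r \<le> (2 * of_int S)\<^sup>2 \<Longrightarrow> of_int (mem (f xs) vNrm 0) \<le> (r::real)"
  shows "measure_pmf.prob (map_pmf (\<lambda>xs. Some (f xs)) (orc (qry g)))
    {Some \<tau> | \<tau>. \<not> of_int (mem \<tau> vNrm 0) \<le> (197 / 100)\<^sup>2 * m} \<le> 88 / 100"
proof -
  interpret E: embedding n d b "sg g" by (rule emb)
  define R where "R = (197 / 100)\<^sup>2 * m"
  let ?N = "{xs. \<forall>x\<in>set xs. real_vec x \<notin> E.good R}"
  have q: "qry g = (n + 1, E.bq, sg g)" by (simp add: qry_def)
  have v: "valid_query (n + 1, E.bq, sg g)" using E.bq_basis sg_pos by (simp add: valid_query_def)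
  have len: "length xs \<le> 2 ^ ((n + 1) div 2) \<and> set xs \<subseteq> carrier_vec (n + 1)" if "xs \<in> set_pmf (orc (qry g))" for xs
  proof -
    have "length xs = nat \<lfloor>2 powr (real n / 2)\<rfloor>" "set xs \<subseteq> carrier_vec (n + 1)"
      using orc v that unfolding dgs_oracle_def q by blast+
    \<comment> \<open>The program looks at \<open>2 ^ \<lceil>n / 2\<rceil>\<close> slots, so no
      sample is missed.\<close>
    moreover have "nat \<lfloor>2 powr (real n / 2)\<rfloor> \<le> 2 ^ ((n + 1) div 2)"
    proof -
      have "real n / 2 \<le> real ((n + 1) div 2)" by linarith
      then have "2 powr (real n / 2) \<le> 2 powr (real ((n + 1) div 2))" by (intro powr_mono) auto
      also have "\<dots> = real (2 ^ ((n + 1) div 2))" by (simp add: powr_realpow)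
      finally show ?thesis by linarith
    qed
    ultimately show ?thesis by simp
  qed
  have m0: "0 \<le> m" unfolding m(1) by (rule nq_nonneg)
  \<comment> \<open>As 1.97 is below 2, clamping at \<open>2 * S\<close> spares every vector that
    counts.\<close>
  have R: "R \<le> (2 * of_int S)\<^sup>2"
    using m(2) m0 unfolding R_def by (simp add: power2_eq_square)
  have "measure_pmf.prob (map_pmf (\<lambda>xs. Some (f xs)) (orc (qry g))) {Some \<tau> | \<tau>. \<not> of_int (mem \<tau> vNrm 0) \<le> R} =
      measure_pmf.prob (orc (qry g)) {xs. \<not> of_int (mem (f xs) vNrm 0) \<le> R}"
    by (simp add: measure_map_pmf vimage_def)
  also have "\<dots> \<le> measure_pmf.prob (orc (qry g)) ?N"
  proof (rule measure_pmf.finite_measure_mono_AE)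
    show "AE xs in measure_pmf (orc (qry g)). xs \<in> {xs. \<not> of_int (mem (f xs) vNrm 0) \<le> R} \<longrightarrow> xs \<in> ?N"
      unfolding AE_measure_pmf_iff using len f[OF _ _ _ R] by blast
  qed simp
  also have "\<dots> \<le> 88 / 100"
    unfolding q R_def by (rule E.miss_le[OF gd orc c _ n]) (use m w in \<open>simp_all only: of_rat_sg\<close>)
  finally show ?thesis unfolding R_def .
qed

text \<open>Two ways to succeed: the preprocessing has already found a vector that is close enough,
  or nine favourable rounds lie ahead. The remaining rounds get the trivial bound 1, which is
  harmless because the best vector only improves.\<close>

lemma loop_res:
  assumes I: "Inv 0 \<sigma>" and n: "n \<ge> 1" and fl: "fuel > 30000 * n"
    and orc: "dgs_oracle (nat \<lfloor>2 powr (real n / 2)\<rfloor>) (1 / 2) orc"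
    and c: "c \<in> lat d b" and m: "m = nq n c (\<lambda>j. of_int (- 1) * of_int (b d j))"
    and hyp: "of_int (mem \<sigma> vNrm 0) \<le> (197 / 100)\<^sup>2 * m \<or>
      (good_dim n \<and> 1 \<le> m \<and> m \<le> nrm \<and> nrm \<le> (of_int S)\<^sup>2 \<and> nrm \<le> 2 ^ n * m \<and> (S = 1 \<or> (of_int S)\<^sup>2 < 4 * nrm))"
  shows "let res = exec orc fuel (While guard_b body_c) \<sigma> in None \<notin> set_pmf res \<and> (\<forall>\<tau>. Some \<tau> \<in> set_pmf res \<longrightarrow> Fin \<tau>) \<and>
    measure_pmf.prob res {Some \<tau> | \<tau>. \<not> of_int (mem \<tau> vNrm 0) \<le> (197 / 100)\<^sup>2 * m} \<le> 1 / 3"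
proof -
  define R where "R = (197 / 100)\<^sup>2 * m"
  define Good where "Good \<sigma> \<longleftrightarrow> of_int (mem \<sigma> vNrm 0) \<le> R" for \<sigma> :: config
  obtain g0 where g0: "Good \<sigma> \<or> (g0 + 9 \<le> 30000 * n \<and> good_dim n \<and> m \<le> (of_int S)\<^sup>2 \<and> (\<forall>g. g0 \<le> g \<and> g < g0 + 9 \<longrightarrow>
     345 / 1000 \<le> pi * m / (4 * of_int S * (10000 / 10001) ^ (g + 1))\<^sup>2 / real n \<and>
     pi * m / (4 * of_int S * (10000 / 10001) ^ (g + 1))\<^sup>2 / real n \<le> 3465 / 10000))"
  proof (cases "Good \<sigma>")
    case False
    then have h: "good_dim n" "1 \<le> m" "m \<le> nrm" "nrm \<le> (of_int S)\<^sup>2" "nrm \<le> 2 ^ n * m" "of_int S = (1::real) \<or> (of_int S)\<^sup>2 < 4 * nrm"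
      using hyp by (auto simp: Good_def R_def)
    have "1 \<le> real_of_int S" using S(1) by simp
    from guesses_hit[OF n h(2-5) this h(6)] h that show thesis by force
  qed (use that in blast)
  define \<delta> :: "nat \<Rightarrow> real" where "\<delta> g = (if Good \<sigma> \<or> \<not> (g0 \<le> g \<and> g < g0 + 9) then 1 else 88 / 100)" for g
  have main: "let res = (loopF orc fuel guard_b body_c ^^ fuel) (\<lambda>\<sigma>. return_pmf None) \<sigma> in
     None \<notin> set_pmf res \<and> (\<forall>\<tau>. Some \<tau> \<in> set_pmf res \<longrightarrow> Fin \<tau>) \<and>
     measure_pmf.prob res {Some \<tau> | \<tau>. \<not> Good \<tau>} \<le> (if Good \<sigma> then 0 else \<Prod>i\<in>{0..<30000 * n}. \<delta> i)"
  proof (rule loop_prob[where Inv = Inv])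
    fix g \<tau> assume g: "g < 30000 * n" and Ig: "Inv g \<tau>"
    obtain f where f: "exec orc fuel body_c (tick (1 + bcost (mem \<tau>) guard_b) \<tau>) = map_pmf (\<lambda>xs. Some (f xs)) (orc (qry g))"
      "\<And>xs. Inv (Suc g) (f xs)" "\<And>xs. mem (f xs) vNrm 0 \<le> mem \<tau> vNrm 0"
      "\<And>xs r. length xs \<le> 2 ^ ((n + 1) div 2) \<Longrightarrow> set xs \<subseteq> carrier_vec (n + 1) \<Longrightarrow>
        \<exists>x\<in>set xs. real_vec x \<in> embedding.good n d b (sg g) r \<Longrightarrow> r \<le> (2 * of_int S)\<^sup>2 \<Longrightarrow> of_int (mem (f xs) vNrm 0) \<le> (r::real)"
      using iter[OF Ig g] by blast
    have mono: "Good (f xs)" if "Good \<tau>" for xs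
      using that f(3)[of xs] unfolding Good_def by (meson of_int_le_iff order_trans)
    have "measure_pmf.prob (map_pmf (\<lambda>xs. Some (f xs)) (orc (qry g))) {Some \<tau> | \<tau>. \<not> Good \<tau>} \<le> \<delta> g"
    proof (cases "Good \<sigma> \<or> \<not> (g0 \<le> g \<and> g < g0 + 9)")
      case False
      then have h: "good_dim n" "m \<le> (of_int S)\<^sup>2" "345 / 1000 \<le> pi * m / (4 * of_int S * (10000 / 10001) ^ (g + 1))\<^sup>2 / real n"
        "pi * m / (4 * of_int S * (10000 / 10001) ^ (g + 1))\<^sup>2 / real n \<le> 3465 / 10000" using g0 by auto
      show ?thesis using False step_miss[OF Ig g h(1) n orc c m h(2-4) f(4)] unfolding Good_def R_def \<delta>_def by simp
    qed (simp add: \<delta>_def)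
    then show "bval (mem \<tau>) guard_b \<and>
      (let p = exec orc fuel body_c (tick (1 + bcost (mem \<tau>) guard_b) \<tau>) in
        None \<notin> set_pmf p \<and> (\<forall>\<tau>'. Some \<tau>' \<in> set_pmf p \<longrightarrow> Inv (Suc g) \<tau>' \<and> (Good \<tau> \<longrightarrow> Good \<tau>')) \<and>
        (\<not> Good \<tau> \<longrightarrow> measure_pmf.prob p {Some \<tau> | \<tau>. \<not> Good \<tau>} \<le> \<delta> g))"
      unfolding f(1) Let_def using guard_val[OF Ig] g f(2) mono by auto
  next
    fix \<tau> assume "Inv (30000 * n) \<tau>"
    then show "\<not> bval (mem \<tau>) guard_b \<and> Fin (tick (1 + bcost (mem \<tau>) guard_b) \<tau>) \<and> (Good \<tau> \<longrightarrow> Good (tick (1 + bcost (mem \<tau>) guard_b) \<tau>))"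
      using guard_val[of "30000 * n" \<tau>] by (auto simp: Fin_def Good_def tick_def)
  next
    show "0 \<le> \<delta> g" for g by (simp add: \<delta>_def)
  qed (use I fl in auto)
  have "(if Good \<sigma> then 0 else \<Prod>i\<in>{0..<30000 * n}. \<delta> i) \<le> 1 / 3"
  proof (cases "Good \<sigma>")
    case False
    then have "g0 + 9 \<le> 30000 * n" using g0 by auto
    then have "(\<Prod>i\<in>{0..<30000 * n}. \<delta> i) = (\<Prod>i\<in>{g0..<g0 + 9}. \<delta> i)"
      by (intro prod.mono_neutral_right) (auto simp: \<delta>_def)
    also have "\<dots> = (\<Prod>i\<in>{g0..<g0 + 9}. 88 / 100)" using False by (intro prod.cong) (auto simp: \<delta>_def)
    also have "\<dots> \<le> 1 / 3" by (simp add: power_divide)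
    finally show ?thesis using False by simp
  qed simp
  then show ?thesis using main unfolding exec_While Let_def Good_def R_def by auto
qed

lemma search_res:
  assumes I: "Inv 0 \<sigma>" and n: "n \<ge> 1" and fl: "fuel > 30000 * n" "fuel \<ge> 4 * s + 2"
    and orc: "dgs_oracle (nat \<lfloor>2 powr (real n / 2)\<rfloor>) (1 / 2) orc"
    and c: "c \<in> lat d b" and m: "m = nq n c (\<lambda>j. of_int (- 1) * of_int (b d j))"
    and hyp: "of_int (mem \<sigma> vNrm 0) \<le> (197 / 100)\<^sup>2 * m \<or>
      (good_dim n \<and> 1 \<le> m \<and> m \<le> nrm \<and> nrm \<le> (of_int S)\<^sup>2 \<and> nrm \<le> 2 ^ n * m \<and> (S = 1 \<or> (of_int S)\<^sup>2 < 4 * nrm))"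
    and KO: "csz out_c \<le> K" and ZO: "Tb + Cb \<le> Z"
  shows "let res = exec orc fuel (Seq (While guard_b body_c) out_c) \<sigma> in None \<notin> set_pmf res \<and>
    (\<forall>\<tau>. Some \<tau> \<in> set_pmf res \<longrightarrow> length (queries \<tau>) = 30000 * n \<and>
      (\<forall>(n', B', s') \<in> set (queries \<tau>). valid_query (n', B', s') \<and> n' = n + 1 \<and> length B' = d + 1) \<and>
      cost \<tau> \<le> c0 + 30000 * n * c1 + (4 * s + 3) * unit_cost K Z) \<and>
    measure_pmf.prob res {Some \<tau> | \<tau>. Succ ((197 / 100)\<^sup>2 * m) \<tau>} \<ge> 2 / 3"
proof -
  define R where "R = (197 / 100)\<^sup>2 * m"
  define Good where "Good \<sigma> \<longleftrightarrow> of_int (mem \<sigma> vNrm 0) \<le> R" for \<sigma> :: config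
  define p where "p = exec orc fuel (While guard_b body_c) \<sigma>"
  have p: "None \<notin> set_pmf p" "\<And>\<tau>. Some \<tau> \<in> set_pmf p \<Longrightarrow> Fin \<tau>" "measure_pmf.prob p {Some \<tau> | \<tau>. \<not> Good \<tau>} \<le> 1 / 3"
    using loop_res[OF I n fl(1) orc c m hyp] by (auto simp: Let_def p_def Good_def R_def)
  define PP where "PP \<tau> \<tau>' \<longleftrightarrow> exec orc fuel out_c \<tau> = return_pmf (Some \<tau>') \<and> (Good \<tau> \<longrightarrow> Succ R \<tau>') \<and> length (queries \<tau>') = 30000 * n \<and>
      (\<forall>(n', B', s') \<in> set (queries \<tau>'). valid_query (n', B', s') \<and> n' = n + 1 \<and> length B' = d + 1) \<and>
      cost \<tau>' \<le> c0 + 30000 * n * c1 + (4 * s + 3) * unit_cost K Z" for \<tau> \<tau>'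
  have "\<exists>\<tau>'. PP \<tau> \<tau>'" if F: "Fin \<tau>" for \<tau>
  proof -
    obtain \<sigma>' where s': "Inv (30000 * n) \<sigma>'" "\<tau> = tick (1 + bcost (mem \<sigma>') guard_b) \<sigma>'" using F by (auto simp: Fin_def)
    define M where "M = mem \<tau>"
    have M: "Base M" "Best M" "M vDen 0 = Den" "bd Z M" and q: "length (queries \<tau>) = 30000 * n"
      "\<forall>(n', B', s') \<in> set (queries \<tau>). valid_query (n', B', s') \<and> n' = n + 1 \<and> length B' = d + 1"
      and cst: "cost \<tau> \<le> c0 + 30000 * n * c1 + unit_cost K Z"
      using s' bsz_guard_cost[of "mem \<sigma>'"] by (auto simp: Inv_def Let_def tick_def M_def)
    have "\<bar>M vDen 0\<bar> \<le> Z" using M(4) by (simp add: bd_def)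
    then have "tri Z out_c M (4 * s + 2) (\<lambda>M'. \<forall>j<n. M' output_array (2 * j) = b d j + M aBest j \<and> M' output_array (2 * j + 1) = Den)"
      using M by (intro out_c[OF M(1) _ _ ZO]) (auto simp: Best_def)
    then obtain t M' where b: "t \<le> 4 * s + 2" "bs Z out_c M t M'"
      "\<forall>j<n. M' output_array (2 * j) = b d j + M aBest j \<and> M' output_array (2 * j + 1) = Den" by (auto simp: tri_def)
    obtain C where C: "C \<le> t * unit_cost K Z" "exec orc fuel out_c \<tau> = return_pmf (Some (\<tau>\<lparr>mem := M', cost := cost \<tau> + C\<rparr>))"
      using bs_exec[OF b(2) wfc_parts(4) M(4) KO, of fuel \<tau> orc] b(1) fl by (auto simp: M_def)
    have "Succ R (\<tau>\<lparr>mem := M', cost := cost \<tau> + C\<rparr>)" if G: "Good \<tau>"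
      unfolding Succ_def
    proof (intro bexI conjI)
      let ?z = "\<lambda>x. irow n (M aBest) 0 x + b d x"
      show "?z \<in> lat d b" using M(2) by (simp add: Best_def)
      show "\<forall>j<n. mem (\<tau>\<lparr>mem := M', cost := cost \<tau> + C\<rparr>) output_array (2 * j) = ?z j \<and>
         mem (\<tau>\<lparr>mem := M', cost := cost \<tau> + C\<rparr>) output_array (2 * j + 1) = Den"
        using b(3) by (auto simp: irow_def)
      show "of_int (ip n (\<lambda>x. ?z x - b d x) (\<lambda>x. ?z x - b d x)) \<le> R"
        using G M(2) by (simp add: Good_def Best_def M_def)
    qed
    moreover have "C \<le> (4 * s + 2) * unit_cost K Z" using C(1) b(1) by (meson le_trans mult_le_mono1)
    ultimately show ?thesis using C(2) q cst by (intro exI[of _ "\<tau>\<lparr>mem := M', cost := cost \<tau> + C\<rparr>"]) (auto simp: PP_def algebra_simps)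
  qed
  then obtain h where "\<And>\<tau>. Fin \<tau> \<Longrightarrow> PP \<tau> (h \<tau>)" by metis
  then have h: "\<And>\<tau>. Fin \<tau> \<Longrightarrow> exec orc fuel out_c \<tau> = return_pmf (Some (h \<tau>))" "\<And>\<tau>. Fin \<tau> \<Longrightarrow> Good \<tau> \<Longrightarrow> Succ R (h \<tau>)"
    "\<And>\<tau>. Fin \<tau> \<Longrightarrow> length (queries (h \<tau>)) = 30000 * n \<and>
      (\<forall>(n', B', s') \<in> set (queries (h \<tau>)). valid_query (n', B', s') \<and> n' = n + 1 \<and> length B' = d + 1) \<and>
      cost (h \<tau>) \<le> c0 + 30000 * n * c1 + (4 * s + 3) * unit_cost K Z" unfolding PP_def by blast+
  define N where "N = case_option (return_pmf None) (exec orc fuel out_c)"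
  define res where "res = exec orc fuel (Seq (While guard_b body_c) out_c) \<sigma>"
  have res: "res = bind_pmf p N" by (simp add: res_def p_def N_def)
  have N: "\<exists>\<tau>. x = Some \<tau> \<and> Fin \<tau> \<and> N x = return_pmf (Some (h \<tau>))" if "x \<in> set_pmf p" for x
    using that p(1,2) h(1) by (cases x) (auto simp: N_def)
  have supp: "\<exists>\<tau>. Fin \<tau> \<and> y = Some (h \<tau>)" if "y \<in> set_pmf res" for y
    using that N by (fastforce simp: res)
  let ?A = "- {Some \<tau> | \<tau>. Succ R \<tau>}"
  \<comment> \<open>Writing the output is deterministic, so the run can fail only where the loop
    ended without a good vector.\<close>
  have "measure_pmf.prob res ?A \<le> 1 / 3 * 1"
    unfolding res
  proof (rule bind_prob_le[OF _ p(3)])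
    fix x assume "x \<in> set_pmf p"
    then obtain \<tau> where "x = Some \<tau>" "Fin \<tau>" "N x = return_pmf (Some (h \<tau>))" using N by blast
    then show "measure_pmf.prob (N x) ?A \<le> (if x \<in> {Some \<tau> | \<tau>. \<not> Good \<tau>} then 1 else 0)"
      using h(2)[of \<tau>] by auto
  qed simp
  moreover have "measure_pmf.prob res ?A = 1 - measure_pmf.prob res {Some \<tau> | \<tau>. Succ R \<tau>}"
    using measure_pmf.prob_compl[of "{Some \<tau> | \<tau>. Succ R \<tau>}" res] by (simp add: Compl_eq_Diff_UNIV)
  ultimately have "2 / 3 \<le> measure_pmf.prob res {Some \<tau> | \<tau>. Succ R \<tau>}" by linarith
  then show ?thesis unfolding res_def[symmetric] Let_def R_def[symmetric] using supp h(3) by fastforce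
qed

end

section \<open>Sizes of the numbers involved\<close>

text \<open>All bounds are powers of two, so comparing sizes becomes linear arithmetic with
  exponents; \<open>N_simps\<close> supplies the inequalities between powers of
  \<open>N\<close>.\<close>

lemma pow2_mult: "0 \<le> y \<Longrightarrow> x \<le> 2 ^ a \<Longrightarrow> y \<le> 2 ^ b \<Longrightarrow> a + b \<le> c \<Longrightarrow> x * y \<le> (2 :: int) ^ c"
  by (rule order_trans[OF mult_mono[of x "2 ^ a" y "2 ^ b"]]) (auto simp: power_add[symmetric] intro: power_increasing)

lemma pow2_add: "x \<le> 2 ^ a \<Longrightarrow> y \<le> 2 ^ b \<Longrightarrow> a + 1 \<le> c \<Longrightarrow> b + 1 \<le> c \<Longrightarrow> x + y \<le> (2 :: int) ^ c"
proof -
  assume h: "x \<le> 2 ^ a" "y \<le> 2 ^ b" "a + 1 \<le> c" "b + 1 \<le> c"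
  have "(2::int) ^ a \<le> 2 ^ (c - 1)" "(2::int) ^ b \<le> 2 ^ (c - 1)" using h by (auto intro!: power_increasing)
  moreover have "(2::int) ^ c = 2 ^ (c - 1) + 2 ^ (c - 1)" using h(3) by (cases c) auto
  ultimately show ?thesis using h(1,2) by linarith
qed

lemma pow2_pow: "0 \<le> x \<Longrightarrow> x \<le> 2 ^ a \<Longrightarrow> a * d \<le> c \<Longrightarrow> x ^ d \<le> (2 :: int) ^ c"
  by (rule order_trans[OF power_mono[of x "2 ^ a" d]]) (auto simp: power_mult[symmetric] intro: power_increasing)

lemma pow2_le: "a \<le> c \<Longrightarrow> (2 :: int) ^ a \<le> 2 ^ c" by (rule power_increasing) auto

lemma nat_le_pow2: "m \<le> c \<Longrightarrow> int m \<le> 2 ^ c"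
proof -
  assume "m \<le> c"
  have "m < 2 ^ m" by (rule less_exp)
  then have "int m \<le> 2 ^ m" by (metis less_imp_le of_nat_le_iff of_nat_numeral of_nat_power)
  also have "\<dots> \<le> 2 ^ c" using \<open>m \<le> c\<close> by (rule pow2_le)
  finally show ?thesis .
qed

locale sizes =
  fixes n d N :: nat
  assumes N: "n \<ge> 1" "2 + 2 * ((d + 1) * n) \<le> N"
begin

lemma N_simps: "4 \<le> N" "n + 2 \<le> N" "d + 1 \<le> N" "(d + 1) * n \<le> N" "4 * N \<le> N\<^sup>2" "4 * N\<^sup>2 \<le> N ^ 3" "16 \<le> N\<^sup>2"
proof -
  have 1: "n \<le> (d + 1) * n" "d + 1 \<le> (d + 1) * n" using N(1) mult_le_mono2[OF N(1), of "d + 1"] by auto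
  show 4: "4 \<le> N" "n + 2 \<le> N" "d + 1 \<le> N" "(d + 1) * n \<le> N" using N 1 by linarith+
  show "4 * N \<le> N\<^sup>2" using 4(1) by (simp add: power2_eq_square)
  show "4 * N\<^sup>2 \<le> N ^ 3" using 4(1) by (simp add: power2_eq_square power3_eq_cube)
  have "4 * 4 \<le> N * N" using 4(1) by (intro mult_mono) auto
  then show "16 \<le> N\<^sup>2" by (simp add: power2_eq_square)
qed

text \<open>\<open>N\<close> will be the length of the input. Squared norms of the rows start below
  \<open>2 ^ (5 * N)\<close>, and squared Gram-Schmidt norms stay below it. A size-reduced row then
  has squared norm at most \<open>d * 2 ^ (5 * N) \<le> Y\<^sup>2\<close>, and determinants are at
  most \<open>2 ^ (5 * N * d) \<le> G\<close>.\<close>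

definition Y :: int where "Y = 2 ^ (3 * N)"
definition G :: int where "G = 2 ^ (5 * N\<^sup>2)"
definition GY :: int where "GY = 2 ^ (5 * N\<^sup>2 + 3 * N)"
text \<open>The large constant makes room for the last guess: \<open>10001 < 2 ^ 14\<close>, and
  \<open>14 * 30000 = 420000\<close>.\<close>

definition Z :: int where "Z = 2 ^ (500000 * N ^ 3)"
definition Xb :: int where "Xb = 2 ^ (3 * N + 2)"
definition Wm :: int where "Wm = 2 ^ (N + 2)"
definition Hm :: int where "Hm = 2 ^ N"
definition F :: int where "F = 1 + (int n * GY + 1 + Wm + Hm) * Y"
definition BB :: int where "BB = 2 ^ (22 * N ^ 3)"
definition Cb :: int where "Cb = 2 ^ (23 * N ^ 3)"

lemma GY: "G * Y = GY" by (simp add: G_def Y_def GY_def power_add)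

lemma pos_consts: "0 \<le> Y" "0 \<le> G" "0 \<le> GY" "0 \<le> Xb" "1 \<le> Wm" "0 \<le> Hm" "0 \<le> BB" "0 \<le> Cb" "1 \<le> Y" "1 \<le> Z"
  unfolding Y_def G_def GY_def Xb_def Wm_def Hm_def BB_def Cb_def Z_def by (simp_all del: power_add_numeral power_Suc add: one_le_power del: add_2_eq_Suc')

lemma nN: "int n \<le> 2 ^ N" "int d \<le> 2 ^ N" by (rule nat_le_pow2, use N_simps in linarith)+

lemma exp_d: "(5 * N\<^sup>2 + 8 * N) * d \<le> 5 * N ^ 3 + 8 * N\<^sup>2"
proof -
  have "(5 * N\<^sup>2 + 8 * N) * d \<le> (5 * N\<^sup>2 + 8 * N) * N" using N_simps by (intro mult_left_mono) auto
  also have "\<dots> = 5 * N ^ 3 + 8 * N\<^sup>2" by (simp add: power2_eq_square power3_eq_cube algebra_simps)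
  finally show ?thesis .
qed

lemma sum_GY: assumes "k \<le> GY" "0 \<le> k" shows "1 + (int n * GY + k) * Y \<le> 2 ^ (5 * N\<^sup>2 + 8 * N)"
proof (rule pow2_add[of 1 0])
  have "int n * GY + k \<le> (int n + 1) * GY" using assms by (simp add: algebra_simps)
  also have "\<dots> \<le> 2 ^ (N + (5 * N\<^sup>2 + 3 * N))"
    using N_simps pos_consts nat_le_pow2[of "n + 1" N] by (intro pow2_mult[where a = N and b = "5 * N\<^sup>2 + 3 * N"]) (auto simp: GY_def)
  finally show "(int n * GY + k) * Y \<le> 2 ^ (N + (5 * N\<^sup>2 + 3 * N) + 3 * N)"
    using pos_consts by (intro pow2_mult[where b = "3 * N"]) (auto simp: Y_def)
qed (use N_simps in auto)

lemma bnd_lll: "Y * (1 + (int n * (G * Y) + 2) * Y) ^ d \<le> 2 ^ (17 * N ^ 3)"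
proof -
  have "2 \<le> GY" unfolding GY_def using pow2_le[of 1] N_simps by simp
  then have "(1 + (int n * GY + 2) * Y) ^ d \<le> 2 ^ (5 * N ^ 3 + 8 * N\<^sup>2)"
    using sum_GY[of 2] exp_d pos_consts by (intro pow2_pow[where a = "5 * N\<^sup>2 + 8 * N"]) auto
  then show ?thesis unfolding GY using N_simps pos_consts
    by (intro pow2_mult[where a = "3 * N" and b = "5 * N ^ 3 + 8 * N\<^sup>2"]) (auto simp: Y_def)
qed

lemma bnd_F: "(4 ^ N + Xb + 1) * F ^ d \<le> BB"
proof -
  have "1 + Wm + Hm \<le> GY" unfolding Wm_def Hm_def GY_def
    using N_simps by (intro pow2_add[where a = "N + 3" and b = N] pow2_add[where a = 0 and b = "N + 2"]) auto
  then have "F \<le> 2 ^ (5 * N\<^sup>2 + 8 * N)" unfolding F_def using sum_GY[of "1 + Wm + Hm"] pos_consts by (simp add: add.assoc)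
  then have "F ^ d \<le> 2 ^ (5 * N ^ 3 + 8 * N\<^sup>2)" using exp_d pos_consts by (intro pow2_pow[where a = "5 * N\<^sup>2 + 8 * N"]) (auto simp: F_def)
  moreover have "4 ^ N + Xb + 1 \<le> 2 ^ (3 * N + 4)"
  proof -
    have "(4::int) ^ N = 2 ^ (2 * N)" by (simp add: power_mult)
    then show ?thesis unfolding Xb_def
      by (intro pow2_add[where a = "3 * N + 3" and b = 0] pow2_add[where a = "2 * N" and b = "3 * N + 2"]) auto
  qed
  ultimately show ?thesis unfolding BB_def using N_simps pos_consts
    by (intro pow2_mult[where a = "3 * N + 4" and b = "5 * N ^ 3 + 8 * N\<^sup>2"]) (auto simp: F_def)
qed

lemma bnd_Cb: "Xb + BB \<le> Cb"
  unfolding Xb_def BB_def Cb_def using N_simps by (intro pow2_add[where a = "3 * N + 2" and b = "22 * N ^ 3"]) auto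

lemma bnd_Z: "int n * 2 ^ (17 * N ^ 3) * (G * Y) + 2 \<le> Z" "2 ^ (17 * N ^ 3) \<le> Z" "int n \<le> Z" "int d \<le> Z"
  "int n * Y * (G * Y) \<le> Z" "G * Y \<le> Z" "int n * BB * GY + 1 + Wm + Hm \<le> Z" "int n * Cb * Cb \<le> Z" "Cb \<le> Z"
  "4 ^ N + Cb \<le> Z" "4 ^ N \<le> Z" "Y \<le> Z" "int ((d + 1) * (n + 1)) \<le> Z" "2 ^ ((n + 1) div 2) \<le> Z" "30000 * int n \<le> Z"
  "2 ^ N \<le> Z" "2 * 2 ^ d + 1 \<le> Z" "(2 * 2 ^ d + 1) ^ d \<le> Z" "3 \<le> Z" "2 ^ (3 * N) \<le> Z" "2 * 2 ^ d + 1 \<le> Wm" "2 ^ d \<le> Hm"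
proof -
  note s = N_simps
  have m: "int n * 2 ^ k * (G * Y) \<le> 2 ^ (N + k + (5 * N\<^sup>2 + 3 * N))" for k
    unfolding GY GY_def using nN by (intro pow2_mult[where a = "N + k" and b = "5 * N\<^sup>2 + 3 * N"] pow2_mult[where a = N and b = k]) auto
  show "int n * 2 ^ (17 * N ^ 3) * (G * Y) + 2 \<le> Z"
    unfolding Z_def using s by (intro pow2_add[OF m, where b = 1]) auto
  show "int n * Y * (G * Y) \<le> Z" unfolding Z_def using s m[of "3 * N"] unfolding Y_def[symmetric]
    by (elim order_trans) (intro pow2_le, auto)
  show "int n * BB * GY + 1 + Wm + Hm \<le> Z"
    unfolding Z_def Wm_def Hm_def using s m[of "22 * N ^ 3"] unfolding BB_def[symmetric] GY
    by (intro pow2_add[where a = "30 * N ^ 3" and b = N] pow2_add[where a = "29 * N ^ 3" and b = "N + 2"] pow2_add[where a = "28 * N ^ 3" and b = 0])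
      (auto elim!: order_trans intro!: pow2_le)
  show "int n * Cb * Cb \<le> Z"
    unfolding Z_def Cb_def using s nN by (intro pow2_mult[where a = "N + 23 * N ^ 3" and b = "23 * N ^ 3"] pow2_mult[where a = N and b = "23 * N ^ 3"]) auto
  have f: "(4::int) ^ N = 2 ^ (2 * N)" by (simp add: power_mult)
  show "4 ^ N + Cb \<le> Z" unfolding Z_def Cb_def f using s by (intro pow2_add[where a = "2 * N" and b = "23 * N ^ 3"]) auto
  have "(d + 1) * (n + 1) = (d + 1) * n + (d + 1)" by simp
  then have "(d + 1) * (n + 1) \<le> 500000 * N ^ 3" using s by linarith
  then show "int ((d + 1) * (n + 1)) \<le> Z" unfolding Z_def by (rule nat_le_pow2)
  have "30000 * n \<le> 500000 * N ^ 3" using s by linarith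
  from nat_le_pow2[OF this] show "30000 * int n \<le> Z" unfolding Z_def by simp
  have W: "2 * 2 ^ d + 1 \<le> (2::int) ^ (d + 2)"
  proof -
    have "(2::int) ^ (d + 2) = 4 * 2 ^ d" "(1::int) \<le> 2 ^ d" by simp_all
    then show ?thesis by linarith
  qed
  show "2 * 2 ^ d + 1 \<le> Z" unfolding Z_def by (rule order_trans[OF W]) (intro pow2_le, use s in linarith)
  show "2 * 2 ^ d + 1 \<le> Wm" unfolding Wm_def by (rule order_trans[OF W]) (intro pow2_le, use s in linarith)
  have "(d + 2) * d \<le> (2 * N) * N" using s by (intro mult_mono) auto
  then have "(d + 2) * d \<le> 500000 * N ^ 3" using s by (simp add: power2_eq_square)
  then show "(2 * 2 ^ d + 1) ^ d \<le> Z" unfolding Z_def using W by (intro pow2_pow[where a = "d + 2"]) auto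
  show "3 \<le> Z" unfolding Z_def by (rule order_trans[OF _ pow2_le[of 2]]) (use s in auto)
  show "G * Y \<le> Z" unfolding GY unfolding GY_def Z_def using s by (intro pow2_le) auto
  show "2 ^ (17 * N ^ 3) \<le> Z" "Cb \<le> Z" "4 ^ N \<le> Z" "Y \<le> Z" "2 ^ ((n + 1) div 2) \<le> Z" "2 ^ N \<le> Z" "2 ^ (3 * N) \<le> Z" "2 ^ d \<le> Hm"
    unfolding Cb_def Y_def Z_def Hm_def f using s by (auto intro!: pow2_le)
  show "int n \<le> Z" "int d \<le> Z" unfolding Z_def by (rule nat_le_pow2, use s in linarith)+
qed

lemma bnd_guess: "k \<le> 3 * N \<Longrightarrow> 4 * 2 ^ k * 10001 ^ (30000 * n) \<le> Z"
proof -
  assume k: "k \<le> 3 * N"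
  have h1: "(10001 :: int) ^ (30000 * n) \<le> 2 ^ (420000 * N)"
    using N_simps by (intro pow2_pow[where a = 14]) auto
  have h2: "4 * 2 ^ k \<le> (2::int) ^ (3 * N + 2)" using pow2_le[of "k + 2" "3 * N + 2"] k by (simp add: power_add)
  have h3: "3 * N + 2 + 420000 * N \<le> 500000 * N ^ 3" using N_simps by linarith
  show ?thesis unfolding Z_def by (rule pow2_mult[OF _ h2 h1 h3]) simp
qed

lemma len_Z: "len Z = 500000 * N ^ 3 + 1"
proof (rule antisym)
  show "len Z \<le> 500000 * N ^ 3 + 1" unfolding len_le_iff Z_def by simp
  have "\<not> len Z \<le> 500000 * N ^ 3" unfolding len_le_iff Z_def by simp
  then show "500000 * N ^ 3 + 1 \<le> len Z" by simp
qed

end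

section \<open>Closest vectors after preprocessing\<close>

lemma ip_int_nonneg: "0 \<le> ip n v (v :: nat \<Rightarrow> int)" by (simp add: ip_def sum_nonneg)

lemma ip_minus_commute: "ip n (\<lambda>x. u x - v x) (\<lambda>x. u x - v x) = ip n (\<lambda>x. v x - u x) (\<lambda>x. v x - u x :: 'a :: comm_ring_1)"
  unfolding ip_def by (intro sum.cong) (auto simp: algebra_simps)

text \<open>The minimum is attained because squared distances are nonnegative integers.\<close>

lemma lat_closest:
  "\<exists>z\<in>lat d b. \<forall>z'\<in>lat d b. ip n (\<lambda>x. z x - t x) (\<lambda>x. z x - t x) \<le> ip n (\<lambda>x. z' x - t x) (\<lambda>x. z' x - t x :: int)"
proof -
  let ?f = "\<lambda>z. ip n (\<lambda>x. z x - t x) (\<lambda>x. z x - t x)"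
  have ne: "lc d (\<lambda>_. 0) b \<in> lat d b" by (simp add: lat_def)
  obtain z where z: "z \<in> lat d b" "\<And>z'. z' \<in> lat d b \<Longrightarrow> nat (?f z) \<le> nat (?f z')"
    using ex_has_least_nat[of "\<lambda>z. z \<in> lat d b" _ "\<lambda>z. nat (?f z)", OF ne] by blast
  have "?f z \<le> ?f z'" if "z' \<in> lat d b" for z'
    using z(2)[OF that] ip_int_nonneg[of n "\<lambda>x. z' x - t x"] by linarith
  then show ?thesis using z(1) by blast
qed

lemma babai_closest:
  fixes t :: "nat \<Rightarrow> int" and e :: int
  assumes pos: "\<And>j. j < d \<Longrightarrow> gsn n (rl b) j > 0" and lll: "lll_reduced n d b" and z: "z \<in> lat d b"
  defines "r \<equiv> fst (np n b 1 0 d (t, e))"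
  shows "ip n r r \<le> 2 ^ d * ip n (\<lambda>x. z x - t x) (\<lambda>x. z x - t x)"
proof -
  obtain c where c: "r = (\<lambda>x. t x - lc d c b x)" unfolding r_def using np_lc[of n b 1 0 d "(t, e)"] by auto
  obtain c' where c': "z = lc d c' b" using z by (auto simp: lat_def)
  have "ip n (ri r) (ri r) \<le> 2 ^ d * ip n (\<lambda>x. ri r x + lc d (\<lambda>l. of_int (c l - c' l)) (rl b) x) (\<lambda>x. ri r x + lc d (\<lambda>l. of_int (c l - c' l)) (rl b) x)"
    using lll pos np_reduced[OF pos] unfolding lll_reduced_def r_def by (intro babai) auto
  also have "(\<lambda>x. ri r x + lc d (\<lambda>l. of_int (c l - c' l)) (rl b) x) = (\<lambda>x. of_int (t x - z x))"
    unfolding c c' of_int_lc_apply[symmetric] by (auto simp: lc_def algebra_simps sum_subtractf)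
  finally have "real_of_int (ip n r r) \<le> real_of_int (2 ^ d * ip n (\<lambda>x. t x - z x) (\<lambda>x. t x - z x))"
    by (simp add: of_int_ip)
  then show ?thesis unfolding of_int_le_iff by (subst ip_minus_commute)
qed

text \<open>By \<open>closest_mu\<close> the residue of a closest vector has coefficients at most
  \<open>2 ^ j\<close>. Together with the rounding error 1/2 they stay within the half width
  \<open>2 ^ d\<close>, so \<open>np_enum\<close> yields a code that produces this residue.\<close>

lemma enum_closest:
  assumes pos: "\<And>j. j < d \<Longrightarrow> gsn n (rl b) j > 0" and lll: "lll_reduced n d b" and z: "z \<in> lat d b"
    and nrm: "\<And>e. e < (2 * 2 ^ d + 1) ^ d \<Longrightarrow>
      nrm \<le> ip n (fst (np n b (2 * 2 ^ d + 1) (2 ^ d) d (t, int e))) (fst (np n b (2 * 2 ^ d + 1) (2 ^ d) d (t, int e)))"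
  shows "nrm \<le> ip n (\<lambda>x. z x - t x) (\<lambda>x. z x - t x)"
proof -
  obtain z0 where z0: "z0 \<in> lat d b" "\<And>z'. z' \<in> lat d b \<Longrightarrow> ip n (\<lambda>x. z0 x - t x) (\<lambda>x. z0 x - t x) \<le> ip n (\<lambda>x. z' x - t x) (\<lambda>x. z' x - t x)"
    using lat_closest by blast
  obtain c where c: "z0 = lc d c b" using z0(1) by (auto simp: lat_def)
  define r where "r = (\<lambda>x. t x - z0 x)"
  have mu: "\<bar>mu n (rl b) (ri r) j\<bar> \<le> 2 ^ j" if j: "j < d" for j
  proof (rule closest_mu[OF pos _ _ j])
    fix c' :: "nat \<Rightarrow> int"
    have e: "(\<lambda>x. ri r x - lc d (\<lambda>l. of_int (c' l)) (rl b) x) = ri (\<lambda>x. t x - lc d (\<lambda>l. c l + c' l) b x)"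
      unfolding r_def c of_int_lc_apply[symmetric] by (auto simp: lc_def algebra_simps sum.distrib)
    have "ip n r r \<le> ip n (\<lambda>x. t x - lc d (\<lambda>l. c l + c' l) b x) (\<lambda>x. t x - lc d (\<lambda>l. c l + c' l) b x)"
      unfolding r_def using z0(2)[of "lc d (\<lambda>l. c l + c' l) b"] by (subst (1 2) ip_minus_commute) (auto simp: lat_def)
    then have "real_of_int (ip n r r) \<le> of_int (ip n (\<lambda>x. t x - lc d (\<lambda>l. c l + c' l) b x) (\<lambda>x. t x - lc d (\<lambda>l. c l + c' l) b x))"
      by (simp only: of_int_le_iff)
    then show "ip n (ri r) (ri r) \<le> ip n (\<lambda>x. ri r x - lc d (\<lambda>l. of_int (c' l)) (rl b) x) (\<lambda>x. ri r x - lc d (\<lambda>l. of_int (c' l)) (rl b) x)"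
      unfolding e of_int_ip .
  qed (use lll in \<open>auto simp: lll_reduced_def\<close>)
  have "\<bar>mu n (rl b) (ri r) j\<bar> + 1 / 2 \<le> of_int (2 ^ d)" if j: "j < d" for j
  proof -
    have "(2::real) ^ Suc j \<le> 2 ^ d" using j by (intro power_increasing) auto
    moreover have "(1::real) \<le> 2 ^ j" by simp
    ultimately have "\<bar>mu n (rl b) (ri r) j\<bar> + 1 / 2 \<le> 2 ^ d" using mu[OF j] unfolding power_Suc by linarith
    then show ?thesis by simp
  qed
  from np_enum[OF pos this]
  obtain e where e: "0 \<le> e" "e < (2 * 2 ^ d + 1) ^ d" "fst (np n b (2 * 2 ^ d + 1) (2 ^ d) d (\<lambda>x. r x + lc d c b x, e)) = r"
    by auto
  have t: "(\<lambda>x. r x + lc d c b x) = t" by (auto simp: r_def c)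
  have "int (nat e) = e" "nat e < (2 * 2 ^ d + 1) ^ d"
    using e(1,2) by (simp_all add: nat_less_iff add.commute)
  then have "nrm \<le> ip n r r" using nrm[of "nat e"] e(3) t by simp
  also have "\<dots> = ip n (\<lambda>x. z0 x - t x) (\<lambda>x. z0 x - t x)" unfolding r_def by (rule ip_minus_commute)
  also have "\<dots> \<le> ip n (\<lambda>x. z x - t x) (\<lambda>x. z x - t x)" by (rule z0(2)[OF z])
  finally show ?thesis .
qed


section \<open>Correctness of the preprocessing\<close>

locale prep = sizes n d N for n d N +
  fixes n0 :: nat and num den :: "nat \<Rightarrow> int" and Den :: int and M0 :: memory and b0 :: "nat \<Rightarrow> nat \<Rightarrow> int"
  assumes dn: "d \<le> n" and M0: "M0 0 0 = int n" "M0 0 1 = int d" "\<And>k i. k \<noteq> 0 \<Longrightarrow> M0 k i = 0"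
    and inp: "\<And>i. i < (d + 1) * n \<Longrightarrow> M0 0 (2 + 2 * i) = num i" "\<And>i. i < (d + 1) * n \<Longrightarrow> M0 0 (3 + 2 * i) = den i"
    and den: "\<And>i. i < (d + 1) * n \<Longrightarrow> den i \<ge> 1" and num: "\<And>i. i < (d + 1) * n \<Longrightarrow> \<bar>num i\<bar> \<le> 2 ^ N"
    and Den: "Den = (\<Prod>i<(d + 1) * n. den i)" "Den \<le> 2 ^ N"
    and b0: "\<And>i x. i \<le> d \<Longrightarrow> b0 i x = (if x < n then Den * num (i * n + x) div den (i * n + x) else 0)"
    and gs: "\<And>b j. (\<And>i. i < d \<Longrightarrow> b i = b0 i) \<Longrightarrow> j < d \<Longrightarrow> gsn n (rl b) j > 0"
begin

text \<open>Bounds the number of enumerated candidates in terms of \<open>n0\<close> alone, since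
  they are enumerated only when \<open>d \<le> n < n0\<close>.\<close>

definition E0 :: nat where "E0 = (2 * 2 ^ n0 + 1) ^ n0"

definition T :: nat where "T = (30 * N ^ 3 + 1) * (86 * N ^ 3 + 1) + E0 * (42 * N\<^sup>2 + 3) + 27 * N + 40"

text \<open>The last clause covers both regimes: below \<open>n0\<close> the distance is exact, from
  there on it is Babai's, with the factor \<open>2 ^ d\<close> on squares.\<close>

definition post :: "(nat \<Rightarrow> nat \<Rightarrow> int) \<Rightarrow> nat \<Rightarrow> memory \<Rightarrow> bool" where
  "post b k M \<longleftrightarrow> reduced n d N b GY Y (4 ^ N) Xb Wm Hm F BB Cb Z \<and> lat d b = lat d b0 \<and> b d = b0 d \<and>
     reduced.Base n d b M \<and> reduced.Best n d b Cb M \<and> M vW 0 = 1 \<and> M vH 0 = 0 \<and> M vE 0 = 0 \<and> M vS 0 = 2 ^ k \<and> k \<le> 3 * N \<and>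
     M vM 0 = 2 ^ ((n + 1) div 2) \<and> M vDen 0 = Den \<and> M vG 0 = 0 \<and> M vP 0 = 4 * 2 ^ k \<and> M vQ 0 = 1 \<and>
     M vNrm 0 \<le> (2 ^ k)\<^sup>2 \<and> (k = 0 \<or> (2 ^ k)\<^sup>2 < 4 * M vNrm 0) \<and>
     (\<forall>z\<in>lat d b. M vNrm 0 \<le> (if n < n0 then 1 else 2 ^ d) * ip n (\<lambda>x. z x - b d x) (\<lambda>x. z x - b d x))"

lemma Den1: "1 \<le> Den" unfolding Den(1) using den by (intro prod_ge_1) auto

lemma entry_bound: "i < (d + 1) * n \<Longrightarrow> \<bar>Den * num i div den i\<bar> \<le> 4 ^ N"
proof -
  assume i: "i < (d + 1) * n"
  have "\<bar>Den * num i div den i\<bar> \<le> \<bar>Den * num i\<bar>" by (rule abs_div_le)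
  also have "\<dots> \<le> 2 ^ N * 2 ^ N" unfolding abs_mult using Den(2) Den1 num[OF i] by (intro mult_mono) auto
  also have "\<dots> = (4::int) ^ N" by (simp add: power_mult_distrib[symmetric])
  finally show ?thesis .
qed

lemma idx: "i \<le> d \<Longrightarrow> x < n \<Longrightarrow> i * n + x < (d + 1) * n"
proof -
  assume "i \<le> d" "x < n"
  have "i * n \<le> d * n" using \<open>i \<le> d\<close> by (rule mult_le_mono1)
  then show ?thesis using \<open>x < n\<close> unfolding add_mult_distrib by linarith
qed

lemma b0_bound: "i \<le> d \<Longrightarrow> \<bar>b0 i x\<bar> \<le> 4 ^ N"
  using entry_bound[OF idx[of i x]] by (auto simp: b0)

lemma b0_norm: "i \<le> d \<Longrightarrow> ip n (b0 i) (b0 i) \<le> 2 ^ (5 * N)"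
proof -
  assume i: "i \<le> d"
  have f: "(4::int) ^ N = 2 ^ (2 * N)" by (simp add: power_mult)
  have "ip n (b0 i) (b0 i) \<le> (\<Sum>x<n. 2 ^ (4 * N))" unfolding ip_def
  proof (rule sum_mono)
    fix x
    have "b0 i x * b0 i x = \<bar>b0 i x\<bar> * \<bar>b0 i x\<bar>" by simp
    also have "\<dots> \<le> 2 ^ (4 * N)" using b0_bound[OF i, of x] unfolding f
      by (intro pow2_mult[where a = "2 * N" and b = "2 * N"]) auto
    finally show "b0 i x * b0 i x \<le> 2 ^ (4 * N)" .
  qed
  also have "\<dots> = int n * 2 ^ (4 * N)" by simp
  also have "\<dots> \<le> 2 ^ (5 * N)" using nN by (intro pow2_mult[where a = N and b = "4 * N"]) auto
  finally show ?thesis .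
qed

end

lemma bs_set: "\<bar>aval M f\<bar> \<le> Z \<Longrightarrow> bs Z (set_var v f) M 1 (upd M v 0 (aval M f))"
  using bs.Store[of M f Z v "Num 0"] by simp

context prep
begin

lemma lll_step:
  assumes M: "same {vDen, aB, vI, aD, vW} M0 M" "M aD 0 = 1" "M vW 0 = 1" "\<And>i. i < (d + 1) * n \<Longrightarrow> M aB i = Den * num i div den i"
  shows "tri Z lll_c M ((30 * N ^ 3 + 1) * (86 * N ^ 3 + 1) + 2) (\<lambda>M'. \<exists>b. same {aB, aW, aD, aU, vE, vI, vJ, vK, vL, vp, vq, vPos} M M' \<and>
     reduced n d N b GY Y (4 ^ N) Xb Wm Hm F BB Cb Z \<and> lat d b = lat d b0 \<and> b d = b0 d \<and> lll_reduced n d b \<and>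
     reduced.Base n d b M')"
proof -
  define b1 where "b1 = irow n (M aB)"
  have b1: "b1 i = b0 i" if i: "i \<le> d" for i
    using M(4)[OF idx[OF i]] i by (auto simp: b1_def irow_def b0 fun_eq_iff)
  have lat1: "lat d b1 = lat d b0" unfolding lat_def lc_def using b1 by (intro arg_cong[where f = range] ext sum.cong) auto
  have pos: "gsn n (rl b1) j > 0" if "j < d" for j using b1 that by (intro gs) auto
  let ?X = "2 ^ (5 * N) :: real"
  have le: "gsn n (rl b1) j \<le> ?X" if j: "j < d" for j
  proof -
    have "gsn n (rl b1) j \<le> ip n (rl b1 j) (rl b1 j)"
      unfolding gsn_eq_norm by (auto intro!: sum_nonneg simp: gsn_nonneg)
    also have "\<dots> = of_int (ip n (b0 j) (b0 j))" using b1[of j] j by (simp add: of_int_ip rl_def)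
    also have "\<dots> \<le> of_int (2 ^ (5 * N))" using b0_norm[of j] j by (subst of_int_le_iff) simp
    finally show ?thesis by simp
  qed
  have LB0: "LB n d b1 ?X b1" using pos le by (simp add: LB_def)
  have Yi: "ip n (b1 i) (b1 i) \<le> Y\<^sup>2" if "i < d" for i
  proof -
    have "(2::int) ^ (5 * N) \<le> Y\<^sup>2" unfolding Y_def power_mult[symmetric] by (rule pow2_le) simp
    then show ?thesis using b0_norm[of i] b1[of i] that by simp
  qed
  have Yr: "(of_int Y :: real) = 2 ^ (3 * N)" by (simp add: Y_def)
  have dX: "real d * ?X \<le> (of_int Y)\<^sup>2"
  proof -
    have "int d * 2 ^ (5 * N) \<le> 2 ^ (6 * N)" using nN by (intro pow2_mult[where a = N and b = "5 * N"]) auto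
    then have "real_of_int (int d * 2 ^ (5 * N)) \<le> of_int (2 ^ (6 * N))" by (subst of_int_le_iff)
    then show ?thesis unfolding Yr power_mult[symmetric] by (simp add: mult.commute)
  qed
  have XG: "?X ^ d \<le> of_int G"
  proof -
    have "5 * N * d \<le> 5 * N * N" using N_simps by (intro mult_le_mono2) auto
    then have "(2::real) ^ (5 * N * d) \<le> 2 ^ (5 * N\<^sup>2)" by (intro power_increasing) (auto simp: power2_eq_square)
    then show ?thesis by (simp add: G_def power_mult)
  qed
  \<comment> \<open>The potential starts at no more than \<open>2 ^ (5 * N ^ 3)\<close>, and six
    swaps take away more than a factor 2 because \<open>2 * 3 ^ 6 \<le> 4 ^ 6\<close>. Hence at most
    \<open>30 * N ^ 3\<close> swaps.\<close>
  have pot: "pot n d b1 * 3 ^ (30 * N ^ 3) \<le> 4 ^ (30 * N ^ 3)"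
  proof -
    have "pot n d b1 \<le> (\<Prod>i\<le>d. G)" unfolding pot_def
    proof (rule prod_mono)
      fix i assume i: "i \<in> {..d}"
      have "1 \<le> gram n b1 i" using i pos by (intro gram_pos) auto
      moreover have "gram n b1 i \<le> G" using i pos le XG by (intro gram_le[where X = ?X and d = d]) auto
      ultimately show "0 \<le> gram n b1 i \<and> gram n b1 i \<le> G" by simp
    qed
    also have "\<dots> = G ^ (d + 1)" by simp
    also have "\<dots> \<le> 2 ^ (5 * N ^ 3)"
    proof -
      have "5 * N\<^sup>2 * (d + 1) \<le> 5 * N\<^sup>2 * N" using N_simps by (intro mult_le_mono2) auto
      then have "5 * N\<^sup>2 * (d + 1) \<le> 5 * N ^ 3" by (simp add: power2_eq_square power3_eq_cube)
      from pow2_pow[OF _ order_refl this] show ?thesis unfolding G_def by simp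
    qed
    finally have p: "pot n d b1 \<le> 2 ^ (5 * N ^ 3)" .
    have e: "a ^ (30 * N ^ 3) = (a ^ 6) ^ (5 * N ^ 3)" for a :: int by (simp add: power_mult[symmetric])
    have "pot n d b1 * 3 ^ (30 * N ^ 3) \<le> 2 ^ (5 * N ^ 3) * 3 ^ (30 * N ^ 3)" using p by (intro mult_right_mono) auto
    also have "\<dots> = (2 * 3 ^ 6) ^ (5 * N ^ 3)" unfolding e[of 3] power_mult_distrib ..
    also have "\<dots> \<le> (4 ^ 6) ^ (5 * N ^ 3)" by (intro power_mono) auto
    also have "\<dots> = 4 ^ (30 * N ^ 3)" by (rule e[symmetric])
    finally show ?thesis .
  qed
  note sm = sameD[OF M(1)]
  show ?thesis
  proof (rule lll_c[OF _ _ M(2,3) _ _ b1_def LB0 Yi pos_consts(9) dX _ XG bnd_lll bnd_Z(1-6) pos_consts(10) _ _ _ pot])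
    fix M' b assume Q: "same {aB, aW, aD, aU, vE, vI, vJ, vK, vL, vp, vq, vPos} M M'" "M' vE 0 = 0" "b = irow n (M' aB)"
      "gso_ok n d M' b" "LB n d b1 ?X b" "lll_reduced n d b" "\<And>i. i < d \<Longrightarrow> ip n (b i) (b i) \<le> Y\<^sup>2"
    have bp: "gsn n (rl b) j > 0" "gsn n (rl b) j \<le> ?X" if "j < d" for j using Q(5) that by (auto simp: LB_def)
    have bd: "b d = b0 d" using Q(5) b1[of d] by (simp add: LB_def)
    have red: "reduced n d N b GY Y (4 ^ N) Xb Wm Hm F BB Cb Z"
    proof
      show "b l x = 0" if "n \<le> x" for l x using that by (simp add: Q(3) irow_def)
      show "\<bar>wv n b l l x\<bar> \<le> GY" if "l < d" "x < n" for l x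
      proof -
        have "\<bar>wv n b l l x\<bar> \<le> gram n b l * Y" using that bp Q(7) pos_consts by (intro wv_bound) auto
        also have "\<dots> \<le> G * Y" using that bp XG pos_consts by (intro mult_right_mono gram_le[where X = ?X and d = d]) auto
        finally show ?thesis by (simp add: GY)
      qed
      show "\<bar>b l x\<bar> \<le> Y" if "l < d" "x < n" for l x
        using Q(7)[OF that(1)] that(2) pos_consts by (intro abs_le_of_ip) auto
      show "\<bar>b d x\<bar> \<le> 4 ^ N" for x unfolding bd by (rule b0_bound) simp
      show "F = 1 + (int n * GY + 1 + Wm + Hm) * Y" by (rule F_def)
      show "(4 ^ N + Xb + 1) * F ^ d \<le> BB" by (rule bnd_F)
      show "Xb + BB \<le> Cb" by (rule bnd_Cb)
      show "int n * BB * GY + 1 + Wm + Hm \<le> Z" "int n * Cb * Cb \<le> Z" "Cb \<le> Z" "int n \<le> Z" "int d \<le> Z" by (rule bnd_Z)+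
      show "n \<le> N" "d \<le> N" "1 \<le> N" using N_simps by auto
    qed (use bp pos_consts in auto)
    interpret reduced n d N b GY Y "4 ^ N" Xb Wm Hm F BB Cb Z by (rule red)
    have "Base M'" unfolding Base_def using Q(3,4) sameD[OF Q(1), of 0] sm[of 0] M0 by simp
    moreover have "lat d b = lat d b0" using Q(5) lat1 by (simp add: LB_def)
    ultimately show "\<exists>b. same {aB, aW, aD, aU, vE, vI, vJ, vK, vL, vp, vq, vPos} M M' \<and>
       reduced n d N b GY Y (4 ^ N) Xb Wm Hm F BB Cb Z \<and> lat d b = lat d b0 \<and> b d = b0 d \<and> lll_reduced n d b \<and> reduced.Base n d b M'"
      using Q(1,6) red bd by blast
  qed (use sm M0 N_simps in \<open>auto simp: one_le_power\<close>)
qed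

lemma prep_res: "tri Z (prep_c n0) M0 T (\<lambda>M'. \<exists>b k. post b k M')"
proof -
  have P1: "tri Z parse_c M0 (6 * N + 5) (\<lambda>M'. same {vDen, aB, vI} M0 M' \<and> M' vDen 0 = Den \<and>
       (\<forall>i<(d + 1) * n. M' aB i = Den * num i div den i))"
  proof (rule parse_c[where n = n and d = d and M = M0 and num = num and den = den, OF M0(1,2) inp den Den(1)])
    show "Den \<le> Z" using Den(2) bnd_Z(16) by linarith
    show "\<bar>Den * num i div den i\<bar> \<le> Z" if "i < (d + 1) * n" for i using entry_bound[OF that] bnd_Z(11) by linarith
    have "int ((d + 1) * n) \<le> int ((d + 1) * (n + 1))" by simp
    then show "int ((d + 1) * n) \<le> Z" using bnd_Z(13) by linarith
    show "(d + 1) * n \<le> N" by (rule N_simps)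
  qed auto
  obtain t1 M1 where 1: "t1 \<le> 6 * N + 5" "bs Z parse_c M0 t1 M1" "same {vDen, aB, vI} M0 M1" "M1 vDen 0 = Den"
    "\<And>i. i < (d + 1) * n \<Longrightarrow> M1 aB i = Den * num i div den i"
    using P1 by (auto simp: tri_def)
  define M2 where "M2 = upd M1 aD 0 1"
  have 2: "bs Z (set_var aD (Num 1)) M1 1 M2" using bs_set[of M1 "Num 1" Z aD] pos_consts(10) by (simp add: M2_def)
  define M3 where "M3 = upd M2 vW 0 1"
  have 3: "bs Z (set_var vW (Num 1)) M2 1 M3" using bs_set[of M2 "Num 1" Z vW] pos_consts(10) by (simp add: M3_def)
  have s3: "same {vDen, aB, vI, aD, vW} M0 M3" using 1(3) by (auto simp: same_def M3_def M2_def)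
  have d3: "M3 aD 0 = 1" "M3 vW 0 = 1" "\<And>i. i < (d + 1) * n \<Longrightarrow> M3 aB i = Den * num i div den i" "M3 vDen 0 = Den"
    using 1(4,5) by (simp_all add: M3_def M2_def)
  obtain t4 M4 b where 4: "t4 \<le> (30 * N ^ 3 + 1) * (86 * N ^ 3 + 1) + 2" "bs Z lll_c M3 t4 M4"
    "same {aB, aW, aD, aU, vE, vI, vJ, vK, vL, vp, vq, vPos} M3 M4"
    "reduced n d N b GY Y (4 ^ N) Xb Wm Hm F BB Cb Z" "lat d b = lat d b0" "b d = b0 d" "lll_reduced n d b" "reduced.Base n d b M4"
    using lll_step[OF s3 d3(1-3)] unfolding tri_def by blast
  interpret R: reduced n d N b GY Y "4 ^ N" Xb Wm Hm F BB Cb Z by (rule 4(4))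
  have P5: "tri Z initbest_c M4 (6 * N + 6) (\<lambda>M'. same {aBest, vNrm, vJ, vp} M4 M' \<and> R.Base M' \<and> R.Best M')"
    by (rule R.initbest_c[OF 4(8)]) auto
  obtain t5 M5 where 5: "t5 \<le> 6 * N + 6" "bs Z initbest_c M4 t5 M5" "same {aBest, vNrm, vJ, vp} M4 M5" "R.Base M5" "R.Best M5"
    using P5 by (auto simp: tri_def)
  have P6: "tri Z (param_c n0) M5 (6 * N + 8) (\<lambda>M'. same {vH, vW, vN, vI} M5 M' \<and> M' vH 0 = (if n < n0 then 2 ^ d else 0) \<and>
      M' vW 0 = (if n < n0 then 2 * 2 ^ d + 1 else 1) \<and> M' vN 0 = (if n < n0 then (2 * 2 ^ d + 1) ^ d else 1))"
    by (rule param_c[of M5 n d N]) (use 5(4) N_simps bnd_Z in \<open>auto simp: R.Base_def\<close>)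
  obtain t6 M6 where 6: "t6 \<le> 6 * N + 8" "bs Z (param_c n0) M5 t6 M6" "same {vH, vW, vN, vI} M5 M6"
     "M6 vH 0 = (if n < n0 then 2 ^ d else 0)" "M6 vW 0 = (if n < n0 then 2 * 2 ^ d + 1 else 1)"
     "M6 vN 0 = (if n < n0 then (2 * 2 ^ d + 1) ^ d else 1)"
    using P6 unfolding tri_def by blast
  define W where "W = (if n < n0 then 2 * 2 ^ d + 1 else 1 :: int)"
  define H where "H = (if n < n0 then 2 ^ d else 0 :: int)"
  define NN where "NN = (if n < n0 then (2 * 2 ^ d + 1) ^ d else 1 :: nat)"
  have B6: "R.Base M6" "R.Best M6" using R.Base_same[OF 5(4) 6(3)] R.Best_same[OF 5(5) 6(3)] by auto
  have X0: "M6 aX x = 0" for x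
    using sameD[OF 6(3), of aX] sameD[OF 5(3), of aX] sameD[OF 4(3), of aX] sameD[OF s3, of aX] M0(3)[of aX x] by simp
  have NE: "NN \<le> E0"
  proof (cases "n < n0")
    case True
    then have "(2::nat) ^ d \<le> 2 ^ n0" using dn by (intro power_increasing) auto
    then have "(2 * 2 ^ d + 1) ^ d \<le> (2 * 2 ^ n0 + 1 :: nat) ^ d" by (intro power_mono) auto
    also have "\<dots> \<le> E0" unfolding E0_def using True dn by (intro power_increasing) auto
    finally show ?thesis using True by (simp add: NN_def)
  qed (simp add: NN_def E0_def)
  have P7: "tri Z enum_c M6 (E0 * (42 * N\<^sup>2 + 3) + 2) (\<lambda>M'. same {aU, aC, aBest, vNrm, vE, vI, vJ, vL, vp, vq, vG} M6 M' \<and> R.Base M' \<and> R.Best M' \<and>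
       (\<forall>e<NN. M' vNrm 0 \<le> ip n (fst (np n b W H d (b d, int e))) (fst (np n b W H d (b d, int e)))))"
  proof (rule R.enum_c[OF B6, where N = NN])
    show "M6 vW 0 = W" "M6 vH 0 = H" "M6 vN 0 = int NN" using 6 by (auto simp: W_def H_def NN_def add.commute)
    show "1 \<le> W" "0 \<le> H" by (auto simp: W_def H_def)
    show "W \<le> Wm" "H \<le> Hm" using bnd_Z(21,22) pos_consts by (auto simp: W_def H_def)
    show "int NN \<le> Z" using bnd_Z(18) pos_consts by (simp add: NN_def add.commute)
  qed (use X0 NE in auto)
  obtain t7 M7 where 7: "t7 \<le> E0 * (42 * N\<^sup>2 + 3) + 2" "bs Z enum_c M6 t7 M7" "same {aU, aC, aBest, vNrm, vE, vI, vJ, vL, vp, vq, vG} M6 M7"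
     "R.Base M7" "R.Best M7" "\<And>e. e < NN \<Longrightarrow> M7 vNrm 0 \<le> ip n (fst (np n b W H d (b d, int e))) (fst (np n b W H d (b d, int e)))"
    using P7 unfolding tri_def by blast
  define nrm where "nrm = M7 vNrm 0"
  have near: "nrm \<le> (if n < n0 then 1 else 2 ^ d) * ip n (\<lambda>x. z x - b d x) (\<lambda>x. z x - b d x)" if z: "z \<in> lat d b" for z
  proof (cases "n < n0")
    case True
    have "nrm \<le> ip n (\<lambda>x. z x - b d x) (\<lambda>x. z x - b d x)"
      by (rule enum_closest[OF R.pos 4(7) z]) (use 7(6) True in \<open>auto simp: nrm_def W_def H_def NN_def\<close>)
    then show ?thesis using True by simp
  next
    case False
    have "nrm \<le> ip n (fst (np n b 1 0 d (b d, 0))) (fst (np n b 1 0 d (b d, 0)))"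
      using 7(6)[of 0] False by (simp add: nrm_def W_def H_def NN_def)
    also have "\<dots> \<le> 2 ^ d * ip n (\<lambda>x. z x - b d x) (\<lambda>x. z x - b d x)" by (rule babai_closest[OF R.pos 4(7) z])
    finally show ?thesis using False by simp
  qed
  \<comment> \<open>The lattice vector 0 bounds the squared distance by that of the target to the
    origin, at most \<open>2 ^ (5 * N)\<close>; the approximation contributes at most
    \<open>2 ^ d\<close>.\<close>
  have nrm4: "nrm \<le> 4 ^ (3 * N)"
  proof -
    have "lc d (\<lambda>_. 0) b \<in> lat d b" by (simp add: lat_def)
    from near[OF this] have "nrm \<le> (if n < n0 then 1 else 2 ^ d) * ip n (b0 d) (b0 d)"
      by (simp add: lc_def 4(6) ip_def)
    also have "\<dots> \<le> 2 ^ d * ip n (b0 d) (b0 d)" using ip_int_nonneg[of n "b0 d"] by (intro mult_right_mono) auto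
    also have "\<dots> \<le> 2 ^ (6 * N)"
      using b0_norm[of d] N_simps ip_int_nonneg[of n "b0 d"] by (intro pow2_mult[where a = d and b = "5 * N"]) auto
    also have "\<dots> = (2 ^ 2) ^ (3 * N)" by (simp only: power_mult[symmetric]) simp
    finally show ?thesis by simp
  qed
  define M10 where "M10 = upd (upd (upd M7 vH 0 0) vW 0 1) vE 0 0"
  have 8: "bs Z (set_var vH (Num 0)) M7 1 (upd M7 vH 0 0)" using bs_set[of M7 "Num 0" Z vH] pos_consts(10) by simp
  have 9: "bs Z (set_var vW (Num 1)) (upd M7 vH 0 0) 1 (upd (upd M7 vH 0 0) vW 0 1)"
    using bs_set[of _ "Num 1" Z vW] pos_consts(10) by simp
  have 10: "bs Z (set_var vE (Num 0)) (upd (upd M7 vH 0 0) vW 0 1) 1 M10"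
    using bs_set[of _ "Num 0" Z vE] pos_consts(10) by (simp add: M10_def)
  have s10: "same {vH, vW, vE} M7 M10" by (simp add: same_def M10_def)
  have P11: "tri Z sq_c M10 (2 * (3 * N) + 2) (\<lambda>M'. \<exists>k. same {vS} M10 M' \<and> M' vS 0 = 2 ^ k \<and> k \<le> 3 * N \<and> nrm \<le> (2 ^ k)\<^sup>2 \<and>
       (k = 0 \<or> (2 ^ k)\<^sup>2 < 4 * nrm))"
    by (rule sq_c[of M10 nrm]) (use nrm4 bnd_Z(20) in \<open>auto simp: nrm_def M10_def\<close>)
  obtain t11 M11 k where 11: "t11 \<le> 6 * N + 2" "bs Z sq_c M10 t11 M11" "same {vS} M10 M11" "M11 vS 0 = 2 ^ k" "k \<le> 3 * N"
    "nrm \<le> (2 ^ k)\<^sup>2" "k = 0 \<or> (2 ^ k)\<^sup>2 < 4 * nrm"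
    using P11 unfolding tri_def by auto
  have n11: "M11 0 0 = int n"
    using sameD[OF 11(3), of 0] sameD[OF s10, of 0] 7(4) by (simp add: R.Base_def)
  have P12: "tri Z pow_c M11 (3 * N + 3) (\<lambda>M'. same {vI, vM} M11 M' \<and> M' vM 0 = 2 ^ ((n + 1) div 2))"
    by (rule pow_c[where n = n and M = M11, OF n11]) (use N_simps bnd_Z in auto)
  obtain t12 M12 where 12: "t12 \<le> 3 * N + 3" "bs Z pow_c M11 t12 M12" "same {vI, vM} M11 M12" "M12 vM 0 = 2 ^ ((n + 1) div 2)"
    using P12 unfolding tri_def by blast
  have S12: "M12 vS 0 = 2 ^ k" using sameD[OF 12(3), of vS] 11(4) by simp
  define M15 where "M15 = upd (upd (upd M12 vP 0 (4 * 2 ^ k)) vQ 0 1) vG 0 0"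
  have kZ: "4 * 2 ^ k \<le> Z"
  proof -
    have "(1::int) \<le> 10001 ^ (30000 * n)" by simp
    then have "4 * 2 ^ k * (1::int) \<le> 4 * 2 ^ k * 10001 ^ (30000 * n)" by (intro mult_left_mono) auto
    then show ?thesis using bnd_guess[OF 11(5)] by linarith
  qed
  have 13: "bs Z (set_var vP (Mul (Num 4) (var vS))) M12 1 (upd M12 vP 0 (4 * 2 ^ k))"
    using bs_set[of M12 "Mul (Num 4) (var vS)" Z vP] kZ S12 by (simp add: abs_mult)
  have 14: "bs Z (set_var vQ (Num 1)) (upd M12 vP 0 (4 * 2 ^ k)) 1 (upd (upd M12 vP 0 (4 * 2 ^ k)) vQ 0 1)"
    using bs_set[of _ "Num 1" Z vQ] pos_consts(10) by simp
  have 15: "bs Z (set_var vG (Num 0)) (upd (upd M12 vP 0 (4 * 2 ^ k)) vQ 0 1) 1 M15"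
    using bs_set[of _ "Num 0" Z vG] pos_consts(10) by (simp add: M15_def)
  have s15: "same {vH, vW, vE, vS, vI, vM, vP, vQ, vG} M7 M15"
    using s10 11(3) 12(3) by (auto simp: same_def M15_def)
  have v15: "M15 vW 0 = 1" "M15 vH 0 = 0" "M15 vE 0 = 0" "M15 vS 0 = 2 ^ k" "M15 vM 0 = 2 ^ ((n + 1) div 2)"
    "M15 vG 0 = 0" "M15 vP 0 = 4 * 2 ^ k" "M15 vQ 0 = 1" "M15 vNrm 0 = nrm"
    using 12(4) S12 sameD[OF 12(3)] sameD[OF 11(3)] sameD[OF s15, of vNrm] by (simp_all add: M15_def M10_def nrm_def)
  have Den15: "M15 vDen 0 = Den"
    using sameD[OF s15, of vDen] sameD[OF 7(3), of vDen] sameD[OF 6(3), of vDen] sameD[OF 5(3), of vDen] sameD[OF 4(3), of vDen] d3(4)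
    by simp
  have post: "post b k M15"
    unfolding post_def using 4(4,5,6) R.Base_same[OF 7(4) s15] R.Best_same[OF 7(5) s15] v15 Den15 11(5-7) near by auto
  note bs = bs.Seq[OF 1(2) bs.Seq[OF 2 bs.Seq[OF 3 bs.Seq[OF 4(2) bs.Seq[OF 5(2) bs.Seq[OF 6(2) bs.Seq[OF 7(2) bs.Seq[OF 8 bs.Seq[OF 9
    bs.Seq[OF 10 bs.Seq[OF 11(2) bs.Seq[OF 12(2) bs.Seq[OF 13 bs.Seq[OF 14 15]]]]]]]]]]]]]]
  show ?thesis unfolding tri_def prep_c_def
    by (rule exI, rule exI[of _ M15], rule conjI[OF _ conjI[OF bs]])
      (use post 1(1) 4(1) 5(1) 6(1) 7(1) 11(1) 12(1) in \<open>auto simp: T_def\<close>)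
qed

end

section \<open>The reduction\<close>

lemma length_le_enc_size: "length xs \<le> enc_size xs"
  by (induction xs) (auto simp: enc_size_def)

lemma len_le_enc_size: "x \<in> set xs \<Longrightarrow> len x \<le> enc_size xs"
  by (induction xs) (auto simp: enc_size_def)

lemma abs_le_enc_size: "x \<in> set xs \<Longrightarrow> \<bar>x\<bar> \<le> 2 ^ enc_size xs"
  using len_le_enc_size[of x xs] by (simp add: len_le_iff)

text \<open>Distinct cells contribute separately to the input length, so even the product of all
  denominators is no longer than the input.\<close>

lemma sum_len_le_enc_size:
  assumes "inj_on f I" "f ` I \<subseteq> {..<length xs}" shows "(\<Sum>i\<in>I. len (xs ! f i)) \<le> enc_size xs"
proof -
  have "(\<Sum>i\<in>I. len (xs ! f i)) = (\<Sum>j\<in>f ` I. len (xs ! j))" by (simp add: sum.reindex[OF assms(1)])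
  also have "\<dots> \<le> (\<Sum>j<length xs. len (xs ! j))" using assms(2) by (intro sum_mono2) auto
  also have "\<dots> \<le> (\<Sum>j<length xs. 1 + len (xs ! j))" by (intro sum_mono) auto
  also have "\<dots> = enc_size xs" by (simp add: enc_size_def sum_list_sum_nth atLeast0LessThan)
  finally show ?thesis .
qed

lemma nq_int: "nq n c (\<lambda>j. of_int (- 1) * of_int (t j)) = of_int (ip n (\<lambda>x. c x - t x) (\<lambda>x. c x - t x))"
  by (simp add: nq_def ip_def power2_eq_square)

text \<open>Up to constants and the factor \<open>MM\<close> there are \<open>N ^ 6\<close> steps,
  each of cost \<open>N ^ 3\<close>. The exponential factor \<open>MM\<close> is split off, and
  \<open>E0\<close> enters as a constant.\<close>

lemma cost_bound:
  fixes N n E0 MM K u T c1 :: nat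
  assumes "1 \<le> N" "n \<le> N" "1 \<le> MM" "1 \<le> K"
    and T: "T = (30 * N ^ 3 + 1) * (86 * N ^ 3 + 1) + E0 * (42 * N\<^sup>2 + 3) + 27 * N + 40"
    and u: "u = 2 * K\<^sup>2 * (500000 * N ^ 3 + 2)"
    and c1: "c1 = (MM * (50 * N\<^sup>2) + 30 * N\<^sup>2 + 6) * u"
  shows "T * u + 30000 * n * c1 + (4 * N + 3) * u \<le> MM * ((2800000 + 45 * E0) * (2 * K\<^sup>2 * 500002) * N ^ 9)"
proof -
  have p: "1 \<le> N ^ k" for k using assms(1) by simp
  have q: "N ^ j \<le> N ^ k" if "j \<le> k" for j k using assms(1) that by (intro power_increasing) auto
  have "T \<le> (2800 + 45 * E0) * N ^ 6"
  proof -
    have "(30 * N ^ 3 + 1) * (86 * N ^ 3 + 1) \<le> (31 * N ^ 3) * (87 * N ^ 3)" using p[of 3] by (intro mult_mono) auto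
    moreover have "(31 * N ^ 3) * (87 * N ^ 3) = 2697 * N ^ 6" by (simp add: power_add[symmetric])
    moreover have "E0 * (42 * N\<^sup>2 + 3) \<le> E0 * (45 * N ^ 6)" using q[of 2 6] p[of 6] by (intro mult_left_mono) auto
    moreover have "27 * N + 40 \<le> 67 * N ^ 6" using q[of 1 6] p[of 6] by simp
    ultimately show ?thesis unfolding T add_mult_distrib using p[of 6] by linarith
  qed
  then have 1: "T \<le> MM * ((2800 + 45 * E0) * N ^ 6)" using assms(3) by (metis le_trans mult_1 mult_le_mono1)
  have 2: "30000 * n * (MM * (50 * N\<^sup>2) + 30 * N\<^sup>2 + 6) \<le> MM * (2580000 * N ^ 6)"
  proof -
    have "MM * (50 * N\<^sup>2) + 30 * N\<^sup>2 + 6 \<le> MM * (50 * N\<^sup>2) + 36 * N\<^sup>2" using p[of 2] by simp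
    also have "\<dots> \<le> MM * (50 * N\<^sup>2) + MM * (36 * N\<^sup>2)" using assms(3) by simp
    finally have "MM * (50 * N\<^sup>2) + 30 * N\<^sup>2 + 6 \<le> MM * (86 * N\<^sup>2)" by simp
    then have "30000 * n * (MM * (50 * N\<^sup>2) + 30 * N\<^sup>2 + 6) \<le> 30000 * N * (MM * (86 * N\<^sup>2))"
      using assms(2) by (intro mult_mono) auto
    also have "\<dots> = MM * (2580000 * N ^ 3)" by (simp add: power2_eq_square power3_eq_cube)
    also have "\<dots> \<le> MM * (2580000 * N ^ 6)" using q[of 3 6] by (intro mult_left_mono) auto
    finally show ?thesis .
  qed
  have 3: "4 * N + 3 \<le> MM * (7 * N ^ 6)"
  proof -
    have "4 * N + 3 \<le> 7 * N ^ 6" using q[of 1 6] p[of 6] by simp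
    also have "\<dots> \<le> MM * (7 * N ^ 6)" using assms(3) by simp
    finally show ?thesis .
  qed
  have ub: "u \<le> 2 * K\<^sup>2 * 500002 * N ^ 3" unfolding u using p[of 3] by (simp add: algebra_simps)
  have "T * u + 30000 * n * c1 + (4 * N + 3) * u = (T + 30000 * n * (MM * (50 * N\<^sup>2) + 30 * N\<^sup>2 + 6) + (4 * N + 3)) * u"
    by (simp add: c1 algebra_simps)
  also have "\<dots> \<le> (MM * ((2800000 + 45 * E0) * N ^ 6)) * (2 * K\<^sup>2 * 500002 * N ^ 3)"
  proof (rule mult_mono[OF _ ub])
    have "MM * ((2800 + 45 * E0) * N ^ 6) + MM * (2580000 * N ^ 6) + MM * (7 * N ^ 6) \<le> MM * ((2800000 + 45 * E0) * N ^ 6)"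
      unfolding add_mult_distrib2[symmetric] add_mult_distrib[symmetric] by (intro mult_left_mono mult_right_mono) auto
    then show "T + 30000 * n * (MM * (50 * N\<^sup>2) + 30 * N\<^sup>2 + 6) + (4 * N + 3) \<le> MM * ((2800000 + 45 * E0) * N ^ 6)"
      using 1 2 3 by linarith
  qed auto
  also have "\<dots> = MM * ((2800000 + 45 * E0) * (2 * K\<^sup>2 * 500002) * N ^ 9)"
    by (simp add: power_add[of N 6 3, simplified] algebra_simps)
  finally show ?thesis .
qed

text \<open>Rounding the exponent up costs at most a factor 2, which goes into the constant
  \<open>C\<close> of the running time.\<close>

lemma pow_half: "real (2 ^ ((n + 1) div 2)) \<le> 2 * 2 powr (real n / 2)"
proof -
  have "real ((n + 1) div 2) \<le> 1 + real n / 2" by linarith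
  then have "2 powr real ((n + 1) div 2) \<le> 2 powr (1 + real n / 2)" by (intro powr_mono) auto
  then show ?thesis by (simp add: powr_realpow powr_add)
qed

text \<open>Multiplying by \<open>Den\<close> scales all distances alike, so the approximation
  factor carries over. The program compares squares, hence \<open>\<gamma>\<^sup>2\<close>;
  \<open>m\<close> is a lower bound for the scaled squared distances.\<close>

lemma cvp_solution_scaled:
  fixes b0 :: "nat \<Rightarrow> nat \<Rightarrow> int" and B :: "rat vec list" and t y :: "rat vec" and Den :: int and z :: "nat \<Rightarrow> int"
  assumes B: "set B \<subseteq> carrier_vec n" and t: "t \<in> carrier_vec n" and Den: "Den > 0" and \<gamma>: "\<gamma> \<ge> 0"
    and b0: "\<And>i j. i < length B \<Longrightarrow> j < n \<Longrightarrow> real_of_int (b0 i j) = of_int Den * of_rat (B ! i $ j)"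
    and t0: "\<And>j. j < n \<Longrightarrow> real_of_int (t0 j) = of_int Den * of_rat (t $ j)"
    and z: "z \<in> lat (length B) b0" "of_int (ip n (\<lambda>x. z x - t0 x) (\<lambda>x. z x - t0 x)) \<le> \<gamma>\<^sup>2 * m"
    and m: "\<And>w. w \<in> lat (length B) b0 \<Longrightarrow> m \<le> of_int (ip n (\<lambda>x. w x - t0 x) (\<lambda>x. w x - t0 x))"
    and y: "y \<in> carrier_vec n" "\<And>j. j < n \<Longrightarrow> y $ j = Rat.Fract (z j) Den"
  shows "cvp_solution \<gamma> (lattice_of n (map real_vec B)) (real_vec t) (real_vec y)"
proof -
  let ?L = "lattice_of n (map real_vec B)"
  have BC: "set (map real_vec B) \<subseteq> carrier_vec n" using B by auto
  have el: "(\<Sum>i<length (map real_vec B). of_int (c i) * map real_vec B ! i $ j) = of_int (lc (length B) c b0 j) / of_int Den"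
    if j: "j < n" for c :: "nat \<Rightarrow> int" and j
  proof -
    have "(\<Sum>i<length (map real_vec B). of_int (c i) * map real_vec B ! i $ j) = (\<Sum>i<length B. of_int (c i) * (of_int (b0 i j) / of_int Den))"
    proof (rule sum.cong)
      fix i assume i: "i \<in> {..<length B}"
      then have "B ! i \<in> carrier_vec n" using B by auto
      then show "of_int (c i) * map real_vec B ! i $ j = of_int (c i) * (of_int (b0 i j) / of_int Den)"
        using i j Den b0[of i j] by simp
    qed simp
    also have "\<dots> = of_int (lc (length B) c b0 j) / of_int Den" by (simp add: lc_def sum_divide_distrib)
    finally show ?thesis .
  qed
  have mem: "x \<in> ?L \<longleftrightarrow> (\<exists>w\<in>lat (length B) b0. x = vec n (\<lambda>j. of_int (w j) / of_int Den))" for x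
  proof -
    have "vec n (\<lambda>j. \<Sum>i<length (map real_vec B). of_int (c i) * map real_vec B ! i $ j) = vec n (\<lambda>j. of_int (lc (length B) c b0 j) / of_int Den)"
      for c :: "nat \<Rightarrow> int" by (intro eq_vecI) (simp_all del: length_map add: el)
    then show ?thesis unfolding lattice_of_iff[OF BC] lat_def by auto
  qed
  have nrm: "vnorm (vec n (\<lambda>j. of_int (w j) / of_int Den) - real_vec t) = sqrt (of_int (ip n (\<lambda>x. w x - t0 x) (\<lambda>x. w x - t0 x))) / of_int Den" for w
  proof -
    have "vec n (\<lambda>j. of_int (w j) / of_int Den) - real_vec t = vec n (\<lambda>j. of_int (w j - t0 j) / of_int Den)"
      using t t0 Den by (intro eq_vecI) (auto simp: field_simps)
    then have "(vnorm (vec n (\<lambda>j. of_int (w j) / of_int Den) - real_vec t))\<^sup>2 = of_int (ip n (\<lambda>x. w x - t0 x) (\<lambda>x. w x - t0 x)) / (of_int Den)\<^sup>2"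
      by (simp only: vnorm_vec) (simp add: ip_def sum_divide_distrib power2_eq_square)
    then have "sqrt ((vnorm (vec n (\<lambda>j. of_int (w j) / of_int Den) - real_vec t))\<^sup>2) = sqrt (of_int (ip n (\<lambda>x. w x - t0 x) (\<lambda>x. w x - t0 x)) / (of_int Den)\<^sup>2)" by simp
    then show ?thesis using Den by (simp add: real_sqrt_divide vnorm_def scalar_self sum_nonneg)
  qed
  have yv: "real_vec y = vec n (\<lambda>j. of_int (z j) / of_int Den)"
    using y Den by (intro eq_vecI) (auto simp: of_rat_rat)
  have "sqrt m / of_int Den \<le> (INF x\<in>?L. vnorm (x - real_vec t))"
  proof (rule cINF_greatest)
    show "?L \<noteq> {}" using mem z(1) by blast
    fix x assume "x \<in> ?L"
    then obtain w where "w \<in> lat (length B) b0" "x = vec n (\<lambda>j. of_int (w j) / of_int Den)" using mem by blast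
    then show "sqrt m / of_int Den \<le> vnorm (x - real_vec t)" using m Den by (auto simp: nrm intro!: divide_right_mono)
  qed
  then have "\<gamma> * (sqrt m / of_int Den) \<le> \<gamma> * (INF x\<in>?L. vnorm (x - real_vec t))" using \<gamma> by (rule mult_left_mono)
  moreover have "vnorm (real_vec y - real_vec t) \<le> \<gamma> * (sqrt m / of_int Den)"
  proof -
    have "sqrt (of_int (ip n (\<lambda>x. z x - t0 x) (\<lambda>x. z x - t0 x))) \<le> sqrt (\<gamma>\<^sup>2 * m)" using z(2) by simp
    also have "\<dots> = \<gamma> * sqrt m" using \<gamma> by (simp add: real_sqrt_mult)
    finally show ?thesis unfolding yv nrm using Den by (simp add: divide_right_mono)
  qed
  ultimately show ?thesis unfolding cvp_solution_def using mem z(1) yv by auto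
qed

lemma reduction_correct:
  assumes n: "n > 0" and B: "is_basis n (map real_vec B)" and t: "t \<in> carrier_vec n"
    and orc: "dgs_oracle (nat \<lfloor>2 powr (real n / 2)\<rfloor>) (1 / 2) orc" and n0: "\<And>n. n \<ge> n0 \<Longrightarrow> good_dim n"
    and K: "K = csz (prep_c n0) + csz (q_c 10000) + csz inc_c + (1 + bsz guard_b) + csz out_c"
    and C: "C = 2 * ((2800000 + 45 * (2 * 2 ^ n0 + 1) ^ n0) * (2 * K\<^sup>2 * 500002))"
  shows "\<exists>fuel. let res = exec orc fuel (reduction_c n0) (init n B t) in
           None \<notin> set_pmf res \<and>
           (\<forall>\<sigma>. Some \<sigma> \<in> set_pmf res \<longrightarrow>
              length (queries \<sigma>) \<le> 30000 * n \<and>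
              (\<forall>(n', B', s) \<in> set (queries \<sigma>).
                 valid_query (n', B', s) \<and> n' = n + 1 \<and> length B' = length B + 1) \<and>
              real (cost \<sigma>) \<le> 2 powr (real n / 2) * (real C * real (enc_size (enc_cvp n B t)) ^ 9)) \<and>
           measure_pmf.prob res
             {Some \<sigma> | \<sigma>. cvp_solution 1.97 (lattice_of n (map real_vec B)) (real_vec t)
                            (real_vec (out_vec n \<sigma>))} \<ge> 2 / 3"
proof -
  define d where "d = length B"
  define vs where "vs = B @ [t]"
  define xs where "xs = enc_cvp n B t"
  define N where "N = enc_size xs"
  define q where "q i = vs ! (i div n) $ (i mod n)" for i
  define num where "num i = fst (quotient_of (q i))" for i
  define den where "den i = snd (quotient_of (q i))" for i
  define Den where "Den = (\<Prod>i<(d + 1) * n. den i)"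
  define b0 where "b0 i x = (if x < n then Den * num (i * n + x) div den (i * n + x) else 0)" for i x
  define M0 where "M0 = mem (init n B t)"
  have BC: "set B \<subseteq> carrier_vec n" using B by (auto simp: is_basis_def)
  have dim: "dim_vec v = n" if "v \<in> set vs" for v using that BC t by (auto simp: vs_def)
  have lvs: "length vs = d + 1" by (simp add: vs_def d_def)
  have dn: "d \<le> n" using is_basis_length[OF B] by (simp add: d_def)
  have xs: "xs = [int n, int d] @ concat (map enc_vec vs)" by (simp add: xs_def enc_cvp_def vs_def d_def)
  have split: "i div n < length vs \<and> i mod n < n \<and> (i div n) * n + i mod n = i" if "i < (d + 1) * n" for i
    using that n lvs by (simp add: less_mult_imp_div_less)
  have ent: "xs ! (2 + 2 * i) = num i" "xs ! (3 + 2 * i) = den i" "3 + 2 * i < length xs" if i: "i < (d + 1) * n" for i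
    using enc_vecs_nth[of vs n "i div n" "i mod n", OF dim] split[OF i] by (auto simp: xs num_def den_def q_def nth_Cons split: nat.splits)
  have M0a: "M0 0 = (\<lambda>i. if i < length xs then xs ! i else 0)" "\<And>k i. k \<noteq> 0 \<Longrightarrow> M0 k i = 0"
    unfolding M0_def xs_def by (simp_all add: init_def load_def)
  have den1: "den i \<ge> 1" for i using quotient_of_denom_pos[of "q i" "num i" "den i"] by (simp add: num_def den_def)
  have numq: "of_rat (q i) = (of_int (num i) / of_int (den i) :: real)" for i
  proof -
    have "q i = of_int (num i) / of_int (den i)" using quotient_of_div[of "q i" "num i" "den i"] by (simp add: num_def den_def)
    from arg_cong[OF this, of real_of_rat] show ?thesis by (simp add: of_rat_divide)
  qed
  \<comment> \<open>Divisibility is what makes the integer divisions of \<open>parse_c\<close>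
    exact.\<close>
  have dvd: "den i dvd Den" if "i < (d + 1) * n" for i unfolding Den_def using that by (intro dvd_prodI) auto
  have Den1: "Den \<ge> 1" unfolding Den_def using den1 by (intro prod_ge_1) auto
  have b0r: "real_of_int (b0 i x) = of_int Den * of_rat (vs ! i $ x)" if ix: "i \<le> d" "x < n" for i x
  proof -
    have "i * n \<le> d * n" using ix(1) by (rule mult_le_mono1)
    then have l: "i * n + x < (d + 1) * n" using ix(2) unfolding add_mult_distrib by linarith
    have qi: "q (i * n + x) = vs ! i $ x" using ix by (simp add: q_def)
    have "den (i * n + x) dvd Den * num (i * n + x)" using dvd[OF l] by simp
    then have "real_of_int (b0 i x) = of_int (Den * num (i * n + x)) / of_int (den (i * n + x))"
      using ix by (simp add: b0_def real_of_int_div)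
    then show ?thesis using numq[of "i * n + x"] by (simp add: qi)
  qed
  have lenN: "length xs \<le> N" unfolding N_def by (rule length_le_enc_size)
  have lx: "2 + 2 * ((d + 1) * n) \<le> length xs"
  proof -
    have "0 < (d + 1) * n" using n by simp
    then show ?thesis using ent(3)[of "(d + 1) * n - 1"] by linarith
  qed
  have DenN: "Den \<le> 2 ^ N"
  proof -
    have "Den \<le> (\<Prod>i<(d + 1) * n. 2 ^ len (den i))" unfolding Den_def
    proof (rule prod_mono)
      fix i
      have "\<bar>den i\<bar> < 2 ^ len (den i)" using len_le_iff[of "den i" "len (den i)"] by simp
      then show "0 \<le> den i \<and> den i \<le> 2 ^ len (den i)" using den1[of i] by linarith
    qed
    also have "\<dots> = 2 ^ (\<Sum>i<(d + 1) * n. len (den i))" by (simp add: power_sum)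
    also have "\<dots> \<le> 2 ^ N"
    proof (rule pow2_le)
      have "(\<Sum>i<(d + 1) * n. len (den i)) = (\<Sum>i<(d + 1) * n. len (xs ! (3 + 2 * i)))" using ent(2) by simp
      also have "\<dots> \<le> N" unfolding N_def using ent(3) by (intro sum_len_le_enc_size) (auto simp: inj_on_def)
      finally show "(\<Sum>i<(d + 1) * n. len (den i)) \<le> N" .
    qed
    finally show ?thesis .
  qed
  have gs: "gsn n (rl b) j > 0" if "\<And>i. i < d \<Longrightarrow> b i = b0 i" "j < d" for b j
  proof (rule gsn_pos_of_indep[OF _ that(2)])
    fix c i assume c: "\<And>x. x < n \<Longrightarrow> (\<Sum>i<d. c i * rl b i x) = 0" and i: "i < d"
    show "c i = 0"
    proof (rule is_basis_indep[OF B])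
      show "i < length (map real_vec B)" using i by (simp add: d_def)
      fix x assume x: "x < n"
      have "(\<Sum>i<length (map real_vec B). c i * map real_vec B ! i $ x) = (\<Sum>i<d. c i * rl b i x / of_int Den)"
      proof (rule sum.cong)
        fix i assume i: "i \<in> {..<d}"
        then have "B ! i \<in> carrier_vec n" using BC by (auto simp: d_def)
        then show "c i * map real_vec B ! i $ x = c i * rl b i x / of_int Den"
          using i x Den1 that(1)[of i] b0r[of i x] by (simp add: rl_def d_def vs_def nth_append)
      qed (simp add: d_def)
      also have "\<dots> = 0" using c[OF x] by (simp add: sum_divide_distrib[symmetric])
      finally show "(\<Sum>i<length (map real_vec B). c i * map real_vec B ! i $ x) = 0" .
    qed
  qed
  interpret prep n d N n0 num den Den M0 b0
  proof
    show "1 \<le> n" using n by simp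
    show "2 + 2 * ((d + 1) * n) \<le> N" using lx lenN by linarith
    show "M0 0 0 = int n" "M0 0 1 = int d" using lx by (simp_all add: M0a xs)
    show "M0 0 (2 + 2 * i) = num i" "M0 0 (3 + 2 * i) = den i" if "i < (d + 1) * n" for i
      using ent[OF that] by (simp_all add: M0a(1))
    show "\<bar>num i\<bar> \<le> 2 ^ N" if "i < (d + 1) * n" for i
      unfolding N_def ent(1)[OF that, symmetric] using ent(3)[OF that] by (intro abs_le_enc_size nth_mem) linarith
  qed (use dn M0a(2) den1 DenN gs in \<open>auto simp: Den_def b0_def\<close>)
  define u where "u = unit_cost K Z"
  \<comment> \<open>Each phase needs its own fuel: preprocessing, one round of the search, the
    number of rounds, and the output. Their sum serves all of them.\<close>
  define fuel where "fuel = T + (2 ^ ((n + 1) div 2) * (50 * N\<^sup>2) + 30 * N\<^sup>2 + 6) + (30000 * n + 1) + (4 * N + 2)"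
  obtain t1 M1 b k where 1: "t1 \<le> T" "bs Z (prep_c n0) M0 t1 M1" "post b k M1"
    using prep_res unfolding tri_def by blast
  have bd0: "bd Z M0"
    unfolding bd_def
  proof (intro allI impI)
    fix k i
    have "\<bar>xs ! i\<bar> \<le> Z" if "i < length xs" using abs_le_enc_size[OF nth_mem[OF that]] bnd_Z(16) by (simp add: N_def)
    then show "\<bar>M0 k i\<bar> \<le> Z" using M0a pos_consts(10) by (cases "k = 0") auto
  qed
  obtain C1 where C1: "C1 \<le> t1 * u" "exec orc fuel (prep_c n0) (init n B t) = return_pmf (Some ((init n B t)\<lparr>mem := M1, cost := cost (init n B t) + C1\<rparr>))"
    using bs_exec[OF 1(2) wfc_parts(1) bd0, of K fuel "init n B t" orc] 1(1) by (auto simp: K fuel_def M0_def u_def)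
  define \<sigma>0 where "\<sigma>0 = (init n B t)\<lparr>mem := M1, cost := cost (init n B t) + C1\<rparr>"
  have ex: "exec orc fuel (reduction_c n0) (init n B t) = exec orc fuel (Seq (While guard_b body_c) out_c) \<sigma>0"
    unfolding reduction_c_def exec.simps(3)[of _ _ "prep_c n0"] C1(2) \<sigma>0_def[symmetric] by (simp only: bind_return_pmf option.case)
  interpret R: reduced n d N b GY Y "4 ^ N" Xb Wm Hm F BB Cb Z using 1(3) by (simp add: post_def)
  have pst: "lat d b = lat d b0" "b d = b0 d" "R.Base M1" "R.Best M1" "M1 vW 0 = 1" "M1 vH 0 = 0" "M1 vE 0 = 0" "M1 vS 0 = 2 ^ k" "k \<le> 3 * N"
    "M1 vM 0 = 2 ^ ((n + 1) div 2)" "M1 vDen 0 = Den" "M1 vG 0 = 0" "M1 vP 0 = 4 * 2 ^ k" "M1 vQ 0 = 1"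
    "M1 vNrm 0 \<le> (2 ^ k)\<^sup>2" "k = 0 \<or> (2 ^ k)\<^sup>2 < 4 * M1 vNrm 0"
    "\<And>z. z \<in> lat d b \<Longrightarrow> M1 vNrm 0 \<le> (if n < n0 then 1 else 2 ^ d) * ip n (\<lambda>x. z x - b d x) (\<lambda>x. z x - b d x)"
    using 1(3) by (auto simp: post_def)
  interpret S: search n d N b GY Y "4 ^ N" Xb Wm Hm F BB Cb Z "2 ^ k" Den K "T * u" fuel orc
  proof
    show "2 * 2 ^ k \<le> Xb"
    proof -
      have "(2::int) ^ (k + 1) \<le> Xb" unfolding Xb_def using pst(9) by (intro pow2_le) simp
      then show ?thesis by simp
    qed
    show "4 * 2 ^ k * 10001 ^ (30000 * n) \<le> Z" by (rule bnd_guess[OF pst(9)])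
    show "2 ^ ((n + 1) div 2) * (50 * N\<^sup>2) + 30 * N\<^sup>2 + 6 \<le> fuel" by (simp add: fuel_def)
  qed (use bnd_Z in \<open>auto simp: K\<close>)
  obtain c where c: "c \<in> lat d b" "\<And>w. w \<in> lat d b \<Longrightarrow> ip n (\<lambda>x. c x - b d x) (\<lambda>x. c x - b d x) \<le> ip n (\<lambda>x. w x - b d x) (\<lambda>x. w x - b d x)"
    using lat_closest by blast
  define mi where "mi = ip n (\<lambda>x. c x - b d x) (\<lambda>x. c x - b d x)"
  define m where "m = real_of_int mi"
  have mn: "m = nq n c (\<lambda>j. of_int (- 1) * of_int (b d j))" unfolding m_def mi_def by (rule nq_int[symmetric])
  have mi0: "0 \<le> mi" unfolding mi_def by (rule ip_int_nonneg)
  have memS: "mem \<sigma>0 = M1" by (simp add: \<sigma>0_def)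
  have I0: "S.Inv 0 \<sigma>0"
  proof -
    have "cost \<sigma>0 \<le> T * u" using C1(1) 1(1) by (simp add: \<sigma>0_def init_def load_def) (meson le_trans mult_le_mono1)
    then show ?thesis
      unfolding S.Inv_def Let_def memS using pst bs_bd[OF 1(2) bd0] by (simp add: \<sigma>0_def init_def load_def)
  qed
  \<comment> \<open>If the target is a lattice vector, then \<open>mi = 0\<close> and Babai's bound
    forces norm 0; if \<open>n < n0\<close>, the enumeration was exact. In the remaining case
    \<open>mi \<ge> 1\<close> and the guesses apply.\<close>
  have hyp: "of_int (mem \<sigma>0 vNrm 0) \<le> (197 / 100)\<^sup>2 * m \<or>
      (good_dim n \<and> 1 \<le> m \<and> m \<le> of_int (M1 vNrm 0) \<and> of_int (M1 vNrm 0) \<le> (real_of_int (2 ^ k))\<^sup>2 \<and> of_int (M1 vNrm 0) \<le> 2 ^ n * m \<and>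
        ((2::int) ^ k = 1 \<or> (real_of_int (2 ^ k))\<^sup>2 < 4 * of_int (M1 vNrm 0)))"
  proof (cases "n < n0 \<or> mi = 0")
    case True
    then have "M1 vNrm 0 \<le> mi" using pst(17)[OF c(1)] by (auto simp: mi_def split: if_splits)
    then have "of_int (M1 vNrm 0) \<le> m" by (simp add: m_def)
    also have "m \<le> (197 / 100)\<^sup>2 * m" using mi0 by (simp add: m_def power2_eq_square)
    finally show ?thesis by (simp add: memS)
  next
    case False
    have "mi \<le> M1 vNrm 0" using c(2)[of "\<lambda>x. irow n (M1 aBest) 0 x + b d x"] pst(4) by (simp add: R.Best_def mi_def)
    then have h1: "m \<le> of_int (M1 vNrm 0)" by (simp add: m_def)
    have "real_of_int (M1 vNrm 0) \<le> real_of_int ((2 ^ k)\<^sup>2)" using pst(15) by (simp only: of_int_le_iff)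
    then have h2: "of_int (M1 vNrm 0) \<le> (real_of_int (2 ^ k))\<^sup>2" by simp
    have "M1 vNrm 0 \<le> 2 ^ d * mi" using pst(17)[OF c(1)] False by (simp add: mi_def)
    also have "\<dots> \<le> 2 ^ n * mi" using mi0 dn by (intro mult_right_mono power_increasing) auto
    finally have "real_of_int (M1 vNrm 0) \<le> real_of_int (2 ^ n * mi)" by (simp only: of_int_le_iff)
    then have h3: "of_int (M1 vNrm 0) \<le> 2 ^ n * m" by (simp add: m_def)
    have h4: "(2::int) ^ k = 1 \<or> (real_of_int (2 ^ k))\<^sup>2 < 4 * of_int (M1 vNrm 0)"
    proof (cases "k = 0")
      case False
      then have "(2 ^ k)\<^sup>2 < 4 * M1 vNrm 0" using pst(16) by simp
      then have "real_of_int ((2 ^ k)\<^sup>2) < real_of_int (4 * M1 vNrm 0)" by (simp only: of_int_less_iff)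
      then show ?thesis by simp
    qed simp
    have "good_dim n" "1 \<le> m" using False n0[of n] mi0 by (auto simp: m_def)
    then show ?thesis using h1 h2 h3 h4 by blast
  qed
  have "1 \<le> n" using n by simp
  note sr = S.search_res[OF I0 this _ _ orc c(1) mn hyp _ bnd_Z(10)]
  define res where "res = exec orc fuel (Seq (While guard_b body_c) out_c) \<sigma>0"
  have res: "None \<notin> set_pmf res" "\<And>\<tau>. Some \<tau> \<in> set_pmf res \<Longrightarrow> length (queries \<tau>) = 30000 * n \<and>
      (\<forall>(n', B', s') \<in> set (queries \<tau>). valid_query (n', B', s') \<and> n' = n + 1 \<and> length B' = d + 1) \<and>
      cost \<tau> \<le> T * u + 30000 * n * S.c1 + (4 * N + 3) * u"
    "measure_pmf.prob res {Some \<tau> | \<tau>. S.Succ ((197 / 100)\<^sup>2 * m) \<tau>} \<ge> 2 / 3"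
    using sr by (auto simp: res_def fuel_def K Let_def u_def)
  have cost: "real (cost \<tau>) \<le> 2 powr (real n / 2) * (real C * real N ^ 9)" if "Some \<tau> \<in> set_pmf res" for \<tau>
  proof -
    let ?D = "(2800000 + 45 * E0) * (2 * K\<^sup>2 * 500002)"
    have K1: "1 \<le> K" by (simp add: K)
    have uK: "u = 2 * K\<^sup>2 * (500000 * N ^ 3 + 2)" by (simp add: u_def unit_cost_def len_Z)
    have "cost \<tau> \<le> T * u + 30000 * n * S.c1 + (4 * N + 3) * u" using res(2)[OF that] by blast
    also have "\<dots> \<le> 2 ^ ((n + 1) div 2) * (?D * N ^ 9)"
      by (rule cost_bound[OF _ _ _ _ T_def uK]) (use N_simps K1 in \<open>auto simp: S.c1_def u_def\<close>)
    finally have "real (cost \<tau>) \<le> real (2 ^ ((n + 1) div 2) * (?D * N ^ 9))" by (simp only: of_nat_le_iff)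
    also have "\<dots> = real (2 ^ ((n + 1) div 2)) * (real ?D * real N ^ 9)" by (simp only: of_nat_mult of_nat_power)
    also have "\<dots> \<le> (2 * 2 powr (real n / 2)) * (real ?D * real N ^ 9)" by (intro mult_right_mono pow_half) auto
    also have "\<dots> = 2 powr (real n / 2) * (real C * real N ^ 9)" by (simp add: C E0_def)
    finally show ?thesis .
  qed
  have sol: "cvp_solution 1.97 (lattice_of n (map real_vec B)) (real_vec t) (real_vec (out_vec n \<tau>))"
    if Su: "S.Succ ((197 / 100)\<^sup>2 * m) \<tau>" for \<tau>
  proof -
    obtain z where z: "z \<in> lat d b" "\<And>j. j < n \<Longrightarrow> mem \<tau> output_array (2 * j) = z j \<and> mem \<tau> output_array (2 * j + 1) = Den"
      "of_int (ip n (\<lambda>x. z x - b d x) (\<lambda>x. z x - b d x)) \<le> (197 / 100)\<^sup>2 * m" using Su by (auto simp: S.Succ_def)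
    have "cvp_solution (197 / 100) (lattice_of n (map real_vec B)) (real_vec t) (real_vec (out_vec n \<tau>))"
    proof (rule cvp_solution_scaled[OF BC t, where Den = Den and ?b0.0 = b0 and ?t0.0 = "b0 d" and z = z and m = m])
      show "0 < Den" using Den1 by simp
      show "real_of_int (b0 i j) = of_int Den * of_rat (B ! i $ j)" if "i < length B" "j < n" for i j
        using b0r[of i j] that by (simp add: d_def vs_def nth_append)
      show "real_of_int (b0 d j) = of_int Den * of_rat (t $ j)" if "j < n" for j
        using b0r[of d j] that by (simp add: d_def vs_def)
      show "z \<in> lat (length B) b0" using z(1) pst(1) by (simp add: d_def)
      show "of_int (ip n (\<lambda>x. z x - b0 d x) (\<lambda>x. z x - b0 d x)) \<le> (197 / 100)\<^sup>2 * m" using z(3) pst(2) by simp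
      show "m \<le> of_int (ip n (\<lambda>x. w x - b0 d x) (\<lambda>x. w x - b0 d x))" if "w \<in> lat (length B) b0" for w
        using c(2)[of w] that pst(1,2) by (simp add: m_def mi_def d_def)
      show "out_vec n \<tau> \<in> carrier_vec n" by (simp add: out_vec_def dec_vec_def)
      show "out_vec n \<tau> $ j = Rat.Fract (z j) Den" if "j < n" for j
        using z(2)[OF that] that by (simp add: out_vec_def dec_vec_def dec_rat_def)
    qed simp
    then show ?thesis by simp
  qed
  have "{Some \<tau> | \<tau>. S.Succ ((197 / 100)\<^sup>2 * m) \<tau>} \<subseteq> {Some \<sigma> | \<sigma>. cvp_solution 1.97 (lattice_of n (map real_vec B)) (real_vec t)
                            (real_vec (out_vec n \<sigma>))}" using sol by blast
  then have pr: "measure_pmf.prob res {Some \<sigma> | \<sigma>. cvp_solution 1.97 (lattice_of n (map real_vec B)) (real_vec t)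
                            (real_vec (out_vec n \<sigma>))} \<ge> 2 / 3"
    by (intro order_trans[OF res(3)] measure_pmf.finite_measure_mono) auto
  have e: "exec orc fuel (reduction_c n0) (init n B t) = res" unfolding res_def by (rule ex)
  have r: "length (queries \<tau>) \<le> 30000 * n" "\<forall>(n', B', s') \<in> set (queries \<tau>). valid_query (n', B', s') \<and> n' = n + 1 \<and> length B' = d + 1"
    if "Some \<tau> \<in> set_pmf res" for \<tau> using res(2)[OF that] by simp_all
  show ?thesis
    by (rule exI[of _ fuel], unfold e Let_def d_def[symmetric] xs_def[symmetric] N_def[symmetric], intro conjI allI impI)
      (rule res(1) pr | erule r cost)+
qed

theorem theorem7p1:
  shows "\<exists>P calls. \<exists>p :: real poly.
    (\<lambda>n. real (calls n)) \<in> O(\<lambda>n. (real n)\<^sup>2) \<and>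
    cvp_to_dgs_reduction P 1.97 (\<lambda>n. nat \<lfloor>2 powr (real n / 2)\<rfloor>) (1 / 2) calls
      (\<lambda>n size. 2 powr (real n / 2) * poly p (real size))"
proof -
  \<comment> \<open>\<open>n0\<close> is only known to exist, but it is one number for all inputs,
    so it can be a constant of the program and of the polynomial.\<close>
  obtain n0 where n0: "\<And>n. n \<ge> n0 \<Longrightarrow> good_dim n" using good_dim_ex by blast
  define K where "K = csz (prep_c n0) + csz (q_c 10000) + csz inc_c + (1 + bsz guard_b) + csz out_c"
  define C where "C = 2 * ((2800000 + 45 * (2 * 2 ^ n0 + 1) ^ n0) * (2 * K\<^sup>2 * 500002))"
  have "(\<lambda>n. real (30000 * n)) \<in> O(\<lambda>n. (real n)\<^sup>2)" by real_asymp
  moreover have "cvp_to_dgs_reduction (reduction_c n0) 1.97 (\<lambda>n. nat \<lfloor>2 powr (real n / 2)\<rfloor>) (1 / 2) (\<lambda>n. 30000 * n)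
      (\<lambda>n size. 2 powr (real n / 2) * poly (monom (real C) 9) (real size))"
    unfolding cvp_to_dgs_reduction_def poly_monom
    using reduction_correct[OF _ _ _ _ n0 K_def C_def] by blast
  ultimately show ?thesis by blast
qed

end
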